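(* Let $R>1$, and let $\mathcal A_0$ be the stellar equilibrium operator matrix on $L^2((1,R))\oplus L^2((1,R))$ described in the context. Then, for every closed symmetric extension $\mathcal A_{[1,R)}$ of $\mathcal A_0$ in $L^2((1,R))\oplus L^2((1,R))$, \[ \sigma_{\rm ess}^{\,\rm s}(\mathcal A_{[1,R)})=\emptyset,\qquad \sigma_{\rm ess}(\mathcal A_{[1,R)})=\sigma_{\rm ess}^{\,\rm r}(\mathcal A_{[1,R)})=\{0\}. \]
   Context: Let $n\in(0,5)$ (polytropic index), $\alpha_n>0$, $R>1$, and let $\theta_n\in C^2([1,R],\mathbb R)$ satisfy $\theta_n''(t)+\frac2t\theta_n'(t)=-\frac1{\alpha_n^2}\theta_n(t)^n$ on $[1,R]$, with $\theta_n>0$ on $[1,R)$ and $\theta_n(R)=0$ (Lane–Emden function with first zero $R$). Let $p_c,\varrho_c>0$, $p(t)=p_c\theta_n(t)^{n+1}$, $\varrho(t)=\varrho_c\theta_n(t)^n$. Let $\Gamma_1\in C^2([1,R],\mathbb R)$ with $\Gamma_1>0$ on $[1,R]$ and $\Gamma_1'(R)=0$. Let $l\in\mathbb N$, $l\ge1$, $c_l=\sqrt{l(l+1)}$. On $[1,R)$ define \[ p_1=\frac{\Gamma_1p}{\varrho},\quad p_2=c_l\frac{\Gamma_1p}{t\varrho},\quad p_3=c_l^2\frac{\Gamma_1p}{t^2\varrho}, \] \[ q_1=\frac1{t\varrho}\big((4-3\Gamma_1)p\big)'+\frac1{t^2\sqrt\varrho}\Big(\frac{\Gamma_1p}{\varrho}(t^2\sqrt\varrho)'\Big)',\qquad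 q_2=p_2\Big(\frac{\varrho'}{\varrho}-\frac{p'}{\Gamma_1p}-\frac12\frac{(t^2\varrho)'}{t^2\varrho}\Big). \] $\mathcal A_0$ is the symmetric operator with domain $C_0^2((1,R))\oplus C_0^1((1,R))$ (compactly supported functions in $(1,R)$) given by \[ \mathcal A_0\binom{y_1}{y_2}=\binom{-(p_1y_1')'+q_1y_1+(p_2y_2)'+q_2y_2}{-p_2y_1'+q_2y_1+p_3y_2}. \] For a densely defined closed operator $T$, $\sigma_{\rm ess}(T)=\{\lambda\in\mathbb C:T-\lambda\text{ is not Fredholm}\}$. The regular part of the essential spectrum of a closed symmetric extension $\mathcal A$ of $\mathcal A_0$ is $\sigma_{\rm ess}^{\,\rm r}(\mathcal A)=\overline{\{\Delta(t):t\in[1,R)\}}$ with $\Delta=p_3-p_2^2/p_1$, and the singular part is $\sigma_{\rm ess}^{\,\rm s}(\mathcal A)=\sigma_{\rm ess}(\mathcal A)\setminus\sigma_{\rm ess}^{\,\rm r}(\mathcal A)$. *)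

theory Defs
  imports "HOL-Analysis.Analysis"
begin

section \<open>Complex inner product spaces\<close>

text \<open>
  The topology is the one of the underlying real inner product space; the complex inner product
  is linear in its first argument.
\<close>

class complex_inner = real_inner +
  fixes scaleC :: "complex \<Rightarrow> 'a \<Rightarrow> 'a"  (infixr \<open>*\<^sub>C\<close> 75)
    and cinner :: "'a \<Rightarrow> 'a \<Rightarrow> complex"
  assumes scaleC_add_right: "a *\<^sub>C (x + y) = a *\<^sub>C x + a *\<^sub>C y"
    and scaleC_add_left: "(a + b) *\<^sub>C x = a *\<^sub>C x + b *\<^sub>C x"
    and scaleC_scaleC: "a *\<^sub>C b *\<^sub>C x = (a * b) *\<^sub>C x"
    and scaleR_scaleC: "r *\<^sub>R x = complex_of_real r *\<^sub>C x"
    and cinner_commute: "cinner x y = cnj (cinner y x)"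
    and cinner_add_left: "cinner (x + y) z = cinner x z + cinner y z"
    and cinner_scaleC_left: "cinner (a *\<^sub>C x) y = a * cinner x y"
    and inner_eq_Re_cinner: "inner x y = Re (cinner x y)"

global_interpretation complex_vector:
    vector_space "scaleC :: complex \<Rightarrow> 'a \<Rightarrow> 'a::complex_inner"
proof
  show "1 *\<^sub>C x = x" for x :: 'a
    using scaleR_scaleC[of 1 x] by simp
qed (simp_all add: scaleC_add_right scaleC_add_left scaleC_scaleC)

instantiation prod :: (complex_inner, complex_inner) complex_inner
begin

definition scaleC_prod :: "complex \<Rightarrow> 'a \<times> 'b \<Rightarrow> 'a \<times> 'b"
  where "scaleC_prod a x = (a *\<^sub>C fst x, a *\<^sub>C snd x)"

definition cinner_prod :: "'a \<times> 'b \<Rightarrow> 'a \<times> 'b \<Rightarrow> complex"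
  where "cinner_prod x y = cinner (fst x) (fst y) + cinner (snd x) (snd y)"

instance
proof
  fix x y z :: "'a \<times> 'b" and a b :: complex and r :: real
  show "a *\<^sub>C (x + y) = a *\<^sub>C x + a *\<^sub>C y"
    by (simp add: scaleC_prod_def scaleC_add_right)
  show "(a + b) *\<^sub>C x = a *\<^sub>C x + b *\<^sub>C x"
    by (simp add: scaleC_prod_def scaleC_add_left)
  show "a *\<^sub>C b *\<^sub>C x = (a * b) *\<^sub>C x"
    by (simp add: scaleC_prod_def scaleC_scaleC)
  show "r *\<^sub>R x = complex_of_real r *\<^sub>C x"
    by (simp add: scaleC_prod_def scaleR_prod_def scaleR_scaleC)
  show "cinner x y = cnj (cinner y x)"
    unfolding cinner_prod_def
    by (simp add: cinner_commute[of "fst x" "fst y"] cinner_commute[of "snd x" "snd y"])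
  show "cinner (x + y) z = cinner x z + cinner y z"
    by (simp add: cinner_prod_def cinner_add_left)
  show "cinner (a *\<^sub>C x) y = a * cinner x y"
    by (simp add: cinner_prod_def scaleC_prod_def cinner_scaleC_left distrib_left)
  show "inner x y = Re (cinner x y)"
    by (simp add: cinner_prod_def inner_prod_def inner_eq_Re_cinner)
qed

end


section \<open>Unbounded operators\<close>

text \<open>
  An unbounded operator in a Hilbert space, itself given as a closed subspace \<open>H\<close> of a
  complex inner product space, is represented by its graph, so that its domain and range are
  \<^const>\<open>Domain\<close> and \<^const>\<open>Range\<close>, extension is inclusion, and an operator is
  closed iff its graph is a \<^const>\<open>closed\<close> set.
\<close>

definition linear_operator_in :: "'a::complex_inner set \<Rightarrow> ('a \<times> 'a) set \<Rightarrow> bool"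
  where "linear_operator_in H T \<longleftrightarrow>
    T \<subseteq> H \<times> H \<and> complex_vector.subspace T \<and> single_valued T"

definition symmetric_operator_in :: "'a::complex_inner set \<Rightarrow> ('a \<times> 'a) set \<Rightarrow> bool"
  where "symmetric_operator_in H T \<longleftrightarrow>
    linear_operator_in H T \<and> H \<subseteq> closure (Domain T) \<and>
    (\<forall>(x, u) \<in> T. \<forall>(y, v) \<in> T. cinner u y = cinner x v)"

definition closed_symmetric_extension ::
    "'a::complex_inner set \<Rightarrow> ('a \<times> 'a) set \<Rightarrow> ('a \<times> 'a) set \<Rightarrow> bool"
  where "closed_symmetric_extension H T\<^sub>0 T \<longleftrightarrow>
    symmetric_operator_in H T \<and> closed T \<and> T\<^sub>0 \<subseteq> T"

definition operator_minus_scalar ::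
    "('a::complex_inner \<times> 'a) set \<Rightarrow> complex \<Rightarrow> ('a \<times> 'a) set"
  where "operator_minus_scalar T \<mu> = {(x, u - \<mu> *\<^sub>C x) | x u. (x, u) \<in> T}"

text \<open>
  Closed range, finite-dimensional kernel, and range of finite codimension in \<open>H\<close>.
\<close>

definition fredholm_in :: "'a::complex_inner set \<Rightarrow> ('a \<times> 'a) set \<Rightarrow> bool"
  where "fredholm_in H T \<longleftrightarrow>
    closed (Range T) \<and>
    (\<exists>B. finite B \<and> complex_vector.span B = {x. (x, 0) \<in> T}) \<and>
    (\<exists>B. finite B \<and> B \<subseteq> H \<and> complex_vector.span (Range T \<union> B) = H)"

definition ess_spectrum_in :: "'a::complex_inner set \<Rightarrow> ('a \<times> 'a) set \<Rightarrow> complex set"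
  where "ess_spectrum_in H T = {\<mu>. \<not> fredholm_in H (operator_minus_scalar T \<mu>)}"


section \<open>Square-integrable functions\<close>

definition sq_integrable :: "(real \<Rightarrow> complex) \<Rightarrow> bool"
  where "sq_integrable f \<longleftrightarrow>
    f \<in> borel_measurable lborel \<and> integrable lborel (\<lambda>t. (cmod (f t))\<^sup>2)"

definition l2_rel :: "(real \<Rightarrow> complex) \<Rightarrow> (real \<Rightarrow> complex) \<Rightarrow> bool"
  where "l2_rel f g \<longleftrightarrow>
    sq_integrable f \<and> sq_integrable g \<and> (AE t in lborel. f t = g t)"

quotient_type l2 = "real \<Rightarrow> complex" / partial: l2_rel
  morphisms rep_l2 l2_class
proof (rule part_equivpI)
  show "\<exists>f. l2_rel f f"
    by (rule exI[of _ "\<lambda>_. 0"]) (simp add: l2_rel_def sq_integrable_def)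
  show "symp l2_rel"
    by (auto simp: symp_def l2_rel_def elim: AE_mp)
  show "transp l2_rel"
    by (auto simp: transp_def l2_rel_def elim: AE_mp)
qed

lemma sq_integrable_mult_measurable:
  assumes "sq_integrable f" "sq_integrable g"
  shows "(\<lambda>t. f t * cnj (g t)) \<in> borel_measurable lborel"
  using assms by (auto simp: sq_integrable_def intro!: borel_measurable_times
      measurable_compose[OF _ borel_measurable_continuous_onI[of cnj]] continuous_intros)

lemma sq_integrable_mult:
  assumes "sq_integrable f" "sq_integrable g"
  shows "integrable lborel (\<lambda>t. f t * cnj (g t))"
proof (rule Bochner_Integration.integrable_bound)
  show "integrable lborel (\<lambda>t. (cmod (f t))\<^sup>2 + (cmod (g t))\<^sup>2)"
    using assms by (auto simp: sq_integrable_def)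
  show "(\<lambda>t. f t * cnj (g t)) \<in> borel_measurable lborel"
    using assms by (rule sq_integrable_mult_measurable)
  have "cmod (f t * cnj (g t)) \<le> (cmod (f t))\<^sup>2 + (cmod (g t))\<^sup>2" for t
  proof -
    have "2 * (cmod (f t) * cmod (g t)) \<le> (cmod (f t))\<^sup>2 + (cmod (g t))\<^sup>2"
      using sum_squares_bound[of "cmod (f t)" "cmod (g t)"] by (simp add: algebra_simps)
    moreover have "0 \<le> cmod (f t) * cmod (g t)"
      by simp
    ultimately show ?thesis
      unfolding norm_mult complex_mod_cnj by linarith
  qed
  then show "AE t in lborel. cmod (f t * cnj (g t)) \<le> norm ((cmod (f t))\<^sup>2 + (cmod (g t))\<^sup>2)"
    by simp
qed

lemma sq_integrable_scale: "sq_integrable f \<Longrightarrow> sq_integrable (\<lambda>t. c * f t)"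
  by (auto simp: sq_integrable_def norm_mult power_mult_distrib)

lemma sq_integrable_add:
  assumes "sq_integrable f" "sq_integrable g"
  shows "sq_integrable (\<lambda>t. f t + g t)"
  unfolding sq_integrable_def
proof
  show m: "(\<lambda>t. f t + g t) \<in> borel_measurable lborel"
    using assms by (auto simp: sq_integrable_def)
  show "integrable lborel (\<lambda>t. (cmod (f t + g t))\<^sup>2)"
  proof (rule Bochner_Integration.integrable_bound)
    show "integrable lborel (\<lambda>t. 2 * (cmod (f t))\<^sup>2 + 2 * (cmod (g t))\<^sup>2)"
      using assms by (auto simp: sq_integrable_def)
    show "(\<lambda>t. (cmod (f t + g t))\<^sup>2) \<in> borel_measurable lborel"
      using m by measurable
    have "(cmod (f t + g t))\<^sup>2 \<le> 2 * (cmod (f t))\<^sup>2 + 2 * (cmod (g t))\<^sup>2" for t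
    proof -
      have "(cmod (f t + g t))\<^sup>2 \<le> (cmod (f t) + cmod (g t))\<^sup>2"
        by (intro power_mono norm_triangle_ineq norm_ge_zero)
      also have "\<dots> \<le> 2 * (cmod (f t))\<^sup>2 + 2 * (cmod (g t))\<^sup>2"
        using sum_squares_bound[of "cmod (f t)" "cmod (g t)"]
        unfolding power2_sum by linarith
      finally show ?thesis .
    qed
    then show "AE t in lborel. norm ((cmod (f t + g t))\<^sup>2)
        \<le> norm (2 * (cmod (f t))\<^sup>2 + 2 * (cmod (g t))\<^sup>2)"
      by simp
  qed
qed

lemma l2_relI:
  "sq_integrable f \<Longrightarrow> sq_integrable g \<Longrightarrow> (AE t in lborel. f t = g t) \<Longrightarrow> l2_rel f g"
  by (simp add: l2_rel_def)

instantiation l2 :: complex_inner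
begin

lift_definition zero_l2 :: l2 is "\<lambda>_. 0"
  by (simp add: l2_rel_def sq_integrable_def)

lift_definition plus_l2 :: "l2 \<Rightarrow> l2 \<Rightarrow> l2" is "\<lambda>f g t. f t + g t"
  by (auto simp: l2_rel_def intro: sq_integrable_add elim: AE_mp)

lift_definition scaleC_l2 :: "complex \<Rightarrow> l2 \<Rightarrow> l2" is "\<lambda>c f t. c * f t"
  by (auto simp: l2_rel_def intro: sq_integrable_scale elim: AE_mp)

lift_definition cinner_l2 :: "l2 \<Rightarrow> l2 \<Rightarrow> complex"
  is "\<lambda>f g. integral\<^sup>L lborel (\<lambda>t. f t * cnj (g t))"
proof -
  fix f f' g g'
  assume f: "l2_rel f f'" and g: "l2_rel g g'"
  have "AE t in lborel. f t * cnj (g t) = f' t * cnj (g' t)"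
    using f g by (auto simp: l2_rel_def elim: AE_mp)
  then show "integral\<^sup>L lborel (\<lambda>t. f t * cnj (g t)) = integral\<^sup>L lborel (\<lambda>t. f' t * cnj (g' t))"
    using f g by (intro integral_cong_AE sq_integrable_mult_measurable)
      (simp_all add: l2_rel_def)
qed

definition uminus_l2 :: "l2 \<Rightarrow> l2" where "uminus_l2 x = (-1) *\<^sub>C x"
definition minus_l2 :: "l2 \<Rightarrow> l2 \<Rightarrow> l2" where "minus_l2 x y = x + (- y)"
definition scaleR_l2 :: "real \<Rightarrow> l2 \<Rightarrow> l2" where "scaleR_l2 r x = complex_of_real r *\<^sub>C x"
definition inner_l2 :: "l2 \<Rightarrow> l2 \<Rightarrow> real" where "inner_l2 x y = Re (cinner x y)"
definition norm_l2 :: "l2 \<Rightarrow> real" where "norm_l2 x = sqrt (inner x x)"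
definition sgn_l2 :: "l2 \<Rightarrow> l2" where "sgn_l2 x = inverse (norm x) *\<^sub>R x"
definition dist_l2 :: "l2 \<Rightarrow> l2 \<Rightarrow> real" where "dist_l2 x y = norm (x - y)"
definition uniformity_l2 :: "(l2 \<times> l2) filter"
  where "uniformity_l2 = (INF e\<in>{0<..}. principal {(x, y). dist x y < e})"
definition open_l2 :: "l2 set \<Rightarrow> bool"
  where "open_l2 U = (\<forall>x\<in>U. eventually (\<lambda>(x', y). x' = x \<longrightarrow> y \<in> U) uniformity)"

instance
proof
  fix x y z :: l2 and a b :: complex and r s :: real
  show add_assoc: "x + y + z = x + (y + z)"
    by transfer (auto simp: l2_rel_def add.assoc intro!: sq_integrable_add)
  show "x + y = y + x"
    by transfer (auto simp: l2_rel_def add.commute intro!: sq_integrable_add elim: AE_mp)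
  show "0 + x = x"
    by transfer (auto simp: l2_rel_def elim: AE_mp)
  show "- x + x = 0"
    unfolding uminus_l2_def
    by transfer (auto simp: l2_rel_def sq_integrable_def elim: AE_mp)
  show "x - y = x + - y"
    by (rule minus_l2_def)
  show sR: "a *\<^sub>C (x + y) = a *\<^sub>C x + a *\<^sub>C y" for a :: complex and x y :: l2
    by transfer (auto simp: l2_rel_def distrib_left intro!: sq_integrable_add sq_integrable_scale)
  show sL: "(a + b) *\<^sub>C x = a *\<^sub>C x + b *\<^sub>C x" for a b :: complex and x :: l2
    by transfer (auto simp: l2_rel_def distrib_right
        intro!: sq_integrable_add sq_integrable_scale)
  show ss: "a *\<^sub>C b *\<^sub>C x = (a * b) *\<^sub>C x" for a b :: complex and x :: l2
    by transfer (auto simp: l2_rel_def mult.assoc intro!: sq_integrable_scale)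
  show "r *\<^sub>R x = complex_of_real r *\<^sub>C x"
    by (rule scaleR_l2_def)
  show "r *\<^sub>R (x + y) = r *\<^sub>R x + r *\<^sub>R y"
    by (simp add: scaleR_l2_def sR)
  show "(r + s) *\<^sub>R x = r *\<^sub>R x + s *\<^sub>R x"
    by (simp add: scaleR_l2_def sL)
  show "r *\<^sub>R s *\<^sub>R x = (r * s) *\<^sub>R x"
    by (simp add: scaleR_l2_def ss)
  show "1 *\<^sub>R x = x"
    unfolding scaleR_l2_def
    by transfer (auto simp: l2_rel_def elim: AE_mp)
  show cc: "cinner x y = cnj (cinner y x)" for x y :: l2
    by transfer (simp add: mult.commute flip: Bochner_Integration.integral_cnj)
  show ca: "cinner (x + y) z = cinner x z + cinner y z"
    by transfer (auto simp: l2_rel_def distrib_right sq_integrable_mult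
        intro!: Bochner_Integration.integral_add)
  show cs: "cinner (a *\<^sub>C x) y = a * cinner x y" for a :: complex
    by transfer (simp add: mult.assoc)
  show "inner x y = Re (cinner x y)"
    by (rule inner_l2_def)
  show "inner x y = inner y x"
    unfolding inner_l2_def by (subst cc) simp
  show "inner (x + y) z = inner x z + inner y z"
    by (simp add: inner_l2_def ca)
  show "inner (r *\<^sub>R x) y = r * inner x y"
    by (simp add: inner_l2_def scaleR_l2_def cs)
  have self: "Re (integral\<^sup>L lborel (\<lambda>t. f t * cnj (f t))) = integral\<^sup>L lborel (\<lambda>t. (cmod (f t))\<^sup>2)" for f
    by (simp add: complex_norm_square[symmetric] flip: of_real_power)
  show "0 \<le> inner x x"
    unfolding inner_l2_def by transfer (simp add: self)
  show "inner x x = 0 \<longleftrightarrow> x = 0"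
    unfolding inner_l2_def
  proof transfer
    fix f assume "l2_rel f f"
    then have f: "sq_integrable f"
      by (simp add: l2_rel_def)
    then show "Re (integral\<^sup>L lborel (\<lambda>t. f t * cnj (f t))) = 0 \<longleftrightarrow> l2_rel f (\<lambda>_. 0)"
      unfolding self
      by (subst integral_nonneg_eq_0_iff_AE) (auto simp: sq_integrable_def l2_rel_def)
  qed
  show "norm x = sqrt (inner x x)"
    by (rule norm_l2_def)
  show "sgn x = inverse (norm x) *\<^sub>R x"
    by (rule sgn_l2_def)
  show "dist x y = norm (x - y)"
    by (rule dist_l2_def)
  show "uniformity = (INF e\<in>{0<..}. principal {(x :: l2, y). dist x y < e})"
    by (rule uniformity_l2_def)
  show "open U \<longleftrightarrow> (\<forall>x\<in>U. eventually (\<lambda>(x', y). x' = x \<longrightarrow> y \<in> U) uniformity)" for U :: "l2 set"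
    by (rule open_l2_def)
qed

end

text \<open>
  For \<open>S \<subseteq> \<real>\<close>, the space \<open>L\<^sup>2(S)\<close> is identified, by extension by zero, with the
  closed subspace of \<open>L\<^sup>2(\<real>)\<close> of all classes of functions vanishing outside \<open>S\<close>.
\<close>

definition l2_on :: "real set \<Rightarrow> l2 set"
  where "l2_on S = {l2_class f | f. sq_integrable f \<and> (\<forall>t. t \<notin> S \<longrightarrow> f t = 0)}"

definition l2_class_on :: "real set \<Rightarrow> (real \<Rightarrow> complex) \<Rightarrow> l2"
  where "l2_class_on S f = l2_class (\<lambda>t. if t \<in> S then f t else 0)"


section \<open>Continuously differentiable functions\<close>

abbreviation deriv_within :: "real set \<Rightarrow> (real \<Rightarrow> 'a::real_normed_vector) \<Rightarrow> real \<Rightarrow> 'a"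
  where "deriv_within S f t \<equiv> vector_derivative f (at t within S)"

text \<open>
  The class \<open>C\<^sup>k(S, 'a)\<close> for an interval \<open>S\<close> with more than one point; derivatives at
  endpoints belonging to \<open>S\<close> are one-sided.
\<close>

fun Ck_on :: "nat \<Rightarrow> real set \<Rightarrow> (real \<Rightarrow> 'a::real_normed_vector) \<Rightarrow> bool"
  where
    "Ck_on 0 S f = continuous_on S f"
  | "Ck_on (Suc k) S f =
      ((\<forall>t\<in>S. f differentiable (at t within S)) \<and> Ck_on k S (deriv_within S f))"

definition Ck_compact_support :: "nat \<Rightarrow> real set \<Rightarrow> (real \<Rightarrow> complex) \<Rightarrow> bool"
  where "Ck_compact_support k S f \<longleftrightarrow>
    Ck_on k S f \<and> (\<exists>K. compact K \<and> K \<subseteq> S \<and> (\<forall>t \<in> S - K. f t = 0))"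


section \<open>The stellar equilibrium operator matrix\<close>

text \<open>
  \<open>\<Gamma>\<close> is the adiabatic index, \<open>p\<close> the pressure, \<open>\<rho>\<close> the density, \<open>l\<close> the degree.
\<close>

definition coeff_c :: "nat \<Rightarrow> real"
  where "coeff_c l = sqrt (real l * (real l + 1))"

definition coeff_p1 :: "(real \<Rightarrow> real) \<Rightarrow> (real \<Rightarrow> real) \<Rightarrow> (real \<Rightarrow> real) \<Rightarrow> real \<Rightarrow> real"
  where "coeff_p1 \<Gamma> p \<rho> t = \<Gamma> t * p t / \<rho> t"

definition coeff_p2 ::
    "nat \<Rightarrow> (real \<Rightarrow> real) \<Rightarrow> (real \<Rightarrow> real) \<Rightarrow> (real \<Rightarrow> real) \<Rightarrow> real \<Rightarrow> real"
  where "coeff_p2 l \<Gamma> p \<rho> t = coeff_c l * (\<Gamma> t * p t / (t * \<rho> t))"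

definition coeff_p3 ::
    "nat \<Rightarrow> (real \<Rightarrow> real) \<Rightarrow> (real \<Rightarrow> real) \<Rightarrow> (real \<Rightarrow> real) \<Rightarrow> real \<Rightarrow> real"
  where "coeff_p3 l \<Gamma> p \<rho> t = (coeff_c l)\<^sup>2 * (\<Gamma> t * p t / (t\<^sup>2 * \<rho> t))"

definition coeff_q1 ::
    "real \<Rightarrow> (real \<Rightarrow> real) \<Rightarrow> (real \<Rightarrow> real) \<Rightarrow> (real \<Rightarrow> real) \<Rightarrow> real \<Rightarrow> real"
  where "coeff_q1 R \<Gamma> p \<rho> t =
    (let D = deriv_within {1..<R} in
      1 / (t * \<rho> t) * D (\<lambda>s. (4 - 3 * \<Gamma> s) * p s) t
      + 1 / (t\<^sup>2 * sqrt (\<rho> t)) *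
        D (\<lambda>s. \<Gamma> s * p s / \<rho> s * D (\<lambda>r. r\<^sup>2 * sqrt (\<rho> r)) s) t)"

definition coeff_q2 ::
    "nat \<Rightarrow> real \<Rightarrow> (real \<Rightarrow> real) \<Rightarrow> (real \<Rightarrow> real) \<Rightarrow> (real \<Rightarrow> real) \<Rightarrow> real \<Rightarrow> real"
  where "coeff_q2 l R \<Gamma> p \<rho> t =
    (let D = deriv_within {1..<R} in
      coeff_p2 l \<Gamma> p \<rho> t *
        (D \<rho> t / \<rho> t - D p t / (\<Gamma> t * p t)
          - 1 / 2 * (D (\<lambda>s. s\<^sup>2 * \<rho> s) t / (t\<^sup>2 * \<rho> t))))"

definition coeff_Delta ::
    "nat \<Rightarrow> (real \<Rightarrow> real) \<Rightarrow> (real \<Rightarrow> real) \<Rightarrow> (real \<Rightarrow> real) \<Rightarrow> real \<Rightarrow> real"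
  where "coeff_Delta l \<Gamma> p \<rho> t =
    coeff_p3 l \<Gamma> p \<rho> t - (coeff_p2 l \<Gamma> p \<rho> t)\<^sup>2 / coeff_p1 \<Gamma> p \<rho> t"

definition stellar_space :: "real \<Rightarrow> (l2 \<times> l2) set"
  where "stellar_space R = l2_on {1<..<R} \<times> l2_on {1<..<R}"

definition stellar_operator ::
    "nat \<Rightarrow> real \<Rightarrow> (real \<Rightarrow> real) \<Rightarrow> (real \<Rightarrow> real) \<Rightarrow> (real \<Rightarrow> real)
      \<Rightarrow> ((l2 \<times> l2) \<times> (l2 \<times> l2)) set"
  where "stellar_operator l R \<Gamma> p \<rho> =
    (let I = {1<..<R};
         D = deriv_within I;
         p1 = coeff_p1 \<Gamma> p \<rho>; p2 = coeff_p2 l \<Gamma> p \<rho>; p3 = coeff_p3 l \<Gamma> p \<rho>;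
         q1 = coeff_q1 R \<Gamma> p \<rho>; q2 = coeff_q2 l R \<Gamma> p \<rho>
     in {((l2_class_on I y1, l2_class_on I y2),
          (l2_class_on I (\<lambda>t. - D (\<lambda>s. p1 s *\<^sub>R D y1 s) t + q1 t *\<^sub>R y1 t
             + D (\<lambda>s. p2 s *\<^sub>R y2 s) t + q2 t *\<^sub>R y2 t),
           l2_class_on I (\<lambda>t. - (p2 t *\<^sub>R D y1 t) + q2 t *\<^sub>R y1 t + p3 t *\<^sub>R y2 t)))
         | y1 y2. Ck_compact_support 2 I y1 \<and> Ck_compact_support 1 I y2})"

definition ess_spectrum_regular ::
    "nat \<Rightarrow> real \<Rightarrow> (real \<Rightarrow> real) \<Rightarrow> (real \<Rightarrow> real) \<Rightarrow> (real \<Rightarrow> real) \<Rightarrow> complex set"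
  where "ess_spectrum_regular l R \<Gamma> p \<rho> =
    closure ((\<lambda>t. complex_of_real (coeff_Delta l \<Gamma> p \<rho> t)) ` {1..<R})"

definition ess_spectrum_singular ::
    "nat \<Rightarrow> real \<Rightarrow> (real \<Rightarrow> real) \<Rightarrow> (real \<Rightarrow> real) \<Rightarrow> (real \<Rightarrow> real)
      \<Rightarrow> ((l2 \<times> l2) \<times> (l2 \<times> l2)) set \<Rightarrow> complex set"
  where "ess_spectrum_singular l R \<Gamma> p \<rho> A =
    ess_spectrum_in (stellar_space R) A - ess_spectrum_regular l R \<Gamma> p \<rho>"

end

theory Submission
  imports Defs
begin

text \<open>
  The relation \<open>p\<^sub>1 p\<^sub>3 = p\<^sub>2\<^sup>2\<close> makes \<open>\<Delta>\<close> vanish identically, so the regular part of the essential spectrum is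
  \<open>{0}\<close> and it remains to show that \<open>A - \<mu>\<close> is Fredholm if and only if \<open>\<mu> \<noteq> 0\<close>. The same relation means that the
  leading terms of the operator act through \<open>\<xi> = p\<^sub>1 (y\<^sub>1' - (c / t) y\<^sub>2)\<close> only.

  Let \<open>\<mu> \<noteq> 0\<close>. The second row of \<open>(A - \<mu>) y = f\<close> is algebraic, so it can be solved for \<open>y\<^sub>2\<close>, and a system of two
  first-order equations for \<open>y\<^sub>1\<close> and \<open>z = \<xi>\<close> remains. Its coefficients are continuous in the open interval, so the
  weak solutions of the homogeneous equation form a space of dimension at most two
  (\<open>weak_solutions_finite_span\<close>). The Lane-Emden equation forces a simple zero of \<open>\<theta>\<close> at \<open>R\<close>, so \<open>p\<^sub>1\<close> vanishes to first
  order there. With \<open>w = t\<^sup>2 sqrt \<rho>\<close> and \<open>r = p\<^sub>1 w' / w\<close>, which stays bounded, one has \<open>q\<^sub>1 = q\<^sub>0 + r' + r\<^sup>2 / p\<^sub>1\<close> with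
  bounded \<open>q\<^sub>0\<close>. In the unknowns \<open>y\<^sub>1\<close> and \<open>\<zeta> = z - r y\<^sub>1\<close> the only singular coefficients are \<open>1 / p\<^sub>1\<close> and the logarithmic
  derivative of \<open>w\<close> on the diagonal. The latter is absorbed by an integrating factor comparable to \<open>w\<close>; integrating
  the equation for \<open>\<zeta>\<close> backwards from \<open>R\<close> gains enough decay to compensate \<open>1 / p\<^sub>1\<close>, and a contraction argument
  gives bounded solutions for square-integrable right-hand sides (\<open>solvable\<close>, \<open>bounded_solution\<close>). A finite-dimensional
  space of weak solutions at \<open>\<mu>\<close> and \<open>cnj \<mu>\<close> together with a bounded right inverse of the adjoint of \<open>A\<^sub>0 - cnj \<mu>\<close> implies
  the Fredholm property for every closed symmetric extension (\<open>fredholm_criterion\<close>); no description of the domain of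
  the extension is needed.

  At \<open>\<mu> = 0\<close>, every \<open>\<phi>\<^sub>1\<close> has a companion \<open>\<phi>\<^sub>2\<close>, of first order in \<open>\<phi>\<^sub>1\<close>, for which the second row of the image vanishes
  and the first one is a multiple of \<open>\<phi>\<^sub>1\<close> by a fixed function. On short intervals \<open>\<phi>\<^sub>2\<close> is much larger than \<open>\<phi>\<^sub>1\<close>, so
  there are orthonormal vectors with rapidly decaying images (\<open>small_image\<close>). By symmetry the range then has
  infinite codimension (\<open>not_fredholm_criterion\<close>).
\<close>

section \<open>Complex inner product spaces\<close>

lemma cinner_add_right: "cinner x (y + z) = cinner x y + cinner x z"
  by (metis cinner_add_left cinner_commute complex_cnj_add)

lemma cinner_scaleC_right: "cinner x (a *\<^sub>C y) = cnj a * cinner x y"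
  by (metis cinner_scaleC_left cinner_commute complex_cnj_mult)

lemma scaleC_minus_one: "(- 1) *\<^sub>C x = - x"
  by (simp add: complex_vector.scale_minus_left)

lemma cinner_zero_left [simp]: "cinner 0 x = 0"
  by (metis add_cancel_right_right add_0 cinner_add_left)

lemma cinner_zero_right [simp]: "cinner x 0 = 0"
  by (metis cinner_zero_left cinner_commute complex_cnj_zero)

lemma cinner_minus_left: "cinner (- x) y = - cinner x y"
  by (metis cinner_scaleC_left scaleC_minus_one mult_minus1)

lemma cinner_minus_right: "cinner x (- y) = - cinner x y"
  by (metis cinner_minus_left cinner_commute complex_cnj_minus)

lemma cinner_diff_left: "cinner (x - y) z = cinner x z - cinner y z"
  by (metis (no_types) cinner_add_left cinner_minus_left diff_conv_add_uminus)

lemma cinner_diff_right: "cinner x (y - z) = cinner x y - cinner x z"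
  by (metis (no_types) cinner_add_right cinner_minus_right diff_conv_add_uminus)

lemma cinner_self: "cinner x x = complex_of_real ((norm x)\<^sup>2)"
proof -
  have "Im (cinner x x) = 0"
    using arg_cong[OF cinner_commute[of x x], of Im] by simp
  moreover have "Re (cinner x x) = (norm x)\<^sup>2"
    by (simp add: inner_eq_Re_cinner[symmetric] power2_norm_eq_inner)
  ultimately show ?thesis
    by (simp add: complex_eq_iff)
qed

lemma norm_scaleC: "norm (a *\<^sub>C x) = cmod a * norm (x :: 'a::complex_inner)"
proof -
  have "complex_of_real ((norm (a *\<^sub>C x))\<^sup>2) = a * cnj a * cinner x x"
    by (simp only: cinner_self[symmetric] cinner_scaleC_left cinner_scaleC_right mult_ac)
  also have "\<dots> = complex_of_real ((cmod a * norm x)\<^sup>2)"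
    by (simp only: cinner_self complex_norm_square[symmetric] power_mult_distrib of_real_mult)
  finally have "(norm (a *\<^sub>C x))\<^sup>2 = (cmod a * norm x)\<^sup>2"
    by (simp only: of_real_eq_iff)
  then show ?thesis
    by simp
qed

text \<open>
  Rotating \<open>x\<close> by a phase makes \<open>cinner x y\<close> real, which reduces the claim to the real inequality.
\<close>

lemma cinner_Cauchy_Schwarz: "cmod (cinner x y) \<le> norm x * norm y"
proof (cases "cinner x y = 0")
  case False
  define u where "u = cnj (cinner x y) / cmod (cinner x y)"
  have u: "cmod u = 1"
    using False by (simp add: u_def norm_divide)
  have "u * cinner x y = complex_of_real (cmod (cinner x y))"
    using False complex_norm_square[of "cinner x y"]
    by (simp add: u_def power2_eq_square field_simps)
  then have "cmod (cinner x y) = Re (cinner (u *\<^sub>C x) y)"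
    by (simp add: cinner_scaleC_left)
  also have "\<dots> \<le> norm (u *\<^sub>C x) * norm y"
    unfolding inner_eq_Re_cinner[symmetric] by (rule norm_cauchy_schwarz)
  finally show ?thesis
    by (simp add: norm_scaleC u)
qed simp

lemma bounded_linear_cinner_left: "bounded_linear (\<lambda>x. cinner x y)"
  by (rule bounded_linear_intro[where K = "norm y"])
    (simp_all add: cinner_add_left scaleR_scaleC cinner_scaleC_left cinner_Cauchy_Schwarz
      scaleR_conv_of_real)

lemma tendsto_scaleC:
  assumes "(f \<longlongrightarrow> a) F" "(g \<longlongrightarrow> (b :: 'a::complex_inner)) F"
  shows "((\<lambda>x. f x *\<^sub>C g x) \<longlongrightarrow> a *\<^sub>C b) F"
proof -
  interpret bounded_bilinear "(*\<^sub>C) :: complex \<Rightarrow> 'a \<Rightarrow> 'a"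
  proof
    show "\<exists>K. \<forall>a b. norm (a *\<^sub>C b :: 'a) \<le> norm a * norm b * K"
      by (rule exI[of _ 1]) (simp add: norm_scaleC)
  qed (simp_all add: scaleC_add_left scaleC_add_right scaleR_scaleC scaleC_scaleC
      scaleR_conv_of_real mult.commute)
  show ?thesis
    using assms by (rule tendsto)
qed


section \<open>Finite-dimensional and closed subspaces\<close>

lemma finite_span_of_subset:
  assumes "complex_vector.subspace V" "finite B" "V \<subseteq> complex_vector.span B"
  shows "\<exists>B'. finite B' \<and> B' \<subseteq> V \<and> complex_vector.span B' = V"
proof -
  obtain B' where B': "B' \<subseteq> V" "\<not> complex_vector.dependent B'" "V \<subseteq> complex_vector.span B'"
    using complex_vector.basis_exists[of V] by metis
  have "finite B'"
    using complex_vector.independent_span_bound[of B B'] B' assms by blast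
  moreover have "complex_vector.span B' = V"
    using B' assms(1) complex_vector.span_minimal[of B' V] by blast
  ultimately show ?thesis
    using B'(1) by blast
qed

text \<open>
  A subspace is finite-dimensional if the kernel of a linear functional on it is. The functional
  is only given as a relation, since in the application its value is the value at a point of some
  continuous representative of a class of functions.
\<close>

lemma finite_span_by_functional:
  assumes V: "\<And>x y k. x \<in> V \<Longrightarrow> y \<in> V \<Longrightarrow> x - k *\<^sub>C y \<in> V"
    and P: "\<And>x y a b k. P x a \<Longrightarrow> P y b \<Longrightarrow> P (x - k *\<^sub>C y) (a - k * b :: complex)"
    and ex: "\<And>x. x \<in> V \<Longrightarrow> \<exists>a. P x a"
    and B: "finite B" "{x \<in> V. P x 0} \<subseteq> complex_vector.span B"
  shows "\<exists>B. finite B \<and> V \<subseteq> complex_vector.span B"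
proof (cases "\<exists>x a. x \<in> V \<and> P x a \<and> a \<noteq> 0")
  case True
  then obtain y b where y: "y \<in> V" "P y b" "b \<noteq> 0"
    by blast
  have "x \<in> complex_vector.span (insert y B)" if "x \<in> V" for x
  proof -
    obtain a where "P x a"
      using ex[OF \<open>x \<in> V\<close>] by blast
    then have "P (x - (a / b) *\<^sub>C y) 0"
      using P[of x a y b "a / b"] y by simp
    then have "x - (a / b) *\<^sub>C y \<in> complex_vector.span B"
      using B(2) V[OF that y(1)] by blast
    then show ?thesis
      unfolding complex_vector.span_insert by blast
  qed
  then show ?thesis
    using B by (intro exI[of _ "insert y B"]) auto
next
  case False
  have "P x 0" if "x \<in> V" for x
    using ex[OF that] False that by metis
  then have "V \<subseteq> {x \<in> V. P x 0}"
    by blast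
  then show ?thesis
    using B by (intro exI[of _ B]) simp
qed

text \<open>
  Adjoining one vector outside a closed subspace keeps it closed: the distance of \<open>x\<close> from \<open>S\<close> is positive
  and bounds the coefficient of \<open>x\<close> by the norm.
\<close>

lemma closed_span_insert:
  fixes x :: "'a::{complex_inner, complete_space}"
  assumes S: "complex_vector.subspace S" "closed S"
  shows "closed (complex_vector.span (insert x S))"
proof -
  have spanS: "complex_vector.span S = S"
    using S(1) by (simp only: complex_vector.span_eq_iff)
  show ?thesis
  proof (cases "x \<in> S")
    case True
    then show ?thesis
      using S(2) by (simp only: insert_absorb spanS)
  next
    case False
    have ne: "S \<noteq> {}"
      using complex_vector.subspace_0[OF S(1)] by blast
    define d where "d = infdist x S"
    have d: "d > 0"
      unfolding d_def using in_closed_iff_infdist_zero[OF S(2) ne, of x] False infdist_nonneg[of x S] by simp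
    \<comment> \<open>the coefficient of \<open>x\<close> depends continuously on the vector\<close>
    have le: "cmod k * d \<le> norm (k *\<^sub>C x + s)" if "s \<in> S" for k s
    proof (cases "k = 0")
      case False
      have "- ((1 / k) *\<^sub>C s) \<in> S"
        using S(1) that by (simp add: complex_vector.subspace_neg complex_vector.subspace_scale)
      then have "d \<le> dist x (- ((1 / k) *\<^sub>C s))"
        unfolding d_def by (rule infdist_le)
      also have "\<dots> = norm ((1 / k) *\<^sub>C (k *\<^sub>C x + s))"
        using False by (simp add: dist_norm scaleC_add_right scaleC_scaleC)
      also have "\<dots> = norm (k *\<^sub>C x + s) / cmod k"
        by (simp add: norm_scaleC norm_divide)
      finally show ?thesis
        using False by (simp add: field_simps)
    qed simp
    show ?thesis
      unfolding closed_sequential_limits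
    proof (intro allI impI, elim conjE)
      fix z w assume z: "\<forall>n::nat. z n \<in> complex_vector.span (insert x S)" and lim: "z \<longlonglongrightarrow> w"
      have "\<forall>n. \<exists>k. z n - k *\<^sub>C x \<in> S"
        using z unfolding complex_vector.span_insert spanS by blast
      then obtain k where k: "\<And>n. z n - k n *\<^sub>C x \<in> S"
        by metis
      have "Cauchy k"
      proof (rule metric_CauchyI)
        fix e :: real assume e: "e > 0"
        obtain M where M: "\<And>m n. m \<ge> M \<Longrightarrow> n \<ge> M \<Longrightarrow> dist (z m) (z n) < e * d"
          using metric_CauchyD[OF LIMSEQ_imp_Cauchy[OF lim], of "e * d"] e d by auto
        have "dist (k m) (k n) < e" if "m \<ge> M" "n \<ge> M" for m n
        proof -
          have "(z m - k m *\<^sub>C x) - (z n - k n *\<^sub>C x) \<in> S"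
            using k S(1) by (simp add: complex_vector.subspace_diff)
          from le[OF this, of "k m - k n"] have "cmod (k m - k n) * d \<le> norm (z m - z n)"
            by (simp add: complex_vector.scale_left_diff_distrib algebra_simps)
          also have "\<dots> < e * d"
            using M[OF that] by (simp add: dist_norm)
          finally show ?thesis
            using d by (simp add: dist_norm)
        qed
        then show "\<exists>M. \<forall>m\<ge>M. \<forall>n\<ge>M. dist (k m) (k n) < e"
          by blast
      qed
      then obtain k0 where k0: "k \<longlonglongrightarrow> k0"
        using Cauchy_convergent_iff convergent_def by blast
      have "(\<lambda>n. z n - k n *\<^sub>C x) \<longlonglongrightarrow> w - k0 *\<^sub>C x"
        by (intro tendsto_diff lim tendsto_scaleC k0 tendsto_const)
      then have "w - k0 *\<^sub>C x \<in> S"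
        by (rule closed_sequentially[OF S(2) k])
      then show "w \<in> complex_vector.span (insert x S)"
        unfolding complex_vector.span_insert spanS by blast
    qed
  qed
qed

lemma closed_span_Un_finite:
  fixes S :: "'a::{complex_inner, complete_space} set"
  assumes "finite B" "complex_vector.subspace S" "closed S"
  shows "closed (complex_vector.span (S \<union> B))"
  using assms(1)
proof (induction B)
  case empty
  have "complex_vector.span S = S"
    using assms(2) by (simp only: complex_vector.span_eq_iff)
  then show ?case
    using assms(3) by (simp only: Un_empty_right)
next
  case (insert b B)
  have "complex_vector.span (S \<union> insert b B)
      = complex_vector.span (insert b (complex_vector.span (S \<union> B)))"
    by (simp add: complex_vector.span_insert complex_vector.span_span)
  then show ?case
    using closed_span_insert[OF complex_vector.subspace_span insert.IH] by simp
qed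

text \<open>Orthogonal projection onto a closed subspace: by the parallelogram law, a minimizing
  sequence for the distance is a Cauchy sequence.\<close>

lemma orthogonal_projection_exists:
  fixes x :: "'a::{complex_inner, complete_space}"
  assumes S: "complex_vector.subspace S" "closed S"
  shows "\<exists>p\<in>S. \<forall>s\<in>S. cinner (x - p) s = 0"
proof -
  have ne: "S \<noteq> {}"
    using complex_vector.subspace_0[OF S(1)] by blast
  define d where "d = infdist x S"
  have d0: "d \<ge> 0"
    by (simp add: d_def infdist_nonneg)
  have d_le: "d \<le> norm (x - s)" if "s \<in> S" for s
    using infdist_le[OF that, of x] by (simp add: d_def dist_norm)
  have "\<exists>s\<in>S. norm (x - s) < d + 1 / Suc n" for n
  proof (rule ccontr)
    assume "\<not> ?thesis"
    then have "d + 1 / Suc n \<le> infdist x S"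
      by (subst infdist_def) (auto simp: ne dist_norm not_less intro!: cINF_greatest)
    then show False
      by (simp add: d_def)
  qed
  then obtain s where s: "\<And>n. s n \<in> S" "\<And>n. norm (x - s n) < d + 1 / Suc n"
    by metis
  have half: "(1 / 2) *\<^sub>R (u + v) \<in> S" if "u \<in> S" "v \<in> S" for u v
    using S(1) that
    by (simp add: scaleR_scaleC complex_vector.subspace_add complex_vector.subspace_scale)
  have par: "(norm (u - v))\<^sup>2 \<le> 2 * (norm (x - u))\<^sup>2 + 2 * (norm (x - v))\<^sup>2 - 4 * d\<^sup>2"
    if "u \<in> S" "v \<in> S" for u v
  proof -
    have "(norm (u - v))\<^sup>2 = 2 * (norm (x - u))\<^sup>2 + 2 * (norm (x - v))\<^sup>2
        - 4 * (norm (x - (1 / 2) *\<^sub>R (u + v)))\<^sup>2"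
      unfolding power2_norm_eq_inner
      by (simp add: inner_diff_left inner_diff_right inner_add_left inner_add_right inner_commute
          algebra_simps)
    moreover have "d\<^sup>2 \<le> (norm (x - (1 / 2) *\<^sub>R (u + v)))\<^sup>2"
      using d_le[OF half[OF that]] d0 by (rule power_mono)
    ultimately show ?thesis
      by simp
  qed
  have gap: "(norm (x - s n))\<^sup>2 \<le> d\<^sup>2 + (2 * d + 1) / Suc n" for n
  proof -
    have "(norm (x - s n))\<^sup>2 \<le> (d + 1 / Suc n)\<^sup>2"
      using s(2)[of n] by (intro power_mono) auto
    also have "\<dots> = d\<^sup>2 + 2 * d / Suc n + 1 / Suc n * (1 / Suc n)"
      by (simp only: power2_sum) (simp add: power2_eq_square)
    also have "1 / Suc n * (1 / Suc n) \<le> 1 / real (Suc n)"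
      by (rule mult_left_le) auto
    finally show ?thesis
      by (simp add: add_divide_distrib)
  qed
  have "Cauchy s"
  proof (rule metric_CauchyI)
    fix e :: real assume e: "e > 0"
    obtain M where "4 * (2 * d + 1) / e\<^sup>2 < real M"
      using reals_Archimedean2 by blast
    then have M: "4 * (2 * d + 1) / e\<^sup>2 < real (Suc M)"
      by simp
    have "dist (s m) (s n) < e" if "m \<ge> M" "n \<ge> M" for m n
    proof -
      have mono: "(2 * d + 1) / Suc j \<le> (2 * d + 1) / Suc M" if "j \<ge> M" for j
        using that d0 by (intro divide_left_mono) auto
      have "(norm (s m - s n))\<^sup>2 \<le> 2 * ((2 * d + 1) / Suc m) + 2 * ((2 * d + 1) / Suc n)"
        using par[OF s(1) s(1), of m n] gap[of m] gap[of n] by linarith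
      also have "\<dots> \<le> 4 * ((2 * d + 1) / Suc M)"
        using mono[OF that(1)] mono[OF that(2)] by linarith
      also have "\<dots> < e\<^sup>2"
        using M e by (simp add: field_simps)
      finally show ?thesis
        using e by (simp add: dist_norm power_less_imp_less_base)
    qed
    then show "\<exists>M. \<forall>m\<ge>M. \<forall>n\<ge>M. dist (s m) (s n) < e"
      by blast
  qed
  then obtain p where p: "s \<longlonglongrightarrow> p"
    using Cauchy_convergent_iff convergent_def by blast
  have pS: "p \<in> S"
    by (rule closed_sequentially[OF S(2) s(1) p])
  have "norm (x - p) \<le> d"
  proof (rule LIMSEQ_le)
    show "(\<lambda>n. norm (x - s n)) \<longlonglongrightarrow> norm (x - p)"
      by (intro tendsto_norm tendsto_diff tendsto_const p)
    show "(\<lambda>n. d + 1 / Suc n) \<longlonglongrightarrow> d"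
      using tendsto_add[OF tendsto_const LIMSEQ_Suc[OF lim_1_over_n], of d] by simp
    show "\<exists>N. \<forall>n\<ge>N. norm (x - s n) \<le> d + 1 / Suc n"
      using s(2) less_imp_le by blast
  qed
  have real_orth: "inner (x - p) t = 0" if t: "t \<in> S" for t
  proof (rule ccontr)
    assume c: "inner (x - p) t \<noteq> 0"
    then have t0: "inner t t > 0"
      by auto
    define k where "k = inner (x - p) t / inner t t"
    have "p + k *\<^sub>R t \<in> S"
      using S(1) pS t by (simp add: scaleR_scaleC complex_vector.subspace_add complex_vector.subspace_scale)
    then have "(norm (x - p))\<^sup>2 \<le> (norm (x - (p + k *\<^sub>R t)))\<^sup>2"
      using d_le \<open>norm (x - p) \<le> d\<close> by (meson norm_ge_zero order_trans power_mono)
    also have "\<dots> = (norm (x - p))\<^sup>2 - 2 * k * inner (x - p) t + k * k * inner t t"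
      unfolding power2_norm_eq_inner
      by (simp add: inner_diff_left inner_diff_right inner_add_left inner_add_right inner_commute
          algebra_simps)
    also have "\<dots> = (norm (x - p))\<^sup>2 - (inner (x - p) t)\<^sup>2 / inner t t"
      using t0 by (simp add: k_def power2_eq_square field_simps)
    finally have "(inner (x - p) t)\<^sup>2 / inner t t \<le> 0"
      by simp
    moreover have "(inner (x - p) t)\<^sup>2 / inner t t > 0"
      using c t0 by simp
    ultimately show False
      by simp
  qed
  have "cinner (x - p) t = 0" if t: "t \<in> S" for t
  proof -
    have "\<i> *\<^sub>C t \<in> S"
      using S(1) t by (rule complex_vector.subspace_scale)
    from real_orth[OF t] real_orth[OF this] show ?thesis
      by (simp add: inner_eq_Re_cinner cinner_scaleC_right complex_eq_iff)
  qed
  then show ?thesis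
    using pS by blast
qed

section \<open>Criteria for the Fredholm property\<close>

text \<open>
  The kernel of \<open>T - \<zeta>\<close> and, via orthogonal projection, a complement of its range lie in the spaces
  of weak solutions of \<open>A\<^sub>0\<^sup>* y = \<zeta> y\<close> and \<open>A\<^sub>0\<^sup>* y = cnj \<zeta> y\<close>. The range is closed for the
  following reason. Enlarge the graph of \<open>T - \<zeta>\<close> by the finite-dimensional space of weak
  solutions of \<open>A\<^sub>0\<^sup>* y = \<zeta> y\<close>; this preserves closedness and the range. The enlarged graph contains
  every bounded solution \<open>y\<close> of \<open>(A\<^sub>0\<^sup>* - \<zeta>) y = f\<close> with \<open>f\<close> in the range, so the bounded solutions
  belonging to a convergent sequence of right-hand sides converge inside it.
\<close>

lemma fredholm_criterion:
  fixes T A\<^sub>0 :: "('a::{complex_inner, complete_space} \<times> 'a) set"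
  assumes H: "complex_vector.subspace H" "closed H"
    and T: "closed_symmetric_extension H A\<^sub>0 T"
    and ker: "\<And>\<mu>. \<mu> \<in> {\<zeta>, cnj \<zeta>} \<Longrightarrow> \<exists>B. finite B \<and>
      {y \<in> H. \<forall>(\<phi>, a) \<in> A\<^sub>0. cinner y a = \<mu> * cinner y \<phi>} \<subseteq> complex_vector.span B"
    and solv: "\<And>f. f \<in> H \<Longrightarrow> \<exists>y\<in>H. norm y \<le> C * norm f \<and>
      (\<forall>(\<phi>, a) \<in> A\<^sub>0. cinner y a = cinner (f + \<zeta> *\<^sub>C y) \<phi>)"
  shows "fredholm_in H (operator_minus_scalar T \<zeta>)"
proof -
  define N where "N = (\<lambda>\<mu>. {y \<in> H. \<forall>(\<phi>, a) \<in> A\<^sub>0. cinner y a = \<mu> * cinner y \<phi>})"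
  define T' where "T' = operator_minus_scalar T \<zeta>"
  have TH: "T \<subseteq> H \<times> H" and subT: "complex_vector.subspace T" and clT: "closed T" and A0T: "A\<^sub>0 \<subseteq> T"
    and sym: "\<And>x u y v. (x, u) \<in> T \<Longrightarrow> (y, v) \<in> T \<Longrightarrow> cinner u y = cinner x v"
    using T unfolding closed_symmetric_extension_def symmetric_operator_in_def linear_operator_in_def
    by blast+
  have T'_iff: "(x, v) \<in> T' \<longleftrightarrow> (x, v + \<zeta> *\<^sub>C x) \<in> T" for x v
    by (force simp: T'_def operator_minus_scalar_def)
  have subT': "complex_vector.subspace T'"
  proof (rule complex_vector.subspaceI)
    show "0 \<in> T'"
      using complex_vector.subspace_0[OF subT] by (simp add: T'_iff zero_prod_def)
    show "p + q \<in> T'" if "p \<in> T'" "q \<in> T'" for p q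
      using that complex_vector.subspace_add[OF subT, of "(fst p, snd p + \<zeta> *\<^sub>C fst p)"
          "(fst q, snd q + \<zeta> *\<^sub>C fst q)"]
      by (cases p; cases q) (simp add: T'_iff scaleC_add_right algebra_simps)
    show "k *\<^sub>C p \<in> T'" if "p \<in> T'" for p k
      using that complex_vector.subspace_scale[OF subT, of "(fst p, snd p + \<zeta> *\<^sub>C fst p)" k]
      by (cases p) (simp add: T'_iff scaleC_prod_def scaleC_add_right scaleC_scaleC mult.commute)
  qed
  have clT': "closed T'"
  proof -
    have "T' = (\<lambda>p. (fst p, snd p + \<zeta> *\<^sub>C fst p)) -` T"
      by (auto simp: T'_iff)
    moreover have "continuous_on UNIV (\<lambda>p :: 'a \<times> 'a. (fst p, snd p + \<zeta> *\<^sub>C fst p))"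
      unfolding continuous_on_def by (intro ballI tendsto_intros tendsto_scaleC)
    ultimately show ?thesis
      using clT by (simp add: closed_vimage)
  qed
  have T'H: "x \<in> H" "v \<in> H" if "(x, v) \<in> T'" for x v
  proof -
    have *: "x \<in> H" "v + \<zeta> *\<^sub>C x \<in> H"
      using that TH by (auto simp: T'_iff)
    then have "(v + \<zeta> *\<^sub>C x) - \<zeta> *\<^sub>C x \<in> H"
      using H(1) by (intro complex_vector.subspace_diff complex_vector.subspace_scale)
    then show "x \<in> H" "v \<in> H"
      using * by simp_all
  qed
  have T'_sym: "cinner x a = cinner (v + \<zeta> *\<^sub>C x) \<phi>" if "(x, v) \<in> T'" "(\<phi>, a) \<in> A\<^sub>0" for x v \<phi> a
    using that sym A0T unfolding T'_iff by (metis subsetD)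
  have subR: "complex_vector.subspace (Range T')"
  proof (rule complex_vector.subspaceI)
    show "0 \<in> Range T'"
      using complex_vector.subspace_0[OF subT'] by (auto simp: zero_prod_def)
    show "p + q \<in> Range T'" if "p \<in> Range T'" "q \<in> Range T'" for p q
      using that complex_vector.subspace_add[OF subT'] by fastforce
    show "k *\<^sub>C p \<in> Range T'" if p: "p \<in> Range T'" for p k
    proof -
      obtain x where "(x, p) \<in> T'"
        using p by blast
      from complex_vector.subspace_scale[OF subT' this, of k] show ?thesis
        by (auto simp: scaleC_prod_def)
    qed
  qed
  have N_iff: "y \<in> N \<mu> \<longleftrightarrow> y \<in> H \<and> (\<forall>\<phi> a. (\<phi>, a) \<in> A\<^sub>0 \<longrightarrow> cinner y a = \<mu> * cinner y \<phi>)" for y \<mu>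
    by (auto simp: N_def)
  have sub: "complex_vector.subspace (N \<mu>)" for \<mu>
    using H(1)
    by (intro complex_vector.subspaceI)
      (auto simp: N_iff complex_vector.subspace_0 complex_vector.subspace_add
        complex_vector.subspace_scale cinner_add_left cinner_scaleC_left distrib_left)
  obtain B1 where B1: "finite B1" "N \<zeta> \<subseteq> complex_vector.span B1" "B1 \<subseteq> N \<zeta>"
  proof -
    obtain B where "finite B" "N \<zeta> \<subseteq> complex_vector.span B"
      using ker[of \<zeta>] by (auto simp: N_def)
    then show thesis
      using finite_span_of_subset[OF sub, of B \<zeta>] that by blast
  qed
  define S where "S = complex_vector.span (T' \<union> B1 \<times> {0})"
  have clS: "closed S"
    unfolding S_def using B1(1) subT' clT' by (intro closed_span_Un_finite) auto
  have S_Range: "Range S \<subseteq> Range T'"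
  proof -
    have "complex_vector.subspace (UNIV \<times> Range T')"
    proof (rule complex_vector.subspaceI)
      show "0 \<in> UNIV \<times> Range T'"
        using complex_vector.subspace_0[OF subR] by (simp add: zero_prod_def)
      show "p + q \<in> UNIV \<times> Range T'" if "p \<in> UNIV \<times> Range T'" "q \<in> UNIV \<times> Range T'" for p q
        using that complex_vector.subspace_add[OF subR, of "snd p" "snd q"]
        by (simp add: mem_Times_iff)
      show "k *\<^sub>C p \<in> UNIV \<times> Range T'" if "p \<in> UNIV \<times> Range T'" for p k
        using that complex_vector.subspace_scale[OF subR, of "snd p" k]
        by (simp add: mem_Times_iff scaleC_prod_def)
    qed
    moreover have "T' \<union> B1 \<times> {0} \<subseteq> UNIV \<times> Range T'"
      using complex_vector.subspace_0[OF subR] by auto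
    ultimately have "S \<subseteq> UNIV \<times> Range T'"
      unfolding S_def by (rule complex_vector.span_minimal[rotated])
    then show ?thesis
      by blast
  qed
  have subS: "complex_vector.subspace S"
    unfolding S_def by (rule complex_vector.subspace_span)
  have N_S: "(n, 0) \<in> S" if "n \<in> N \<zeta>" for n
  proof -
    have "complex_vector.subspace {n. (n, 0) \<in> S}"
    proof (rule complex_vector.subspaceI)
      show "0 \<in> {n. (n, 0) \<in> S}"
        using complex_vector.subspace_0[OF subS] by (simp add: zero_prod_def)
      show "p + q \<in> {n. (n, 0) \<in> S}" if "p \<in> {n. (n, 0) \<in> S}" "q \<in> {n. (n, 0) \<in> S}" for p q
        using that complex_vector.subspace_add[OF subS, of "(p, 0)" "(q, 0)"] by simp
      show "k *\<^sub>C p \<in> {n. (n, 0) \<in> S}" if "p \<in> {n. (n, 0) \<in> S}" for p k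
        using that complex_vector.subspace_scale[OF subS, of "(p, 0)" k]
        by (simp add: scaleC_prod_def)
    qed
    moreover have "B1 \<subseteq> {n. (n, 0) \<in> S}"
      unfolding S_def using complex_vector.span_superset[of "T' \<union> B1 \<times> {0}"] by blast
    ultimately have "complex_vector.span B1 \<subseteq> {n. (n, 0) \<in> S}"
      by (rule complex_vector.span_minimal[rotated])
    then show ?thesis
      using that B1(2) by blast
  qed
  have T'_S: "T' \<subseteq> S"
    unfolding S_def using complex_vector.span_superset[of "T' \<union> B1 \<times> {0}"] by blast
  have clR: "closed (Range T')"
    unfolding closed_sequential_limits
  proof (intro allI impI, elim conjE)
    fix g f assume g: "\<forall>k::nat. g k \<in> Range T'" and lim: "g \<longlonglongrightarrow> f"
    have "\<forall>k. \<exists>x. (x, g k) \<in> T'"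
      using g by (simp add: Range_iff)
    then obtain x where x: "\<And>k. (x k, g k) \<in> T'"
      by metis
    have gH: "g k \<in> H" for k
      using x T'H by blast
    have fH: "f \<in> H"
      by (rule closed_sequentially[OF H(2) gH lim])
    have dH: "g k - f \<in> H" for k
      using gH fH H(1) by (simp add: complex_vector.subspace_diff)
    obtain y where y: "y \<in> H" "\<And>\<phi> a. (\<phi>, a) \<in> A\<^sub>0 \<Longrightarrow> cinner y a = cinner (f + \<zeta> *\<^sub>C y) \<phi>"
      using solv[OF fH] by blast
    have "\<forall>k. \<exists>e. e \<in> H \<and> norm e \<le> C * norm (g k - f) \<and>
        (\<forall>(\<phi>, a) \<in> A\<^sub>0. cinner e a = cinner (g k - f + \<zeta> *\<^sub>C e) \<phi>)"
      using solv[OF dH] by blast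
    from choice[OF this] obtain e where e': "\<forall>k. e k \<in> H \<and> norm (e k) \<le> C * norm (g k - f) \<and>
        (\<forall>(\<phi>, a) \<in> A\<^sub>0. cinner (e k) a = cinner (g k - f + \<zeta> *\<^sub>C e k) \<phi>)" ..
    then have e: "\<And>k. e k \<in> H" "\<And>k. norm (e k) \<le> C * norm (g k - f)"
        "\<And>k \<phi> a. (\<phi>, a) \<in> A\<^sub>0 \<Longrightarrow> cinner (e k) a = cinner (g k - f + \<zeta> *\<^sub>C e k) \<phi>"
      by auto
    have "e \<longlonglongrightarrow> 0"
    proof (rule tendsto_norm_zero_cancel, rule tendsto_sandwich)
      show "\<forall>\<^sub>F k in sequentially. 0 \<le> norm (e k)" "\<forall>\<^sub>F k in sequentially. norm (e k) \<le> C * norm (g k - f)"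
        using e(2) by simp_all
      have "(\<lambda>k. C * norm (g k - f)) \<longlonglongrightarrow> C * norm (f - f)"
        by (intro tendsto_intros lim)
      then show "(\<lambda>k. C * norm (g k - f)) \<longlonglongrightarrow> 0"
        by simp
    qed (rule tendsto_const)
    then have "(\<lambda>k. (y + e k, g k)) \<longlonglongrightarrow> (y + 0, f)"
      by (intro tendsto_Pair tendsto_add tendsto_const lim)
    moreover have "(y + e k, g k) \<in> S" for k
    proof -
      have "y + e k - x k \<in> N \<zeta>"
      proof -
        have "y + e k - x k \<in> H"
          using y e(1) x T'H(1) H(1)
          by (intro complex_vector.subspace_diff complex_vector.subspace_add) blast+
        moreover have "cinner (y + e k - x k) a = \<zeta> * cinner (y + e k - x k) \<phi>"
          if "(\<phi>, a) \<in> A\<^sub>0" for \<phi> a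
          using y(2)[OF that] e(3)[OF that, of k] T'_sym[OF x[of k] that]
          by (simp add: cinner_add_left cinner_diff_left cinner_scaleC_left algebra_simps)
        ultimately show ?thesis
          by (auto simp: N_def)
      qed
      then have "(x k, g k) + (y + e k - x k, 0) \<in> S"
        using subS T'_S x N_S by (intro complex_vector.subspace_add) blast+
      then show ?thesis
        by simp
    qed
    ultimately have "(y + 0, f) \<in> S"
      by (rule closed_sequentially[OF clS, rotated])
    then show "f \<in> Range T'"
      using S_Range by blast
  qed
  have kernel: "\<exists>B. finite B \<and> complex_vector.span B = {x. (x, 0) \<in> T'}"
  proof -
    have "complex_vector.subspace {x. (x, 0) \<in> T'}"
    proof (rule complex_vector.subspaceI)
      show "0 \<in> {n. (n, 0) \<in> T'}"
        using complex_vector.subspace_0[OF subT'] by (simp add: zero_prod_def)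
      show "p + q \<in> {n. (n, 0) \<in> T'}" if "p \<in> {n. (n, 0) \<in> T'}" "q \<in> {n. (n, 0) \<in> T'}" for p q
        using that complex_vector.subspace_add[OF subT', of "(p, 0)" "(q, 0)"] by simp
      show "k *\<^sub>C p \<in> {n. (n, 0) \<in> T'}" if "p \<in> {n. (n, 0) \<in> T'}" for p k
        using that complex_vector.subspace_scale[OF subT', of "(p, 0)" k]
        by (simp add: scaleC_prod_def)
    qed
    moreover have "{x. (x, 0) \<in> T'} \<subseteq> N \<zeta>"
      using T'H(1) T'_sym by (fastforce simp: N_def cinner_scaleC_left)
    ultimately show ?thesis
      using finite_span_of_subset[of "{x. (x, 0) \<in> T'}" B1] B1(1,2) by blast
  qed
  have codim: "\<exists>B. finite B \<and> B \<subseteq> H \<and> complex_vector.span (Range T' \<union> B) = H"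
  proof -
    obtain B where "finite B" "N (cnj \<zeta>) \<subseteq> complex_vector.span B"
      using ker[of "cnj \<zeta>"] by (auto simp: N_def)
    then obtain B2 where B2: "finite B2" "B2 \<subseteq> N (cnj \<zeta>)" "complex_vector.span B2 = N (cnj \<zeta>)"
      using finite_span_of_subset[OF sub, of B "cnj \<zeta>"] by blast
    have B2H: "B2 \<subseteq> H"
      using B2(2) by (auto simp: N_def)
    have "h \<in> complex_vector.span (Range T' \<union> B2)" if h: "h \<in> H" for h
    proof -
      obtain p where p: "p \<in> Range T'" "\<And>w. w \<in> Range T' \<Longrightarrow> cinner (h - p) w = 0"
        using orthogonal_projection_exists[OF subR clR, of h] by blast
      have "h - p \<in> H"
        using h p(1) T'H(2) H(1) by (blast intro: complex_vector.subspace_diff)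
      moreover have "cinner (h - p) a = cnj \<zeta> * cinner (h - p) \<phi>" if "(\<phi>, a) \<in> A\<^sub>0" for \<phi> a
      proof -
        have "(\<phi>, a - \<zeta> *\<^sub>C \<phi>) \<in> T'"
          using that A0T by (auto simp: T'_iff)
        then have "cinner (h - p) (a - \<zeta> *\<^sub>C \<phi>) = 0"
          using p(2) by blast
        then show ?thesis
          by (simp add: cinner_diff_right cinner_scaleC_right)
      qed
      ultimately have "h - p \<in> complex_vector.span B2"
        unfolding B2(3) by (auto simp: N_def)
      then have "h - p \<in> complex_vector.span (Range T' \<union> B2)"
        using complex_vector.span_mono[of B2 "Range T' \<union> B2"] by blast
      moreover have "p \<in> complex_vector.span (Range T' \<union> B2)"
        using p(1) by (simp add: complex_vector.span_base)
      ultimately have "(h - p) + p \<in> complex_vector.span (Range T' \<union> B2)"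
        by (rule complex_vector.span_add)
      then show ?thesis
        by simp
    qed
    moreover have "complex_vector.span (Range T' \<union> B2) \<subseteq> H"
      using B2H T'H(2) H(1) by (intro complex_vector.span_minimal) blast+
    ultimately show ?thesis
      using B2(1) B2H by blast
  qed
  show ?thesis
    unfolding fredholm_in_def T'_def[symmetric] using clR kernel codim by blast
qed

text \<open>
  A thin set contains vectors with rapidly decaying coefficients only, with respect to some
  orthonormal sequence. Thinness survives the addition of one vector \<open>b\<close>, because any two
  consecutive members of the sequence have a normalized combination orthogonal to \<open>b\<close>; so it
  measures infinite codimension.
\<close>

definition thin_in :: "'a::complex_inner set \<Rightarrow> 'a set \<Rightarrow> bool"
  where "thin_in H W \<longleftrightarrow> (\<exists>y :: nat \<Rightarrow> 'a. (\<forall>k. y k \<in> H) \<and>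
    (\<forall>j k. cinner (y j) (y k) = (if j = k then 1 else 0)) \<and>
    (\<forall>w\<in>W. \<exists>C. \<forall>k. cmod (cinner w (y k)) \<le> C / 4 ^ k))"

lemma unit_combination_vanishing:
  "\<exists>\<alpha> \<beta>. (cmod \<alpha>)\<^sup>2 + (cmod \<beta>)\<^sup>2 = 1 \<and> cnj \<alpha> * p + cnj \<beta> * q = 0"
proof (cases "p = 0 \<and> q = 0")
  case True
  then show ?thesis
    by (intro exI[of _ 1] exI[of _ 0]) simp
next
  case False
  define r where "r = sqrt ((cmod p)\<^sup>2 + (cmod q)\<^sup>2)"
  have "(cmod p)\<^sup>2 + (cmod q)\<^sup>2 > 0"
    using False by (auto simp: add_pos_nonneg add_nonneg_pos)
  then have r: "r > 0" "r\<^sup>2 = (cmod p)\<^sup>2 + (cmod q)\<^sup>2"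
    by (simp_all add: r_def)
  have "(cmod (cnj q / r))\<^sup>2 + (cmod (- cnj p / r))\<^sup>2 = ((cmod q)\<^sup>2 + (cmod p)\<^sup>2) / r\<^sup>2"
    using r(1) by (simp add: norm_divide power_divide add_divide_distrib)
  also have "\<dots> = 1"
    using r by (metis add.commute divide_self less_irrefl zero_less_power)
  finally show ?thesis
    by (intro exI[of _ "cnj q / r"] exI[of _ "- cnj p / r"]) simp
qed

lemma thin_in_span_insert:
  assumes H: "complex_vector.subspace H" and W: "complex_vector.subspace W" "thin_in H W"
  shows "thin_in H (complex_vector.span (insert b W))"
proof -
  obtain y where y: "\<And>k. y k \<in> H" "\<And>j k. cinner (y j) (y k) = (if j = k then 1 else 0)"
      "\<And>w. w \<in> W \<Longrightarrow> \<exists>C. \<forall>k::nat. cmod (cinner w (y k)) \<le> C / 4 ^ k"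
    using W(2) unfolding thin_in_def by blast
  obtain \<alpha> \<beta> where ab: "\<And>k. (cmod (\<alpha> k))\<^sup>2 + (cmod (\<beta> k))\<^sup>2 = 1"
      "\<And>k::nat. cnj (\<alpha> k) * cinner b (y (2 * k)) + cnj (\<beta> k) * cinner b (y (2 * k + 1)) = 0"
    using unit_combination_vanishing[of "cinner b (y (2 * k))" "cinner b (y (2 * k + 1))" for k] by metis
  define z where "z = (\<lambda>k. \<alpha> k *\<^sub>C y (2 * k) + \<beta> k *\<^sub>C y (2 * k + 1))"
  have le1: "cmod (\<alpha> k) \<le> 1" "cmod (\<beta> k) \<le> 1" for k
    using ab(1)[of k] by (smt (verit) norm_ge_zero power2_le_imp_le power_one zero_le_power2)+
  have cz: "cinner w (z k) = cnj (\<alpha> k) * cinner w (y (2 * k)) + cnj (\<beta> k) * cinner w (y (2 * k + 1))"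
    for w k by (simp add: z_def cinner_add_right cinner_scaleC_right)
  have "z k \<in> H" for k
    unfolding z_def using H y(1)
    by (simp add: complex_vector.subspace_add complex_vector.subspace_scale)
  moreover have "cinner (z j) (z k) = (if j = k then 1 else 0)" for j k
  proof -
    have "2 * j \<noteq> Suc (2 * k)" "Suc (2 * j) \<noteq> 2 * k"
      by presburger+
    then have "cinner (z j) (z k) = (if j = k then \<alpha> k * cnj (\<alpha> k) + \<beta> k * cnj (\<beta> k) else 0)"
      unfolding cz by (simp add: z_def cinner_add_left cinner_scaleC_left y(2))
    also have "\<alpha> k * cnj (\<alpha> k) + \<beta> k * cnj (\<beta> k) = complex_of_real ((cmod (\<alpha> k))\<^sup>2 + (cmod (\<beta> k))\<^sup>2)"
      by (simp only: complex_norm_square of_real_add)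
    also have "\<dots> = 1"
      by (simp only: ab(1) of_real_1)
    finally show ?thesis .
  qed
  moreover have "\<exists>C. \<forall>k. cmod (cinner v (z k)) \<le> C / 4 ^ k"
    if v: "v \<in> complex_vector.span (insert b W)" for v
  proof -
    have spanW: "complex_vector.span W = W"
      using W(1) by (simp only: complex_vector.span_eq_iff)
    obtain k where k: "v - k *\<^sub>C b \<in> W"
      using v unfolding complex_vector.span_insert spanW by blast
    define w where "w = v - k *\<^sub>C b"
    have eq: "cinner v (z j) = cinner w (z j)" for j
    proof -
      have "cinner v (z j) - cinner w (z j)
          = k * (cnj (\<alpha> j) * cinner b (y (2 * j)) + cnj (\<beta> j) * cinner b (y (2 * j + 1)))"
        by (simp add: w_def cinner_diff_left cinner_scaleC_left cz algebra_simps)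
      then show ?thesis
        unfolding ab(2) by simp
    qed
    obtain C where C: "\<And>k. cmod (cinner w (y k)) \<le> C / 4 ^ k"
      using y(3) k unfolding w_def by blast
    have C0: "C \<ge> 0"
      using C[of 0] by (simp add: order_trans[OF norm_ge_zero])
    have "cmod (cinner v (z j)) \<le> 2 * C / 4 ^ j" for j
    proof -
      have le: "cmod (cinner w (y i)) \<le> C / 4 ^ j" if "i \<ge> j" for i
      proof -
        have "C / 4 ^ i \<le> C / (4 :: real) ^ j"
          using that C0 by (intro divide_left_mono power_increasing) auto
        then show ?thesis
          using C[of i] by linarith
      qed
      have "cmod (cinner v (z j)) \<le> cmod (\<alpha> j) * cmod (cinner w (y (2 * j)))
          + cmod (\<beta> j) * cmod (cinner w (y (2 * j + 1)))"
        unfolding eq unfolding cz by (rule norm_triangle_le) (simp add: norm_mult)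
      also have "\<dots> \<le> 1 * (C / 4 ^ j) + 1 * (C / 4 ^ j)"
        using le1 le C0 by (intro add_mono mult_mono) auto
      finally show ?thesis
        by simp
    qed
    then show ?thesis
      by blast
  qed
  ultimately show ?thesis
    unfolding thin_in_def by blast
qed

lemma thin_in_span_Un_finite:
  assumes "finite B" "complex_vector.subspace H" "complex_vector.subspace W" "thin_in H W"
  shows "thin_in H (complex_vector.span (W \<union> B))"
  using assms(1)
proof (induction B)
  case empty
  have "complex_vector.span W = W"
    using assms(3) by (simp only: complex_vector.span_eq_iff)
  then show ?case
    using assms(4) by (simp only: Un_empty_right)
next
  case (insert b B)
  have "complex_vector.span (W \<union> insert b B)
      = complex_vector.span (insert b (complex_vector.span (W \<union> B)))"
    by (simp add: complex_vector.span_insert complex_vector.span_span)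
  then show ?case
    using thin_in_span_insert[OF assms(2) complex_vector.subspace_span insert.IH] by simp
qed

text \<open>The witness is the vector with the coefficients \<open>2 ^ - k\<close>, which decay too slowly.\<close>

lemma not_thin_in_itself:
  fixes H :: "'a::{complex_inner, banach} set"
  assumes H: "complex_vector.subspace H" "closed H"
  shows "\<not> thin_in H H"
proof
  assume "thin_in H H"
  then obtain y where y: "\<And>k. y k \<in> H" "\<And>j k. cinner (y j) (y k) = (if j = k then 1 else 0)"
      "\<And>w. w \<in> H \<Longrightarrow> \<exists>C. \<forall>k::nat. cmod (cinner w (y k)) \<le> C / 4 ^ k"
    unfolding thin_in_def by blast
  have ny: "norm (y k) = 1" for k
  proof -
    have "complex_of_real ((norm (y k))\<^sup>2) = 1"
      using y(2)[of k k] by (simp only: cinner_self simp_thms if_True)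
    then have "(norm (y k))\<^sup>2 = 1"
      by (simp only: of_real_eq_1_iff)
    then show ?thesis
      by (smt (verit) norm_ge_zero power2_eq_1_iff)
  qed
  define g where "g = (\<Sum>k. (1 / 2) ^ k *\<^sub>R y k)"
  have "summable (\<lambda>k. (1 / 2) ^ k *\<^sub>R y k)"
    by (rule summable_norm_cancel) (simp add: ny summable_geometric)
  then have sums: "(\<lambda>k. (1 / 2) ^ k *\<^sub>R y k) sums g"
    unfolding g_def by (rule summable_sums)
  have "g \<in> H"
  proof (rule closed_sequentially[OF H(2)])
    show "(\<lambda>n. \<Sum>k<n. (1 / 2) ^ k *\<^sub>R y k) \<longlonglongrightarrow> g"
      using sums unfolding sums_def .
    show "(\<Sum>k<n. (1 / 2) ^ k *\<^sub>R y k) \<in> H" for n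
      using H(1) y(1) unfolding scaleR_scaleC
      by (intro complex_vector.subspace_sum complex_vector.subspace_scale)
  qed
  then obtain C where C: "\<And>k. cmod (cinner g (y k)) \<le> C / 4 ^ k"
    using y(3) by blast
  have "2 ^ k \<le> C" for k :: nat
  proof -
    have "(\<lambda>j. cinner ((1 / 2) ^ j *\<^sub>R y j) (y k)) sums cinner g (y k)"
      by (rule bounded_linear.sums[OF bounded_linear_cinner_left sums])
    moreover have "(\<lambda>j. cinner ((1 / 2) ^ j *\<^sub>R y j) (y k)) = (\<lambda>j. if j = k then (1 / 2) ^ k else 0)"
      by (auto simp: scaleR_scaleC cinner_scaleC_left y(2))
    ultimately have "cinner g (y k) = (1 / 2) ^ k"
      using sums_unique2[OF _ sums_single[of k "\<lambda>_. (1 / 2) ^ k :: complex"]] by simp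
    then have "(1 / 2) ^ k \<le> C / (4 :: real) ^ k"
      using C[of k] by (simp add: norm_power norm_divide)
    then have "(1 / 2) ^ k * 4 ^ k \<le> C"
      by (simp add: field_simps)
    then show ?thesis
      by (simp add: power_mult_distrib[symmetric])
  qed
  moreover obtain k :: nat where "C < 2 ^ k"
    using real_arch_pow[of 2 C] by auto
  ultimately show False
    by (metis not_less)
qed

text \<open>
  By symmetry \<open>cinner (T x) (y k) = cinner x (z k)\<close>, so the range of \<open>T\<close> is thin; this needs no knowledge of
  the domain of \<open>T\<close> beyond the vectors \<open>y k\<close>, and therefore applies to every symmetric extension at once.
\<close>

lemma not_fredholm_criterion:
  fixes T A\<^sub>0 :: "('a::{complex_inner, banach} \<times> 'a) set"
  assumes H: "complex_vector.subspace H" "closed H"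
    and T: "closed_symmetric_extension H A\<^sub>0 T"
    and y: "\<And>k. (y k, z k) \<in> A\<^sub>0" "\<And>j k. cinner (y j) (y k) = (if j = k then 1 else 0)"
    and z: "\<And>k::nat. norm (z k) \<le> 1 / 4 ^ k"
  shows "\<not> fredholm_in H T"
proof
  assume "fredholm_in H T"
  then obtain B where B: "finite B" "complex_vector.span (Range T \<union> B) = H"
    unfolding fredholm_in_def by blast
  have TH: "T \<subseteq> H \<times> H" and subT: "complex_vector.subspace T" and A0T: "A\<^sub>0 \<subseteq> T"
    and sym: "\<And>x u y v. (x, u) \<in> T \<Longrightarrow> (y, v) \<in> T \<Longrightarrow> cinner u y = cinner x v"
    using T unfolding closed_symmetric_extension_def symmetric_operator_in_def linear_operator_in_def
    by blast+
  have subR: "complex_vector.subspace (Range T)"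
  proof (rule complex_vector.subspaceI)
    show "0 \<in> Range T"
      using complex_vector.subspace_0[OF subT] by (auto simp: zero_prod_def)
    show "p + q \<in> Range T" if "p \<in> Range T" "q \<in> Range T" for p q
      using that complex_vector.subspace_add[OF subT] by fastforce
    show "k *\<^sub>C p \<in> Range T" if p: "p \<in> Range T" for p k
    proof -
      obtain x where "(x, p) \<in> T"
        using p by blast
      from complex_vector.subspace_scale[OF subT this, of k] show ?thesis
        by (auto simp: scaleC_prod_def)
    qed
  qed
  have "\<exists>C. \<forall>k. cmod (cinner w (y k)) \<le> C / 4 ^ k" if "w \<in> Range T" for w
  proof -
    obtain x where x: "(x, w) \<in> T"
      using \<open>w \<in> Range T\<close> by blast
    have "cmod (cinner w (y k)) \<le> norm x / 4 ^ k" for k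
    proof -
      have "cinner w (y k) = cinner x (z k)"
        using sym[OF x] y(1) A0T by blast
      then have "cmod (cinner w (y k)) \<le> norm x * norm (z k)"
        by (simp add: cinner_Cauchy_Schwarz)
      also have "\<dots> \<le> norm x * (1 / 4 ^ k)"
        by (intro mult_left_mono z) simp
      finally show ?thesis
        by simp
    qed
    then show ?thesis
      by blast
  qed
  moreover have "y k \<in> H" for k
    using y(1) A0T TH by blast
  ultimately have "thin_in H (Range T)"
    unfolding thin_in_def using y(2) by blast
  then have "thin_in H H"
    using thin_in_span_Un_finite[OF B(1) H(1) subR] B(2) by simp
  then show False
    using not_thin_in_itself[OF H] by blast
qed

section \<open>The Hilbert space of square-integrable functions\<close>

lemma l2_rel_refl_iff: "l2_rel f f \<longleftrightarrow> sq_integrable f"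
  by (simp add: l2_rel_def)

lemma l2_class_eq_iff:
  assumes "sq_integrable f" "sq_integrable g"
  shows "l2_class f = l2_class g \<longleftrightarrow> (AE t in lborel. f t = g t)"
  using Quotient_rel[OF Quotient_l2, of f g] assms by (auto simp: l2_rel_def)

lemma l2_class_exists: "\<exists>f. sq_integrable f \<and> x = l2_class f"
  using Quotient_abs_rep[OF Quotient_l2, of x] Quotient_rep_reflp[OF Quotient_l2, of x]
  by (auto simp: l2_rel_refl_iff intro!: exI[of _ "rep_l2 x"])

lemma plus_l2_class:
  "sq_integrable f \<Longrightarrow> sq_integrable g \<Longrightarrow> l2_class f + l2_class g = l2_class (\<lambda>t. f t + g t)"
  by (rule plus_l2.abs_eq) (simp_all add: l2_rel_refl_iff)

lemma scaleC_l2_class: "sq_integrable f \<Longrightarrow> c *\<^sub>C l2_class f = l2_class (\<lambda>t. c * f t)"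
  by (rule scaleC_l2.abs_eq) (simp add: l2_rel_refl_iff)

lemma sq_integrable_diff: "sq_integrable f \<Longrightarrow> sq_integrable g \<Longrightarrow> sq_integrable (\<lambda>t. f t - g t)"
  using sq_integrable_add[of f "\<lambda>t. (- 1) * g t"] sq_integrable_scale[of g "- 1"] by simp

lemma minus_l2_class:
  assumes "sq_integrable f" "sq_integrable g"
  shows "l2_class f - l2_class g = l2_class (\<lambda>t. f t - g t)"
proof -
  have "l2_class f - l2_class g = l2_class f + l2_class (\<lambda>t. (- 1) * g t)"
    by (simp only: minus_l2_def uminus_l2_def scaleC_l2_class assms)
  also have "\<dots> = l2_class (\<lambda>t. f t + (- 1) * g t)"
    by (rule plus_l2_class[OF assms(1) sq_integrable_scale[OF assms(2)]])
  finally show ?thesis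
    by simp
qed

lemma cinner_l2_class:
  "sq_integrable f \<Longrightarrow> sq_integrable g
    \<Longrightarrow> cinner (l2_class f) (l2_class g) = integral\<^sup>L lborel (\<lambda>t. f t * cnj (g t))"
  by (rule cinner_l2.abs_eq) (simp_all add: l2_rel_refl_iff)

lemma zero_l2_class: "0 = l2_class (\<lambda>_. 0)"
  by (rule zero_l2.abs_eq)

lemma norm_l2_class:
  assumes "sq_integrable f"
  shows "(norm (l2_class f))\<^sup>2 = integral\<^sup>L lborel (\<lambda>t. (cmod (f t))\<^sup>2)"
proof -
  have "complex_of_real ((norm (l2_class f))\<^sup>2) = integral\<^sup>L lborel (\<lambda>t. f t * cnj (f t))"
    unfolding cinner_self[symmetric] by (rule cinner_l2_class[OF assms assms])
  also have "\<dots> = complex_of_real (integral\<^sup>L lborel (\<lambda>t. (cmod (f t))\<^sup>2))"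
    by (simp add: complex_norm_square[symmetric] flip: of_real_power)
  finally show ?thesis
    by (simp only: of_real_eq_iff)
qed

lemma nn_integral_l2_class:
  assumes "sq_integrable f"
  shows "(\<integral>\<^sup>+ t. ennreal ((cmod (f t))\<^sup>2) \<partial>lborel) = ennreal ((norm (l2_class f))\<^sup>2)"
  using assms unfolding norm_l2_class[OF assms]
  by (intro nn_integral_eq_integral) (auto simp: sq_integrable_def)

lemma sq_integrableI_nn_integral:
  assumes "f \<in> borel_measurable lborel" "(\<integral>\<^sup>+ t. ennreal ((cmod (f t))\<^sup>2) \<partial>lborel) < \<infinity>"
  shows "sq_integrable f"
  unfolding sq_integrable_def
proof
  show "integrable lborel (\<lambda>t. (cmod (f t))\<^sup>2)"
    using assms by (intro integrableI_nonneg) auto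
qed (rule assms)

text \<open>A rapidly converging subsequence converges almost everywhere, and by Fatou's lemma its limit
  is a limit in the mean.\<close>

lemma l2_rapidly_Cauchy_convergent:
  fixes X :: "nat \<Rightarrow> l2"
  assumes X: "\<And>k m. m \<ge> k \<Longrightarrow> norm (X m - X k) \<le> (1 / 4) ^ k"
  shows "\<exists>x. \<forall>k. norm (x - X k) \<le> (1 / 4) ^ k"
proof -
  have "\<forall>k. \<exists>f. sq_integrable f \<and> X k = l2_class f"
    by (simp add: l2_class_exists)
  from choice[OF this] obtain f where "\<forall>k. sq_integrable (f k) \<and> X k = l2_class (f k)" ..
  then have f: "sq_integrable (f k)" and Xf: "X k = l2_class (f k)" for k
    by auto
  have [measurable]: "f k \<in> borel_measurable lborel" for k
    using f by (simp add: sq_integrable_def)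
  have int_le: "(\<integral>\<^sup>+ t. ennreal ((cmod (f m t - f k t))\<^sup>2) \<partial>lborel) \<le> ennreal ((1 / 16) ^ k)"
    if "m \<ge> k" for m k
  proof -
    have "(\<integral>\<^sup>+ t. ennreal ((cmod (f m t - f k t))\<^sup>2) \<partial>lborel) = ennreal ((norm (X m - X k))\<^sup>2)"
      unfolding Xf minus_l2_class[OF f f] by (rule nn_integral_l2_class) (intro sq_integrable_diff f)
    also have "\<dots> \<le> ennreal (((1 / 4) ^ k)\<^sup>2)"
      using X[OF that] by (intro ennreal_leI power_mono) auto
    also have "((1 / 4 :: real) ^ k)\<^sup>2 = (1 / 16) ^ k"
      by (simp add: power2_eq_square power_mult_distrib[symmetric])
    finally show ?thesis .
  qed
  define s where "s = (\<lambda>t. \<Sum>k. ennreal (4 ^ k * (cmod (f (Suc k) t - f k t))\<^sup>2))"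
  have "(\<integral>\<^sup>+ t. s t \<partial>lborel)
      = (\<Sum>k. \<integral>\<^sup>+ t. ennreal (4 ^ k * (cmod (f (Suc k) t - f k t))\<^sup>2) \<partial>lborel)"
    unfolding s_def by (rule nn_integral_suminf) measurable
  also have "\<dots> \<le> (\<Sum>k. ennreal ((1 / 4) ^ k))"
  proof (rule suminf_le)
    fix k :: nat
    have "(\<integral>\<^sup>+ t. ennreal (4 ^ k * (cmod (f (Suc k) t - f k t))\<^sup>2) \<partial>lborel)
        = ennreal (4 ^ k) * (\<integral>\<^sup>+ t. ennreal ((cmod (f (Suc k) t - f k t))\<^sup>2) \<partial>lborel)"
      by (simp add: ennreal_mult nn_integral_cmult)
    also have "\<dots> \<le> ennreal (4 ^ k) * ennreal ((1 / 16) ^ k)"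
      by (intro mult_left_mono int_le) auto
    also have "\<dots> = ennreal ((1 / 4) ^ k)"
      by (simp add: ennreal_mult[symmetric] power_mult_distrib[symmetric])
    finally show "(\<integral>\<^sup>+ t. ennreal (4 ^ k * (cmod (f (Suc k) t - f k t))\<^sup>2) \<partial>lborel)
        \<le> ennreal ((1 / 4) ^ k)" .
  qed auto
  also have "\<dots> < \<infinity>"
    by (subst suminf_ennreal2) (auto simp: summable_geometric)
  finally have "AE t in lborel. s t \<noteq> \<infinity>"
    by (intro nn_integral_noteq_infinite) (auto simp: s_def)
  then have conv: "AE t in lborel. convergent (\<lambda>k. f k t)"
  proof eventually_elim
    fix t assume t: "s t \<noteq> \<infinity>"
    have "summable (\<lambda>k. 4 ^ k * (cmod (f (Suc k) t - f k t))\<^sup>2)"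
      using t unfolding s_def by (intro summable_suminf_not_top) auto
    then have "(\<lambda>k. 4 ^ k * (cmod (f (Suc k) t - f k t))\<^sup>2) \<longlonglongrightarrow> 0"
      by (rule summable_LIMSEQ_zero)
    then have "\<forall>\<^sub>F k in sequentially. 4 ^ k * (cmod (f (Suc k) t - f k t))\<^sup>2 < 1"
      by (rule order_tendstoD) simp
    then have "\<forall>\<^sub>F k in sequentially. norm (f (Suc k) t - f k t) \<le> (1 / 2) ^ k"
    proof eventually_elim
      fix k assume "4 ^ k * (cmod (f (Suc k) t - f k t))\<^sup>2 < 1"
      then have "(2 ^ k * cmod (f (Suc k) t - f k t))\<^sup>2 < 1\<^sup>2"
        by (simp add: power_mult_distrib power2_eq_square[of "2 ^ k"] flip: power_mult_distrib[of 2 2])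
      then have "2 ^ k * cmod (f (Suc k) t - f k t) < 1"
        by (rule power_less_imp_less_base) simp
      then show "norm (f (Suc k) t - f k t) \<le> (1 / 2) ^ k"
        by (simp add: field_simps)
    qed
    then have "summable (\<lambda>k. f (Suc k) t - f k t)"
      by (rule summable_comparison_test_ev) (simp add: summable_geometric)
    then have "convergent (\<lambda>n. f 0 t + (\<Sum>k<n. f (Suc k) t - f k t))"
      by (intro convergent_add convergent_const) (simp add: summable_iff_convergent)
    then show "convergent (\<lambda>k. f k t)"
      using sum_lessThan_telescope[of "\<lambda>k. f k t"] by simp
  qed
  define F where "F = (\<lambda>t. lim (\<lambda>k. f k t))"
  have [measurable]: "F \<in> borel_measurable lborel"
    unfolding F_def by (rule borel_measurable_lim_metric) measurable
  have F: "AE t in lborel. (\<lambda>k. f k t) \<longlonglongrightarrow> F t"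
    using conv unfolding F_def by eventually_elim (rule convergent_LIMSEQ_iff[THEN iffD1])
  have F_le: "(\<integral>\<^sup>+ t. ennreal ((cmod (F t - f k t))\<^sup>2) \<partial>lborel) \<le> ennreal ((1 / 16) ^ k)" for k
  proof -
    have "(\<integral>\<^sup>+ t. ennreal ((cmod (F t - f k t))\<^sup>2) \<partial>lborel)
        \<le> (\<integral>\<^sup>+ t. liminf (\<lambda>m. ennreal ((cmod (f m t - f k t))\<^sup>2)) \<partial>lborel)"
    proof (rule nn_integral_mono_AE, use F in eventually_elim)
      fix t assume "(\<lambda>m. f m t) \<longlonglongrightarrow> F t"
      then have "(\<lambda>m. ennreal ((cmod (f m t - f k t))\<^sup>2)) \<longlonglongrightarrow> ennreal ((cmod (F t - f k t))\<^sup>2)"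
        by (intro tendsto_intros)
      from lim_imp_Liminf[OF trivial_limit_sequentially this]
      show "ennreal ((cmod (F t - f k t))\<^sup>2) \<le> liminf (\<lambda>m. ennreal ((cmod (f m t - f k t))\<^sup>2))"
        by (simp only: order_refl)
    qed
    also have "\<dots> \<le> liminf (\<lambda>m. \<integral>\<^sup>+ t. ennreal ((cmod (f m t - f k t))\<^sup>2) \<partial>lborel)"
      by (rule nn_integral_liminf) measurable
    also have "\<dots> \<le> liminf (\<lambda>m. ennreal ((1 / 16) ^ k))"
      using int_le by (intro Liminf_mono) (auto intro: eventually_sequentiallyI[of k])
    finally show ?thesis
      by (simp add: Liminf_const)
  qed
  have sqd: "sq_integrable (\<lambda>t. F t - f k t)" for k
    using F_le[of k] by (intro sq_integrableI_nn_integral) (auto intro: le_less_trans)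
  have sqF: "sq_integrable F"
    using sq_integrable_add[OF sqd[of 0] f[of 0]] by simp
  have "norm (l2_class F - X k) \<le> (1 / 4) ^ k" for k
  proof -
    have "ennreal ((norm (l2_class F - X k))\<^sup>2) \<le> ennreal ((1 / 16) ^ k)"
      using F_le[of k] unfolding Xf minus_l2_class[OF sqF f] nn_integral_l2_class[OF sqd] .
    then have "(norm (l2_class F - X k))\<^sup>2 \<le> ((1 / 4) ^ k)\<^sup>2"
      by (simp add: power2_eq_square power_mult_distrib[symmetric])
    then show ?thesis
      by (rule power2_le_imp_le) simp
  qed
  then show ?thesis
    by blast
qed

instance l2 :: banach
proof
  fix X :: "nat \<Rightarrow> l2" assume "Cauchy X"
  then have "\<forall>k. \<exists>M. \<forall>m\<ge>M. \<forall>n\<ge>M. dist (X m) (X n) < (1 / 4) ^ k"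
    by (intro allI metric_CauchyD) simp_all
  from choice[OF this] obtain M
    where M: "\<And>k m n. m \<ge> M k \<Longrightarrow> n \<ge> M k \<Longrightarrow> dist (X m) (X n) < (1 / 4) ^ k"
    by blast
  define r where "r = (\<lambda>k. \<Sum>i\<le>k. M i)"
  have r: "M k \<le> r m" if "k \<le> m" for k m
    unfolding r_def using that by (intro member_le_sum) auto
  have "\<exists>x. \<forall>k. norm (x - X (r k)) \<le> (1 / 4) ^ k"
    by (rule l2_rapidly_Cauchy_convergent) (use M r in \<open>force simp: dist_norm intro: less_imp_le\<close>)
  then obtain x where x: "\<And>k. norm (x - X (r k)) \<le> (1 / 4) ^ k"
    by blast
  have "X \<longlonglongrightarrow> x"
  proof (rule metric_LIMSEQ_I)
    fix e :: real assume "e > 0"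
    then obtain k :: nat where k: "(1 / 4) ^ k < e / 2"
      using real_arch_pow_inv[of "e / 2" "1 / 4"] by auto
    have "dist (X n) x < e" if "n \<ge> M k" for n
    proof -
      have "dist (X n) x \<le> dist (X n) (X (r k)) + dist (X (r k)) x"
        by (rule dist_triangle)
      also have "\<dots> < (1 / 4) ^ k + (1 / 4) ^ k"
        using M[OF that r[OF order_refl]] x[of k]
        by (intro add_less_le_mono) (simp_all add: dist_norm norm_minus_commute)
      finally show ?thesis
        using k by simp
    qed
    then show "\<exists>no. \<forall>n\<ge>no. dist (X n) x < e"
      by blast
  qed
  then show "convergent X"
    by (auto simp: convergent_def)
qed

lemma subspace_l2_on: "complex_vector.subspace (l2_on S)"
proof (rule complex_vector.subspaceI)
  show "0 \<in> l2_on S"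
    unfolding l2_on_def zero_l2_class by (auto simp: sq_integrable_def intro!: exI[of _ "\<lambda>_. 0"])
  show "x + y \<in> l2_on S" if x: "x \<in> l2_on S" and y: "y \<in> l2_on S" for x y
  proof -
    obtain f where "sq_integrable f" "\<forall>t. t \<notin> S \<longrightarrow> f t = 0" "x = l2_class f"
      using x unfolding l2_on_def by blast
    moreover obtain g where "sq_integrable g" "\<forall>t. t \<notin> S \<longrightarrow> g t = 0" "y = l2_class g"
      using y unfolding l2_on_def by blast
    ultimately show ?thesis
      unfolding l2_on_def
      by (intro CollectI exI[of _ "\<lambda>t. f t + g t"]) (simp add: plus_l2_class sq_integrable_add)
  qed
  show "c *\<^sub>C x \<in> l2_on S" if x: "x \<in> l2_on S" for c x
  proof -
    obtain f where "sq_integrable f" "\<forall>t. t \<notin> S \<longrightarrow> f t = 0" "x = l2_class f"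
      using x unfolding l2_on_def by blast
    then show ?thesis
      unfolding l2_on_def
      by (intro CollectI exI[of _ "\<lambda>t. c * f t"]) (simp add: scaleC_l2_class sq_integrable_scale)
  qed
qed

lemma sq_integrable_restrict:
  assumes "sq_integrable f" "S \<in> sets borel"
  shows "sq_integrable (\<lambda>t. if t \<in> S then f t else 0)"
  unfolding sq_integrable_def
proof
  show m: "(\<lambda>t. if t \<in> S then f t else 0) \<in> borel_measurable lborel"
    using assms by (auto simp: sq_integrable_def)
  show "integrable lborel (\<lambda>t. (cmod (if t \<in> S then f t else 0))\<^sup>2)"
  proof (rule Bochner_Integration.integrable_bound)
    show "integrable lborel (\<lambda>t. (cmod (f t))\<^sup>2)"
      using assms by (simp add: sq_integrable_def)
    show "(\<lambda>t. (cmod (if t \<in> S then f t else 0))\<^sup>2) \<in> borel_measurable lborel"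
      using m by measurable
  qed simp
qed

text \<open>\<open>L\<^sup>2(S)\<close> is the orthogonal complement of the functions supported outside \<open>S\<close>.\<close>

lemma closed_l2_on:
  assumes S: "S \<in> sets borel"
  shows "closed (l2_on S)"
proof -
  define E where "E = {e. sq_integrable e \<and> (\<forall>t\<in>S. e t = 0)}"
  have "l2_on S = (\<Inter>e\<in>E. {x. cinner x (l2_class e) = 0})"
  proof (intro set_eqI iffI)
    fix x assume "x \<in> l2_on S"
    then obtain f where f: "sq_integrable f" "\<forall>t. t \<notin> S \<longrightarrow> f t = 0" "x = l2_class f"
      by (auto simp: l2_on_def)
    have "cinner x (l2_class e) = 0" if e: "e \<in> E" for e
    proof -
      have "f t * cnj (e t) = 0" for t
        using e f(2) by (cases "t \<in> S") (auto simp: E_def)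
      then have "(\<lambda>t. f t * cnj (e t)) = (\<lambda>_. 0)"
        by blast
      then show ?thesis
        using e f(1,3) by (simp add: E_def cinner_l2_class)
    qed
    then show "x \<in> (\<Inter>e\<in>E. {x. cinner x (l2_class e) = 0})"
      by blast
  next
    fix x assume x: "x \<in> (\<Inter>e\<in>E. {x. cinner x (l2_class e) = 0})"
    obtain f where f: "sq_integrable f" "x = l2_class f"
      using l2_class_exists by blast
    define g where "g = (\<lambda>t. if t \<in> - S then f t else 0)"
    define h where "h = (\<lambda>t. if t \<in> S then f t else 0)"
    have sq: "sq_integrable g" "sq_integrable h"
      unfolding g_def h_def by (rule sq_integrable_restrict[OF f(1) borel_comp[OF S]] sq_integrable_restrict[OF f(1) S])+
    have "g \<in> E"
      using sq by (auto simp: E_def g_def)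
    then have "cinner x (l2_class g) = 0"
      using x by auto
    also have "cinner x (l2_class g) = integral\<^sup>L lborel (\<lambda>t. g t * cnj (g t))"
      unfolding f(2) cinner_l2_class[OF f(1) sq(1)]
      by (intro Bochner_Integration.integral_cong) (auto simp: g_def)
    also have "\<dots> = cinner (l2_class g) (l2_class g)"
      by (rule cinner_l2_class[OF sq(1) sq(1), symmetric])
    finally have g0: "l2_class g = 0"
      by (simp add: cinner_self)
    have "x = l2_class h + l2_class g"
      unfolding f(2) plus_l2_class[OF sq(2) sq(1)]
      by (rule arg_cong[of _ _ l2_class]) (auto simp: g_def h_def)
    then show "x \<in> l2_on S"
      using sq(2) unfolding g0 l2_on_def by (auto simp: h_def intro!: exI[of _ h])
  qed
  moreover have "closed {x. cinner x (l2_class e) = 0}" for e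
  proof -
    have "continuous_on UNIV (\<lambda>x. cinner x (l2_class e))"
      by (rule linear_continuous_on[OF bounded_linear_cinner_left])
    then have "closed ((\<lambda>x. cinner x (l2_class e)) -` {0})"
      by (intro closed_vimage) auto
    then show ?thesis
      by (simp add: vimage_def)
  qed
  ultimately show ?thesis
    by auto
qed

section \<open>Test functions\<close>

text \<open>
  The derivative is carried along as a second function, so that no choice of a derivative operator has to be
  unfolded, and iterating the predicate describes higher smoothness. The functions are defined on the whole
  line, which makes them directly integrable against any locally integrable function.
\<close>

definition test_pair :: "real \<Rightarrow> real \<Rightarrow> (real \<Rightarrow> complex) \<Rightarrow> (real \<Rightarrow> complex) \<Rightarrow> bool"
  where "test_pair a b \<psi> \<psi>' \<longleftrightarrow>
    (\<forall>t. (\<psi> has_vector_derivative \<psi>' t) (at t)) \<and> continuous_on UNIV \<psi>' \<and>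
    (\<forall>t. t \<notin> {a..b} \<longrightarrow> \<psi> t = 0)"

lemma test_pair_zero: "test_pair a b \<psi> \<psi>' \<Longrightarrow> t \<notin> {a..b} \<Longrightarrow> \<psi> t = 0"
  by (simp add: test_pair_def)

lemma test_pair_deriv: "test_pair a b \<psi> \<psi>' \<Longrightarrow> (\<psi> has_vector_derivative \<psi>' t) (at t)"
  by (simp add: test_pair_def)

lemma test_pair_continuous_deriv: "test_pair a b \<psi> \<psi>' \<Longrightarrow> continuous_on UNIV \<psi>'"
  by (simp add: test_pair_def)

lemma test_pair_continuous:
  assumes "test_pair a b \<psi> \<psi>'"
  shows "continuous_on UNIV \<psi>"
  using test_pair_deriv[OF assms]
  by (intro continuous_at_imp_continuous_on) (blast intro: has_vector_derivative_continuous)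

lemma test_pair_deriv_zero:
  assumes "test_pair a b \<psi> \<psi>'" "t \<notin> {a..b}"
  shows "\<psi>' t = 0"
proof -
  have "((\<lambda>_. 0) has_vector_derivative \<psi>' t) (at t)"
    by (rule has_vector_derivative_transform_within_open[OF test_pair_deriv[OF assms(1)], of "- {a..b}"])
      (use assms test_pair_zero in auto)
  then show ?thesis
    using vector_derivative_unique_at[OF _ has_vector_derivative_const] by blast
qed

lemma test_pairI:
  assumes I: "open I" "{a..b} \<subseteq> I"
    and d: "\<And>t. t \<in> I \<Longrightarrow> (\<psi> has_vector_derivative \<psi>' t) (at t)"
    and c: "continuous_on I \<psi>'"
    and z: "\<And>t. t \<notin> {a..b} \<Longrightarrow> \<psi> t = 0" "\<And>t. t \<notin> {a..b} \<Longrightarrow> \<psi>' t = 0"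
  shows "test_pair a b \<psi> \<psi>'"
  unfolding test_pair_def
proof (intro conjI allI impI)
  show "(\<psi> has_vector_derivative \<psi>' t) (at t)" for t
  proof (cases "t \<in> {a..b}")
    case False
    have "((\<lambda>_. 0) has_vector_derivative 0) (at t)"
      by (rule has_vector_derivative_const)
    then have "(\<psi> has_vector_derivative 0) (at t)"
      by (rule has_vector_derivative_transform_within_open[of _ _ _ "- {a..b}"]) (use False z in auto)
    then show ?thesis
      using z(2)[OF False] by simp
  qed (use I d in blast)
  have "continuous_on (- {a..b}) \<psi>'"
    by (rule continuous_on_eq[of _ "\<lambda>_. 0"]) (use z in auto)
  then have "continuous_on (I \<union> - {a..b}) \<psi>'"
    using c I by (intro continuous_on_open_Un) auto
  then show "continuous_on UNIV \<psi>'"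
    using I(2) by (metis Compl_partition2 Un_commute sup.order_iff Un_mono subset_refl sup_top_left
        top_le Compl_partition)
qed (rule z)

lemma test_pair_widen: "test_pair a b \<psi> \<psi>' \<Longrightarrow> a' \<le> a \<Longrightarrow> b \<le> b' \<Longrightarrow> test_pair a' b' \<psi> \<psi>'"
  by (auto simp: test_pair_def)

lemma test_pair_mult:
  assumes \<psi>: "test_pair a b \<psi> \<psi>'" and lr: "l < a" "b < r"
    and f: "\<And>t. t \<in> {l<..<r} \<Longrightarrow> (f has_vector_derivative f' t) (at t)" "continuous_on {l<..<r} f'"
  shows "test_pair a b (\<lambda>t. f t * \<psi> t) (\<lambda>t. f' t * \<psi> t + f t * \<psi>' t)"
proof (rule test_pairI[of "{l<..<r}"])
  show "((\<lambda>t. f t * \<psi> t) has_vector_derivative f' t * \<psi> t + f t * \<psi>' t) (at t)"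
    if "t \<in> {l<..<r}" for t
    using has_vector_derivative_mult[OF f(1)[OF that] test_pair_deriv[OF \<psi>]]
    by (simp add: add.commute)
  have "continuous_on {l<..<r} f"
    using f(1) by (intro continuous_at_imp_continuous_on) (blast intro: has_vector_derivative_continuous)
  then show "continuous_on {l<..<r} (\<lambda>t. f' t * \<psi> t + f t * \<psi>' t)"
    using f(2) test_pair_continuous[OF \<psi>] test_pair_continuous_deriv[OF \<psi>]
    by (intro continuous_intros) (auto intro: continuous_on_subset)
qed (use \<psi> lr in \<open>auto simp: test_pair_zero test_pair_deriv_zero\<close>)

lemma test_pair_scale: "test_pair a b \<psi> \<psi>' \<Longrightarrow> test_pair a b (\<lambda>t. c * \<psi> t) (\<lambda>t. c * \<psi>' t)"
  using test_pair_mult[of a b \<psi> \<psi>' "a - 1" "b + 1" "\<lambda>_. c" "\<lambda>_. 0"] by simp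

lemma test_pair_diff:
  assumes "test_pair a b \<psi> \<psi>'" "test_pair a b \<phi> \<phi>'"
  shows "test_pair a b (\<lambda>t. \<psi> t - \<phi> t) (\<lambda>t. \<psi>' t - \<phi>' t)"
  using assms unfolding test_pair_def
  by (auto intro: has_vector_derivative_diff continuous_on_diff)

lemma test_pair_cnj:
  assumes "test_pair a b \<psi> \<psi>'"
  shows "test_pair a b (\<lambda>t. cnj (\<psi> t)) (\<lambda>t. cnj (\<psi>' t))"
  using assms unfolding test_pair_def
  by (auto intro: has_vector_derivative_cnj continuous_on_cnj)

lemma test_pair_zero_fun: "test_pair a b (\<lambda>_. 0) (\<lambda>_. 0)"
  by (simp add: test_pair_def)

lemma test_pair_integral_deriv:
  assumes \<psi>: "test_pair a b \<psi> \<psi>'"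
  shows "integral\<^sup>L lborel (\<lambda>t. indicator {u..} t *\<^sub>R \<psi>' t) = - \<psi> u"
proof -
  define v where "v = max u b + 1"
  have "set_integrable lborel {u..v} \<psi>'"
    using test_pair_continuous_deriv[OF \<psi>]
    by (intro borel_integrable_atLeastAtMost') (auto intro: continuous_on_subset)
  then have "(LINT t:{u..v}|lborel. \<psi>' t) = integral {u..v} \<psi>'"
    by (rule set_borel_integral_eq_integral)
  also have "\<dots> = \<psi> v - \<psi> u"
    using test_pair_deriv[OF \<psi>]
    by (intro integral_unique fundamental_theorem_of_calculus)
      (auto simp: v_def intro: has_vector_derivative_at_within)
  also have "\<psi> v = 0"
    using \<psi> by (rule test_pair_zero) (auto simp: v_def)
  also have "(LINT t:{u..v}|lborel. \<psi>' t) = integral\<^sup>L lborel (\<lambda>t. indicator {u..} t *\<^sub>R \<psi>' t)"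
  proof -
    have "x \<le> v" if "\<psi>' x \<noteq> 0" for x
      using test_pair_deriv_zero[OF \<psi>, of x] that by (force simp: v_def)
    then show ?thesis
      unfolding set_lebesgue_integral_def
      by (intro Bochner_Integration.integral_cong) (auto simp: indicator_def)
  qed
  finally show ?thesis
    by simp
qed

lemma DERIV_max_power:
  "((\<lambda>x. (max 0 x) ^ Suc (Suc n)) has_real_derivative real (Suc (Suc n)) * (max 0 x) ^ Suc n) (at x)"
proof -
  consider "x < 0" | "x > 0" | "x = 0"
    by linarith
  then show ?thesis
  proof cases
    case 1
    have "((\<lambda>x. 0) has_real_derivative 0) (at x)"
      by simp
    then have "((\<lambda>x. (max 0 x) ^ Suc (Suc n)) has_real_derivative 0) (at x)"
      by (rule has_field_derivative_transform_within_open[of _ _ _ "{..<0}"]) (use 1 in auto)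
    then show ?thesis
      using 1 by simp
  next
    case 2
    have "((\<lambda>x. x ^ Suc (Suc n)) has_real_derivative real (Suc (Suc n)) * x ^ Suc n) (at x)"
      using DERIV_pow[of "Suc (Suc n)" x] by simp
    then have "((\<lambda>x. (max 0 x) ^ Suc (Suc n)) has_real_derivative real (Suc (Suc n)) * x ^ Suc n) (at x)"
      by (rule has_field_derivative_transform_within_open[of _ _ _ "{0<..}"]) (use 2 in auto)
    then show ?thesis
      using 2 by simp
  next
    case 3
    have "(\<lambda>h. ((max 0 (0 + h)) ^ Suc (Suc n) - (max 0 0) ^ Suc (Suc n)) / h) \<midarrow>0\<rightarrow> (0 :: real)"
    proof (rule Lim_null_comparison)
      show "\<forall>\<^sub>F h in at 0. norm (((max 0 (0 + h)) ^ Suc (Suc n) - (max 0 0) ^ Suc (Suc n)) / h)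
          \<le> \<bar>h\<bar> ^ Suc n"
      proof (rule always_eventually, rule allI)
        fix h :: real
        show "norm (((max 0 (0 + h)) ^ Suc (Suc n) - (max 0 0) ^ Suc (Suc n)) / h) \<le> \<bar>h\<bar> ^ Suc n"
        proof (cases "h \<le> 0")
          case True
          then have m: "max 0 (0 + h) = 0"
            by simp
          show ?thesis
            unfolding m by (simp del: power_Suc)
        qed (simp add: max_def)
      qed
      have "(\<lambda>h. \<bar>h\<bar> ^ Suc n) \<midarrow>0\<rightarrow> \<bar>0 :: real\<bar> ^ Suc n"
        by (intro tendsto_intros)
      then show "(\<lambda>h. \<bar>h\<bar> ^ Suc n) \<midarrow>0\<rightarrow> (0 :: real)"
        by simp
    qed
    then show ?thesis
      using 3 by (simp add: DERIV_def)
  qed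
qed

text \<open>
  An explicit \<open>C\<^sup>2\<close> bump, a polynomial on its support; two derivatives suffice, since the domain of the
  operator matrix asks for no more.
\<close>

definition bump :: "real \<Rightarrow> real \<Rightarrow> real \<Rightarrow> real"
  where "bump a b t = (max 0 ((t - a) * (b - t))) ^ 3"

definition bump' :: "real \<Rightarrow> real \<Rightarrow> real \<Rightarrow> real"
  where "bump' a b t = 3 * (max 0 ((t - a) * (b - t)))\<^sup>2 * (a + b - 2 * t)"

definition bump'' :: "real \<Rightarrow> real \<Rightarrow> real \<Rightarrow> real"
  where "bump'' a b t = 6 * max 0 ((t - a) * (b - t)) * (a + b - 2 * t)\<^sup>2
    - 6 * (max 0 ((t - a) * (b - t)))\<^sup>2"

lemma bump_derivs:
  "(bump a b has_real_derivative bump' a b t) (at t)"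
  "(bump' a b has_real_derivative bump'' a b t) (at t)"
proof -
  have q: "((\<lambda>t. (t - a) * (b - t)) has_real_derivative a + b - 2 * t) (at t)" for t
    by (auto intro!: derivative_eq_intros)
  have 3: "((\<lambda>t. (max 0 ((t - a) * (b - t))) ^ 3) has_real_derivative
      3 * (max 0 ((t - a) * (b - t)))\<^sup>2 * (a + b - 2 * t)) (at t)" for t
    using DERIV_chain2[OF DERIV_max_power[of 1] q] by (simp add: numeral_eq_Suc)
  have 2: "((\<lambda>t. (max 0 ((t - a) * (b - t)))\<^sup>2) has_real_derivative
      2 * max 0 ((t - a) * (b - t)) * (a + b - 2 * t)) (at t)" for t
    using DERIV_chain2[OF DERIV_max_power[of 0] q] by (simp add: numeral_eq_Suc)
  show "(bump a b has_real_derivative bump' a b t) (at t)"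
    using 3[of t] by (simp add: bump_def[abs_def] bump'_def)
  show "(bump' a b has_real_derivative bump'' a b t) (at t)"
    unfolding bump'_def[abs_def] bump''_def
    by (rule derivative_eq_intros 2 refl)+ (simp add: power2_eq_square algebra_simps)
qed

lemma bump_zero: "t \<notin> {a<..<b} \<Longrightarrow> a < b \<Longrightarrow> bump a b t = 0 \<and> bump' a b t = 0 \<and> bump'' a b t = 0"
proof -
  assume "t \<notin> {a<..<b}" "a < b"
  then have "(t - a) * (b - t) \<le> 0"
    by (auto simp: mult_le_0_iff)
  then show ?thesis
    by (simp add: bump_def bump'_def bump''_def max_def)
qed

lemma bump_pos: "t \<in> {a<..<b} \<Longrightarrow> bump a b t > 0"
  by (simp add: bump_def max_def not_le)

lemma bump_le: "a < b \<Longrightarrow> bump a b t \<le> (b - a) ^ 6"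
proof (cases "t \<in> {a<..<b}")
  case True
  then have "(t - a) * (b - t) \<le> (b - a) * (b - a)"
    by (intro mult_mono) auto
  then have "(max 0 ((t - a) * (b - t))) ^ 3 \<le> ((b - a) * (b - a)) ^ 3"
    by (intro power_mono) (auto simp: max_def)
  also have "\<dots> = (b - a) ^ 6"
    by (simp add: power2_eq_square[symmetric] power_mult[symmetric])
  finally show ?thesis
    by (simp add: bump_def)
qed (simp add: bump_zero)

lemma continuous_bump'': "continuous_on S (bump'' a b)"
  unfolding bump''_def[abs_def] by (intro continuous_intros)

lemma test_pair_bump:
  assumes "a < b"
  shows "test_pair a b (\<lambda>t. of_real (bump a b t)) (\<lambda>t. of_real (bump' a b t))"
    and "test_pair a b (\<lambda>t. of_real (bump' a b t)) (\<lambda>t. of_real (bump'' a b t))"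
proof -
  have "continuous_on UNIV (bump' a b)"
    using bump_derivs(2) by (intro continuous_at_imp_continuous_on) (blast intro: DERIV_isCont)
  then show "test_pair a b (\<lambda>t. of_real (bump a b t)) (\<lambda>t. of_real (bump' a b t))"
    using bump_derivs(1) bump_zero[OF _ assms] unfolding test_pair_def
    by (auto intro!: continuous_intros has_vector_derivative_of_real
        simp flip: has_real_derivative_iff_has_vector_derivative)
  show "test_pair a b (\<lambda>t. of_real (bump' a b t)) (\<lambda>t. of_real (bump'' a b t))"
    using bump_derivs(2) bump_zero[OF _ assms] unfolding test_pair_def
    by (auto intro!: continuous_intros continuous_bump'' has_vector_derivative_of_real
        simp flip: has_real_derivative_iff_has_vector_derivative)
qed


section \<open>Locally integrable functions\<close>

definition loc_integrable :: "real \<Rightarrow> real \<Rightarrow> (real \<Rightarrow> complex) \<Rightarrow> bool"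
  where "loc_integrable l r F \<longleftrightarrow> (\<forall>a b. l < a \<longrightarrow> b < r \<longrightarrow> set_integrable lborel {a..b} F)"

lemma loc_integrable_add:
  "loc_integrable l r F \<Longrightarrow> loc_integrable l r G \<Longrightarrow> loc_integrable l r (\<lambda>t. F t + G t)"
  by (simp add: loc_integrable_def)

lemma loc_integrable_diff:
  "loc_integrable l r F \<Longrightarrow> loc_integrable l r G \<Longrightarrow> loc_integrable l r (\<lambda>t. F t - G t)"
  by (simp add: loc_integrable_def)

lemma set_integrable_bounded_mult:
  fixes f F :: "real \<Rightarrow> complex"
  assumes f: "(\<lambda>t. indicator S t *\<^sub>R f t) \<in> borel_measurable borel"
    and B: "\<And>t. t \<in> S \<Longrightarrow> cmod (f t) \<le> B" and F: "set_integrable lborel S F"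
  shows "set_integrable lborel S (\<lambda>t. f t * F t)"
  unfolding set_integrable_def
proof (rule Bochner_Integration.integrable_bound)
  show "integrable lborel (\<lambda>t. B * norm (indicator S t *\<^sub>R F t))"
    using F unfolding set_integrable_def by (intro integrable_mult_right integrable_norm)
  have "(\<lambda>t. indicator S t *\<^sub>R F t) \<in> borel_measurable borel"
    using F unfolding set_integrable_def by (auto dest: borel_measurable_integrable)
  then have "(\<lambda>t. (indicator S t *\<^sub>R f t) * (indicator S t *\<^sub>R F t)) \<in> borel_measurable borel"
    using f by (intro borel_measurable_times)
  also have "(\<lambda>t. (indicator S t *\<^sub>R f t) * (indicator S t *\<^sub>R F t))
      = (\<lambda>t. indicator S t *\<^sub>R (f t * F t))"
    by (auto simp: indicator_def)
  finally show "(\<lambda>t. indicator S t *\<^sub>R (f t * F t)) \<in> borel_measurable lborel"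
    by simp
  show "AE t in lborel. norm (indicator S t *\<^sub>R (f t * F t)) \<le> norm (B * norm (indicator S t *\<^sub>R F t))"
  proof (rule AE_I2)
    fix t
    show "norm (indicator S t *\<^sub>R (f t * F t)) \<le> norm (B * norm (indicator S t *\<^sub>R F t))"
    proof (cases "t \<in> S")
      case True
      have "cmod (f t) * cmod (F t) \<le> \<bar>B\<bar> * cmod (F t)"
        using B[OF True] by (intro mult_right_mono) auto
      then show ?thesis
        using True by (simp add: norm_mult abs_mult)
    qed simp
  qed
qed

lemma continuous_bounded_on_Icc:
  fixes f :: "real \<Rightarrow> complex"
  assumes "continuous_on {a..b} f"
  shows "\<exists>B. \<forall>t\<in>{a..b}. cmod (f t) \<le> B"
proof -
  have "bounded (f ` {a..b})"
    by (intro compact_imp_bounded compact_continuous_image assms compact_Icc)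
  then show ?thesis
    by (auto simp: bounded_iff)
qed

lemma loc_integrable_mult:
  assumes f: "continuous_on {l<..<r} f" and F: "loc_integrable l r F"
  shows "loc_integrable l r (\<lambda>t. f t * F t)"
  unfolding loc_integrable_def
proof (intro allI impI)
  fix a b assume ab: "l < a" "b < r"
  have c: "continuous_on {a..b} f"
    by (rule continuous_on_subset[OF f]) (use ab in auto)
  obtain B where "\<forall>t\<in>{a..b}. cmod (f t) \<le> B"
    using continuous_bounded_on_Icc[OF c] by blast
  then show "set_integrable lborel {a..b} (\<lambda>t. f t * F t)"
    using F ab c by (intro set_integrable_bounded_mult[where B = B] borel_measurable_continuous_on_indicator)
      (auto simp: loc_integrable_def)
qed

lemma loc_integrable_continuous: "continuous_on {l<..<r} f \<Longrightarrow> loc_integrable l r f"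
  unfolding loc_integrable_def
  by (intro allI impI borel_integrable_atLeastAtMost') (erule continuous_on_subset, auto)

lemma integrable_test_mult:
  assumes F: "loc_integrable l r F" and ab: "l < a" "b < r"
    and \<psi>: "continuous_on UNIV \<psi>" "\<And>t. t \<notin> {a..b} \<Longrightarrow> \<psi> t = 0"
  shows "integrable lborel (\<lambda>t. \<psi> t * F t)"
proof -
  have "set_integrable lborel {a..b} (\<lambda>t. \<psi> t * F t)"
    using loc_integrable_mult[OF _ F, of \<psi>] \<psi>(1) ab
    by (auto simp: loc_integrable_def intro: continuous_on_subset)
  also have "(\<lambda>t. indicator {a..b} t *\<^sub>R (\<psi> t * F t)) = (\<lambda>t. \<psi> t * F t)"
    using \<psi>(2) by (auto simp: indicator_def)
  ultimately show ?thesis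
    by (simp add: set_integrable_def)
qed

lemma sq_integrable_loc_integrable:
  assumes "sq_integrable f"
  shows "loc_integrable l r f"
  unfolding loc_integrable_def set_integrable_def
proof (intro allI impI)
  fix a b
  have m: "f \<in> borel_measurable lborel" "integrable lborel (\<lambda>t. (cmod (f t))\<^sup>2)"
    using assms by (auto simp: sq_integrable_def)
  show "integrable lborel (\<lambda>t. indicator {a..b} t *\<^sub>R f t)"
  proof (rule Bochner_Integration.integrable_bound)
    show "integrable lborel (\<lambda>t. indicator {a..b} t + (cmod (f t))\<^sup>2)"
      using m by (intro Bochner_Integration.integrable_add integrable_real_indicator)
        (auto simp: emeasure_lborel_Icc_eq)
    show "(\<lambda>t. indicator {a..b} t *\<^sub>R f t) \<in> borel_measurable lborel"
      using m by (intro borel_measurable_scaleR) auto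
    have "cmod (f t) \<le> 1 + (cmod (f t))\<^sup>2" for t
    proof -
      have "2 * cmod (f t) \<le> 1 + (cmod (f t))\<^sup>2"
        using sum_squares_bound[of 1 "cmod (f t)"] by simp
      then show ?thesis
        using norm_ge_zero[of "f t"] by linarith
    qed
    then show "AE t in lborel. norm (indicator {a..b} t *\<^sub>R f t)
        \<le> norm (indicator {a..b} t + (cmod (f t))\<^sup>2)"
      by (auto simp: indicator_def intro!: AE_I2)
  qed
qed

text \<open>
  The test functions \<open>1 - (1 - \<beta>)\<^sup>k\<close> with a normalized bump \<open>\<beta>\<close> converge boundedly to the indicator
  function of an open interval.
\<close>

lemma zero_on_intervals:
  assumes H: "loc_integrable l r H"
    and z: "\<And>a b \<eta> \<eta>'. l < a \<Longrightarrow> b < r \<Longrightarrow> test_pair a b \<eta> \<eta>' \<Longrightarrow> integral\<^sup>L lborel (\<lambda>t. \<eta> t * H t) = 0"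
    and uv: "l < u" "v < r"
  shows "(LINT t:{u<..<v}|lborel. H t) = 0"
proof (cases "u < v")
  case True
  define m where "m = (v - u) ^ 6"
  have m: "m > 0"
    using True by (simp add: m_def)
  define \<beta> where "\<beta> = (\<lambda>t. bump u v t / m)"
  have \<beta>: "0 \<le> \<beta> t" "\<beta> t \<le> 1" for t
    using bump_le[OF True, of t] m by (auto simp: \<beta>_def m_def bump_def)
  define \<eta> where "\<eta> = (\<lambda>k t. complex_of_real (1 - (1 - \<beta> t) ^ k))"
  have test: "test_pair u v (\<eta> k) (\<lambda>t. of_real (of_nat k * (1 - \<beta> t) ^ (k - 1) * (bump' u v t / m)))" for k
  proof (rule test_pairI[of UNIV])
    have d: "(\<beta> has_real_derivative bump' u v t / m) (at t)" for t
      unfolding \<beta>_def by (rule DERIV_cdivide[OF bump_derivs(1)])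
    have "((\<lambda>t. 1 - (1 - \<beta> t) ^ k) has_real_derivative
        of_nat k * (1 - \<beta> t) ^ (k - 1) * (bump' u v t / m)) (at t)" for t
      by (auto intro!: derivative_eq_intros d)
    then show "(\<eta> k has_vector_derivative of_real (of_nat k * (1 - \<beta> t) ^ (k - 1) * (bump' u v t / m)))
        (at t)" for t
      unfolding \<eta>_def
      by (intro has_vector_derivative_of_real) (simp flip: has_real_derivative_iff_has_vector_derivative)
    have "continuous_on UNIV (bump' u v)" "continuous_on UNIV (bump u v)"
      using bump_derivs by (auto intro!: continuous_at_imp_continuous_on DERIV_isCont)
    then show "continuous_on UNIV (\<lambda>t. complex_of_real (of_nat k * (1 - \<beta> t) ^ (k - 1) * (bump' u v t / m)))"
      unfolding \<beta>_def using m by (intro continuous_intros) auto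
  qed (use True bump_zero[of _ u v] in \<open>auto simp: \<eta>_def \<beta>_def\<close>)
  have "(\<lambda>k. integral\<^sup>L lborel (\<lambda>t. \<eta> k t * H t))
      \<longlonglongrightarrow> integral\<^sup>L lborel (\<lambda>t. indicator {u<..<v} t *\<^sub>R H t)"
  proof (rule integral_dominated_convergence)
    have i: "integrable lborel (\<lambda>t. indicator {u..v} t *\<^sub>R H t)"
      using H uv by (simp add: loc_integrable_def set_integrable_def)
    then show "integrable lborel (\<lambda>t. norm (indicator {u..v} t *\<^sub>R H t))"
      by (rule integrable_norm)
    have "(\<lambda>t. indicator {u<..<v} t *\<^sub>R (indicator {u..v} t *\<^sub>R H t)) \<in> borel_measurable lborel"
      by (rule borel_measurable_scaleR) (use borel_measurable_integrable[OF i] in auto)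
    also have "(\<lambda>t. indicator {u<..<v} t *\<^sub>R (indicator {u..v} t *\<^sub>R H t))
        = (\<lambda>t. indicator {u<..<v} t *\<^sub>R H t)"
      by (auto simp: indicator_def)
    finally show "(\<lambda>t. indicator {u<..<v} t *\<^sub>R H t) \<in> borel_measurable lborel" .
    show "(\<lambda>t. \<eta> k t * H t) \<in> borel_measurable lborel" for k
      using integrable_test_mult[OF H uv test_pair_continuous[OF test] test_pair_zero[OF test]]
      by (rule borel_measurable_integrable)
    show "AE t in lborel. (\<lambda>k. \<eta> k t * H t) \<longlonglongrightarrow> indicator {u<..<v} t *\<^sub>R H t"
    proof (rule AE_I2)
      fix t
      have "(\<lambda>k. 1 - (1 - \<beta> t) ^ k) \<longlonglongrightarrow> (if t \<in> {u<..<v} then 1 - 0 else 0)"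
      proof (cases "t \<in> {u<..<v}")
        case t: True
        have "\<bar>1 - \<beta> t\<bar> < 1"
          using bump_pos[OF t] m \<beta>[of t] by (auto simp: \<beta>_def)
        then have "(\<lambda>k. 1 - (1 - \<beta> t) ^ k) \<longlonglongrightarrow> 1 - 0"
          by (intro tendsto_diff tendsto_const LIMSEQ_power_zero) simp
        then show ?thesis
          using t by simp
      next
        case False
        then show ?thesis
          using bump_zero[of t u v] True by (auto simp: \<beta>_def)
      qed
      then have "(\<lambda>k. \<eta> k t * H t) \<longlonglongrightarrow> of_real (if t \<in> {u<..<v} then 1 - 0 else 0) * H t"
        unfolding \<eta>_def by (intro tendsto_intros)
      then show "(\<lambda>k. \<eta> k t * H t) \<longlonglongrightarrow> indicator {u<..<v} t *\<^sub>R H t"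
        by (auto simp: indicator_def split: if_splits)
    qed
    show "AE t in lborel. norm (\<eta> k t * H t) \<le> norm (indicator {u..v} t *\<^sub>R H t)" for k
    proof (rule AE_I2)
      fix t
      have "0 \<le> (1 - \<beta> t) ^ k" "(1 - \<beta> t) ^ k \<le> 1"
        using \<beta>[of t] by (auto intro: power_le_one)
      then have "cmod (\<eta> k t) \<le> 1"
        unfolding \<eta>_def norm_of_real by auto
      then show "norm (\<eta> k t * H t) \<le> norm (indicator {u..v} t *\<^sub>R H t)"
        using test_pair_zero[OF test, of t k]
        by (cases "t \<in> {u..v}") (auto simp: norm_mult mult_left_le_one_le)
    qed
  qed
  then have "(\<lambda>k. 0) \<longlonglongrightarrow> integral\<^sup>L lborel (\<lambda>t. indicator {u<..<v} t *\<^sub>R H t)"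
    by (simp add: z[OF uv test])
  then show ?thesis
    using LIMSEQ_unique[OF _ tendsto_const] unfolding set_lebesgue_integral_def by blast
qed (simp add: set_lebesgue_integral_def)

text \<open>
  Open intervals generate the Borel sets and are stable under intersection; the sets over which \<open>f\<close> has integral
  zero form a Dynkin system, hence comprise all Borel sets.
\<close>

lemma AE_zero_if_zero_on_intervals:
  fixes f :: "real \<Rightarrow> complex"
  assumes f: "integrable lborel f"
    and z: "\<And>u v. (LINT t:{u<..<v}|lborel. f t) = 0" and z': "integral\<^sup>L lborel f = 0"
  shows "AE t in lborel. f t = 0"
proof (rule sigma_finite_measure.density_zero[OF _ f])
  show "sigma_finite_measure (lborel :: real measure)"
    by (rule sigma_finite_lborel)
  have si: "set_integrable lborel A f" if "A \<in> sets borel" for A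
    unfolding set_integrable_def using f that by (intro integrable_mult_indicator) auto
  fix A :: "real set" assume A: "A \<in> sets lborel"
  have "Int_stable (range (\<lambda>(a, b). box a (b :: real)))"
    by (auto simp: Int_stable_def box_Int_box)
  moreover have "range (\<lambda>(a, b). box a (b :: real)) \<subseteq> Pow UNIV"
    by auto
  moreover have "A \<in> sigma_sets UNIV (range (\<lambda>(a, b). box a b))"
    using A by (simp add: borel_eq_box)
  ultimately show "(LINT t:A|lborel. f t) = 0"
  proof (induction rule: sigma_sets_induct_disjoint)
    case (basic A)
    then show ?case
      using z by (auto simp: box_real)
  next
    case (compl A)
    then have A: "A \<in> sets borel"
      by (simp add: borel_eq_box)
    have "(LINT t:UNIV - A|lborel. f t) = integral\<^sup>L lborel (\<lambda>t. f t - indicator A t *\<^sub>R f t)"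
      unfolding set_lebesgue_integral_def
      by (intro Bochner_Integration.integral_cong) (auto simp: indicator_def)
    also have "\<dots> = integral\<^sup>L lborel f - (LINT t:A|lborel. f t)"
      using si[OF A] f unfolding set_lebesgue_integral_def set_integrable_def
      by (intro Bochner_Integration.integral_diff)
    finally show ?case
      using compl.IH z' by simp
  next
    case (union A)
    then have A: "A i \<in> sets borel" for i
      by (simp add: borel_eq_box subset_eq del: box_real)
    have "(LINT t:(\<Union>i. A i)|lborel. f t) = (\<Sum>i. LINT t:A i|lborel. f t)"
      using union(1) A by (intro lebesgue_integral_countable_add si) (auto simp: disjoint_family_on_def)
    then show ?case
      using union by simp
  qed (simp add: set_lebesgue_integral_def)
qed

lemma AE_zero_if_test_zero:
  assumes H: "loc_integrable l r H"
    and z: "\<And>a b \<eta> \<eta>'. l < a \<Longrightarrow> b < r \<Longrightarrow> test_pair a b \<eta> \<eta>' \<Longrightarrow> integral\<^sup>L lborel (\<lambda>t. \<eta> t * H t) = 0"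
  shows "AE t in lborel. t \<in> {l<..<r} \<longrightarrow> H t = 0"
proof -
  have ae: "AE t in lborel. indicator {a<..<b} t *\<^sub>R H t = 0" if ab: "l < a" "b < r" for a b
  proof (rule AE_zero_if_zero_on_intervals)
    have "integrable lborel (\<lambda>t. indicator {a<..<b} t *\<^sub>R (indicator {a..b} t *\<^sub>R H t))"
      by (rule integrable_mult_indicator)
        (use H ab in \<open>auto simp: loc_integrable_def set_integrable_def\<close>)
    also have "(\<lambda>t. indicator {a<..<b} t *\<^sub>R (indicator {a..b} t *\<^sub>R H t))
        = (\<lambda>t. indicator {a<..<b} t *\<^sub>R H t)"
      by (auto simp: indicator_def)
    finally show "integrable lborel (\<lambda>t. indicator {a<..<b} t *\<^sub>R H t)" .
    show "integral\<^sup>L lborel (\<lambda>t. indicator {a<..<b} t *\<^sub>R H t) = 0"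
      using zero_on_intervals[OF H z ab] unfolding set_lebesgue_integral_def .
    show "(LINT t:{u<..<v}|lborel. indicator {a<..<b} t *\<^sub>R H t) = 0" for u v
    proof -
      have "(LINT t:{u<..<v}|lborel. indicator {a<..<b} t *\<^sub>R H t)
          = (LINT t:{max u a<..<min v b}|lborel. H t)"
        unfolding set_lebesgue_integral_def
        by (intro Bochner_Integration.integral_cong) (auto simp: indicator_def)
      also have "\<dots> = 0"
        using ab by (intro zero_on_intervals[OF H z]) auto
      finally show ?thesis .
    qed
  qed
  have "AE t in lborel. \<forall>n. indicator {l + 1 / Suc n<..<r - 1 / Suc n} t *\<^sub>R H t = 0"
    by (intro AE_all_countable[THEN iffD2] allI ae) simp_all
  then show ?thesis
  proof eventually_elim
    fix t assume t: "\<forall>n. indicator {l + 1 / Suc n<..<r - 1 / Suc n} t *\<^sub>R H t = 0"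
    show "t \<in> {l<..<r} \<longrightarrow> H t = 0"
    proof
      assume "t \<in> {l<..<r}"
      then have "min (t - l) (r - t) > 0"
        by auto
      then obtain n where "1 / Suc n < min (t - l) (r - t)"
        using nat_approx_posE by blast
      then show "H t = 0"
        using t[rule_format, of n] by (auto simp: indicator_def)
    qed
  qed
qed

section \<open>Weak derivatives\<close>

definition weak_deriv :: "real \<Rightarrow> real \<Rightarrow> (real \<Rightarrow> complex) \<Rightarrow> (real \<Rightarrow> complex) \<Rightarrow> bool"
  where "weak_deriv l r F g \<longleftrightarrow> loc_integrable l r F \<and> loc_integrable l r g \<and>
    (\<forall>a b \<psi> \<psi>'. l < a \<longrightarrow> b < r \<longrightarrow> test_pair a b \<psi> \<psi>' \<longrightarrow>
      integral\<^sup>L lborel (\<lambda>t. \<psi>' t * F t) = - integral\<^sup>L lborel (\<lambda>t. \<psi> t * g t))"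

lemma weak_derivD:
  "weak_deriv l r F g \<Longrightarrow> l < a \<Longrightarrow> b < r \<Longrightarrow> test_pair a b \<psi> \<psi>'
    \<Longrightarrow> integral\<^sup>L lborel (\<lambda>t. \<psi>' t * F t) = - integral\<^sup>L lborel (\<lambda>t. \<psi> t * g t)"
  by (auto simp: weak_deriv_def)

lemma weak_deriv_loc_integrable:
  "weak_deriv l r F g \<Longrightarrow> loc_integrable l r F" "weak_deriv l r F g \<Longrightarrow> loc_integrable l r g"
  by (auto simp: weak_deriv_def)

lemma weak_deriv_mult:
  assumes F: "weak_deriv l r F g"
    and f: "\<And>t. t \<in> {l<..<r} \<Longrightarrow> (f has_vector_derivative f' t) (at t)" "continuous_on {l<..<r} f'"
  shows "weak_deriv l r (\<lambda>t. f t * F t) (\<lambda>t. f' t * F t + f t * g t)"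
proof -
  have cf: "continuous_on {l<..<r} f"
    using f(1) by (intro continuous_at_imp_continuous_on) (blast intro: has_vector_derivative_continuous)
  note li = loc_integrable_mult[OF cf] loc_integrable_mult[OF f(2)] weak_deriv_loc_integrable[OF F]
  have "integral\<^sup>L lborel (\<lambda>t. \<psi>' t * (f t * F t))
      = - integral\<^sup>L lborel (\<lambda>t. \<psi> t * (f' t * F t + f t * g t))"
    if ab: "l < a" "b < r" and \<psi>: "test_pair a b \<psi> \<psi>'" for a b \<psi> \<psi>'
  proof -
    note c = test_pair_continuous[OF \<psi>] test_pair_continuous_deriv[OF \<psi>]
    note z = test_pair_zero[OF \<psi>] test_pair_deriv_zero[OF \<psi>]
    have i: "integrable lborel (\<lambda>t. \<psi>' t * (f t * F t))" "integrable lborel (\<lambda>t. \<psi> t * (f' t * F t))"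
        "integrable lborel (\<lambda>t. \<psi> t * (f t * g t))"
      using ab c z li by (auto intro!: integrable_test_mult[of l r _ a b])
    have "integral\<^sup>L lborel (\<lambda>t. (f' t * \<psi> t + f t * \<psi>' t) * F t)
        = - integral\<^sup>L lborel (\<lambda>t. (f t * \<psi> t) * g t)"
      by (rule weak_derivD[OF F ab test_pair_mult[OF \<psi> ab f]])
    also have "(\<lambda>t. (f' t * \<psi> t + f t * \<psi>' t) * F t)
        = (\<lambda>t. \<psi> t * (f' t * F t) + \<psi>' t * (f t * F t))"
      by (auto simp: algebra_simps)
    also have "(\<lambda>t. (f t * \<psi> t) * g t) = (\<lambda>t. \<psi> t * (f t * g t))"
      by (auto simp: algebra_simps)
    finally show ?thesis
      using i by (simp add: distrib_left) algebra
  qed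
  then show ?thesis
    unfolding weak_deriv_def using li by (auto intro: loc_integrable_add)
qed

lemma weak_deriv_add:
  assumes "weak_deriv l r F g" "weak_deriv l r G h"
  shows "weak_deriv l r (\<lambda>t. F t + G t) (\<lambda>t. g t + h t)"
proof -
  note li = weak_deriv_loc_integrable[OF assms(1)] weak_deriv_loc_integrable[OF assms(2)]
  have "integral\<^sup>L lborel (\<lambda>t. \<psi>' t * (F t + G t)) = - integral\<^sup>L lborel (\<lambda>t. \<psi> t * (g t + h t))"
    if ab: "l < a" "b < r" and \<psi>: "test_pair a b \<psi> \<psi>'" for a b \<psi> \<psi>'
  proof -
    note c = test_pair_continuous[OF \<psi>] test_pair_continuous_deriv[OF \<psi>]
    note z = test_pair_zero[OF \<psi>] test_pair_deriv_zero[OF \<psi>]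
    have "integrable lborel (\<lambda>t. \<psi>' t * F t)" "integrable lborel (\<lambda>t. \<psi>' t * G t)"
        "integrable lborel (\<lambda>t. \<psi> t * g t)" "integrable lborel (\<lambda>t. \<psi> t * h t)"
      using ab c z li by (auto intro!: integrable_test_mult[of l r _ a b])
    then show ?thesis
      using weak_derivD[OF assms(1) ab \<psi>] weak_derivD[OF assms(2) ab \<psi>]
      by (simp add: distrib_left)
  qed
  then show ?thesis
    unfolding weak_deriv_def using li by (auto intro: loc_integrable_add)
qed

text \<open>\<open>F\<close> is a locally absolutely continuous function with derivative \<open>g\<close>.\<close>

definition primitive_of :: "real \<Rightarrow> real \<Rightarrow> (real \<Rightarrow> complex) \<Rightarrow> (real \<Rightarrow> complex) \<Rightarrow> bool"
  where "primitive_of l r g F \<longleftrightarrow> loc_integrable l r g \<and>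
    (\<forall>u v. l < u \<longrightarrow> u \<le> v \<longrightarrow> v < r \<longrightarrow> F v - F u = integral {u..v} g)"

lemma loc_integrable_integral:
  assumes "loc_integrable l r g" "l < u" "v < r"
  shows "g integrable_on {u..v}" "(LINT t:{u..v}|lborel. g t) = integral {u..v} g"
  using assms by (auto intro!: set_borel_integral_eq_integral simp: loc_integrable_def)

lemma primitive_of_integral:
  assumes g: "loc_integrable l r g" and s: "l < s" "s < r"
  defines "F \<equiv> (\<lambda>t. if s \<le> t then integral {s..t} g else - integral {t..s} g)"
  shows "primitive_of l r g F"
proof -
  have "F v - F u = integral {u..v} g" if uv: "l < u" "u \<le> v" "v < r" for u v
  proof -
    consider "s \<le> u" | "u < s" "s \<le> v" | "v < s"
      by linarith
    then show ?thesis
    proof cases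
      case 1
      then show ?thesis
        using Henstock_Kurzweil_Integration.integral_combine[of s u v g] loc_integrable_integral(1)[OF g s(1) uv(3)] uv
        by (simp add: F_def algebra_simps)
    next
      case 2
      then show ?thesis
        using Henstock_Kurzweil_Integration.integral_combine[of u s v g] loc_integrable_integral(1)[OF g uv(1) uv(3)] uv
        by (simp add: F_def algebra_simps)
    next
      case 3
      then show ?thesis
        using Henstock_Kurzweil_Integration.integral_combine[of u v s g] loc_integrable_integral(1)[OF g uv(1) s(2)] uv
        by (simp add: F_def algebra_simps)
    qed
  qed
  then show ?thesis
    using g by (simp add: primitive_of_def)
qed

lemma primitive_of_continuous:
  assumes "primitive_of l r g F"
  shows "continuous_on {l<..<r} F"
proof (rule continuous_at_imp_continuous_on, rule ballI)
  fix t assume t: "t \<in> {l<..<r}"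
  define a b where "a = (l + t) / 2" and "b = (t + r) / 2"
  have ab: "l < a" "a < t" "t < b" "b < r"
    using t by (auto simp: a_def b_def)
  have g: "loc_integrable l r g"
    using assms by (simp add: primitive_of_def)
  have "continuous_on {a..b} (\<lambda>x. F a + integral {a..x} g)"
    by (intro continuous_intros indefinite_integral_continuous_1 loc_integrable_integral[OF g] ab)
  then have "continuous_on {a..b} F"
  proof (rule continuous_on_eq)
    fix x assume "x \<in> {a..b}"
    then have "F x - F a = integral {a..x} g"
      using assms ab unfolding primitive_of_def by auto
    then show "F a + integral {a..x} g = F x"
      by (metis add.commute diff_add_cancel)
  qed
  then show "isCont F t"
    using ab by (auto intro: continuous_on_interior)
qed

lemma primitive_of_has_vector_derivative:
  assumes F: "primitive_of l r g F" and g: "continuous_on {l<..<r} g" and t: "t \<in> {l<..<r}"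
  shows "(F has_vector_derivative g t) (at t)"
proof -
  define a b where "a = (l + t) / 2" and "b = (t + r) / 2"
  have ab: "l < a" "a < t" "t < b" "b < r"
    using t by (auto simp: a_def b_def)
  have "continuous_on {a..b} g"
    by (rule continuous_on_subset[OF g]) (use ab in auto)
  then have "((\<lambda>x. integral {a..x} g) has_vector_derivative g t) (at t within {a..b})"
    by (rule integral_has_vector_derivative) (use ab in auto)
  then have "((\<lambda>x. F a + integral {a..x} g) has_vector_derivative 0 + g t) (at t)"
    using ab by (intro has_vector_derivative_add has_vector_derivative_const)
      (simp add: at_within_Icc_at)
  then have "((\<lambda>x. F a + integral {a..x} g) has_vector_derivative g t) (at t)"
    by simp
  then show ?thesis
  proof (rule has_vector_derivative_transform_within_open[of _ _ _ "{a<..<b}"])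
    fix x assume "x \<in> {a<..<b}"
    then have "F x - F a = integral {a..x} g"
      using F ab unfolding primitive_of_def by auto
    then show "F a + integral {a..x} g = F x"
      by (metis add.commute diff_add_cancel)
  qed (use ab in auto)
qed

text \<open>Integration by parts is Fubini's theorem on the triangle \<open>\<sigma> \<le> t\<close>.\<close>

lemma primitive_of_weak_deriv:
  assumes F: "primitive_of l r g F"
  shows "weak_deriv l r F g"
proof -
  have g: "loc_integrable l r g"
    using F by (simp add: primitive_of_def)
  have cF: "continuous_on {l<..<r} F"
    by (rule primitive_of_continuous[OF F])
  have "integral\<^sup>L lborel (\<lambda>t. \<psi>' t * F t) = - integral\<^sup>L lborel (\<lambda>t. \<psi> t * g t)"
    if ab: "l < a" "b < r" and \<psi>: "test_pair a b \<psi> \<psi>'" for a b \<psi> \<psi>'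
  proof (cases "a \<le> b")
    case False
    then have "\<psi> = (\<lambda>_. 0)" "\<psi>' = (\<lambda>_. 0)"
      using test_pair_zero[OF \<psi>] test_pair_deriv_zero[OF \<psi>] by auto
    then show ?thesis
      by simp
  next
    case True
    note c = test_pair_continuous[OF \<psi>] test_pair_continuous_deriv[OF \<psi>]
    note z = test_pair_zero[OF \<psi>] test_pair_deriv_zero[OF \<psi>]
    define h where "h = (\<lambda>\<sigma>. indicator {a..b} \<sigma> *\<^sub>R g \<sigma>)"
    have ih: "integrable lborel h"
      using g ab by (simp add: h_def loc_integrable_def set_integrable_def)
    have [measurable]: "h \<in> borel_measurable borel"
      using borel_measurable_integrable[OF ih] by simp
    have [measurable]: "\<psi>' \<in> borel_measurable borel"
      by (rule borel_measurable_continuous_onI[OF c(2)])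
    have i\<psi>': "integrable lborel \<psi>'"
    proof -
      have "set_integrable lborel {a..b} \<psi>'"
        by (intro borel_integrable_atLeastAtMost' continuous_on_subset[OF c(2)]) auto
      also have "(\<lambda>t. indicator {a..b} t *\<^sub>R \<psi>' t) = \<psi>'"
        using z(2) by (auto simp: indicator_def)
      ultimately show ?thesis
        by (simp add: set_integrable_def)
    qed
    define k where "k = (\<lambda>t \<sigma>. \<psi>' t * ((if \<sigma> \<le> t then 1 else 0) * h \<sigma>))"
    have meas: "case_prod k \<in> borel_measurable (lborel \<Otimes>\<^sub>M lborel)"
      unfolding k_def by measurable
    have kk: "integrable (lborel \<Otimes>\<^sub>M lborel) (case_prod k)"
    proof (rule lborel_pair.Fubini_integrable[OF meas])
      have *: "integrable lborel (\<lambda>\<sigma>. k t \<sigma>)" for t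
      proof (rule Bochner_Integration.integrable_bound)
        show "integrable lborel (\<lambda>\<sigma>. \<psi>' t * h \<sigma>)"
          using ih by simp
        show "k t \<in> borel_measurable lborel"
          unfolding k_def by measurable
      qed (auto simp: k_def norm_mult intro!: AE_I2)
      then show "AE t in lborel. integrable lborel (\<lambda>\<sigma>. case_prod k (t, \<sigma>))"
        by simp
      show "integrable lborel (\<lambda>t. \<integral>\<sigma>. norm (case_prod k (t, \<sigma>)) \<partial>lborel)"
      proof (rule Bochner_Integration.integrable_bound)
        show "integrable lborel (\<lambda>t. norm (\<psi>' t) * (\<integral>\<sigma>. norm (h \<sigma>) \<partial>lborel))"
          using i\<psi>' by simp
        show "(\<lambda>t. \<integral>\<sigma>. norm (case_prod k (t, \<sigma>)) \<partial>lborel) \<in> borel_measurable lborel"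
          using meas by measurable
        show "AE t in lborel. norm (\<integral>\<sigma>. norm (case_prod k (t, \<sigma>)) \<partial>lborel)
            \<le> norm (norm (\<psi>' t) * (\<integral>\<sigma>. norm (h \<sigma>) \<partial>lborel))"
        proof (rule AE_I2)
          fix t
          have "(\<integral>\<sigma>. norm (k t \<sigma>) \<partial>lborel) \<le> (\<integral>\<sigma>. norm (\<psi>' t) * norm (h \<sigma>) \<partial>lborel)"
          proof (rule integral_mono)
            show "integrable lborel (\<lambda>\<sigma>. norm (k t \<sigma>))"
              by (rule integrable_norm[OF *])
            show "integrable lborel (\<lambda>\<sigma>. norm (\<psi>' t) * norm (h \<sigma>))"
              using ih by simp
          qed (auto simp: k_def norm_mult)
          then show "norm (\<integral>\<sigma>. norm (case_prod k (t, \<sigma>)) \<partial>lborel)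
              \<le> norm (norm (\<psi>' t) * (\<integral>\<sigma>. norm (h \<sigma>) \<partial>lborel))"
            by simp
        qed
      qed
    qed
    have inner1: "(\<integral>\<sigma>. k t \<sigma> \<partial>lborel) = \<psi>' t * (F t - F a)" for t
    proof (cases "t \<in> {a..b}")
      case t: True
      have "(\<integral>\<sigma>. k t \<sigma> \<partial>lborel) = \<psi>' t * (LINT \<sigma>:{a..t}|lborel. g \<sigma>)"
        unfolding k_def set_lebesgue_integral_def integral_mult_right_zero h_def
        by (rule arg_cong[of _ _ "\<lambda>x. \<psi>' t * x"], rule Bochner_Integration.integral_cong)
          (use t in \<open>auto simp: indicator_def\<close>)
      also have "(LINT \<sigma>:{a..t}|lborel. g \<sigma>) = F t - F a"
        using F t ab loc_integrable_integral(2)[OF g ab(1), of t] unfolding primitive_of_def by auto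
      finally show ?thesis .
    qed (simp add: k_def z)
    have inner2: "(\<integral>t. k t \<sigma> \<partial>lborel) = - \<psi> \<sigma> * g \<sigma>" for \<sigma>
    proof -
      have "(\<integral>t. k t \<sigma> \<partial>lborel) = (\<integral>t. (indicator {\<sigma>..} t *\<^sub>R \<psi>' t) * h \<sigma> \<partial>lborel)"
        unfolding k_def by (intro Bochner_Integration.integral_cong) (auto simp: indicator_def)
      also have "\<dots> = - \<psi> \<sigma> * h \<sigma>"
        unfolding integral_mult_left_zero test_pair_integral_deriv[OF \<psi>] by simp
      also have "\<dots> = - \<psi> \<sigma> * g \<sigma>"
        using z(1) by (auto simp: h_def indicator_def)
      finally show ?thesis .
    qed
    have "(\<integral>\<sigma>. (\<integral>t. k t \<sigma> \<partial>lborel) \<partial>lborel) = (\<integral>t. (\<integral>\<sigma>. k t \<sigma> \<partial>lborel) \<partial>lborel)"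
      by (rule lborel_pair.Fubini_integral[OF kk])
    then have "(\<integral>t. \<psi>' t * (F t - F a) \<partial>lborel) = - (\<integral>\<sigma>. \<psi> \<sigma> * g \<sigma> \<partial>lborel)"
      unfolding inner1 inner2 by simp
    moreover have "(\<integral>t. \<psi>' t * (F t - F a) \<partial>lborel)
        = (\<integral>t. \<psi>' t * F t \<partial>lborel) - (\<integral>t. \<psi>' t \<partial>lborel) * F a"
      using integrable_test_mult[OF loc_integrable_continuous[OF cF] ab c(2) z(2)] i\<psi>'
      by (simp add: right_diff_distrib)
    moreover have "(\<integral>t. \<psi>' t \<partial>lborel) = 0"
    proof -
      have "(\<integral>t. \<psi>' t \<partial>lborel) = (\<integral>t. indicator {a - 1..} t *\<^sub>R \<psi>' t \<partial>lborel)"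
        by (intro Bochner_Integration.integral_cong) (auto simp: indicator_def z(2))
      also have "\<dots> = 0"
        unfolding test_pair_integral_deriv[OF \<psi>] by (simp add: z(1))
      finally show ?thesis .
    qed
    ultimately show ?thesis
      by simp
  qed
  then show ?thesis
    unfolding weak_deriv_def using g cF by (auto intro: loc_integrable_continuous)
qed

lemma test_pair_primitive:
  assumes \<omega>: "test_pair a b \<omega> \<omega>'" and ab: "a \<le> b" and z: "integral\<^sup>L lborel \<omega> = 0"
  shows "\<exists>\<psi>. test_pair a b \<psi> \<omega>"
proof -
  define \<psi> where "\<psi> = (\<lambda>t. integral {a - 1..t} \<omega>)"
  note c = test_pair_continuous[OF \<omega>]
  have si: "set_integrable lborel {u..v} \<omega>" for u v
    by (intro borel_integrable_atLeastAtMost' continuous_on_subset[OF c]) auto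
  have "test_pair a b \<psi> \<omega>"
  proof (rule test_pairI[of "{a - 1<..}"])
    show "(\<psi> has_vector_derivative \<omega> t) (at t)" if "t \<in> {a - 1<..}" for t
    proof -
      have "continuous_on {a - 1..t + 1} \<omega>"
        by (rule continuous_on_subset[OF c]) auto
      then have "(\<psi> has_vector_derivative \<omega> t) (at t within {a - 1..t + 1})"
        unfolding \<psi>_def by (rule integral_has_vector_derivative) (use that in auto)
      then show ?thesis
        using that by (simp add: at_within_Icc_at)
    qed
    show "continuous_on {a - 1<..} \<omega>"
      by (rule continuous_on_subset[OF c]) auto
    show "\<omega> t = 0" if "t \<notin> {a..b}" for t
      using that by (rule test_pair_zero[OF \<omega>])
    show "\<psi> t = 0" if "t \<notin> {a..b}" for t
    proof -
      have "\<psi> t = (LINT \<tau>:{a - 1..t}|lborel. \<omega> \<tau>)"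
        unfolding \<psi>_def by (rule set_borel_integral_eq_integral(2)[OF si, symmetric])
      also have "\<dots> = (if t < a then 0 else integral\<^sup>L lborel \<omega>)"
      proof (cases "t < a")
        case True
        then have "(\<lambda>\<tau>. indicator {a - 1..t} \<tau> *\<^sub>R \<omega> \<tau>) = (\<lambda>_. 0)"
          using test_pair_zero[OF \<omega>] by (auto simp: indicator_def)
        then show ?thesis
          using True by (simp add: set_lebesgue_integral_def)
      next
        case False
        then have "(\<lambda>\<tau>. indicator {a - 1..t} \<tau> *\<^sub>R \<omega> \<tau>) = \<omega>"
          using test_pair_zero[OF \<omega>] that by (auto simp: indicator_def fun_eq_iff)
        then show ?thesis
          using False by (simp add: set_lebesgue_integral_def)
      qed
      finally show ?thesis
        using z by simp
    qed
  qed auto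
  then show ?thesis
    by blast
qed

text \<open>The lemma of du Bois-Reymond. Every test function is, up to a multiple of a fixed one, the
  derivative of a test function.\<close>

lemma AE_const_if_weak_deriv_zero:
  assumes F: "loc_integrable l r F" and lr: "l < r"
    and z: "\<And>a b \<psi> \<psi>' \<psi>''. l < a \<Longrightarrow> b < r \<Longrightarrow> test_pair a b \<psi> \<psi>' \<Longrightarrow> test_pair a b \<psi>' \<psi>''
      \<Longrightarrow> integral\<^sup>L lborel (\<lambda>t. \<psi>' t * F t) = 0"
  shows "\<exists>c. AE t in lborel. t \<in> {l<..<r} \<longrightarrow> F t = c"
proof -
  define a0 b0 where "a0 = (2 * l + r) / 3" and "b0 = (l + 2 * r) / 3"
  have ab0: "l < a0" "a0 < b0" "b0 < r"
    using lr by (auto simp: a0_def b0_def field_simps)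
  have int: "integrable lborel \<omega>" if "test_pair a b \<omega> \<omega>'" for a b \<omega> \<omega>'
    using integrable_test_mult[of "a - 1" "b + 1" "\<lambda>_. 1" a b \<omega>] test_pair_continuous[OF that]
      test_pair_zero[OF that] by (simp add: loc_integrable_continuous)
  note b = test_pair_bump[OF ab0(2)]
  define m where "m = integral\<^sup>L lborel (bump a0 b0)"
  have ib: "integrable lborel (bump a0 b0)"
    using integrable_Re[OF int[OF b(1)]] by simp
  have m: "m > 0"
  proof -
    have "m \<ge> 0"
      unfolding m_def by (rule integral_nonneg_AE) (simp add: bump_def)
    moreover have "m \<noteq> 0"
    proof
      assume "m = 0"
      then have "AE t in lborel. bump a0 b0 t = 0"
        unfolding m_def using ib by (subst (asm) integral_nonneg_eq_0_iff_AE) (auto simp: bump_def)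
      then have "AE t in lborel. t \<notin> {a0<..<b0}"
      proof eventually_elim
        fix t assume "bump a0 b0 t = 0"
        then show "t \<notin> {a0<..<b0}"
          using bump_pos[of t a0 b0] by auto
      qed
      then have "{a0<..<b0} \<in> null_sets lborel"
        by (subst AE_iff_null_sets) auto
      then show False
        using ab0 by (auto simp: null_sets_def)
    qed
    ultimately show ?thesis
      by simp
  qed
  define \<eta>0 where "\<eta>0 = (\<lambda>t. complex_of_real (1 / m) * of_real (bump a0 b0 t))"
  have \<eta>0: "test_pair a0 b0 \<eta>0 (\<lambda>t. of_real (1 / m) * of_real (bump' a0 b0 t))"
    unfolding \<eta>0_def by (rule test_pair_scale[OF b(1)])
  have int0: "integral\<^sup>L lborel \<eta>0 = 1"
    unfolding \<eta>0_def integral_mult_right_zero integral_complex_of_real m_def[symmetric]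
    using m by (simp flip: of_real_mult)
  define c where "c = integral\<^sup>L lborel (\<lambda>t. \<eta>0 t * F t)"
  have "AE t in lborel. t \<in> {l<..<r} \<longrightarrow> F t - c = 0"
  proof (rule AE_zero_if_test_zero)
    show "loc_integrable l r (\<lambda>t. F t - c)"
      by (intro loc_integrable_diff F loc_integrable_continuous continuous_intros)
    fix a b \<eta> \<eta>' assume ab: "l < a" "b < r" and \<eta>: "test_pair a b \<eta> \<eta>'"
    define k where "k = integral\<^sup>L lborel \<eta>"
    define a1 b1 where "a1 = min a a0" and "b1 = max b b0"
    have ab1: "l < a1" "a1 \<le> b1" "b1 < r"
      using ab ab0 by (auto simp: a1_def b1_def)
    define \<omega> where "\<omega> = (\<lambda>t. \<eta> t - k * \<eta>0 t)"
    define \<omega>' where "\<omega>' = (\<lambda>t. \<eta>' t - k * (of_real (1 / m) * of_real (bump' a0 b0 t)))"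
    have \<omega>: "test_pair a1 b1 \<omega> \<omega>'"
      unfolding \<omega>_def \<omega>'_def
      by (intro test_pair_diff test_pair_scale[OF test_pair_widen[OF \<eta>0]] test_pair_widen[OF \<eta>])
        (auto simp: a1_def b1_def)
    have "integral\<^sup>L lborel \<omega> = 0"
      unfolding \<omega>_def using int[OF \<eta>] int[OF \<eta>0] int0 by (simp add: k_def)
    then obtain \<psi> where \<psi>: "test_pair a1 b1 \<psi> \<omega>"
      using test_pair_primitive[OF \<omega> ab1(2)] by blast
    note ti = integrable_test_mult[OF F ab test_pair_continuous[OF \<eta>] test_pair_zero[OF \<eta>]]
      integrable_test_mult[OF F ab0(1,3) test_pair_continuous[OF \<eta>0] test_pair_zero[OF \<eta>0]]
    have "0 = integral\<^sup>L lborel (\<lambda>t. \<omega> t * F t)"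
      using z[OF ab1(1,3) \<psi> \<omega>] by simp
    also have "(\<lambda>t. \<omega> t * F t) = (\<lambda>t. \<eta> t * F t - k * (\<eta>0 t * F t))"
      by (auto simp: \<omega>_def algebra_simps)
    also have "integral\<^sup>L lborel \<dots> = integral\<^sup>L lborel (\<lambda>t. \<eta> t * F t) - k * c"
      using ti by (simp add: c_def)
    also have "\<dots> = integral\<^sup>L lborel (\<lambda>t. \<eta> t * (F t - c))"
      using ti int[OF \<eta>] by (simp add: right_diff_distrib k_def)
    finally show "integral\<^sup>L lborel (\<lambda>t. \<eta> t * (F t - c)) = 0" ..
  qed
  then show ?thesis
    by (intro exI[of _ c]) simp
qed

text \<open>
  Regularity: an equation tested only against \<open>C\<^sup>2\<close> functions \<open>\<psi>\<close> (the class of first components in the domain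
  of the operator matrix) still yields an absolutely continuous representative.
\<close>

lemma weak_deriv_primitive:
  assumes F: "loc_integrable l r F" and g: "loc_integrable l r g" and lr: "l < r"
    and w: "\<And>a b \<psi> \<psi>' \<psi>''. l < a \<Longrightarrow> b < r \<Longrightarrow> test_pair a b \<psi> \<psi>' \<Longrightarrow> test_pair a b \<psi>' \<psi>''
      \<Longrightarrow> integral\<^sup>L lborel (\<lambda>t. \<psi>' t * F t) = - integral\<^sup>L lborel (\<lambda>t. \<psi> t * g t)"
  shows "\<exists>G. primitive_of l r g G \<and> (AE t in lborel. t \<in> {l<..<r} \<longrightarrow> F t = G t)"
proof -
  have s: "l < (l + r) / 2" "(l + r) / 2 < r"
    using lr by auto
  obtain G where G: "primitive_of l r g G"
    using primitive_of_integral[OF g s] by blast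
  note wG = primitive_of_weak_deriv[OF G]
  note liG = weak_deriv_loc_integrable(1)[OF wG]
  have "\<exists>c. AE t in lborel. t \<in> {l<..<r} \<longrightarrow> F t - G t = c"
  proof (rule AE_const_if_weak_deriv_zero[OF loc_integrable_diff[OF F liG] lr])
    fix a b \<psi> \<psi>' \<psi>'' assume ab: "l < a" "b < r" and \<psi>: "test_pair a b \<psi> \<psi>'" "test_pair a b \<psi>' \<psi>''"
    note i = integrable_test_mult[OF _ ab test_pair_continuous[OF \<psi>(2)] test_pair_zero[OF \<psi>(2)]]
    show "integral\<^sup>L lborel (\<lambda>t. \<psi>' t * (F t - G t)) = 0"
      using w[OF ab \<psi>] weak_derivD[OF wG ab \<psi>(1)] i[OF F] i[OF liG]
      by (simp add: right_diff_distrib)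
  qed
  then obtain c where "AE t in lborel. t \<in> {l<..<r} \<longrightarrow> F t - G t = c"
    by blast
  then have "AE t in lborel. t \<in> {l<..<r} \<longrightarrow> F t = G t + c"
    by eventually_elim (auto simp: algebra_simps)
  moreover have "primitive_of l r g (\<lambda>t. G t + c)"
    using G by (simp add: primitive_of_def)
  ultimately show ?thesis
    by blast
qed

section \<open>The operator matrix and its weak solutions\<close>

lemma sq_integrable_compact_support:
  assumes g: "continuous_on {a..b} g" "\<And>t. t \<notin> {a..b} \<Longrightarrow> g t = 0"
  shows "sq_integrable g"
  unfolding sq_integrable_def
proof
  have eq: "(\<lambda>t. indicator {a..b} t *\<^sub>R g t) = g"
    using g(2) by (auto simp: indicator_def)
  show "g \<in> borel_measurable lborel"
    using borel_measurable_continuous_on_indicator[of "{a..b}" g] g(1) unfolding eq by simp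
  have "set_integrable lborel {a..b} (\<lambda>t. (cmod (g t))\<^sup>2)"
    by (intro borel_integrable_atLeastAtMost' continuous_intros g)
  also have "(\<lambda>t. indicator {a..b} t *\<^sub>R (cmod (g t))\<^sup>2) = (\<lambda>t. (cmod (g t))\<^sup>2)"
  proof
    show "indicator {a..b} t *\<^sub>R (cmod (g t))\<^sup>2 = (cmod (g t))\<^sup>2" for t
      using g(2)[of t] by (cases "t \<in> {a..b}") auto
  qed
  ultimately show "integrable lborel (\<lambda>t. (cmod (g t))\<^sup>2)"
    by (simp add: set_integrable_def)
qed

lemma sq_integrable_test:
  assumes f: "continuous_on {l<..<r} f" and ab: "l < a" "b < r"
    and \<psi>: "continuous_on UNIV \<psi>" "\<And>t. t \<notin> {a..b} \<Longrightarrow> \<psi> t = 0"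
  shows "sq_integrable (\<lambda>t. f t * \<psi> t)"
proof (rule sq_integrable_compact_support)
  show "continuous_on {a..b} (\<lambda>t. f t * \<psi> t)"
    by (intro continuous_intros continuous_on_subset[OF f] continuous_on_subset[OF \<psi>(1)])
      (use ab in auto)
qed (use \<psi> in auto)

lemma cinner_l2_pair:
  assumes "sq_integrable f1" "sq_integrable f2" "sq_integrable g1" "sq_integrable g2"
  shows "cinner (l2_class f1, l2_class f2) (l2_class g1, l2_class g2)
    = integral\<^sup>L lborel (\<lambda>t. f1 t * cnj (g1 t) + f2 t * cnj (g2 t))"
  using assms by (simp add: cinner_prod_def cinner_l2_class sq_integrable_mult)

lemma l2_on_cases:
  assumes "x \<in> l2_on S"
  obtains f where "sq_integrable f" "\<And>t. t \<notin> S \<Longrightarrow> f t = 0" "x = l2_class f"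
  using assms unfolding l2_on_def by blast

lemma primitive_of_cong_AE:
  assumes F: "primitive_of l r g F" and h: "loc_integrable l r h"
    and ae: "AE t in lborel. t \<in> {l<..<r} \<longrightarrow> g t = h t"
  shows "primitive_of l r h F"
  unfolding primitive_of_def
proof (intro conjI allI impI)
  fix u v assume uv: "l < u" "u \<le> v" "v < r"
  have g: "loc_integrable l r g"
    using F by (simp add: primitive_of_def)
  have "integral {u..v} g = (LINT t:{u..v}|lborel. g t)"
    using loc_integrable_integral(2)[OF g uv(1,3)] by simp
  also have "\<dots> = (LINT t:{u..v}|lborel. h t)"
    unfolding set_lebesgue_integral_def
  proof (rule integral_cong_AE)
    have i: "integrable lborel (\<lambda>t. indicator {u..v} t *\<^sub>R g t)"
        "integrable lborel (\<lambda>t. indicator {u..v} t *\<^sub>R h t)"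
      using g h uv unfolding loc_integrable_def set_integrable_def by blast+
    show "(\<lambda>t. indicator {u..v} t *\<^sub>R g t) \<in> borel_measurable lborel"
      by (rule borel_measurable_integrable[OF i(1)])
    show "(\<lambda>t. indicator {u..v} t *\<^sub>R h t) \<in> borel_measurable lborel"
      by (rule borel_measurable_integrable[OF i(2)])
    show "AE t in lborel. indicator {u..v} t *\<^sub>R g t = indicator {u..v} t *\<^sub>R h t"
      using ae by eventually_elim (use uv in \<open>auto simp: indicator_def\<close>)
  qed
  also have "\<dots> = integral {u..v} h"
    using loc_integrable_integral(2)[OF h uv(1,3)] by simp
  finally show "F v - F u = integral {u..v} h"
    using F uv by (simp add: primitive_of_def)
qed (rule h)

text \<open>Uniqueness for linear systems: \<open>|F|\<^sup>2 + |Z|\<^sup>2\<close> grows at most exponentially.\<close>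

lemma linear_system_unique:
  assumes a: "continuous_on {l<..<r} a11" "continuous_on {l<..<r} a12"
      "continuous_on {l<..<r} a21" "continuous_on {l<..<r} a22"
    and F: "primitive_of l r (\<lambda>t. a11 t * F t + a12 t * Z t) F"
    and Z: "primitive_of l r (\<lambda>t. a21 t * F t + a22 t * Z t) Z"
    and s: "s \<in> {l<..<r}" "F s = 0" "Z s = 0" and t: "t \<in> {l<..<r}"
  shows "F t = 0 \<and> Z t = 0"
proof -
  define x0 x1 where "x0 = min s t" and "x1 = max s t"
  have x: "{x0..x1} \<subseteq> {l<..<r}"
    using s t by (auto simp: x0_def x1_def)
  note cF = primitive_of_continuous[OF F] and cZ = primitive_of_continuous[OF Z]
  have "continuous_on {l<..<r} (\<lambda>t. a11 t * F t + a12 t * Z t)"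
    and "continuous_on {l<..<r} (\<lambda>t. a21 t * F t + a22 t * Z t)"
    by (intro continuous_intros a cF cZ)+
  note dF = primitive_of_has_vector_derivative[OF F this(1)]
    and dZ = primitive_of_has_vector_derivative[OF Z this(2)]
  have "\<exists>K. \<forall>y\<in>{x0..x1}. cmod (f y) \<le> K" if "continuous_on {l<..<r} f" for f
    by (intro continuous_bounded_on_Icc continuous_on_subset[OF that] x)
  then obtain K1 K2 K3 K4 where K':
    "\<forall>y\<in>{x0..x1}. cmod (a11 y) \<le> K1" "\<forall>y\<in>{x0..x1}. cmod (a12 y) \<le> K2"
    "\<forall>y\<in>{x0..x1}. cmod (a21 y) \<le> K3" "\<forall>y\<in>{x0..x1}. cmod (a22 y) \<le> K4"
    using a by meson
  define K where "K = max (max K1 K2) (max K3 K4)"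
  have K: "cmod (a11 y) \<le> K" "cmod (a12 y) \<le> K" "cmod (a21 y) \<le> K" "cmod (a22 y) \<le> K"
    if "y \<in> {x0..x1}" for y
    using K' that by (auto simp: K_def le_max_iff_disj)
  define E where "E = (\<lambda>y. inner (F y) (F y) + inner (Z y) (Z y))"
  define E' where "E' = (\<lambda>y. 2 * inner (F y) (a11 y * F y + a12 y * Z y)
    + 2 * inner (Z y) (a21 y * F y + a22 y * Z y))"
  have dE: "(E has_real_derivative E' y) (at y)" if "y \<in> {l<..<r}" for y
    unfolding E_def E'_def has_real_derivative_iff_has_vector_derivative
    using has_vector_derivative_add[OF
        bounded_bilinear.has_vector_derivative[OF bounded_bilinear_inner dF[OF that] dF[OF that]]
        bounded_bilinear.has_vector_derivative[OF bounded_bilinear_inner dZ[OF that] dZ[OF that]]]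
    by (simp add: inner_commute)
  have E0: "E y \<ge> 0" for y
    by (simp add: E_def)
  have E': "\<bar>E' y\<bar> \<le> 4 * K * E y" if y: "y \<in> {x0..x1}" for y
  proof -
    have K0: "K \<ge> 0"
      using K(1)[OF y] by (rule order_trans[OF norm_ge_zero])
    have b: "\<bar>inner u (p * F y + q * Z y)\<bar> \<le> norm u * (K * (norm (F y) + norm (Z y)))"
      if "cmod p \<le> K" "cmod q \<le> K" for u p q
    proof -
      have "norm (p * F y + q * Z y) \<le> cmod p * norm (F y) + cmod q * norm (Z y)"
        by (rule norm_triangle_le) (simp add: norm_mult)
      also have "\<dots> \<le> K * norm (F y) + K * norm (Z y)"
        using that by (intro add_mono mult_right_mono) auto
      finally show ?thesis
        by (intro order_trans[OF Cauchy_Schwarz_ineq2] mult_left_mono) (simp_all add: distrib_left)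
    qed
    have "\<bar>E' y\<bar> \<le> 2 * (norm (F y) * (K * (norm (F y) + norm (Z y))))
        + 2 * (norm (Z y) * (K * (norm (F y) + norm (Z y))))"
      using b[OF K(1)[OF y] K(2)[OF y], of "F y"] b[OF K(3)[OF y] K(4)[OF y], of "Z y"] unfolding E'_def by linarith
    also have "\<dots> = K * (2 * (norm (F y) + norm (Z y))\<^sup>2)"
      by (simp add: power2_eq_square algebra_simps)
    also have "\<dots> \<le> K * (4 * E y)"
    proof (intro mult_left_mono K0)
      have "2 * norm (F y) * norm (Z y) \<le> (norm (F y))\<^sup>2 + (norm (Z y))\<^sup>2"
        by (rule sum_squares_bound)
      then show "2 * (norm (F y) + norm (Z y))\<^sup>2 \<le> 4 * E y"
        unfolding E_def by (simp add: power2_sum flip: power2_norm_eq_inner)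
    qed
    finally show ?thesis
      by simp
  qed
  have "E t = 0"
  proof (cases "s \<le> t")
    case True
    have "E t * exp (- (4 * K) * t) \<le> E s * exp (- (4 * K) * s)"
    proof (rule DERIV_nonpos_imp_nonincreasing[OF True, where f = "\<lambda>y. E y * exp (- (4 * K) * y)"])
      fix y assume y: "s \<le> y" "y \<le> t"
      then have yx: "y \<in> {x0..x1}"
        by (auto simp: x0_def x1_def)
      have "((\<lambda>y. E y * exp (- (4 * K) * y)) has_real_derivative
          (E' y - 4 * K * E y) * exp (- (4 * K) * y)) (at y)"
        using x yx by (auto intro!: derivative_eq_intros dE simp: algebra_simps)
      moreover have "(E' y - 4 * K * E y) * exp (- (4 * K) * y) \<le> 0"
        using E'[OF yx] by (intro mult_nonpos_nonneg) auto
      ultimately show "\<exists>d. ((\<lambda>y. E y * exp (- (4 * K) * y)) has_real_derivative d) (at y) \<and> d \<le> 0"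
        by blast
    qed
    then have "E t * exp (- (4 * K) * t) \<le> 0"
      using s by (simp add: E_def)
    then have "E t \<le> 0"
      using exp_gt_zero by (metis mult_le_0_iff not_le)
    then show ?thesis
      using E0[of t] by simp
  next
    case False
    have "E t * exp (4 * K * t) \<le> E s * exp (4 * K * s)"
    proof (rule DERIV_nonneg_imp_nondecreasing[where f = "\<lambda>y. E y * exp (4 * K * y)"])
      fix y assume y: "t \<le> y" "y \<le> s"
      then have yx: "y \<in> {x0..x1}"
        by (auto simp: x0_def x1_def)
      have "((\<lambda>y. E y * exp (4 * K * y)) has_real_derivative
          (E' y + 4 * K * E y) * exp (4 * K * y)) (at y)"
        using x yx by (auto intro!: derivative_eq_intros dE simp: algebra_simps)
      moreover have "(E' y + 4 * K * E y) * exp (4 * K * y) \<ge> 0"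
        using E'[OF yx] by (intro mult_nonneg_nonneg) auto
      ultimately show "\<exists>d. ((\<lambda>y. E y * exp (4 * K * y)) has_real_derivative d) (at y) \<and> d \<ge> 0"
        by blast
    qed (use False in simp)
    then have "E t * exp (4 * K * t) \<le> 0"
      using s by (simp add: E_def)
    then have "E t \<le> 0"
      using exp_gt_zero by (metis mult_le_0_iff not_le)
    then show ?thesis
      using E0[of t] by simp
  qed
  then show ?thesis
    by (simp add: E_def add_nonneg_eq_0_iff)
qed

text \<open>
  The operator matrix with \<open>p\<^sub>1 = p\<close>, \<open>p\<^sub>2 = (c / t) p\<close> and \<open>p\<^sub>3 = (c / t)\<^sup>2 p\<close>. The relation \<open>p\<^sub>1 p\<^sub>3 = p\<^sub>2\<^sup>2\<close> is the
  vanishing of \<open>\<Delta>\<close>: all terms containing \<open>p\<close> act through the single combination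
  \<open>\<xi> = p (y\<^sub>1' - (c / t) y\<^sub>2)\<close>.
\<close>

locale degenerate_matrix =
  fixes R c :: real and p p' q1 q2 :: "real \<Rightarrow> real"
  assumes R: "1 < R" and c: "0 < c"
    and p_pos: "\<And>t. t \<in> {1<..<R} \<Longrightarrow> 0 < p t"
    and p_deriv: "\<And>t. t \<in> {1<..<R} \<Longrightarrow> (p has_real_derivative p' t) (at t)"
    and p'_cont: "continuous_on {1<..<R} p'"
    and q1_cont: "continuous_on {1<..<R} q1"
    and q2_cont: "continuous_on {1<..<R} q2"
begin

text \<open>
  The restriction of the operator matrix to pairs for which \<open>\<xi>\<close> is itself a \<open>C\<^sup>1\<close> test function. A smaller
  domain only enlarges the class of extensions, and it is large enough for testing.
\<close>

definition minimal_operator :: "((l2 \<times> l2) \<times> (l2 \<times> l2)) set"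
  where "minimal_operator = {((l2_class \<phi>1, l2_class \<phi>2),
      (l2_class (\<lambda>t. - \<xi>' t + of_real (q1 t) * \<phi>1 t + of_real (q2 t) * \<phi>2 t),
       l2_class (\<lambda>t. - (of_real (c / t) * \<xi> t) + of_real (q2 t) * \<phi>1 t)))
    | \<phi>1 \<phi>2 \<xi> \<xi>'. \<exists>a b \<phi>1' \<phi>1'' \<phi>2'. 1 < a \<and> b < R \<and>
        test_pair a b \<phi>1 \<phi>1' \<and> test_pair a b \<phi>1' \<phi>1'' \<and> test_pair a b \<phi>2 \<phi>2' \<and> test_pair a b \<xi> \<xi>' \<and>
        (\<forall>t. \<xi> t = of_real (p t) * (\<phi>1' t - of_real (c / t) * \<phi>2 t))}"

lemma minimal_operatorI:
  assumes "1 < a" "b < R" "test_pair a b \<phi>1 \<phi>1'" "test_pair a b \<phi>1' \<phi>1''" "test_pair a b \<phi>2 \<phi>2'"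
    "test_pair a b \<xi> \<xi>'" "\<And>t. \<xi> t = of_real (p t) * (\<phi>1' t - of_real (c / t) * \<phi>2 t)"
  shows "((l2_class \<phi>1, l2_class \<phi>2),
      (l2_class (\<lambda>t. - \<xi>' t + of_real (q1 t) * \<phi>1 t + of_real (q2 t) * \<phi>2 t),
       l2_class (\<lambda>t. - (of_real (c / t) * \<xi> t) + of_real (q2 t) * \<phi>1 t))) \<in> minimal_operator"
  unfolding minimal_operator_def using assms by blast

lemma p_cont: "continuous_on {1<..<R} p"
  using p_deriv by (intro continuous_at_imp_continuous_on) (blast intro: DERIV_isCont)

lemma p_nz: "t \<in> {1<..<R} \<Longrightarrow> p t \<noteq> 0"
  using p_pos by fastforce

lemma complex_coeff_cont:
  "continuous_on {1<..<R} (\<lambda>t. complex_of_real (p t))"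
  "continuous_on {1<..<R} (\<lambda>t. complex_of_real (q1 t))"
  "continuous_on {1<..<R} (\<lambda>t. complex_of_real (q2 t))"
  "continuous_on {1<..<R} (\<lambda>t. complex_of_real (c / t))"
  using p_cont q1_cont q2_cont by (auto intro!: continuous_intros)

lemma minimal_operator_sq_integrable:
  assumes ab: "1 < a" "b < R" and \<phi>1: "test_pair a b \<phi>1 \<phi>1'" and \<phi>2: "test_pair a b \<phi>2 \<phi>2'"
    and \<xi>: "test_pair a b \<xi> \<xi>'"
  shows "sq_integrable \<phi>1" "sq_integrable \<phi>2"
    "sq_integrable (\<lambda>t. - \<xi>' t + of_real (q1 t) * \<phi>1 t + of_real (q2 t) * \<phi>2 t)"
    "sq_integrable (\<lambda>t. - (of_real (c / t) * \<xi> t) + of_real (q2 t) * \<phi>1 t)"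
proof -
  note st = sq_integrable_test[OF _ ab]
  note \<phi>1 = test_pair_continuous[OF \<phi>1] test_pair_zero[OF \<phi>1]
  note \<phi>2 = test_pair_continuous[OF \<phi>2] test_pair_zero[OF \<phi>2]
  note \<xi>0 = test_pair_continuous[OF \<xi>] test_pair_zero[OF \<xi>]
  note \<xi>1 = test_pair_continuous_deriv[OF \<xi>] test_pair_deriv_zero[OF \<xi>]
  show "sq_integrable \<phi>1" "sq_integrable \<phi>2"
    using st[OF _ \<phi>1, of "\<lambda>_. 1"] st[OF _ \<phi>2, of "\<lambda>_. 1"] by simp_all
  have "sq_integrable (\<lambda>t. (- 1) * \<xi>' t)"
    by (rule st[OF _ \<xi>1]) (rule continuous_on_const)
  moreover have "sq_integrable (\<lambda>t. (- complex_of_real (c / t)) * \<xi> t)"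
    by (rule st[OF _ \<xi>0]) (intro continuous_on_minus complex_coeff_cont)
  ultimately have sq: "sq_integrable (\<lambda>t. - \<xi>' t)" "sq_integrable (\<lambda>t. - (of_real (c / t) * \<xi> t))"
    by simp_all
  note q = st[OF complex_coeff_cont(2) \<phi>1] st[OF complex_coeff_cont(3) \<phi>1] st[OF complex_coeff_cont(3) \<phi>2]
  show "sq_integrable (\<lambda>t. - \<xi>' t + of_real (q1 t) * \<phi>1 t + of_real (q2 t) * \<phi>2 t)"
    by (rule sq_integrable_add[OF sq_integrable_add[OF sq(1) q(1)] q(3)])
  show "sq_integrable (\<lambda>t. - (of_real (c / t) * \<xi> t) + of_real (q2 t) * \<phi>1 t)"
    by (rule sq_integrable_add[OF sq(2) q(2)])
qed

end

locale nonzero_eigenvalue = degenerate_matrix +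
  fixes \<mu> :: complex
  assumes \<mu>: "\<mu> \<noteq> 0"
begin

text \<open>
  Since \<open>\<mu> \<noteq> 0\<close>, the second row of \<open>A y = \<mu> y\<close> expresses \<open>y\<^sub>2\<close> by \<open>F = y\<^sub>1\<close> and by
  \<open>Z = p (y\<^sub>1' - c/t y\<^sub>2)\<close>, and the equation becomes a regular linear system for \<open>F\<close> and \<open>Z\<close>.
\<close>

definition second :: "(real \<Rightarrow> complex) \<Rightarrow> (real \<Rightarrow> complex) \<Rightarrow> real \<Rightarrow> complex"
  where "second F Z t = (of_real (q2 t) * F t - of_real (c / t) * Z t) / \<mu>"

definition a11 :: "real \<Rightarrow> complex" where "a11 t = of_real (c / t) * of_real (q2 t) / \<mu>"
definition a12 :: "real \<Rightarrow> complex" where "a12 t = of_real (1 / p t) - (of_real (c / t))\<^sup>2 / \<mu>"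
definition a21 :: "real \<Rightarrow> complex" where "a21 t = of_real (q1 t) - \<mu> + (of_real (q2 t))\<^sup>2 / \<mu>"

lemma a_cont: "continuous_on {1<..<R} a11" "continuous_on {1<..<R} a12" "continuous_on {1<..<R} a21"
  "continuous_on {1<..<R} (\<lambda>t. - a11 t)"
  unfolding a11_def[abs_def] a12_def[abs_def] a21_def[abs_def]
  using complex_coeff_cont p_cont p_nz \<mu> by (auto intro!: continuous_intros)

definition solution :: "(real \<Rightarrow> complex) \<Rightarrow> (real \<Rightarrow> complex) \<Rightarrow> bool"
  where "solution F Z \<longleftrightarrow> primitive_of 1 R (\<lambda>t. a11 t * F t + a12 t * Z t) F \<and>
    primitive_of 1 R (\<lambda>t. a21 t * F t + - a11 t * Z t) Z"

text \<open>
  Cauchy data at \<open>s\<close> of a weak solution given as a class of functions: the values of its continuous representative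
  \<open>F\<close> and of its quasi-derivative \<open>Z\<close>. It is a relation because a class determines its representative only
  through the differential equation.
\<close>

definition has_value :: "real \<Rightarrow> l2 \<times> l2 \<Rightarrow> complex \<Rightarrow> complex \<Rightarrow> bool"
  where "has_value s y \<alpha> \<beta> \<longleftrightarrow> (\<exists>y1 y2 F Z. sq_integrable y1 \<and> sq_integrable y2 \<and>
    y = (l2_class y1, l2_class y2) \<and> solution F Z \<and> F s = \<alpha> \<and> Z s = \<beta> \<and>
    (AE t in lborel. t \<in> {1<..<R} \<longrightarrow> y1 t = F t \<and> y2 t = second F Z t) \<and>
    (\<forall>t. t \<notin> {1<..<R} \<longrightarrow> y1 t = 0 \<and> y2 t = 0))"

lemma primitive_of_combination:
  assumes "primitive_of l r g F" "primitive_of l r h G"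
  shows "primitive_of l r (\<lambda>t. g t - k * h t) (\<lambda>t. F t - k * G t)"
proof -
  have li: "loc_integrable l r g" "loc_integrable l r h"
    using assms by (simp_all add: primitive_of_def)
  have "F v - k * G v - (F u - k * G u) = integral {u..v} (\<lambda>t. g t - k * h t)"
    if uv: "l < u" "u \<le> v" "v < r" for u v
  proof -
    have io: "g integrable_on {u..v}" "h integrable_on {u..v}"
      using loc_integrable_integral(1) li uv by blast+
    have "integral {u..v} (\<lambda>t. g t - k * h t) = integral {u..v} g - integral {u..v} (\<lambda>t. k * h t)"
      using io by (intro integral_diff integrable_on_mult_right)
    also have "\<dots> = (F v - F u) - k * (G v - G u)"
      using assms uv by (simp add: primitive_of_def)
    finally show ?thesis
      by (simp add: algebra_simps)
  qed
  moreover have "loc_integrable l r (\<lambda>t. g t - k * h t)"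
    by (intro loc_integrable_diff li loc_integrable_mult continuous_intros)
  ultimately show ?thesis
    by (simp add: primitive_of_def)
qed

lemma second_combination:
  "second (\<lambda>t. F t - k * G t) (\<lambda>t. Z t - k * W t) t = second F Z t - k * second G W t"
proof -
  have "(q * (f - k * g) - e * (z - k * w)) / \<mu> = (q * f - e * z) / \<mu> - k * ((q * g - e * w) / \<mu>)"
    for q f g e z w
    using \<mu> by (simp add: field_simps)
  then show ?thesis
    unfolding second_def by blast
qed

lemma has_value_combination:
  assumes "has_value s x \<alpha> \<beta>" "has_value s y \<alpha>' \<beta>'"
  shows "has_value s (x - k *\<^sub>C y) (\<alpha> - k * \<alpha>') (\<beta> - k * \<beta>')"
proof -
  obtain x1 x2 F Z where x: "sq_integrable x1" "sq_integrable x2" "x = (l2_class x1, l2_class x2)"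
      "solution F Z" "F s = \<alpha>" "Z s = \<beta>"
      "AE t in lborel. t \<in> {1<..<R} \<longrightarrow> x1 t = F t \<and> x2 t = second F Z t"
      "\<forall>t. t \<notin> {1<..<R} \<longrightarrow> x1 t = 0 \<and> x2 t = 0"
    using assms(1) unfolding has_value_def by blast
  obtain y1 y2 G W where y: "sq_integrable y1" "sq_integrable y2" "y = (l2_class y1, l2_class y2)"
      "solution G W" "G s = \<alpha>'" "W s = \<beta>'"
      "AE t in lborel. t \<in> {1<..<R} \<longrightarrow> y1 t = G t \<and> y2 t = second G W t"
      "\<forall>t. t \<notin> {1<..<R} \<longrightarrow> y1 t = 0 \<and> y2 t = 0"
    using assms(2) unfolding has_value_def by blast
  define F' Z' where "F' = (\<lambda>t. F t - k * G t)" and "Z' = (\<lambda>t. Z t - k * W t)"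
  have "primitive_of 1 R (\<lambda>t. (a11 t * F t + a12 t * Z t) - k * (a11 t * G t + a12 t * W t)) F'"
      "primitive_of 1 R (\<lambda>t. (a21 t * F t + - a11 t * Z t) - k * (a21 t * G t + - a11 t * W t)) Z'"
    using x(4) y(4) unfolding F'_def Z'_def solution_def by (auto intro: primitive_of_combination)
  then have sol: "solution F' Z'"
    unfolding solution_def F'_def Z'_def by (simp add: algebra_simps)
  have ae: "AE t in lborel. t \<in> {1<..<R} \<longrightarrow>
      x1 t - k * y1 t = F' t \<and> x2 t - k * y2 t = second F' Z' t"
    using x(7) y(7)
    by eventually_elim (simp add: F'_def Z'_def second_combination)
  have eq: "x - k *\<^sub>C y = (l2_class (\<lambda>t. x1 t - k * y1 t), l2_class (\<lambda>t. x2 t - k * y2 t))"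
    using x y by (simp add: scaleC_prod_def scaleC_l2_class minus_l2_class sq_integrable_scale)
  show ?thesis
    unfolding has_value_def
  proof (intro exI conjI)
    show "sq_integrable (\<lambda>t. x1 t - k * y1 t)" "sq_integrable (\<lambda>t. x2 t - k * y2 t)"
      by (intro sq_integrable_diff sq_integrable_scale x y)+
    show "F' s = \<alpha> - k * \<alpha>'" "Z' s = \<beta> - k * \<beta>'"
      by (simp_all add: F'_def Z'_def x(5,6) y(5,6))
    show "\<forall>t. t \<notin> {1<..<R} \<longrightarrow> x1 t - k * y1 t = 0 \<and> x2 t - k * y2 t = 0"
      using x(8) y(8) by simp
  qed (fact eq sol ae)+
qed

lemma has_value_zero:
  assumes s: "s \<in> {1<..<R}" and y: "has_value s y 0 0"
  shows "y = 0"
proof -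
  obtain y1 y2 F Z where y: "sq_integrable y1" "sq_integrable y2" "y = (l2_class y1, l2_class y2)"
      and sol: "solution F Z" "F s = 0" "Z s = 0"
      and ae: "AE t in lborel. t \<in> {1<..<R} \<longrightarrow> y1 t = F t \<and> y2 t = second F Z t"
      and z: "\<forall>t. t \<notin> {1<..<R} \<longrightarrow> y1 t = 0 \<and> y2 t = 0"
    using y unfolding has_value_def by blast
  have "F t = 0 \<and> Z t = 0" if "t \<in> {1<..<R}" for t
    using sol s that unfolding solution_def
    by (intro linear_system_unique[OF a_cont(1,2,3,4), of F Z s]) auto
  then have "AE t in lborel. y1 t = 0 \<and> y2 t = 0"
    using ae z by (auto simp: second_def elim!: eventually_mono)
  then have "l2_class y1 = l2_class (\<lambda>_. 0)" "l2_class y2 = l2_class (\<lambda>_. 0)"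
    using y by (subst l2_class_eq_iff; auto simp: sq_integrable_def)+
  then show ?thesis
    unfolding y(3) by (simp add: zero_l2_class zero_prod_def)
qed

text \<open>
  Testing with \<open>(0, \<phi>\<^sub>2)\<close> shows that \<open>y\<^sub>1\<close> has the weak derivative \<open>z / p + (c / t) y\<^sub>2\<close>, where \<open>z\<close> is read off from
  the second row; testing with \<open>(\<phi>\<^sub>1, 0)\<close> then gives the weak derivative of \<open>z\<close>. Both functions are therefore
  absolutely continuous and solve the system.
\<close>

lemma weak_solution_has_value:
  assumes y: "y \<in> stellar_space R"
    and weak: "\<And>\<phi> a. (\<phi>, a) \<in> minimal_operator \<Longrightarrow> cinner y a = \<mu> * cinner y \<phi>"
  shows "\<exists>\<alpha> \<beta>. has_value s y \<alpha> \<beta>"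
proof -
  obtain y1 y2 where y1: "sq_integrable y1" "\<And>t. t \<notin> {1<..<R} \<Longrightarrow> y1 t = 0"
      and y2: "sq_integrable y2" "\<And>t. t \<notin> {1<..<R} \<Longrightarrow> y2 t = 0"
      and yy: "y = (l2_class y1, l2_class y2)"
    using y unfolding stellar_space_def by (auto elim!: l2_on_cases)
  note li1 = sq_integrable_loc_integrable[OF y1(1), of 1 R]
  note li2 = sq_integrable_loc_integrable[OF y2(1), of 1 R]
  have tc: "continuous_on {1<..<R} (\<lambda>t. complex_of_real (t / (c * p t)))"
    "continuous_on {1<..<R} (\<lambda>t. complex_of_real (t / c))"
    "continuous_on {1<..<R} (\<lambda>t. complex_of_real (1 / p t))"
    using p_cont p_nz c by (auto intro!: continuous_intros)
  define z where "z = (\<lambda>t. of_real (t / c) * (of_real (q2 t) * y1 t - \<mu> * y2 t))"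
  define g where "g = (\<lambda>t. of_real (1 / p t) * z t + of_real (c / t) * y2 t)"
  define h where "h = (\<lambda>t. (of_real (q1 t) - \<mu>) * y1 t + of_real (q2 t) * y2 t)"
  have liz: "loc_integrable 1 R z"
    unfolding z_def
    by (intro loc_integrable_mult loc_integrable_diff complex_coeff_cont tc li1 li2 continuous_intros)
  have lig: "loc_integrable 1 R g"
    unfolding g_def
    by (intro loc_integrable_mult loc_integrable_add complex_coeff_cont tc li2 liz)
  have lih: "loc_integrable 1 R h"
    unfolding h_def
    by (intro loc_integrable_mult loc_integrable_add complex_coeff_cont continuous_intros li1 li2)
  \<comment> \<open>testing with \<open>(0, \<phi>\<^sub>2)\<close>, where \<open>\<psi> = cnj (p\<^sub>2 \<phi>\<^sub>2)\<close>\<close>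
  have weak_g: "integral\<^sup>L lborel (\<lambda>t. \<psi>' t * y1 t) = - integral\<^sup>L lborel (\<lambda>t. \<psi> t * g t)"
    if ab: "1 < a" "b < R" and \<psi>: "test_pair a b \<psi> \<psi>'" for a b \<psi> \<psi>'
  proof -
    define f where "f = (\<lambda>t. complex_of_real (t / (c * p t)))"
    define \<phi> where "\<phi> = (\<lambda>t. f t * cnj (\<psi> t))"
    have "((\<lambda>t. t / (c * p t)) has_real_derivative (c * p t - t * (c * p' t)) / (c * p t)\<^sup>2) (at t)"
      if "t \<in> {1<..<R}" for t
      using that p_nz c by (auto intro!: derivative_eq_intros p_deriv simp: power2_eq_square)
    then have f: "(f has_vector_derivative of_real ((c * p t - t * (c * p' t)) / (c * p t)\<^sup>2)) (at t)"
      if "t \<in> {1<..<R}" for t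
      using that unfolding f_def
      by (intro has_vector_derivative_of_real) (simp add: has_real_derivative_iff_has_vector_derivative)
    have f': "continuous_on {1<..<R} (\<lambda>t. complex_of_real ((c * p t - t * (c * p' t)) / (c * p t)\<^sup>2))"
      using p_cont p'_cont p_nz c by (auto intro!: continuous_intros)
    obtain \<phi>' where \<phi>: "test_pair a b \<phi> \<phi>'"
      using test_pair_mult[OF test_pair_cnj[OF \<psi>] ab f f'] unfolding \<phi>_def by blast
    define \<xi> \<xi>' where "\<xi> = (\<lambda>t. (- 1) * cnj (\<psi> t))" and "\<xi>' = (\<lambda>t. (- 1) * cnj (\<psi>' t))"
    have \<xi>: "test_pair a b \<xi> \<xi>'"
      unfolding \<xi>_def \<xi>'_def by (intro test_pair_scale test_pair_cnj \<psi>)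
    have \<xi>eq: "\<xi> t = of_real (p t) * (0 - of_real (c / t) * \<phi> t)" for t
    proof (cases "t \<in> {1<..<R}")
      case True
      then show ?thesis
        using p_nz[OF True] c unfolding \<xi>_def \<phi>_def f_def by (simp add: field_simps)
    next
      case False
      then have "\<psi> t = 0"
        using ab by (intro test_pair_zero[OF \<psi>]) auto
      then show ?thesis
        by (simp add: \<xi>_def \<phi>_def)
    qed
    note zt = test_pair_zero_fun[of a b]
    note mem = minimal_operatorI[OF ab zt zt \<phi> \<xi> \<xi>eq]
    note sq = minimal_operator_sq_integrable[OF ab zt \<phi> \<xi>]
    have "cinner y (l2_class (\<lambda>t. - \<xi>' t + of_real (q1 t) * 0 + of_real (q2 t) * \<phi> t),
        l2_class (\<lambda>t. - (of_real (c / t) * \<xi> t) + of_real (q2 t) * 0)) = \<mu> * cinner y (l2_class (\<lambda>_. 0), l2_class \<phi>)"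
      by (rule weak[OF mem])
    then have "integral\<^sup>L lborel (\<lambda>t. y1 t * cnj (- \<xi>' t + of_real (q1 t) * 0 + of_real (q2 t) * \<phi> t)
        + y2 t * cnj (- (of_real (c / t) * \<xi> t) + of_real (q2 t) * 0))
      = \<mu> * integral\<^sup>L lborel (\<lambda>t. y1 t * cnj 0 + y2 t * cnj (\<phi> t))" (is "integral\<^sup>L _ ?u = _ * integral\<^sup>L _ ?v")
      unfolding yy by (simp only: cinner_l2_pair y1(1) y2(1) sq)
    moreover have "integrable lborel ?u" "integrable lborel ?v"
      by (intro Bochner_Integration.integrable_add sq_integrable_mult y1(1) y2(1) sq)+
    ultimately have "integral\<^sup>L lborel (\<lambda>t. ?u t - \<mu> * ?v t) = 0"
      by (subst Bochner_Integration.integral_diff) (simp_all only: integrable_mult_right integral_mult_right_zero right_minus_eq)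
    also have "(\<lambda>t. ?u t - \<mu> * ?v t) = (\<lambda>t. \<psi>' t * y1 t + \<psi> t * g t)"
    proof
      fix t
      show "?u t - \<mu> * ?v t = \<psi>' t * y1 t + \<psi> t * g t"
      proof (cases "t \<in> {1<..<R}")
        case True
        then have "p t \<noteq> 0" "t \<noteq> 0"
          using p_nz by auto
        then show ?thesis
          using c unfolding g_def z_def \<phi>_def \<xi>_def \<xi>'_def f_def by (simp add: field_simps)
      qed (simp add: y1 y2 g_def z_def)
    qed
    finally show ?thesis
      using integrable_test_mult[OF li1 ab test_pair_continuous_deriv[OF \<psi>] test_pair_deriv_zero[OF \<psi>]]
        integrable_test_mult[OF lig ab test_pair_continuous[OF \<psi>] test_pair_zero[OF \<psi>]]
      by (simp add: eq_neg_iff_add_eq_0)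
  qed
  then have wd: "weak_deriv 1 R y1 g"
    unfolding weak_deriv_def using li1 lig by blast
  \<comment> \<open>testing with \<open>(\<phi>\<^sub>1, 0)\<close>, where \<open>\<psi> = cnj \<phi>\<^sub>1\<close>\<close>
  have weak_h: "integral\<^sup>L lborel (\<lambda>t. \<psi>' t * z t) = - integral\<^sup>L lborel (\<lambda>t. \<psi> t * h t)"
    if ab: "1 < a" "b < R" and \<psi>: "test_pair a b \<psi> \<psi>'" "test_pair a b \<psi>' \<psi>''" for a b \<psi> \<psi>' \<psi>''
  proof -
    have P: "((\<lambda>t. complex_of_real (p t)) has_vector_derivative of_real (p' t)) (at t)"
      if "t \<in> {1<..<R}" for t
      using p_deriv[OF that]
      by (intro has_vector_derivative_of_real) (simp add: has_real_derivative_iff_has_vector_derivative)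
    have P': "continuous_on {1<..<R} (\<lambda>t. complex_of_real (p' t))"
      using p'_cont by (intro continuous_intros)
    define \<omega> \<omega>' where "\<omega> = (\<lambda>t. of_real (p t) * \<psi>' t)"
      and "\<omega>' = (\<lambda>t. of_real (p' t) * \<psi>' t + of_real (p t) * \<psi>'' t)"
    have \<omega>: "test_pair a b \<omega> \<omega>'"
      unfolding \<omega>_def \<omega>'_def by (rule test_pair_mult[OF \<psi>(2) ab P P'])
    have \<xi>eq: "cnj (\<omega> t) = of_real (p t) * (cnj (\<psi>' t) - of_real (c / t) * 0)" for t
      by (simp add: \<omega>_def)
    note zt = test_pair_zero_fun[of a b]
    note cnjs = test_pair_cnj[OF \<psi>(1)] test_pair_cnj[OF \<psi>(2)] test_pair_cnj[OF \<omega>]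
    note mem = minimal_operatorI[OF ab cnjs(1,2) zt cnjs(3) \<xi>eq]
    note sq = minimal_operator_sq_integrable[OF ab cnjs(1) zt cnjs(3)]
    have "cinner y (l2_class (\<lambda>t. - cnj (\<omega>' t) + of_real (q1 t) * cnj (\<psi> t) + of_real (q2 t) * 0),
        l2_class (\<lambda>t. - (of_real (c / t) * cnj (\<omega> t)) + of_real (q2 t) * cnj (\<psi> t)))
      = \<mu> * cinner y (l2_class (\<lambda>t. cnj (\<psi> t)), l2_class (\<lambda>_. 0))"
      by (rule weak[OF mem])
    then have "integral\<^sup>L lborel (\<lambda>t. y1 t * cnj (- cnj (\<omega>' t) + of_real (q1 t) * cnj (\<psi> t) + of_real (q2 t) * 0)
        + y2 t * cnj (- (of_real (c / t) * cnj (\<omega> t)) + of_real (q2 t) * cnj (\<psi> t)))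
      = \<mu> * integral\<^sup>L lborel (\<lambda>t. y1 t * cnj (cnj (\<psi> t)) + y2 t * cnj 0)" (is "integral\<^sup>L _ ?u = _ * integral\<^sup>L _ ?v")
      unfolding yy by (simp only: cinner_l2_pair y1(1) y2(1) sq)
    moreover have i: "integrable lborel ?u" "integrable lborel ?v"
      by (intro Bochner_Integration.integrable_add sq_integrable_mult y1(1) y2(1) sq)+
    moreover note uv = Bochner_Integration.integrable_diff[OF i(1) integrable_mult_right[OF i(2), of \<mu>]]
    ultimately have 1: "integral\<^sup>L lborel (\<lambda>t. ?u t - \<mu> * ?v t) = 0"
      by (subst Bochner_Integration.integral_diff) (simp_all only: integrable_mult_right integral_mult_right_zero right_minus_eq)
    have j: "integrable lborel (\<lambda>t. \<omega>' t * y1 t)" "integrable lborel (\<lambda>t. \<omega> t * g t)"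
      using test_pair_deriv_zero[OF \<omega>] test_pair_zero[OF \<omega>]
      by (intro integrable_test_mult[OF li1 ab test_pair_continuous_deriv[OF \<omega>]]
          integrable_test_mult[OF lig ab test_pair_continuous[OF \<omega>]]; blast)+
    have 2: "integral\<^sup>L lborel (\<lambda>t. \<omega>' t * y1 t + \<omega> t * g t) = 0"
      using weak_derivD[OF wd ab \<omega>] j by simp
    have "integral\<^sup>L lborel (\<lambda>t. (?u t - \<mu> * ?v t) + (\<omega>' t * y1 t + \<omega> t * g t)) = 0"
      by (rule trans[OF Bochner_Integration.integral_add[OF uv Bochner_Integration.integrable_add[OF j]]])
        (simp only: 1 2 add_0_left)
    also have "(\<lambda>t. (?u t - \<mu> * ?v t) + (\<omega>' t * y1 t + \<omega> t * g t)) = (\<lambda>t. \<psi>' t * z t + \<psi> t * h t)"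
    proof
      fix t
      show "(?u t - \<mu> * ?v t) + (\<omega>' t * y1 t + \<omega> t * g t) = \<psi>' t * z t + \<psi> t * h t"
      proof (cases "t \<in> {1<..<R}")
        case True
        then have "p t \<noteq> 0" "t \<noteq> 0"
          using p_nz by auto
        then show ?thesis
          using c unfolding g_def h_def \<omega>_def by (simp add: field_simps)
      qed (simp add: y1 y2 g_def z_def h_def)
    qed
    finally show ?thesis
      using integrable_test_mult[OF liz ab test_pair_continuous[OF \<psi>(2)] test_pair_zero[OF \<psi>(2)]]
        integrable_test_mult[OF lih ab test_pair_continuous[OF \<psi>(1)] test_pair_zero[OF \<psi>(1)]]
      by (simp add: eq_neg_iff_add_eq_0)
  qed
  obtain F where F: "primitive_of 1 R g F" "AE t in lborel. t \<in> {1<..<R} \<longrightarrow> y1 t = F t"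
    using weak_deriv_primitive[OF li1 lig R] weak_g by blast
  obtain Z where Z: "primitive_of 1 R h Z" "AE t in lborel. t \<in> {1<..<R} \<longrightarrow> z t = Z t"
    using weak_deriv_primitive[OF liz lih R] weak_h by blast
  have ae: "AE t in lborel. t \<in> {1<..<R} \<longrightarrow> y1 t = F t \<and> y2 t = second F Z t \<and>
      g t = a11 t * F t + a12 t * Z t \<and> h t = a21 t * F t + - a11 t * Z t"
    using F(2) Z(2)
  proof eventually_elim
    fix t assume 1: "t \<in> {1<..<R} \<longrightarrow> y1 t = F t" "t \<in> {1<..<R} \<longrightarrow> z t = Z t"
    show "t \<in> {1<..<R} \<longrightarrow> y1 t = F t \<and> y2 t = second F Z t \<and>
      g t = a11 t * F t + a12 t * Z t \<and> h t = a21 t * F t + - a11 t * Z t"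
    proof
      assume t: "t \<in> {1<..<R}"
      then have nz: "p t \<noteq> 0" "t \<noteq> 0"
        using p_nz by auto
      have y2t: "y2 t = second F Z t"
        using 1 t nz c \<mu> by (auto simp: z_def second_def field_simps)
      have "g t = a11 t * F t + a12 t * Z t"
        unfolding g_def y2t second_def a11_def a12_def using 1 t \<mu>
        by (simp add: field_simps power2_eq_square)
      moreover have "h t = a21 t * F t + - a11 t * Z t"
        unfolding h_def y2t second_def a11_def a21_def using 1 t \<mu>
        by (simp add: field_simps power2_eq_square)
      ultimately show "y1 t = F t \<and> y2 t = second F Z t \<and>
          g t = a11 t * F t + a12 t * Z t \<and> h t = a21 t * F t + - a11 t * Z t"
        using 1 t y2t by blast
    qed
  qed
  note cF = primitive_of_continuous[OF F(1)] and cZ = primitive_of_continuous[OF Z(1)]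
  have "solution F Z"
    unfolding solution_def
  proof
    show "primitive_of 1 R (\<lambda>t. a11 t * F t + a12 t * Z t) F"
      by (rule primitive_of_cong_AE[OF F(1)], intro loc_integrable_continuous continuous_intros a_cont cF cZ)
        (use ae in \<open>auto elim!: eventually_mono\<close>)
    show "primitive_of 1 R (\<lambda>t. a21 t * F t + - a11 t * Z t) Z"
      by (rule primitive_of_cong_AE[OF Z(1)], intro loc_integrable_continuous continuous_intros a_cont cF cZ)
        (use ae in \<open>auto elim!: eventually_mono\<close>)
  qed
  moreover have "AE t in lborel. t \<in> {1<..<R} \<longrightarrow> y1 t = F t \<and> y2 t = second F Z t"
    using ae by (auto elim!: eventually_mono)
  ultimately show ?thesis
    unfolding has_value_def using y1 y2 yy by blast
qed

text \<open>
  Cauchy data are injective on weak solutions, so two functionals have a trivial common kernel.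
\<close>

lemma weak_solutions_finite_span:
  "\<exists>B. finite B \<and>
    {y \<in> stellar_space R. \<forall>(\<phi>, a) \<in> minimal_operator. cinner y a = \<mu> * cinner y \<phi>}
      \<subseteq> complex_vector.span B"
proof -
  define s where "s = (1 + R) / 2"
  have s: "s \<in> {1<..<R}"
    using R by (auto simp: s_def)
  have "\<exists>B. finite B \<and> {y. has_value s y 0 0} \<subseteq> complex_vector.span B"
    using has_value_zero[OF s] by (intro exI[of _ "{}"]) auto
  then obtain B0 where B0: "finite B0" "{y. has_value s y 0 0} \<subseteq> complex_vector.span B0"
    by blast
  have "\<exists>B. finite B \<and> {y. \<exists>\<beta>. has_value s y 0 \<beta>} \<subseteq> complex_vector.span B"
  proof (rule finite_span_by_functional[where P = "\<lambda>y \<beta>. has_value s y 0 \<beta>", OF _ _ _ B0(1)])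
    show "x - k *\<^sub>C y \<in> {y. \<exists>\<beta>. has_value s y 0 \<beta>}"
      if "x \<in> {y. \<exists>\<beta>. has_value s y 0 \<beta>}" "y \<in> {y. \<exists>\<beta>. has_value s y 0 \<beta>}" for x y k
      using that has_value_combination[of s x 0 _ y 0 _ k] by auto
    show "has_value s (x - k *\<^sub>C y) 0 (\<alpha> - k * \<beta>)" if "has_value s x 0 \<alpha>" "has_value s y 0 \<beta>"
      for x y \<alpha> \<beta> k
      using has_value_combination[OF that, of k] by simp
  qed (use B0(2) in auto)
  then obtain B1 where B1: "finite B1" "{y. \<exists>\<beta>. has_value s y 0 \<beta>} \<subseteq> complex_vector.span B1"
    by blast
  have "\<exists>B. finite B \<and> {y. \<exists>\<alpha> \<beta>. has_value s y \<alpha> \<beta>} \<subseteq> complex_vector.span B"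
  proof (rule finite_span_by_functional[where P = "\<lambda>y \<alpha>. \<exists>\<beta>. has_value s y \<alpha> \<beta>", OF _ _ _ B1(1)])
    show "x - k *\<^sub>C y \<in> {y. \<exists>\<alpha> \<beta>. has_value s y \<alpha> \<beta>}"
      if "x \<in> {y. \<exists>\<alpha> \<beta>. has_value s y \<alpha> \<beta>}" "y \<in> {y. \<exists>\<alpha> \<beta>. has_value s y \<alpha> \<beta>}" for x y k
      using that has_value_combination[of s x _ _ y _ _ k] by blast
    show "\<exists>\<gamma>. has_value s (x - k *\<^sub>C y) (\<alpha> - k * \<beta>) \<gamma>"
      if "\<exists>\<gamma>. has_value s x \<alpha> \<gamma>" "\<exists>\<gamma>. has_value s y \<beta> \<gamma>" for x y \<alpha> \<beta> k
      using that has_value_combination[of s x \<alpha> _ y \<beta> _ k] by blast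
  qed (use B1(2) in auto)
  then obtain B where B: "finite B" "{y. \<exists>\<alpha> \<beta>. has_value s y \<alpha> \<beta>} \<subseteq> complex_vector.span B"
    by blast
  have "{y \<in> stellar_space R. \<forall>(\<phi>, a) \<in> minimal_operator. cinner y a = \<mu> * cinner y \<phi>}
      \<subseteq> {y. \<exists>\<alpha> \<beta>. has_value s y \<alpha> \<beta>}"
    using weak_solution_has_value by fastforce
  then show ?thesis
    using B by (meson order_trans)
qed

end

section \<open>Solving the inhomogeneous system up to the singular endpoint\<close>

text \<open>Picard iteration with respect to a weighted supremum norm.\<close>

lemma weighted_contraction_fixed_point:
  fixes S :: "(real \<Rightarrow> complex) \<Rightarrow> real \<Rightarrow> complex" and m :: "real \<Rightarrow> real"
  assumes m: "\<And>t. t \<in> I \<Longrightarrow> 0 \<le> m t" "\<And>t. t \<in> I \<Longrightarrow> m t \<le> M" and B0: "0 \<le> B0"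
    and cont: "\<And>u B. continuous_on I u \<Longrightarrow> (\<And>t. t \<in> I \<Longrightarrow> cmod (u t) \<le> B) \<Longrightarrow> continuous_on I (S u)"
    and contr: "\<And>u v B B'. continuous_on I u \<Longrightarrow> (\<And>t. t \<in> I \<Longrightarrow> cmod (u t) \<le> B') \<Longrightarrow>
      continuous_on I v \<Longrightarrow> (\<And>t. t \<in> I \<Longrightarrow> cmod (v t) \<le> B') \<Longrightarrow>
      (\<And>t. t \<in> I \<Longrightarrow> cmod (u t - v t) \<le> B * m t) \<Longrightarrow> (\<And>t. t \<in> I \<Longrightarrow> cmod (S u t - S v t) \<le> B / 2 * m t)"
    and start: "\<And>t. t \<in> I \<Longrightarrow> cmod (S (\<lambda>_. 0) t) \<le> B0 * m t"
  shows "\<exists>y. continuous_on I y \<and> (\<forall>t\<in>I. cmod (y t) \<le> 2 * B0 * m t \<and> S y t = y t)"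
proof -
  define f where "f = (\<lambda>n. (S ^^ n) (\<lambda>_. 0))"
  have f0: "f 0 = (\<lambda>_. 0)" and fS: "f (Suc n) = S (f n)" for n
    by (simp_all add: f_def)
  have inv: "continuous_on I (f n) \<and> (\<forall>t\<in>I. cmod (f n t) \<le> (2 - 2 / 2 ^ n) * B0 * m t) \<and>
      (\<forall>t\<in>I. cmod (f (Suc n) t - f n t) \<le> B0 / 2 ^ n * m t)" for n
  proof (induction n)
    case 0
    then show ?case
      using start by (simp add: f0 fS)
  next
    case (Suc n)
    have bd: "cmod (f (Suc n) t) \<le> (2 - 2 / 2 ^ Suc n) * B0 * m t" if "t \<in> I" for t
    proof -
      have "cmod (f (Suc n) t) \<le> cmod (f (Suc n) t - f n t) + cmod (f n t)"
        by (metis diff_add_cancel norm_triangle_ineq)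
      also have "\<dots> \<le> B0 / 2 ^ n * m t + (2 - 2 / 2 ^ n) * B0 * m t"
        using Suc that by (intro add_mono) auto
      also have "\<dots> = (2 - 2 / 2 ^ Suc n) * B0 * m t"
        by (simp add: field_simps)
      finally show ?thesis .
    qed
    have lt: "x * B0 * m t \<le> 2 * B0 * M" if "x \<le> 2" "t \<in> I" for x t
    proof -
      have "x * B0 * m t \<le> 2 * B0 * m t"
        using that B0 m(1) by (intro mult_right_mono) auto
      also have "\<dots> \<le> 2 * B0 * M"
        using that B0 m(2) by (intro mult_left_mono) auto
      finally show ?thesis .
    qed
    have bn: "cmod (f n t) \<le> 2 * B0 * M" if "t \<in> I" for t
    proof -
      have "cmod (f n t) \<le> (2 - 2 / 2 ^ n) * B0 * m t"
        using Suc that by blast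
      also have "\<dots> \<le> 2 * B0 * M"
        by (rule lt) (use that in simp_all)
      finally show ?thesis .
    qed
    have bn': "cmod (f (Suc n) t) \<le> 2 * B0 * M" if "t \<in> I" for t
      by (rule order_trans[OF bd[OF that]], rule lt) (use that in simp_all)
    have c: "continuous_on I (f (Suc n))"
      unfolding fS[of n] using Suc bn(1) by (intro cont[of _ "2 * B0 * M"]) auto
    moreover have "cmod (f (Suc (Suc n)) t - f (Suc n) t) \<le> B0 / 2 ^ n / 2 * m t" if "t \<in> I" for t
      unfolding fS[of "Suc n"] using c Suc bn bn' that
      by (subst (2) fS, intro contr[of _ "2 * B0 * M"]) auto
    ultimately show ?case
      using bd by (simp add: mult.commute)
  qed
  have step: "cmod (f (n + k) t - f n t) \<le> (2 / 2 ^ n - 2 / 2 ^ (n + k)) * B0 * m t" if t: "t \<in> I" for n k t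
  proof (induction k)
    case (Suc k)
    have "cmod (f (n + Suc k) t - f n t) \<le> cmod (f (Suc (n + k)) t - f (n + k) t) + cmod (f (n + k) t - f n t)"
      using norm_triangle_ineq[of "f (Suc (n + k)) t - f (n + k) t" "f (n + k) t - f n t"] by simp
    also have "\<dots> \<le> B0 / 2 ^ (n + k) * m t + (2 / 2 ^ n - 2 / 2 ^ (n + k)) * B0 * m t"
      using inv[of "n + k"] t Suc by (intro add_mono) auto
    also have "\<dots> = (2 / 2 ^ n - 2 / 2 ^ (n + Suc k)) * B0 * m t"
      by (simp add: field_simps)
    finally show ?case .
  qed simp
  have diff: "cmod (f k t - f n t) \<le> 2 * B0 / 2 ^ n * m t" if t: "t \<in> I" and "n \<le> k" for n k t
  proof -
    have "cmod (f k t - f n t) \<le> (2 / 2 ^ n - 2 / 2 ^ k) * B0 * m t"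
      using step[OF t, of n "k - n"] that by simp
    also have "\<dots> \<le> 2 / 2 ^ n * B0 * m t"
      using m(1)[OF t] B0 by (intro mult_right_mono) auto
    finally show ?thesis
      by simp
  qed
  have "uniformly_Cauchy_on I f"
    unfolding uniformly_Cauchy_on_def
  proof (intro allI impI)
    fix e :: real assume e: "e > 0"
    obtain n :: nat where n: "4 * B0 * \<bar>M\<bar> / e < 2 ^ n"
      using real_arch_pow[of 2 "4 * B0 * \<bar>M\<bar> / e"] by auto
    have "dist (f i t) (f j t) < e" if t: "t \<in> I" and ij: "i \<ge> n" "j \<ge> n" for t i j
    proof -
      have mM: "m t \<le> \<bar>M\<bar>"
        using m(2)[OF t] by simp
      have "dist (f i t) (f j t) \<le> cmod (f i t - f n t) + cmod (f j t - f n t)"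
        using dist_triangle2[of "f i t" "f j t" "f n t"] by (simp add: dist_norm)
      also have "\<dots> \<le> 2 * B0 / 2 ^ n * m t + 2 * B0 / 2 ^ n * m t"
        using diff[OF t] ij by (intro add_mono) auto
      also have "\<dots> = 4 * B0 / 2 ^ n * m t"
        by simp
      also have "\<dots> \<le> 4 * B0 / 2 ^ n * \<bar>M\<bar>"
        using mM B0 by (intro mult_left_mono) auto
      also have "\<dots> < e"
        using n e by (simp add: field_simps)
      finally show ?thesis .
    qed
    then show "\<exists>N. \<forall>x\<in>I. \<forall>i\<ge>N. \<forall>j\<ge>N. dist (f i x) (f j x) < e"
      by blast
  qed
  then obtain y where y: "uniform_limit I f y sequentially"
    using Cauchy_uniformly_convergent uniformly_convergent_on_def by blast
  have cy: "continuous_on I y"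
    using inv by (intro uniform_limit_theorem[OF _ y]) auto
  have lim: "(\<lambda>k. f k t) \<longlonglongrightarrow> y t" if "t \<in> I" for t
    by (rule tendsto_uniform_limitI[OF y that])
  have near: "cmod (y t - f n t) \<le> 2 * B0 / 2 ^ n * m t" if t: "t \<in> I" for t n
  proof (rule Lim_bounded)
    show "(\<lambda>k. cmod (f k t - f n t)) \<longlonglongrightarrow> cmod (y t - f n t)"
      by (intro tendsto_intros lim t)
    show "\<forall>k\<ge>n. cmod (f k t - f n t) \<le> 2 * B0 / 2 ^ n * m t"
      using diff[OF t] by blast
  qed
  have ybd: "cmod (y t) \<le> 2 * B0 * m t" if "t \<in> I" for t
    using near[OF that, of 0] by (simp add: f0)
  have M2: "2 * B0 * m t \<le> 2 * B0 * M" if "t \<in> I" for t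
    using m(2)[OF that] B0 by (intro mult_left_mono) auto
  have "S y t = y t" if t: "t \<in> I" for t
  proof -
    have lim0: "(\<lambda>n. B0 / 2 ^ n * m t) \<longlonglongrightarrow> 0"
    proof -
      have "(\<lambda>n. (B0 * m t) * (1 / 2) ^ n) \<longlonglongrightarrow> (B0 * m t) * 0"
        by (intro tendsto_mult tendsto_const LIMSEQ_power_zero) simp
      then show ?thesis
        by (simp add: power_divide field_simps)
    qed
    have "cmod (f (Suc n) t - S y t) \<le> B0 / 2 ^ n * m t" for n
    proof -
      have bfn: "cmod (f n x) \<le> 2 * B0 * M" if "x \<in> I" for x
      proof -
        have "cmod (f n x) \<le> (2 - 2 / 2 ^ n) * B0 * m x"
          using inv[of n] that by blast
        also have "\<dots> \<le> 2 * B0 * m x"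
          using m(1)[OF that] B0 by (intro mult_right_mono) auto
        finally show ?thesis
          using M2[OF that] by linarith
      qed
      have byM: "cmod (y x) \<le> 2 * B0 * M" if "x \<in> I" for x
        using ybd[OF that] M2[OF that] by linarith
      have cfn: "continuous_on I (f n)"
        using inv[of n] by blast
      have "cmod (f n x - y x) \<le> 2 * B0 / 2 ^ n * m x" if "x \<in> I" for x
        using near[OF that, of n] by (simp add: norm_minus_commute)
      from contr[OF cfn bfn cy byM this t] show ?thesis
        by (simp add: fS)
    qed
    then have "(\<lambda>n. f (Suc n) t - S y t) \<longlonglongrightarrow> 0"
      by (intro Lim_null_comparison[OF _ lim0]) (simp add: always_eventually)
    then have "(\<lambda>n. f (Suc n) t) \<longlonglongrightarrow> S y t"
      by (simp add: LIM_zero_iff)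
    then show ?thesis
      using LIMSEQ_unique[OF _ LIMSEQ_Suc[OF lim[OF t]]] by blast
  qed
  then show ?thesis
    using cy ybd by blast
qed

text \<open>
  The factor \<open>sqrt (b - a)\<close> is what compensates half of the singularity \<open>1 / (R - t)\<close> at the endpoint.
\<close>

lemma integral_cmod_le_l2:
  fixes a b :: real
  assumes h: "sq_integrable h" and ab: "a \<le> b"
  shows "(\<lambda>t. cmod (h t)) integrable_on {a..b}" "integral {a..b} (\<lambda>t. cmod (h t)) \<le> sqrt (b - a) * norm (l2_class h)"
proof -
  have "set_integrable lborel {a..b} h"
    using sq_integrable_loc_integrable[OF h, of "a - 1" "b + 1"] by (simp add: loc_integrable_def)
  then have si: "set_integrable lborel {a..b} (\<lambda>t. cmod (h t))"
    by (rule set_integrable_norm)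
  show "(\<lambda>t. cmod (h t)) integrable_on {a..b}"
    by (rule set_borel_integral_eq_integral(1)[OF si])
  define g e where "g = (\<lambda>t. complex_of_real (cmod (h t)))" and "e = (\<lambda>t::real. complex_of_real (indicator {a..b} t))"
  have g: "sq_integrable g"
    using h by (auto simp: sq_integrable_def g_def)
  have e: "sq_integrable e"
    by (rule sq_integrable_compact_support[of a b]) (auto simp: e_def intro!: continuous_on_eq[OF continuous_on_const[of _ 1]])
  have "(norm (l2_class g))\<^sup>2 = (norm (l2_class h))\<^sup>2"
    unfolding norm_l2_class[OF g] norm_l2_class[OF h] by (simp add: g_def)
  then have ng: "norm (l2_class g) = norm (l2_class h)"
    by simp
  have "(norm (l2_class e))\<^sup>2 = b - a"
  proof -
    have "(\<lambda>t. (cmod (e t))\<^sup>2) = indicator {a..b}"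
      by (auto simp: e_def indicator_def)
    then show ?thesis
      unfolding norm_l2_class[OF e] using ab by simp
  qed
  then have ne: "norm (l2_class e) = sqrt (b - a)"
    by (metis norm_ge_zero real_sqrt_unique)
  have "cinner (l2_class g) (l2_class e) = complex_of_real (integral {a..b} (\<lambda>t. cmod (h t)))"
  proof -
    have "cinner (l2_class g) (l2_class e) = integral\<^sup>L lborel (\<lambda>t. complex_of_real (indicator {a..b} t *\<^sub>R cmod (h t)))"
      unfolding cinner_l2_class[OF g e] by (simp add: g_def e_def mult.commute)
    also have "\<dots> = complex_of_real (LINT t:{a..b}|lborel. cmod (h t))"
      unfolding set_lebesgue_integral_def by (rule integral_complex_of_real)
    also have "(LINT t:{a..b}|lborel. cmod (h t)) = integral {a..b} (\<lambda>t. cmod (h t))"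
      by (rule set_borel_integral_eq_integral(2)[OF si])
    finally show ?thesis .
  qed
  then have "integral {a..b} (\<lambda>t. cmod (h t)) \<le> cmod (cinner (l2_class g) (l2_class e))"
    by simp
  also have "\<dots> \<le> norm (l2_class h) * sqrt (b - a)"
    using cinner_Cauchy_Schwarz[of "l2_class g" "l2_class e"] by (simp add: ng ne)
  finally show "integral {a..b} (\<lambda>t. cmod (h t)) \<le> sqrt (b - a) * norm (l2_class h)"
    by (simp add: mult.commute)
qed

lemma integral_inverse_sqrt:
  assumes "a \<le> b" "b < R"
  shows "(\<lambda>t. 1 / sqrt (R - t)) integrable_on {a..b}" "integral {a..b} (\<lambda>t. 1 / sqrt (R - t)) \<le> 2 * sqrt (R - a)"
proof -
  have "((\<lambda>t. 1 / sqrt (R - t)) has_integral (- 2 * sqrt (R - b)) - (- 2 * sqrt (R - a))) {a..b}"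
  proof (rule fundamental_theorem_of_calculus[OF assms(1)])
    fix t assume "t \<in> {a..b}"
    then have "((\<lambda>t. - 2 * sqrt (R - t)) has_real_derivative 1 / sqrt (R - t)) (at t)"
      using assms by (auto intro!: derivative_eq_intros simp: field_simps)
    then show "((\<lambda>t. - 2 * sqrt (R - t)) has_vector_derivative 1 / sqrt (R - t)) (at t within {a..b})"
      unfolding has_real_derivative_iff_has_vector_derivative by (rule has_vector_derivative_at_within)
  qed
  then show "(\<lambda>t. 1 / sqrt (R - t)) integrable_on {a..b}"
    "integral {a..b} (\<lambda>t. 1 / sqrt (R - t)) \<le> 2 * sqrt (R - a)"
    using assms by (auto simp: integral_unique has_integral_integrable)
qed

text \<open>
  The system \<open>(y / W)' = (P \<zeta> + h\<^sub>1) / W\<close>, \<open>(W \<zeta>)' = W (\<kappa> y + h\<^sub>2)\<close>, in which \<open>W\<close> is an integrating factor that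
  has absorbed the diagonal. The weight \<open>W\<close> may tend to zero at \<open>R\<close>; quasi-monotonicity (\<open>W_quasi\<close>) is enough
  to integrate the second equation backwards from \<open>R\<close> and the first one forwards. Outside the interval \<open>W\<close> and
  \<open>\<kappa>\<close> are set to zero, so that integrals up to \<open>R\<close> make sense for closed intervals.
\<close>

locale endpoint_system =
  fixes R C :: real and W P \<kappa> :: "real \<Rightarrow> complex"
  assumes R: "1 < R"
    and W_cont: "continuous_on {1<..<R} W" and P_cont: "continuous_on {1<..<R} P"
    and \<kappa>_cont: "continuous_on {1<..<R} \<kappa>"
    and W_nz: "\<And>t. t \<in> {1<..<R} \<Longrightarrow> W t \<noteq> 0"
    and W_quasi: "\<And>\<tau> t. 1 < \<tau> \<Longrightarrow> \<tau> \<le> t \<Longrightarrow> t < R \<Longrightarrow> cmod (W t) \<le> C * cmod (W \<tau>)"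
    and W_le: "\<And>t. t \<in> {1<..<R} \<Longrightarrow> cmod (W t) \<le> C"
    and P_le: "\<And>t. t \<in> {1<..<R} \<Longrightarrow> cmod (P t) \<le> C / (R - t)"
    and \<kappa>_le: "\<And>t. t \<in> {1<..<R} \<Longrightarrow> cmod (\<kappa> t) \<le> C"
    and W_end: "\<And>t. R \<le> t \<Longrightarrow> W t = 0" and \<kappa>_end: "\<And>t. R \<le> t \<Longrightarrow> \<kappa> t = 0"
begin

lemma C_ge_1: "1 \<le> C"
proof -
  have t: "(1 + R) / 2 \<in> {1<..<R}"
    using R by auto
  have "cmod (W ((1 + R) / 2)) \<le> C * cmod (W ((1 + R) / 2))"
    using t by (intro W_quasi) auto
  then show ?thesis
    using W_nz[OF t] by (simp add: mult_le_cancel_right1)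
qed

lemma W_quasi': "1 < \<tau> \<Longrightarrow> \<tau> \<le> t \<Longrightarrow> cmod (W t) \<le> C * cmod (W \<tau>)"
  using W_quasi[of \<tau> t] W_end[of t] C_ge_1 by (cases "t < R") auto

text \<open>
  Integrability up to the singular endpoint, which is what solving backwards from \<open>R\<close> requires.
\<close>

definition good :: "(real \<Rightarrow> complex) \<Rightarrow> bool"
  where "good g \<longleftrightarrow> (\<forall>t\<in>{1<..<R}. set_integrable lborel {t..R} g)"

lemma good_loc_integrable: "good g \<Longrightarrow> loc_integrable 1 R g"
  unfolding loc_integrable_def good_def
proof (intro allI impI)
  fix a b :: real assume g: "\<forall>t\<in>{1<..<R}. set_integrable lborel {t..R} g" and ab: "1 < a" "b < R"
  show "set_integrable lborel {a..b} g"
  proof (cases "a < R")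
    case True
    then have "set_integrable lborel {a..R} g"
      using g ab by simp
    then show ?thesis
      by (rule set_integrable_subset) (use ab in auto)
  qed (use ab in \<open>simp add: set_integrable_def\<close>)
qed

lemma restrict_end:
  fixes f :: "real \<Rightarrow> complex"
  assumes f: "continuous_on {1<..<R} f" "\<And>t. R \<le> t \<Longrightarrow> f t = 0" and t: "1 < t"
  shows "(\<lambda>\<sigma>. indicator {t..R} \<sigma> *\<^sub>R f \<sigma>) \<in> borel_measurable borel"
proof -
  have "(\<lambda>\<sigma>. indicator {t..<R} \<sigma> *\<^sub>R f \<sigma>) \<in> borel_measurable borel"
    by (rule borel_measurable_continuous_on_indicator) (use t in \<open>auto intro: continuous_on_subset[OF f(1)]\<close>)
  also have "(\<lambda>\<sigma>. indicator {t..<R} \<sigma> *\<^sub>R f \<sigma>) = (\<lambda>\<sigma>. indicator {t..R} \<sigma> *\<^sub>R f \<sigma>)"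
  proof -
    have "\<sigma> < R" if "f \<sigma> \<noteq> 0" for \<sigma>
      using f(2)[of \<sigma>] that by (metis not_le)
    then show ?thesis
      by (auto simp: indicator_def fun_eq_iff)
  qed
  finally show ?thesis .
qed

lemma good_sq_integrable: "sq_integrable h \<Longrightarrow> good h"
  using sq_integrable_loc_integrable[of h 0 "R + 1"] by (auto simp: good_def loc_integrable_def)

lemma good_kappa:
  assumes u: "continuous_on {1<..<R} u" "\<And>t. t \<in> {1<..<R} \<Longrightarrow> cmod (u t) \<le> B"
  shows "good (\<lambda>t. \<kappa> t * u t)"
  unfolding good_def
proof
  fix t assume t: "t \<in> {1<..<R}"
  have "set_integrable lborel {t..R} (\<lambda>\<sigma>. (\<kappa> \<sigma> * u \<sigma>) * 1)"
  proof (rule set_integrable_bounded_mult[where B = "C * \<bar>B\<bar>"])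
    show "(\<lambda>\<sigma>. indicator {t..R} \<sigma> *\<^sub>R (\<kappa> \<sigma> * u \<sigma>)) \<in> borel_measurable borel"
      using t by (intro restrict_end continuous_intros \<kappa>_cont u) (auto simp: \<kappa>_end)
    show "cmod (\<kappa> \<sigma> * u \<sigma>) \<le> C * \<bar>B\<bar>" if "\<sigma> \<in> {t..R}" for \<sigma>
    proof (cases "\<sigma> < R")
      case True
      then have s: "\<sigma> \<in> {1<..<R}"
        using that t by auto
      then show ?thesis
        unfolding norm_mult using \<kappa>_le[OF s] u(2)[OF s] C_ge_1 by (intro mult_mono) auto
    qed (use \<kappa>_end[of \<sigma>] C_ge_1 in simp)
    show "set_integrable lborel {t..R} (\<lambda>_. 1 :: complex)"
      by (intro borel_integrable_atLeastAtMost' continuous_intros)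
  qed
  then show "set_integrable lborel {t..R} (\<lambda>t. \<kappa> t * u t)"
    by simp
qed

lemma good_add: "good f \<Longrightarrow> good g \<Longrightarrow> good (\<lambda>t. f t + g t)"
  by (simp add: good_def)

lemma Wg_integrable:
  assumes g: "good g" and t: "t \<in> {1<..<R}"
  shows "set_integrable lborel {t..R} (\<lambda>\<sigma>. W \<sigma> * g \<sigma>)"
proof (rule set_integrable_bounded_mult[where B = "C * cmod (W t)"])
  show "(\<lambda>\<sigma>. indicator {t..R} \<sigma> *\<^sub>R W \<sigma>) \<in> borel_measurable borel"
    using t by (intro restrict_end W_cont) (auto simp: W_end)
qed (use g t W_quasi' in \<open>auto simp: good_def\<close>)

text \<open>The decaying solution of \<open>(W \<zeta>)' = W g\<close>, and the solution of \<open>(y / W)' = f / W\<close> vanishing at \<open>s\<close>.\<close>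

definition zeta :: "(real \<Rightarrow> complex) \<Rightarrow> real \<Rightarrow> complex"
  where "zeta g t = - integral {t..R} (\<lambda>\<sigma>. W \<sigma> * g \<sigma>) / W t"

definition ypart :: "real \<Rightarrow> (real \<Rightarrow> complex) \<Rightarrow> real \<Rightarrow> complex"
  where "ypart s f t = W t * (if s \<le> t then integral {s..t} (\<lambda>\<tau>. inverse (W \<tau>) * f \<tau>)
    else - integral {t..s} (\<lambda>\<tau>. inverse (W \<tau>) * f \<tau>))"

lemma primitive_of_cong:
  assumes "primitive_of l r g F" "\<And>t. t \<in> {l<..<r} \<Longrightarrow> F t = G t"
  shows "primitive_of l r g G"
  using assms by (simp add: primitive_of_def)

lemma zeta_primitive:
  assumes g: "good g"
  shows "primitive_of 1 R (\<lambda>t. W t * g t) (\<lambda>t. W t * zeta g t)"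
proof (rule primitive_of_cong)
  show "primitive_of 1 R (\<lambda>t. W t * g t) (\<lambda>t. - integral {t..R} (\<lambda>\<sigma>. W \<sigma> * g \<sigma>))"
    unfolding primitive_of_def
  proof (intro conjI allI impI)
    show "loc_integrable 1 R (\<lambda>t. W t * g t)"
      by (intro loc_integrable_mult W_cont good_loc_integrable g)
    fix u v assume uv: "1 < u" "u \<le> v" "v < R"
    have "integral {u..v} (\<lambda>\<sigma>. W \<sigma> * g \<sigma>) + integral {v..R} (\<lambda>\<sigma>. W \<sigma> * g \<sigma>)
        = integral {u..R} (\<lambda>\<sigma>. W \<sigma> * g \<sigma>)"
      using uv Wg_integrable[OF g, of u]
      by (intro Henstock_Kurzweil_Integration.integral_combine set_borel_integral_eq_integral(1)) auto
    then show "- integral {v..R} (\<lambda>\<sigma>. W \<sigma> * g \<sigma>) - - integral {u..R} (\<lambda>\<sigma>. W \<sigma> * g \<sigma>)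
        = integral {u..v} (\<lambda>\<sigma>. W \<sigma> * g \<sigma>)"
      by (simp add: algebra_simps)
  qed
qed (simp add: zeta_def W_nz)

lemma zeta_cont:
  assumes g: "good g"
  shows "continuous_on {1<..<R} (zeta g)"
proof -
  have "continuous_on {1<..<R} (\<lambda>t. (W t * zeta g t) / W t)"
    by (intro continuous_intros primitive_of_continuous[OF zeta_primitive[OF g]] W_cont ballI W_nz)
  then show ?thesis
    by (rule continuous_on_eq) (simp add: W_nz)
qed

lemma zeta_diff:
  assumes "good f" "good g" "t \<in> {1<..<R}"
  shows "zeta f t - zeta g t = zeta (\<lambda>t. f t - g t) t"
proof -
  have "integral {t..R} (\<lambda>\<sigma>. W \<sigma> * (f \<sigma> - g \<sigma>))
      = integral {t..R} (\<lambda>\<sigma>. W \<sigma> * f \<sigma>) - integral {t..R} (\<lambda>\<sigma>. W \<sigma> * g \<sigma>)"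
    unfolding right_diff_distrib
    by (intro integral_diff set_borel_integral_eq_integral(1) Wg_integrable assms)
  then show ?thesis
    by (simp add: zeta_def diff_divide_distrib)
qed

lemma zeta_bound:
  assumes g: "good g" and t: "t \<in> {1<..<R}" and k: "k integrable_on {t..R}"
    and le: "\<And>\<sigma>. \<sigma> \<in> {t..R} \<Longrightarrow> cmod (g \<sigma>) \<le> k \<sigma>"
  shows "cmod (zeta g t) \<le> C * integral {t..R} k"
proof -
  have "cmod (integral {t..R} (\<lambda>\<sigma>. W \<sigma> * g \<sigma>)) \<le> integral {t..R} (\<lambda>\<sigma>. C * cmod (W t) * k \<sigma>)"
  proof (rule integral_norm_bound_integral)
    show "(\<lambda>\<sigma>. W \<sigma> * g \<sigma>) integrable_on {t..R}"
      by (rule set_borel_integral_eq_integral(1)[OF Wg_integrable[OF g t]])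
    show "(\<lambda>\<sigma>. C * cmod (W t) * k \<sigma>) integrable_on {t..R}"
      using k by (rule integrable_on_mult_right)
    show "cmod (W \<sigma> * g \<sigma>) \<le> C * cmod (W t) * k \<sigma>" if "\<sigma> \<in> {t..R}" for \<sigma>
      unfolding norm_mult using that t W_quasi'[of t \<sigma>] le[OF that] C_ge_1 by (intro mult_mono) auto
  qed
  also have "\<dots> = C * cmod (W t) * integral {t..R} k"
    by simp
  finally show ?thesis
    using W_nz[OF t] by (simp add: zeta_def norm_divide field_simps)
qed

lemma ypart_primitive:
  assumes f: "loc_integrable 1 R f" and s: "s \<in> {1<..<R}"
  shows "primitive_of 1 R (\<lambda>t. inverse (W t) * f t) (\<lambda>t. ypart s f t / W t)"
proof -
  have "loc_integrable 1 R (\<lambda>t. inverse (W t) * f t)"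
    by (intro loc_integrable_mult f continuous_intros W_cont ballI W_nz)
  from primitive_of_integral[OF this, of s] s
  have "primitive_of 1 R (\<lambda>t. inverse (W t) * f t)
      (\<lambda>t. if s \<le> t then integral {s..t} (\<lambda>\<tau>. inverse (W \<tau>) * f \<tau>)
        else - integral {t..s} (\<lambda>\<tau>. inverse (W \<tau>) * f \<tau>))"
    by simp
  then show ?thesis
    by (rule primitive_of_cong) (auto simp: ypart_def W_nz)
qed

lemma ypart_cont:
  assumes f: "loc_integrable 1 R f" and s: "s \<in> {1<..<R}"
  shows "continuous_on {1<..<R} (ypart s f)"
proof -
  have "continuous_on {1<..<R} (\<lambda>t. W t * (ypart s f t / W t))"
    by (intro continuous_on_mult primitive_of_continuous[OF ypart_primitive[OF f s]] W_cont)
  then show ?thesis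
    by (rule continuous_on_eq) (simp add: W_nz)
qed

lemma ypart_diff:
  assumes f: "loc_integrable 1 R f" "loc_integrable 1 R g" and s: "s \<in> {1<..<R}" and t: "t \<in> {1<..<R}"
  shows "ypart s f t - ypart s g t = ypart s (\<lambda>t. f t - g t) t"
proof -
  have li: "loc_integrable 1 R (\<lambda>t. inverse (W t) * h t)" if "loc_integrable 1 R h" for h
    by (intro loc_integrable_mult that continuous_intros W_cont ballI W_nz)
  have "integral {a..b} (\<lambda>\<tau>. inverse (W \<tau>) * (f \<tau> - g \<tau>))
      = integral {a..b} (\<lambda>\<tau>. inverse (W \<tau>) * f \<tau>) - integral {a..b} (\<lambda>\<tau>. inverse (W \<tau>) * g \<tau>)"
    if "1 < a" "b < R" for a b
    unfolding right_diff_distrib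
    by (intro integral_diff loc_integrable_integral(1)[OF li] f that)
  then show ?thesis
    using s t by (simp add: ypart_def right_diff_distrib)
qed

lemma ypart_bound:
  assumes f: "loc_integrable 1 R f" and s: "s \<in> {1<..<R}" and t: "t \<in> {1<..<R}"
    and k: "k integrable_on {min s t..max s t}" and A: "0 \<le> A"
    and W: "\<And>\<tau>. \<tau> \<in> {min s t..max s t} \<Longrightarrow> cmod (W t) \<le> A * cmod (W \<tau>)"
    and le: "\<And>\<tau>. \<tau> \<in> {min s t..max s t} \<Longrightarrow> cmod (f \<tau>) \<le> k \<tau>"
  shows "cmod (ypart s f t) \<le> A * integral {min s t..max s t} k"
proof -
  let ?J = "{min s t..max s t}"
  have li: "loc_integrable 1 R (\<lambda>t. inverse (W t) * f t)"
    by (intro loc_integrable_mult f continuous_intros W_cont ballI W_nz)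
  have W0: "0 < cmod (W t)"
    using W_nz[OF t] by simp
  have "cmod (integral ?J (\<lambda>\<tau>. inverse (W \<tau>) * f \<tau>)) \<le> integral ?J (\<lambda>\<tau>. (A / cmod (W t)) * k \<tau>)"
  proof (rule integral_norm_bound_integral)
    show "(\<lambda>\<tau>. inverse (W \<tau>) * f \<tau>) integrable_on ?J"
      using s t by (intro loc_integrable_integral(1)[OF li]) auto
    show "(\<lambda>\<tau>. (A / cmod (W t)) * k \<tau>) integrable_on ?J"
      using k by (rule integrable_on_mult_right)
    fix \<tau> assume \<tau>: "\<tau> \<in> ?J"
    then have "\<tau> \<in> {1<..<R}"
      using s t by (auto simp: min_le_iff_disj le_max_iff_disj)
    then have nz: "0 < cmod (W \<tau>)"
      using W_nz by simp
    have "inverse (cmod (W \<tau>)) \<le> A / cmod (W t)"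
      using W[OF \<tau>] nz W0 by (simp add: field_simps)
    then show "cmod (inverse (W \<tau>) * f \<tau>) \<le> (A / cmod (W t)) * k \<tau>"
      unfolding norm_mult norm_inverse using le[OF \<tau>] A by (intro mult_mono) auto
  qed
  also have "\<dots> = A / cmod (W t) * integral ?J k"
    by simp
  finally have "cmod (W t) * cmod (integral ?J (\<lambda>\<tau>. inverse (W \<tau>) * f \<tau>)) \<le> A * integral ?J k"
    using W0 by (simp add: field_simps)
  moreover have "cmod (ypart s f t) = cmod (W t) * cmod (integral ?J (\<lambda>\<tau>. inverse (W \<tau>) * f \<tau>))"
    by (simp add: ypart_def norm_mult min_def max_def)
  ultimately show ?thesis
    by simp
qed

end

context endpoint_system
begin

text \<open>
  Fix \<open>s\<close> close to \<open>R\<close> first, so that the integral operator is a contraction on \<open>[s, R)\<close> in the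
  supremum norm. To the left of \<open>s\<close> it is a Volterra operator, and there a rapidly growing
  exponential weight makes it a contraction. Square-integrable inhomogeneities lead to bounded functions
  because \<open>\<zeta>\<close> gains the factor \<open>(R - t) powr (1/2)\<close> by the Cauchy-Schwarz inequality, of
  which the factor \<open>1 / (R - t)\<close> in \<open>P\<close> leaves an integrable singularity.
\<close>

lemma solvable:
  "\<exists>D\<ge>0. \<forall>h1 h2. sq_integrable h1 \<longrightarrow> sq_integrable h2 \<longrightarrow>
    (\<exists>y \<zeta>. continuous_on {1<..<R} y \<and> continuous_on {1<..<R} \<zeta> \<and>
      (\<forall>t\<in>{1<..<R}. cmod (y t) \<le> D * (norm (l2_class h1) + norm (l2_class h2)) \<and>
        cmod (\<zeta> t) \<le> D * (norm (l2_class h1) + norm (l2_class h2))) \<and>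
      primitive_of 1 R (\<lambda>t. inverse (W t) * (P t * \<zeta> t + h1 t)) (\<lambda>t. y t / W t) \<and>
      primitive_of 1 R (\<lambda>t. W t * (\<kappa> t * y t + h2 t)) (\<lambda>t. W t * \<zeta> t))"
proof -
  define s where "s = max ((1 + R) / 2) (R - 1 / (2 * C ^ 4))"
  have C0: "0 < C"
    using C_ge_1 by simp
  have s: "s \<in> {1<..<R}"
    using R C0 by (auto simp: s_def less_max_iff_disj)
  have sR: "C ^ 4 * (R - s) \<le> 1 / 2"
  proof -
    have "R - s \<le> 1 / (2 * C ^ 4)"
      by (simp add: s_def)
    then have "C ^ 4 * (R - s) \<le> C ^ 4 * (1 / (2 * C ^ 4))"
      using C0 by (intro mult_left_mono) auto
    then show ?thesis
      using C0 by simp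
  qed
  define A where "A = max C (C\<^sup>2 / cmod (W s))"
  have AC: "C \<le> A" and A0: "0 < A"
    using C0 by (auto simp: A_def)
  have ratio: "cmod (W t) \<le> A * cmod (W \<tau>)" if t: "t \<in> {1<..<R}" and \<tau>: "\<tau> \<in> {min s t..max s t}" for t \<tau>
  proof (cases "s \<le> t")
    case True
    then have "cmod (W t) \<le> C * cmod (W \<tau>)"
      using s t \<tau> by (intro W_quasi') auto
    also have "\<dots> \<le> A * cmod (W \<tau>)"
      using AC by (intro mult_right_mono) auto
    finally show ?thesis .
  next
    case False
    have Ws: "0 < cmod (W s)"
      using W_nz[OF s] by simp
    have "cmod (W s) \<le> C * cmod (W \<tau>)"
      using s t \<tau> False by (intro W_quasi') auto
    then have "C * cmod (W s) \<le> C * (C * cmod (W \<tau>))"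
      using C0 by (intro mult_left_mono) auto
    then have "C \<le> C\<^sup>2 / cmod (W s) * cmod (W \<tau>)"
      using Ws by (simp add: field_simps power2_eq_square)
    also have "\<dots> \<le> A * cmod (W \<tau>)"
      by (intro mult_right_mono) (auto simp: A_def)
    finally show ?thesis
      using W_le[OF t] by simp
  qed
  define k where "k = 2 * A * C ^ 3"
  have k0: "0 < k"
    using A0 C0 by (simp add: k_def)
  define m where "m = (\<lambda>t. exp (k * max 0 (s - t)))"
  define M where "M = exp (k * (R - 1))"
  have m1: "1 \<le> m t" for t
    using k0 by (simp add: m_def)
  have mM: "m t \<le> M" if "t \<in> {1<..<R}" for t
    using that s k0 by (auto simp: m_def M_def)
  have m_anti: "m \<tau> \<le> m t" if "t \<le> \<tau>" for t \<tau>
    using that k0 by (auto simp: m_def max_def)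
  define S where "S = (\<lambda>h1 h2 u. ypart s (\<lambda>t. P t * zeta (\<lambda>\<sigma>. \<kappa> \<sigma> * u \<sigma> + h2 \<sigma>) t + h1 t))"
  have zeta_u: "cmod (zeta (\<lambda>\<sigma>. \<kappa> \<sigma> * u \<sigma>) t) \<le> C\<^sup>2 * B * m t * (R - t)"
    if u: "continuous_on {1<..<R} u" "\<And>t. t \<in> {1<..<R} \<Longrightarrow> cmod (u t) \<le> B * m t"
      and t: "t \<in> {1<..<R}" for u B t
  proof -
    have B0: "0 \<le> B * m t"
      using u(2)[OF t] by (rule order_trans[OF norm_ge_zero])
    then have B: "0 \<le> B"
      using m1[of t] by (simp add: zero_le_mult_iff)
    have "cmod (u x) \<le> B * M" if "x \<in> {1<..<R}" for x
      using u(2)[OF that] mM[OF that] B by (meson mult_left_mono order_trans)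
    then have g: "good (\<lambda>\<sigma>. \<kappa> \<sigma> * u \<sigma>)"
      using u(1) by (intro good_kappa)
    have "cmod (zeta (\<lambda>\<sigma>. \<kappa> \<sigma> * u \<sigma>) t) \<le> C * integral {t..R} (\<lambda>_. C * (B * m t))"
    proof (rule zeta_bound[OF g t])
      fix \<sigma> assume \<sigma>: "\<sigma> \<in> {t..R}"
      show "cmod (\<kappa> \<sigma> * u \<sigma>) \<le> C * (B * m t)"
      proof (cases "\<sigma> < R")
        case True
        then have \<sigma>': "\<sigma> \<in> {1<..<R}"
          using \<sigma> t by auto
        have "cmod (u \<sigma>) \<le> B * m t"
          using u(2)[OF \<sigma>'] m_anti[of t \<sigma>] \<sigma> B by (meson atLeastAtMost_iff mult_left_mono order_trans)
        then show ?thesis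
          unfolding norm_mult using \<kappa>_le[OF \<sigma>'] C0 by (intro mult_mono) auto
      qed (use \<kappa>_end[of \<sigma>] C0 B0 in simp)
    qed auto
    also have "\<dots> = C\<^sup>2 * B * m t * (R - t)"
      using t by (simp add: power2_eq_square)
    finally show ?thesis .
  qed
  have Pzeta_u: "cmod (P t * zeta (\<lambda>\<sigma>. \<kappa> \<sigma> * u \<sigma>) t) \<le> C ^ 3 * B * m t"
    if u: "continuous_on {1<..<R} u" "\<And>t. t \<in> {1<..<R} \<Longrightarrow> cmod (u t) \<le> B * m t"
      and t: "t \<in> {1<..<R}" for u B t
  proof -
    have "cmod (P t * zeta (\<lambda>\<sigma>. \<kappa> \<sigma> * u \<sigma>) t) \<le> C / (R - t) * (C\<^sup>2 * B * m t * (R - t))"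
      unfolding norm_mult using P_le[OF t] zeta_u[OF u t] t C0 by (intro mult_mono) auto
    also have "\<dots> = C ^ 3 * B * m t"
      using t by (simp add: power2_eq_square power3_eq_cube)
    finally show ?thesis .
  qed
  have zeta_h: "cmod (zeta h t) \<le> C * (sqrt (R - t) * norm (l2_class h))"
    if h: "sq_integrable h" and t: "t \<in> {1<..<R}" for h t
  proof -
    have "cmod (zeta h t) \<le> C * integral {t..R} (\<lambda>\<sigma>. cmod (h \<sigma>))"
      using t by (intro zeta_bound good_sq_integrable h integral_cmod_le_l2) auto
    also have "\<dots> \<le> C * (sqrt (R - t) * norm (l2_class h))"
      using t C0 by (intro mult_left_mono integral_cmod_le_l2 h) auto
    finally show ?thesis .
  qed
  have Pzeta_h: "cmod (P t * zeta h t) \<le> C\<^sup>2 * norm (l2_class h) * (1 / sqrt (R - t))"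
    if h: "sq_integrable h" and t: "t \<in> {1<..<R}" for h t
  proof -
    have "cmod (P t * zeta h t) \<le> C / (R - t) * (C * (sqrt (R - t) * norm (l2_class h)))"
      unfolding norm_mult using P_le[OF t] zeta_h[OF h t] t C0 by (intro mult_mono) auto
    also have "\<dots> = C\<^sup>2 * norm (l2_class h) * (sqrt (R - t) / (R - t))"
      by (simp add: power2_eq_square)
    also have "sqrt (R - t) / (R - t) = 1 / sqrt (R - t)"
      using t by (simp add: field_simps)
    finally show ?thesis .
  qed
  define B0 where "B0 = A * ((2 * C\<^sup>2 + 1) * sqrt (R - 1))"
  have B0: "0 \<le> B0"
    using A0 R by (simp add: B0_def)
  define D where "D = 2 * B0 * M + (C\<^sup>2 * (2 * B0) * M * (R - 1) + C * sqrt (R - 1))"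
  have M0: "0 < M"
    by (simp add: M_def)
  have D0: "0 \<le> 2 * B0 * M" "0 \<le> C\<^sup>2 * (2 * B0) * M * (R - 1) + C * sqrt (R - 1)"
    using B0 M0 C0 R by auto
  have "\<exists>y \<zeta>. continuous_on {1<..<R} y \<and> continuous_on {1<..<R} \<zeta> \<and>
      (\<forall>t\<in>{1<..<R}. cmod (y t) \<le> D * (norm (l2_class h1) + norm (l2_class h2)) \<and>
        cmod (\<zeta> t) \<le> D * (norm (l2_class h1) + norm (l2_class h2))) \<and>
      primitive_of 1 R (\<lambda>t. inverse (W t) * (P t * \<zeta> t + h1 t)) (\<lambda>t. y t / W t) \<and>
      primitive_of 1 R (\<lambda>t. W t * (\<kappa> t * y t + h2 t)) (\<lambda>t. W t * \<zeta> t)"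
    if h: "sq_integrable h1" "sq_integrable h2" for h1 h2
  proof -
    define N where "N = norm (l2_class h1) + norm (l2_class h2)"
    have N0: "0 \<le> N" and N1: "norm (l2_class h1) \<le> N" and N2: "norm (l2_class h2) \<le> N"
      by (simp_all add: N_def)
    have good_u: "good (\<lambda>\<sigma>. \<kappa> \<sigma> * u \<sigma> + h2 \<sigma>)"
      if "continuous_on {1<..<R} u" "\<And>t. t \<in> {1<..<R} \<Longrightarrow> cmod (u t) \<le> B" for u B
      using good_add[OF good_kappa[OF that] good_sq_integrable[OF h(2)]] by simp
    have li: "loc_integrable 1 R (\<lambda>t. P t * zeta g t + h1 t)" if "good g" for g
      by (intro loc_integrable_add loc_integrable_mult P_cont loc_integrable_continuous zeta_cont that
          sq_integrable_loc_integrable h)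
    have "\<exists>y. continuous_on {1<..<R} y \<and> (\<forall>t\<in>{1<..<R}. cmod (y t) \<le> 2 * (B0 * N) * m t \<and> S h1 h2 y t = y t)"
    proof (rule weighted_contraction_fixed_point[where M = M])
      show "0 \<le> m t" for t
        using m1[of t] by simp
      show "m t \<le> M" if "t \<in> {1<..<R}" for t
        by (rule mM[OF that])
      show "0 \<le> B0 * N"
        using B0 N0 by simp
      show "continuous_on {1<..<R} (S h1 h2 u)"
        if "continuous_on {1<..<R} u" "\<And>t. t \<in> {1<..<R} \<Longrightarrow> cmod (u t) \<le> B" for u B
        unfolding S_def by (intro ypart_cont li good_u[OF that] s)
    next
      fix u v :: "real \<Rightarrow> complex" and B B' t
      assume u: "continuous_on {1<..<R} u" "\<And>t. t \<in> {1<..<R} \<Longrightarrow> cmod (u t) \<le> B'"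
        and v: "continuous_on {1<..<R} v" "\<And>t. t \<in> {1<..<R} \<Longrightarrow> cmod (v t) \<le> B'"
        and uv: "\<And>t. t \<in> {1<..<R} \<Longrightarrow> cmod (u t - v t) \<le> B * m t" and t: "t \<in> {1<..<R}"
      have B: "0 \<le> B"
        using order_trans[OF norm_ge_zero uv[OF t]] m1[of t] by (simp add: zero_le_mult_iff)
      let ?f = "\<lambda>t. (P t * zeta (\<lambda>\<sigma>. \<kappa> \<sigma> * u \<sigma> + h2 \<sigma>) t + h1 t) - (P t * zeta (\<lambda>\<sigma>. \<kappa> \<sigma> * v \<sigma> + h2 \<sigma>) t + h1 t)"
      note gu = good_u[OF u] and gv = good_u[OF v]
      have lif: "loc_integrable 1 R ?f"
        by (intro loc_integrable_diff li gu gv)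
      have eq: "S h1 h2 u t - S h1 h2 v t = ypart s ?f t"
        unfolding S_def by (rule ypart_diff[OF li[OF gu] li[OF gv] s t])
      have fle: "cmod (?f \<tau>) \<le> C ^ 3 * B * m \<tau>" if \<tau>: "\<tau> \<in> {1<..<R}" for \<tau>
      proof -
        have "?f \<tau> = P \<tau> * (zeta (\<lambda>\<sigma>. \<kappa> \<sigma> * u \<sigma> + h2 \<sigma>) \<tau> - zeta (\<lambda>\<sigma>. \<kappa> \<sigma> * v \<sigma> + h2 \<sigma>) \<tau>)"
          by (simp add: algebra_simps)
        also have "\<dots> = P \<tau> * zeta (\<lambda>\<sigma>. \<kappa> \<sigma> * (u \<sigma> - v \<sigma>)) \<tau>"
          using zeta_diff[OF gu gv \<tau>] by (simp add: right_diff_distrib)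
        finally show ?thesis
          using Pzeta_u[OF continuous_on_diff[OF u(1) v(1)] uv \<tau>] by simp
      qed
      show "cmod (S h1 h2 u t - S h1 h2 v t) \<le> B / 2 * m t"
      proof (cases "s \<le> t")
        case True
        have "cmod (ypart s ?f t) \<le> C * integral {min s t..max s t} (\<lambda>_. C ^ 3 * B)"
        proof (rule ypart_bound[OF lif s t])
          fix \<tau> assume \<tau>: "\<tau> \<in> {min s t..max s t}"
          then have "\<tau> \<in> {1<..<R}" "s \<le> \<tau>" "\<tau> \<le> t"
            using s t True by auto
          then show "cmod (?f \<tau>) \<le> C ^ 3 * B" "cmod (W t) \<le> C * cmod (W \<tau>)"
            using fle[of \<tau>] W_quasi'[of \<tau> t] by (auto simp: m_def)
        qed (use C0 in auto)
        also have "\<dots> = (C ^ 4 * (t - s)) * B"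
          using True by (simp add: power_numeral_reduce)
        also have "\<dots> \<le> (1 / 2) * B"
        proof (rule mult_right_mono[OF _ B])
          have "C ^ 4 * (t - s) \<le> C ^ 4 * (R - s)"
            using t C0 by (intro mult_left_mono) auto
          then show "C ^ 4 * (t - s) \<le> 1 / 2"
            using sR by linarith
        qed
        finally show ?thesis
          unfolding eq using True by (simp add: m_def)
      next
        case False
        have ints: "((\<lambda>\<tau>. exp (k * (s - \<tau>))) has_integral (- (exp (k * (s - s)) / k)) - (- (exp (k * (s - t)) / k))) {t..s}"
        proof (rule fundamental_theorem_of_calculus)
          fix x
          have "((\<lambda>\<tau>. - (exp (k * (s - \<tau>)) / k)) has_real_derivative exp (k * (s - x))) (at x)"
            using k0 by (auto intro!: derivative_eq_intros simp: field_simps)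
          then show "((\<lambda>\<tau>. - (exp (k * (s - \<tau>)) / k)) has_vector_derivative exp (k * (s - x))) (at x within {t..s})"
            unfolding has_real_derivative_iff_has_vector_derivative by (rule has_vector_derivative_at_within)
        qed (use False in simp)
        have int_le: "integral {t..s} (\<lambda>\<tau>. exp (k * (s - \<tau>))) \<le> m t / k"
          unfolding integral_unique[OF ints] using k0 False by (simp add: m_def)
        have "cmod (ypart s ?f t) \<le> A * integral {min s t..max s t} (\<lambda>\<tau>. C ^ 3 * B * exp (k * (s - \<tau>)))"
        proof (rule ypart_bound[OF lif s t])
          show "(\<lambda>\<tau>. C ^ 3 * B * exp (k * (s - \<tau>))) integrable_on {min s t..max s t}"
            by (intro integrable_continuous_real continuous_intros)
          fix \<tau> assume \<tau>: "\<tau> \<in> {min s t..max s t}"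
          then show "cmod (W t) \<le> A * cmod (W \<tau>)"
            by (rule ratio[OF t])
          have "\<tau> \<in> {1<..<R}" "\<tau> \<le> s"
            using s t \<tau> False by auto
          then show "cmod (?f \<tau>) \<le> C ^ 3 * B * exp (k * (s - \<tau>))"
            using fle[of \<tau>] by (simp add: m_def)
        qed (use A0 in simp)
        also have "\<dots> = A * (C ^ 3 * B * integral {t..s} (\<lambda>\<tau>. exp (k * (s - \<tau>))))"
          using False by simp
        also have "\<dots> \<le> A * (C ^ 3 * B * (m t / k))"
          using A0 C0 B int_le by (intro mult_left_mono) auto
        also have "\<dots> = B / 2 * m t"
          using A0 C0 by (simp add: k_def)
        finally show ?thesis
          unfolding eq .
      qed
    next
      fix t assume t: "t \<in> {1<..<R}"
      let ?f = "\<lambda>t. P t * zeta h2 t + h1 t"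
      let ?g = "\<lambda>\<tau>. C\<^sup>2 * norm (l2_class h2) * (1 / sqrt (R - \<tau>)) + cmod (h1 \<tau>)"
      have mM: "min s t \<le> max s t" "max s t < R" "1 < min s t"
        using s t by auto
      note iis = integral_inverse_sqrt[OF mM(1,2)] and ih = integral_cmod_le_l2[OF h(1) mM(1)]
      have "cmod (ypart s ?f t) \<le> A * integral {min s t..max s t} ?g"
      proof (rule ypart_bound[OF _ s t])
        show "loc_integrable 1 R ?f"
          by (rule li[OF good_sq_integrable[OF h(2)]])
        show "?g integrable_on {min s t..max s t}"
          by (intro integrable_add integrable_on_mult_right iis ih)
        fix \<tau> assume \<tau>: "\<tau> \<in> {min s t..max s t}"
        then show "cmod (W t) \<le> A * cmod (W \<tau>)"
          by (rule ratio[OF t])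
        have "\<tau> \<in> {1<..<R}"
          using \<tau> mM by auto
        then show "cmod (?f \<tau>) \<le> ?g \<tau>"
          using Pzeta_h[OF h(2)] by (intro norm_triangle_le add_mono) auto
      qed (use A0 in simp)
      also have "integral {min s t..max s t} ?g
          = C\<^sup>2 * norm (l2_class h2) * integral {min s t..max s t} (\<lambda>\<tau>. 1 / sqrt (R - \<tau>))
            + integral {min s t..max s t} (\<lambda>\<tau>. cmod (h1 \<tau>))"
        using iis(1) ih(1) by (subst integral_add) (auto intro: integrable_on_mult_right simp del: times_divide_eq_right mult_1_right)
      also have "\<dots> \<le> C\<^sup>2 * N * (2 * sqrt (R - 1)) + sqrt (R - 1) * N"
      proof (intro add_mono mult_mono)
        show "integral {min s t..max s t} (\<lambda>\<tau>. 1 / sqrt (R - \<tau>)) \<le> 2 * sqrt (R - 1)"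
          using iis(2) mM by (smt (verit) real_sqrt_le_iff)
        show "0 \<le> integral {min s t..max s t} (\<lambda>\<tau>. 1 / sqrt (R - \<tau>))"
          using mM by (intro integral_nonneg iis(1)) auto
        have "sqrt (max s t - min s t) * norm (l2_class h1) \<le> sqrt (R - 1) * N"
          using mM R N1 by (intro mult_mono) auto
        then show "integral {min s t..max s t} (\<lambda>\<tau>. cmod (h1 \<tau>)) \<le> sqrt (R - 1) * N"
          using ih(2) by linarith
      qed (use N2 N0 C0 in auto)
      also have "A * (C\<^sup>2 * N * (2 * sqrt (R - 1)) + sqrt (R - 1) * N) = B0 * N"
        by (simp add: B0_def algebra_simps)
      also have "\<dots> \<le> B0 * N * m t"
        using mult_left_mono[OF m1[of t], of "B0 * N"] B0 N0 by simp
      finally show "cmod (S h1 h2 (\<lambda>_. 0) t) \<le> B0 * N * m t"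
        using A0 by (simp add: S_def mult_left_mono)
    qed
    then obtain y where y: "continuous_on {1<..<R} y" "\<And>t. t \<in> {1<..<R} \<Longrightarrow> cmod (y t) \<le> 2 * (B0 * N) * m t"
        "\<And>t. t \<in> {1<..<R} \<Longrightarrow> S h1 h2 y t = y t"
      by blast
    have yM: "cmod (y t) \<le> 2 * B0 * M * N" if "t \<in> {1<..<R}" for t
    proof -
      have "2 * (B0 * N) * m t \<le> 2 * (B0 * N) * M"
        using B0 N0 mM[OF that] by (intro mult_left_mono) auto
      then show ?thesis
        using y(2)[OF that] by (simp add: algebra_simps)
    qed
    have gy: "good (\<lambda>\<sigma>. \<kappa> \<sigma> * y \<sigma> + h2 \<sigma>)"
      by (rule good_u[OF y(1)]) (rule yM)
    note gh = good_sq_integrable[OF h(2)]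
    define \<zeta> where "\<zeta> = zeta (\<lambda>\<sigma>. \<kappa> \<sigma> * y \<sigma> + h2 \<sigma>)"
    have \<zeta>M: "cmod (\<zeta> t) \<le> (C\<^sup>2 * (2 * B0) * M * (R - 1) + C * sqrt (R - 1)) * N" if t: "t \<in> {1<..<R}" for t
    proof -
      have "\<zeta> t - zeta h2 t = zeta (\<lambda>\<sigma>. \<kappa> \<sigma> * y \<sigma>) t"
        using zeta_diff[OF gy gh t] by (simp add: \<zeta>_def)
      then have "cmod (\<zeta> t) \<le> cmod (zeta (\<lambda>\<sigma>. \<kappa> \<sigma> * y \<sigma>) t) + cmod (zeta h2 t)"
        by (metis diff_add_cancel norm_triangle_ineq)
      also have "\<dots> \<le> C\<^sup>2 * (2 * (B0 * N)) * m t * (R - t) + C * (sqrt (R - t) * norm (l2_class h2))"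
        by (intro add_mono zeta_u zeta_h y h t)
      also have "\<dots> \<le> C\<^sup>2 * (2 * (B0 * N)) * M * (R - 1) + C * (sqrt (R - 1) * N)"
        using t B0 N0 N2 C0 M0 mM[OF t] order_trans[OF zero_le_one m1[of t]] by (intro add_mono mult_mono) auto
      finally show ?thesis
        by (simp add: algebra_simps)
    qed
    have "primitive_of 1 R (\<lambda>t. inverse (W t) * (P t * \<zeta> t + h1 t)) (\<lambda>t. y t / W t)"
      using ypart_primitive[OF li[OF gy] s] y(3)
      unfolding \<zeta>_def S_def by (elim primitive_of_cong) auto
    moreover have "primitive_of 1 R (\<lambda>t. W t * (\<kappa> t * y t + h2 t)) (\<lambda>t. W t * \<zeta> t)"
      unfolding \<zeta>_def by (rule zeta_primitive[OF gy])
    moreover have "continuous_on {1<..<R} \<zeta>"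
      unfolding \<zeta>_def by (rule zeta_cont[OF gy])
    moreover have "cmod (y t) \<le> D * N \<and> cmod (\<zeta> t) \<le> D * N" if "t \<in> {1<..<R}" for t
    proof
      have "2 * B0 * M * N \<le> D * N" "(C\<^sup>2 * (2 * B0) * M * (R - 1) + C * sqrt (R - 1)) * N \<le> D * N"
        using D0 by (intro mult_right_mono N0; simp add: D_def)+
      then show "cmod (y t) \<le> D * N" "cmod (\<zeta> t) \<le> D * N"
        using yM[OF that] \<zeta>M[OF that] by linarith+
    qed
    ultimately show ?thesis
      using y(1) unfolding N_def by blast
  qed
  moreover have "0 \<le> D"
    using D0 by (simp add: D_def)
  ultimately show ?thesis
    by blast
qed

end

section \<open>Square-integrable solutions of the inhomogeneous equation\<close>

lemma sq_integrable_bounded_mult: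
  assumes f: "continuous_on {l<..<r} f" "\<And>t. t \<in> {l<..<r} \<Longrightarrow> cmod (f t) \<le> B" and B: "0 \<le> B"
    and g: "sq_integrable g" "\<And>t. t \<notin> {l<..<r} \<Longrightarrow> g t = 0"
  shows "sq_integrable (\<lambda>t. f t * g t)" "norm (l2_class (\<lambda>t. f t * g t)) \<le> B * norm (l2_class g)"
proof -
  have gm: "g \<in> borel_measurable lborel" "integrable lborel (\<lambda>t. (cmod (g t))\<^sup>2)"
    using g by (auto simp: sq_integrable_def)
  have "(\<lambda>t. indicator {l<..<r} t *\<^sub>R f t) \<in> borel_measurable borel"
    by (rule borel_measurable_continuous_on_indicator) (use f in auto)
  then have "(\<lambda>t. (indicator {l<..<r} t *\<^sub>R f t) * g t) \<in> borel_measurable lborel"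
    using gm(1) by (intro borel_measurable_times) auto
  also have "(\<lambda>t. (indicator {l<..<r} t *\<^sub>R f t) * g t) = (\<lambda>t. f t * g t)"
  proof
    show "(indicator {l<..<r} t *\<^sub>R f t) * g t = f t * g t" for t
      using g(2)[of t] by (cases "t \<in> {l<..<r}") auto
  qed
  finally have m: "(\<lambda>t. f t * g t) \<in> borel_measurable lborel" .
  have le: "(cmod (f t * g t))\<^sup>2 \<le> B\<^sup>2 * (cmod (g t))\<^sup>2" for t
  proof (cases "t \<in> {l<..<r}")
    case True
    have "cmod (f t) * cmod (g t) \<le> B * cmod (g t)"
      using f(2)[OF True] by (rule mult_right_mono) simp
    then have "(cmod (f t) * cmod (g t))\<^sup>2 \<le> (B * cmod (g t))\<^sup>2"
      by (rule power_mono) simp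
    then show ?thesis
      by (simp add: norm_mult power_mult_distrib)
  qed (simp add: g(2))
  have int: "integrable lborel (\<lambda>t. (cmod (f t * g t))\<^sup>2)"
  proof (rule Bochner_Integration.integrable_bound)
    show "integrable lborel (\<lambda>t. B\<^sup>2 * (cmod (g t))\<^sup>2)"
      using gm by simp
    show "(\<lambda>t. (cmod (f t * g t))\<^sup>2) \<in> borel_measurable lborel"
      using m by measurable
    show "AE t in lborel. norm ((cmod (f t * g t))\<^sup>2) \<le> norm (B\<^sup>2 * (cmod (g t))\<^sup>2)"
      using le by (intro AE_I2) simp
  qed
  show sq: "sq_integrable (\<lambda>t. f t * g t)"
    using m int by (simp add: sq_integrable_def)
  have "(norm (l2_class (\<lambda>t. f t * g t)))\<^sup>2 \<le> B\<^sup>2 * (norm (l2_class g))\<^sup>2"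
    unfolding norm_l2_class[OF sq] norm_l2_class[OF g(1)] Bochner_Integration.integral_mult_right_zero[symmetric]
    using gm int le by (intro integral_mono) auto
  then have "(norm (l2_class (\<lambda>t. f t * g t)))\<^sup>2 \<le> (B * norm (l2_class g))\<^sup>2"
    by (simp add: power_mult_distrib)
  then show "norm (l2_class (\<lambda>t. f t * g t)) \<le> B * norm (l2_class g)"
    by (rule power2_le_imp_le) (use B in simp)
qed

lemma sq_integrable_bounded:
  assumes lr: "l < r" and f: "continuous_on {l<..<r} f" "\<And>t. t \<in> {l<..<r} \<Longrightarrow> cmod (f t) \<le> B" and B: "0 \<le> B"
  defines "g \<equiv> (\<lambda>t. if t \<in> {l<..<r} then f t else 0)"
  shows "sq_integrable g" "norm (l2_class g) \<le> B * sqrt (r - l)"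
proof -
  define e where "e = (\<lambda>t. complex_of_real (indicator {l<..<r} t))"
  have e2: "(\<lambda>t. (cmod (e t))\<^sup>2) = indicator {l<..<r}"
    by (auto simp: e_def indicator_def)
  have e: "sq_integrable e"
    unfolding sq_integrable_def e2 using lr
    by (auto simp: e_def intro!: integrable_real_indicator)
  have "(norm (l2_class e))\<^sup>2 = r - l"
    unfolding norm_l2_class[OF e] e2 using lr by simp
  then have ne: "norm (l2_class e) = sqrt (r - l)"
    by (metis norm_ge_zero real_sqrt_unique)
  have g: "g = (\<lambda>t. f t * e t)"
    by (auto simp: g_def e_def indicator_def)
  have ez: "e t = 0" if "t \<notin> {l<..<r}" for t
    using that by (simp add: e_def)
  show "sq_integrable g"
    unfolding g by (rule sq_integrable_bounded_mult(1)[where B = B]) (use f B e ez in auto)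
  show "norm (l2_class g) \<le> B * sqrt (r - l)"
    unfolding g ne[symmetric] by (rule sq_integrable_bounded_mult(2)) (use f B e ez in auto)
qed

lemma weak_deriv_cong:
  assumes F: "weak_deriv l r F g" and eq: "\<And>t. t \<in> {l<..<r} \<Longrightarrow> F t = G t" "\<And>t. t \<in> {l<..<r} \<Longrightarrow> g t = h t"
  shows "weak_deriv l r G h"
proof -
  have li: "loc_integrable l r v"
    if u: "loc_integrable l r u" and uv: "\<And>t. t \<in> {l<..<r} \<Longrightarrow> u t = v t" for u v :: "real \<Rightarrow> complex"
    unfolding loc_integrable_def
  proof (intro allI impI)
    fix a b assume ab: "l < a" "b < r"
    have "set_integrable lborel {a..b} u \<longleftrightarrow> set_integrable lborel {a..b} v"
      by (rule set_integrable_cong) (use ab uv in auto)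
    then show "set_integrable lborel {a..b} v"
      using u ab by (simp add: loc_integrable_def)
  qed
  have "integral\<^sup>L lborel (\<lambda>t. \<psi>' t * G t) = - integral\<^sup>L lborel (\<lambda>t. \<psi> t * h t)"
    if ab: "l < a" "b < r" and \<psi>: "test_pair a b \<psi> \<psi>'" for a b \<psi> \<psi>'
  proof -
    have "\<psi>' t * F t = \<psi>' t * G t \<and> \<psi> t * g t = \<psi> t * h t" for t
      using eq[of t] ab test_pair_zero[OF \<psi>, of t] test_pair_deriv_zero[OF \<psi>, of t]
      by (cases "t \<in> {a..b}") auto
    then have "(\<lambda>t. \<psi>' t * F t) = (\<lambda>t. \<psi>' t * G t)" "(\<lambda>t. \<psi> t * g t) = (\<lambda>t. \<psi> t * h t)"
      by auto
    then show ?thesis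
      using weak_derivD[OF F ab \<psi>] by simp
  qed
  then show ?thesis
    unfolding weak_deriv_def
    using li[OF weak_deriv_loc_integrable(1)[OF F] eq(1)] li[OF weak_deriv_loc_integrable(2)[OF F] eq(2)]
    by blast
qed

text \<open>
  The structure of the coefficients at the singular endpoint. The coefficient \<open>q1\<close> may be unbounded there, but
  only through \<open>r' + r\<^sup>2 / p\<close>, where \<open>r / p\<close> is the logarithmic derivative of a weight \<open>w\<close>; this is exactly the part
  that the substitution \<open>\<zeta> = z - r y\<^sub>1\<close> removes.
\<close>

locale singular_matrix = degenerate_matrix +
  fixes r r' q0 w :: "real \<Rightarrow> real" and C :: real
  assumes r_deriv: "\<And>t. t \<in> {1<..<R} \<Longrightarrow> (r has_real_derivative r' t) (at t)"
    and r'_cont: "continuous_on {1<..<R} r'"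
    and q1_eq: "\<And>t. t \<in> {1<..<R} \<Longrightarrow> q1 t = q0 t + r' t + (r t)\<^sup>2 / p t"
    and r_le: "\<And>t. t \<in> {1<..<R} \<Longrightarrow> \<bar>r t\<bar> \<le> C"
    and q0_le: "\<And>t. t \<in> {1<..<R} \<Longrightarrow> \<bar>q0 t\<bar> \<le> C"
    and q2_le: "\<And>t. t \<in> {1<..<R} \<Longrightarrow> \<bar>q2 t\<bar> \<le> C"
    and p_ge: "\<And>t. t \<in> {1<..<R} \<Longrightarrow> R - t \<le> C * p t"
    and w_pos: "\<And>t. t \<in> {1<..<R} \<Longrightarrow> 0 < w t"
    and w_deriv: "\<And>t. t \<in> {1<..<R} \<Longrightarrow> (w has_real_derivative r t / p t * w t) (at t)"
    and w_le: "\<And>t. t \<in> {1<..<R} \<Longrightarrow> w t \<le> C"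
    and w_quasi: "\<And>\<tau> t. 1 < \<tau> \<Longrightarrow> \<tau> \<le> t \<Longrightarrow> t < R \<Longrightarrow> w t \<le> C * w \<tau>"
begin

lemma C_pos: "0 < C"
proof -
  have t: "(1 + R) / 2 \<in> {1<..<R}"
    using R by auto
  show ?thesis
    using w_pos[OF t] w_le[OF t] by linarith
qed

lemma r_cont: "continuous_on {1<..<R} r"
  using r_deriv by (intro continuous_at_imp_continuous_on) (blast intro: DERIV_isCont)

lemma q0_cont: "continuous_on {1<..<R} q0"
proof -
  have "continuous_on {1<..<R} (\<lambda>t. q1 t - r' t - (r t)\<^sup>2 / p t)"
    using p_nz by (intro continuous_intros q1_cont r'_cont r_cont p_cont) auto
  then show ?thesis
    by (rule continuous_on_eq) (simp add: q1_eq)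
qed

end

locale singular_matrix_nonzero = singular_matrix + nonzero_eigenvalue
begin

text \<open>
  The bounded part of the coefficient \<open>a12\<close>, and the bounded part \<open>exponent'\<close> of the diagonal after the
  substitution \<open>\<zeta> = z - r y\<^sub>1\<close>; the other part of the diagonal is \<open>r / p\<close>.
\<close>

definition a12_bounded :: "real \<Rightarrow> complex" where "a12_bounded t = - (of_real (c / t))\<^sup>2 / \<mu>"
definition exponent' :: "real \<Rightarrow> complex" where "exponent' t = a11 t + a12_bounded t * of_real (r t)"

lemma a11_cmod_le: "t \<in> {1<..<R} \<Longrightarrow> cmod (a11 t) \<le> c * C / cmod \<mu>"
  unfolding a11_def norm_divide norm_mult norm_of_real using q2_le[of t] c C_pos \<mu>
  by (intro divide_right_mono mult_mono) (auto simp: field_simps)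

lemma a12_bounded_cmod_le: "t \<in> {1<..<R} \<Longrightarrow> cmod (a12_bounded t) \<le> c\<^sup>2 / cmod \<mu>"
  unfolding a12_bounded_def norm_divide norm_minus_cancel norm_power norm_of_real using c \<mu>
  by (intro divide_right_mono power_mono) (auto simp: field_simps)

definition exponent_deriv_bound :: real where "exponent_deriv_bound = c * C / cmod \<mu> + c\<^sup>2 / cmod \<mu> * C"

lemma exponent'_cmod_le:
  assumes t: "t \<in> {1<..<R}"
  shows "cmod (exponent' t) \<le> exponent_deriv_bound"
proof -
  have "cmod (a12_bounded t * of_real (r t)) \<le> c\<^sup>2 / cmod \<mu> * C"
    unfolding norm_mult norm_of_real using a12_bounded_cmod_le[OF t] r_le[OF t] by (intro mult_mono) auto
  then show ?thesis
    unfolding exponent'_def exponent_deriv_bound_def using a11_cmod_le[OF t] by (intro norm_triangle_le add_mono)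
qed

lemma exponent_deriv_bound_nonneg: "0 \<le> exponent_deriv_bound"
  using c C_pos by (simp add: exponent_deriv_bound_def)

lemma a12_bounded_cont: "continuous_on {1<..<R} a12_bounded"
  unfolding a12_bounded_def[abs_def] using \<mu> by (intro continuous_intros) auto

lemma exponent'_cont: "continuous_on {1<..<R} exponent'"
  unfolding exponent'_def[abs_def] by (intro continuous_intros a_cont a12_bounded_cont r_cont)

definition exponent :: "real \<Rightarrow> complex"
  where "exponent t = (if (1 + R) / 2 \<le> t then integral {(1 + R) / 2..t} exponent' else - integral {t..(1 + R) / 2} exponent')"

lemma exponent_primitive: "primitive_of 1 R exponent' exponent"
  unfolding exponent_def[abs_def] using R by (intro primitive_of_integral loc_integrable_continuous exponent'_cont) auto

lemma exponent_deriv: "t \<in> {1<..<R} \<Longrightarrow> (exponent has_vector_derivative exponent' t) (at t)"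
  by (rule primitive_of_has_vector_derivative[OF exponent_primitive exponent'_cont])

definition exponent_bound :: real where "exponent_bound = exponent_deriv_bound * (R - 1)"

lemma exponent_cmod_le:
  assumes t: "t \<in> {1<..<R}"
  shows "cmod (exponent t) \<le> exponent_bound"
proof -
  have *: "cmod (integral {a..b} exponent') \<le> exponent_bound" if ab: "1 < a" "a \<le> b" "b < R" for a b
  proof -
    have "cmod (integral {a..b} exponent') \<le> exponent_deriv_bound * (b - a)"
      using ab by (intro integral_bound continuous_on_subset[OF exponent'_cont] exponent'_cmod_le) auto
    also have "\<dots> \<le> exponent_deriv_bound * (R - 1)"
      using ab exponent_deriv_bound_nonneg by (intro mult_left_mono) auto
    finally show ?thesis
      by (simp add: exponent_bound_def)
  qed
  show ?thesis
    unfolding exponent_def using t R by (auto intro!: *)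
qed

text \<open>
  The integrating factor: with the unknowns \<open>y\<^sub>1 / W\<close> and \<open>W \<zeta>\<close>, where \<open>\<zeta> = z - r y\<^sub>1\<close>
  and \<open>z = p (y\<^sub>1' - c/t y\<^sub>2)\<close>, the system has zero diagonal, and its only singular
  coefficient is \<open>1 / p\<close>.
\<close>

definition int_factor :: "real \<Rightarrow> complex"
  where "int_factor t = (if t < R then of_real (w t) * exp (exponent t) else 0)"

definition coupling :: "real \<Rightarrow> complex"
  where "coupling t = (if t < R then of_real (q0 t) - \<mu> + (of_real (q2 t))\<^sup>2 / \<mu> - a11 t * of_real (r t) - of_real (r t) * exponent' t
    else 0)"

lemma a12_eq: "a12 t = of_real (1 / p t) + a12_bounded t"
  by (simp add: a12_def a12_bounded_def)

lemma int_factor_nz: "t \<in> {1<..<R} \<Longrightarrow> int_factor t \<noteq> 0"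
  using w_pos[of t] by (auto simp: int_factor_def)

lemma int_factor_deriv:
  assumes t: "t \<in> {1<..<R}"
  shows "(int_factor has_vector_derivative (of_real (r t / p t) + exponent' t) * int_factor t) (at t)"
proof -
  have "((\<lambda>t. complex_of_real (w t)) has_vector_derivative of_real (r t / p t * w t)) (at t)"
    using w_deriv[OF t] by (intro has_vector_derivative_of_real) (simp add: has_real_derivative_iff_has_vector_derivative)
  moreover have "((\<lambda>t. exp (exponent t)) has_vector_derivative exponent' t * exp (exponent t)) (at t)"
    using field_vector_diff_chain_at[OF exponent_deriv[OF t] DERIV_exp] by (simp add: o_def)
  ultimately have "((\<lambda>t. of_real (w t) * exp (exponent t)) has_vector_derivative
      of_real (w t) * (exponent' t * exp (exponent t)) + of_real (r t / p t * w t) * exp (exponent t)) (at t)"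
    by (rule has_vector_derivative_mult)
  then have "((\<lambda>t. of_real (w t) * exp (exponent t)) has_vector_derivative (of_real (r t / p t) + exponent' t) * int_factor t) (at t)"
    using t by (simp add: int_factor_def algebra_simps)
  then show ?thesis
    by (rule has_vector_derivative_transform_within_open[of _ _ _ "{..<R}"]) (use t in \<open>auto simp: int_factor_def\<close>)
qed

lemma int_factor_cont: "continuous_on {1<..<R} int_factor"
  using int_factor_deriv by (intro continuous_at_imp_continuous_on) (blast intro: has_vector_derivative_continuous)

lemma int_factor_cmod: "t \<in> {1<..<R} \<Longrightarrow> cmod (int_factor t) = w t * exp (Re (exponent t))"
  using w_pos[of t] by (simp add: int_factor_def norm_mult)

lemma exp_exponent_le: "t \<in> {1<..<R} \<Longrightarrow> exp (Re (exponent t)) \<le> exp exponent_bound"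
  using exponent_cmod_le[of t] abs_Re_le_cmod[of "exponent t"] by simp

lemma exp_exponent_ge: "t \<in> {1<..<R} \<Longrightarrow> exp (- exponent_bound) \<le> exp (Re (exponent t))"
  using exponent_cmod_le[of t] abs_Re_le_cmod[of "exponent t"] by simp

definition coupling_bound :: real
  where "coupling_bound = C + cmod \<mu> + C\<^sup>2 / cmod \<mu> + c * C / cmod \<mu> * C + C * exponent_deriv_bound"

lemma coupling_cmod_le:
  assumes t: "t \<in> {1<..<R}"
  shows "cmod (coupling t) \<le> coupling_bound"
proof -
  have "cmod (coupling t) \<le> cmod (of_real (q0 t)) + cmod \<mu> + cmod ((of_real (q2 t))\<^sup>2 / \<mu>)
      + cmod (a11 t * of_real (r t)) + cmod (of_real (r t) * exponent' t)"
    using t unfolding coupling_def greaterThanLessThan_iff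
    by (simp only: if_True) (intro order_trans[OF norm_triangle_ineq4] order_trans[OF norm_triangle_ineq] add_mono order_refl)
  also have "\<dots> \<le> coupling_bound"
    unfolding coupling_bound_def norm_mult norm_divide norm_power norm_of_real
    using q0_le[OF t] q2_le[OF t] r_le[OF t] a11_cmod_le[OF t] exponent'_cmod_le[OF t] C_pos c
    by (intro add_mono mult_mono divide_right_mono power_mono) auto
  finally show ?thesis .
qed

definition system_bound :: real
  where "system_bound = C * exp (2 * exponent_bound) + C * exp exponent_bound + (C + c\<^sup>2 / cmod \<mu> * (R - 1)) + coupling_bound"

lemma system_bound_ge: "C * exp (2 * exponent_bound) \<le> system_bound" "C * exp exponent_bound \<le> system_bound" "C + c\<^sup>2 / cmod \<mu> * (R - 1) \<le> system_bound" "coupling_bound \<le> system_bound"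
proof -
  have "0 \<le> C * exp (2 * exponent_bound)" "0 \<le> C * exp exponent_bound" "0 \<le> C + c\<^sup>2 / cmod \<mu> * (R - 1)" "0 \<le> coupling_bound"
    using C_pos R c exponent_deriv_bound_nonneg by (auto simp: coupling_bound_def intro!: add_nonneg_nonneg)
  then show "C * exp (2 * exponent_bound) \<le> system_bound" "C * exp exponent_bound \<le> system_bound" "C + c\<^sup>2 / cmod \<mu> * (R - 1) \<le> system_bound" "coupling_bound \<le> system_bound"
    unfolding system_bound_def by linarith+
qed

lemma endpoint: "endpoint_system R system_bound int_factor a12 coupling"
proof
  show "1 < R"
    by (rule R)
  show "continuous_on {1<..<R} int_factor"
    by (rule int_factor_cont)
  show "continuous_on {1<..<R} a12"
    by (rule a_cont(2))
  have "continuous_on {1<..<R} (\<lambda>t. of_real (q0 t) - \<mu> + (of_real (q2 t))\<^sup>2 / \<mu> - a11 t * of_real (r t) - of_real (r t) * exponent' t)"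
    using \<mu> by (intro continuous_intros q0_cont q2_cont a_cont r_cont exponent'_cont) auto
  then show "continuous_on {1<..<R} coupling"
    by (rule continuous_on_eq) (simp add: coupling_def)
  show "int_factor t \<noteq> 0" if "t \<in> {1<..<R}" for t
    by (rule int_factor_nz[OF that])
  show "cmod (int_factor t) \<le> system_bound * cmod (int_factor \<tau>)" if "1 < \<tau>" "\<tau> \<le> t" "t < R" for \<tau> t
  proof -
    have I: "t \<in> {1<..<R}" "\<tau> \<in> {1<..<R}"
      using that by auto
    have "cmod (int_factor t) \<le> (C * w \<tau>) * exp exponent_bound"
      unfolding int_factor_cmod[OF I(1)] using w_quasi[OF that] exp_exponent_le[OF I(1)] w_pos[OF I(2)] C_pos
      by (intro mult_mono) auto
    also have "\<dots> = C * exp (2 * exponent_bound) * (w \<tau> * exp (- exponent_bound))"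
      by (simp add: exp_minus field_simps flip: exp_add)
    also have "\<dots> \<le> system_bound * (w \<tau> * exp (Re (exponent \<tau>)))"
      using system_bound_ge(1) exp_exponent_ge[OF I(2)] w_pos[OF I(2)] C_pos
      by (intro mult_mono) (auto intro: order_trans[OF _ system_bound_ge(1)])
    finally show ?thesis
      unfolding int_factor_cmod[OF I(2)] .
  qed
  show "cmod (int_factor t) \<le> system_bound" if t: "t \<in> {1<..<R}" for t
  proof -
    have "cmod (int_factor t) \<le> C * exp exponent_bound"
      unfolding int_factor_cmod[OF t] using w_le[OF t] exp_exponent_le[OF t] w_pos[OF t] C_pos
      by (intro mult_mono) auto
    then show ?thesis
      using system_bound_ge(2) by linarith
  qed
  show "cmod (a12 t) \<le> system_bound / (R - t)" if t: "t \<in> {1<..<R}" for t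
  proof -
    have "1 / p t \<le> C / (R - t)"
      using p_ge[OF t] p_pos[OF t] t by (simp add: field_simps)
    then have 1: "cmod (of_real (1 / p t)) \<le> C / (R - t)"
      unfolding norm_of_real using p_pos[OF t] by simp
    have "1 \<le> (R - 1) / (R - t)"
      using t by (simp add: field_simps)
    then have "c\<^sup>2 / cmod \<mu> * 1 \<le> c\<^sup>2 / cmod \<mu> * ((R - 1) / (R - t))"
      by (rule mult_left_mono) simp
    then have "cmod (a12 t) \<le> C / (R - t) + c\<^sup>2 / cmod \<mu> * ((R - 1) / (R - t))"
      unfolding a12_eq using 1 a12_bounded_cmod_le[OF t] by (intro norm_triangle_le) linarith
    also have "\<dots> = (C + c\<^sup>2 / cmod \<mu> * (R - 1)) / (R - t)"
      by (simp add: add_divide_distrib)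
    also have "\<dots> \<le> system_bound / (R - t)"
      using t system_bound_ge(3) by (intro divide_right_mono) auto
    finally show ?thesis .
  qed
  show "cmod (coupling t) \<le> system_bound" if "t \<in> {1<..<R}" for t
    using coupling_cmod_le[OF that] system_bound_ge(4) by linarith
qed (simp_all add: int_factor_def coupling_def)

end

text \<open>
  The algebra of the change of unknowns at a fixed point, with \<open>i = 1 / p\<close>, \<open>k = c / t\<close>, \<open>j = 1 / \<mu>\<close>, \<open>m = \<mu>\<close>, and \<open>e\<close> the
  value of \<open>exponent'\<close>: the right-hand sides of the system for \<open>y\<close> and \<open>\<zeta>\<close> agree with those for \<open>y\<close> and \<open>z\<close>.
\<close>

lemma transformation_identities:
  fixes q r r' i k q2 m j y \<zeta> f1 f2 :: complex
  defines "z \<equiv> r * y + \<zeta>" and "e \<equiv> k * q2 * j - k\<^sup>2 * j * r"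
  defines "y2 \<equiv> (q2 * y - k * z) * j - j * f2"
  shows "(r * i + e) * y + ((i - k\<^sup>2 * j) * \<zeta> - k * j * f2) = i * z + k * y2"
    "(r' * y + r * (i * z + k * y2)) + (- (r * i + e) * \<zeta> + ((q - m + q2\<^sup>2 * j - k * q2 * j * r - r * e) * y
      + ((- q2 * j + r * (k * j)) * f2 - f1))) = (q + r' + r\<^sup>2 * i - m) * y + q2 * y2 - f1"
  unfolding z_def e_def y2_def by (simp_all add: algebra_simps power2_eq_square)

context singular_matrix_nonzero
begin

lemma weak_derivatives:
  assumes Y: "primitive_of 1 R (\<lambda>t. inverse (int_factor t) * (a12 t * \<zeta> t + h1 t)) (\<lambda>t. y t / int_factor t)"
    and Z: "primitive_of 1 R (\<lambda>t. int_factor t * (coupling t * y t + h2 t)) (\<lambda>t. int_factor t * \<zeta> t)"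
    and h1: "\<And>t. h1 t = - of_real (c / t) / \<mu> * f2 t"
    and h2: "\<And>t. h2 t = (- of_real (q2 t) / \<mu> + of_real (r t) * (of_real (c / t) / \<mu>)) * f2 t - f1 t"
    and z: "\<And>t. z t = of_real (r t) * y t + \<zeta> t" and y2: "\<And>t. y2 t = second y z t - f2 t / \<mu>"
  shows "weak_deriv 1 R y (\<lambda>t. of_real (1 / p t) * z t + of_real (c / t) * y2 t)"
    "weak_deriv 1 R z (\<lambda>t. (of_real (q1 t) - \<mu>) * y t + of_real (q2 t) * y2 t - f1 t)"
proof -
  let ?d = "\<lambda>t. complex_of_real (r t / p t) + exponent' t"
  have d_cont: "continuous_on {1<..<R} ?d"
    using p_nz by (intro continuous_intros r_cont p_cont exponent'_cont) auto
  have y2': "y2 t = (of_real (q2 t) * y t - of_real (c / t) * z t) * inverse \<mu> - inverse \<mu> * f2 t" for t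
    by (simp add: y2 second_def divide_inverse mult.commute)
  have exponent'_eq: "exponent' t = of_real (c / t) * of_real (q2 t) * inverse \<mu> - (of_real (c / t))\<^sup>2 * inverse \<mu> * of_real (r t)" for t
    by (simp add: exponent'_def a11_def a12_bounded_def divide_inverse)
  have rp: "complex_of_real (r t / p t) = of_real (r t) * of_real (1 / p t)" for t
    by simp
  show wy: "weak_deriv 1 R y (\<lambda>t. of_real (1 / p t) * z t + of_real (c / t) * y2 t)"
  proof (rule weak_deriv_cong)
    show "weak_deriv 1 R (\<lambda>t. int_factor t * (y t / int_factor t))
        (\<lambda>t. (?d t * int_factor t) * (y t / int_factor t) + int_factor t * (inverse (int_factor t) * (a12 t * \<zeta> t + h1 t)))"
      by (rule weak_deriv_mult[OF primitive_of_weak_deriv[OF Y]])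
        (intro int_factor_deriv continuous_on_mult d_cont int_factor_cont; assumption)+
    fix t assume t: "t \<in> {1<..<R}"
    show "int_factor t * (y t / int_factor t) = y t"
      using int_factor_nz[OF t] by simp
    have "(?d t * int_factor t) * (y t / int_factor t) + int_factor t * (inverse (int_factor t) * (a12 t * \<zeta> t + h1 t))
        = ?d t * y t + (a12 t * \<zeta> t + h1 t)"
      using int_factor_nz[OF t] by (simp add: field_simps)
    also have "\<dots> = (of_real (r t) * of_real (1 / p t) + exponent' t) * y t
        + ((of_real (1 / p t) - (of_real (c / t))\<^sup>2 * inverse \<mu>) * \<zeta> t - of_real (c / t) * inverse \<mu> * f2 t)"
      unfolding rp a12_eq a12_bounded_def h1 by (simp add: divide_inverse)
    also have "\<dots> = of_real (1 / p t) * z t + of_real (c / t) * y2 t"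
      unfolding y2' z exponent'_eq by (rule transformation_identities(1))
    finally show "(?d t * int_factor t) * (y t / int_factor t) + int_factor t * (inverse (int_factor t) * (a12 t * \<zeta> t + h1 t))
        = of_real (1 / p t) * z t + of_real (c / t) * y2 t" .
  qed
  have w\<zeta>: "weak_deriv 1 R \<zeta> (\<lambda>t. - ?d t * \<zeta> t + (coupling t * y t + h2 t))"
  proof (rule weak_deriv_cong)
    have "((\<lambda>t. inverse (int_factor t)) has_vector_derivative - ?d t * inverse (int_factor t)) (at t)" if t: "t \<in> {1<..<R}" for t
    proof -
      have "((inverse \<circ> int_factor) has_vector_derivative ?d t * int_factor t * - (inverse (int_factor t))\<^sup>2) (at t)"
        using DERIV_inverse[OF int_factor_nz[OF t]]
        by (intro field_vector_diff_chain_at[OF int_factor_deriv[OF t]]) (simp add: numeral_2_eq_2)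
      moreover have "?d t * int_factor t * - (inverse (int_factor t))\<^sup>2 = - ?d t * inverse (int_factor t)"
      proof -
        have "x * u * - (inverse u)\<^sup>2 = - x * inverse u" if "u \<noteq> 0" for x u :: complex
          using that by (simp add: power2_eq_square field_simps)
        then show ?thesis
          using int_factor_nz[OF t] by blast
      qed
      ultimately show ?thesis
        by (simp only: o_def)
    qed
    moreover have "continuous_on {1<..<R} (\<lambda>t. - ?d t * inverse (int_factor t))"
      using int_factor_nz by (intro continuous_on_mult continuous_on_minus d_cont continuous_on_inverse int_factor_cont) auto
    ultimately show "weak_deriv 1 R (\<lambda>t. inverse (int_factor t) * (int_factor t * \<zeta> t))
        (\<lambda>t. (- ?d t * inverse (int_factor t)) * (int_factor t * \<zeta> t) + inverse (int_factor t) * (int_factor t * (coupling t * y t + h2 t)))"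
      by (intro weak_deriv_mult[OF primitive_of_weak_deriv[OF Z]])
    fix t assume t: "t \<in> {1<..<R}"
    show "inverse (int_factor t) * (int_factor t * \<zeta> t) = \<zeta> t"
      "(- ?d t * inverse (int_factor t)) * (int_factor t * \<zeta> t) + inverse (int_factor t) * (int_factor t * (coupling t * y t + h2 t))
        = - ?d t * \<zeta> t + (coupling t * y t + h2 t)"
      using int_factor_nz[OF t] by (simp_all add: field_simps)
  qed
  have wr: "weak_deriv 1 R (\<lambda>t. of_real (r t) * y t)
      (\<lambda>t. of_real (r' t) * y t + of_real (r t) * (of_real (1 / p t) * z t + of_real (c / t) * y2 t))"
  proof (rule weak_deriv_mult[OF wy])
    show "((\<lambda>t. complex_of_real (r t)) has_vector_derivative of_real (r' t)) (at t)" if "t \<in> {1<..<R}" for t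
      using r_deriv[OF that]
      by (intro has_vector_derivative_of_real) (simp add: has_real_derivative_iff_has_vector_derivative)
    show "continuous_on {1<..<R} (\<lambda>t. complex_of_real (r' t))"
      by (intro continuous_intros r'_cont)
  qed
  show "weak_deriv 1 R z (\<lambda>t. (of_real (q1 t) - \<mu>) * y t + of_real (q2 t) * y2 t - f1 t)"
  proof (rule weak_deriv_cong[OF weak_deriv_add[OF wr w\<zeta>]])
    fix t assume t: "t \<in> {1<..<R}"
    show "of_real (r t) * y t + \<zeta> t = z t"
      by (simp add: z)
    have coupling': "coupling t = of_real (q0 t) - \<mu> + (of_real (q2 t))\<^sup>2 * inverse \<mu>
        - of_real (c / t) * of_real (q2 t) * inverse \<mu> * of_real (r t) - of_real (r t) * exponent' t"
      using t by (simp add: coupling_def a11_def divide_inverse)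
    have h2': "h2 t = (- of_real (q2 t) * inverse \<mu> + of_real (r t) * (of_real (c / t) * inverse \<mu>)) * f2 t - f1 t"
      by (simp add: h2 divide_inverse)
    have q1': "complex_of_real (q1 t) = of_real (q0 t) + of_real (r' t) + (of_real (r t))\<^sup>2 * of_real (1 / p t)"
      using q1_eq[OF t] by simp
    show "of_real (r' t) * y t + of_real (r t) * (of_real (1 / p t) * z t + of_real (c / t) * y2 t)
        + (- ?d t * \<zeta> t + (coupling t * y t + h2 t))
      = (of_real (q1 t) - \<mu>) * y t + of_real (q2 t) * y2 t - f1 t"
      unfolding rp coupling' h2' q1' y2' z exponent'_eq by (rule transformation_identities(2))
  qed
qed

text \<open>
  Integration by parts against the domain of the minimal operator: \<open>\<xi>\<close> is paired with \<open>y\<^sub>1\<close> and \<open>\<phi>\<^sub>1\<close> with \<open>z\<close>, and the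
  second row holds pointwise.
\<close>

lemma weak_solution_verified:
  assumes sq: "sq_integrable y1" "sq_integrable y2" "sq_integrable f1" "sq_integrable f2"
    and f2z: "\<And>t. t \<notin> {1<..<R} \<Longrightarrow> f2 t = 0" and y2z: "\<And>t. t \<notin> {1<..<R} \<Longrightarrow> y2 t = 0"
    and wy: "weak_deriv 1 R y1 (\<lambda>t. of_real (1 / p t) * z t + of_real (c / t) * y2 t)"
    and wz: "weak_deriv 1 R z (\<lambda>t. (of_real (q1 t) - \<mu>) * y1 t + of_real (q2 t) * y2 t - f1 t)"
    and y2: "\<And>t. t \<in> {1<..<R} \<Longrightarrow> y2 t = second y1 z t - f2 t / \<mu>"
    and mem: "(\<phi>, a) \<in> minimal_operator"
  shows "cinner (l2_class y1, l2_class y2) a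
    = cinner ((l2_class f1, l2_class f2) + \<mu> *\<^sub>C (l2_class y1, l2_class y2)) \<phi>"
proof -
  from mem obtain \<phi>1 \<phi>2 \<xi> \<xi>' a' b' \<phi>1' \<phi>1'' \<phi>2' where eq: "\<phi> = (l2_class \<phi>1, l2_class \<phi>2)"
      "a = (l2_class (\<lambda>t. - \<xi>' t + of_real (q1 t) * \<phi>1 t + of_real (q2 t) * \<phi>2 t),
        l2_class (\<lambda>t. - (of_real (c / t) * \<xi> t) + of_real (q2 t) * \<phi>1 t))"
      and ab: "1 < a'" "b' < R"
      and tp: "test_pair a' b' \<phi>1 \<phi>1'" "test_pair a' b' \<phi>1' \<phi>1''" "test_pair a' b' \<phi>2 \<phi>2'" "test_pair a' b' \<xi> \<xi>'"
      and \<xi>: "\<And>t. \<xi> t = of_real (p t) * (\<phi>1' t - of_real (c / t) * \<phi>2 t)"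
    unfolding minimal_operator_def by blast
  note sqm = minimal_operator_sq_integrable[OF ab tp(1,3,4)]
  let ?g = "\<lambda>t. of_real (1 / p t) * z t + of_real (c / t) * y2 t"
  let ?h = "\<lambda>t. (of_real (q1 t) - \<mu>) * y1 t + of_real (q2 t) * y2 t - f1 t"
  let ?A = "\<lambda>t. y1 t * cnj (- \<xi>' t + of_real (q1 t) * \<phi>1 t + of_real (q2 t) * \<phi>2 t)
    + y2 t * cnj (- (of_real (c / t) * \<xi> t) + of_real (q2 t) * \<phi>1 t)"
  let ?B = "\<lambda>t. (f1 t + \<mu> * y1 t) * cnj (\<phi>1 t) + (f2 t + \<mu> * y2 t) * cnj (\<phi>2 t)"
  note c\<xi> = test_pair_cnj[OF tp(4)] and c\<phi> = test_pair_cnj[OF tp(1)]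
  have i1: "integrable lborel (\<lambda>t. cnj (\<xi>' t) * y1 t)"
    by (rule integrable_test_mult[OF weak_deriv_loc_integrable(1)[OF wy] ab test_pair_continuous_deriv[OF c\<xi>]])
      (rule test_pair_deriv_zero[OF c\<xi>])
  have i2: "integrable lborel (\<lambda>t. cnj (\<xi> t) * ?g t)"
    by (rule integrable_test_mult[OF weak_deriv_loc_integrable(2)[OF wy] ab test_pair_continuous[OF c\<xi>]])
      (rule test_pair_zero[OF c\<xi>])
  have i3: "integrable lborel (\<lambda>t. cnj (\<phi>1' t) * z t)"
    by (rule integrable_test_mult[OF weak_deriv_loc_integrable(1)[OF wz] ab test_pair_continuous_deriv[OF c\<phi>]])
      (rule test_pair_deriv_zero[OF c\<phi>])
  have i4: "integrable lborel (\<lambda>t. cnj (\<phi>1 t) * ?h t)"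
    by (rule integrable_test_mult[OF weak_deriv_loc_integrable(2)[OF wz] ab test_pair_continuous[OF c\<phi>]])
      (rule test_pair_zero[OF c\<phi>])
  have sqB: "sq_integrable (\<lambda>t. f1 t + \<mu> * y1 t)" "sq_integrable (\<lambda>t. f2 t + \<mu> * y2 t)"
    by (intro sq_integrable_add sq_integrable_scale sq)+
  have iA: "integrable lborel ?A" and iB: "integrable lborel ?B"
    by (intro Bochner_Integration.integrable_add sq_integrable_mult sq sqm sqB)+
  have pointwise: "?A t - ?B t = - (cnj (\<xi>' t) * y1 t + cnj (\<xi> t) * ?g t) + (cnj (\<phi>1' t) * z t + cnj (\<phi>1 t) * ?h t)" for t
  proof (cases "t \<in> {1<..<R}")
    case True
    then have nz: "p t \<noteq> 0" "t \<noteq> 0"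
      using p_nz by auto
    have 2: "of_real (q2 t) * y1 t - of_real (c / t) * z t - f2 t - \<mu> * y2 t = 0"
      unfolding y2[OF True] second_def using \<mu> by (simp add: field_simps)
    have 1: "cnj (\<xi> t) * (of_real (1 / p t) * z t) = (cnj (\<phi>1' t) - of_real (c / t) * cnj (\<phi>2 t)) * z t"
      unfolding \<xi> using nz by simp
    have "?A t - ?B t - (- (cnj (\<xi>' t) * y1 t + cnj (\<xi> t) * ?g t) + (cnj (\<phi>1' t) * z t + cnj (\<phi>1 t) * ?h t))
      = cnj (\<phi>2 t) * (of_real (q2 t) * y1 t - f2 t - \<mu> * y2 t)
        + cnj (\<xi> t) * (of_real (1 / p t) * z t) - cnj (\<phi>1' t) * z t"
      by (simp add: algebra_simps del: of_real_divide)
    also have "\<dots> = cnj (\<phi>2 t) * (of_real (q2 t) * y1 t - of_real (c / t) * z t - f2 t - \<mu> * y2 t)"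
      unfolding 1 by (simp add: algebra_simps)
    finally show ?thesis
      unfolding 2 by simp
  next
    case False
    then have t: "t \<notin> {a'..b'}"
      using ab by auto
    show ?thesis
      using test_pair_zero[OF tp(1) t] test_pair_deriv_zero[OF tp(1) t] test_pair_zero[OF tp(3) t]
        test_pair_zero[OF tp(4) t] test_pair_deriv_zero[OF tp(4) t] by simp
  qed
  have "integral\<^sup>L lborel ?A - integral\<^sup>L lborel ?B = integral\<^sup>L lborel (\<lambda>t. ?A t - ?B t)"
    by (rule Bochner_Integration.integral_diff[OF iA iB, symmetric])
  also have "\<dots> = integral\<^sup>L lborel (\<lambda>t. - (cnj (\<xi>' t) * y1 t + cnj (\<xi> t) * ?g t) + (cnj (\<phi>1' t) * z t + cnj (\<phi>1 t) * ?h t))"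
    unfolding pointwise ..
  also have "\<dots> = - (integral\<^sup>L lborel (\<lambda>t. cnj (\<xi>' t) * y1 t) + integral\<^sup>L lborel (\<lambda>t. cnj (\<xi> t) * ?g t))
      + (integral\<^sup>L lborel (\<lambda>t. cnj (\<phi>1' t) * z t) + integral\<^sup>L lborel (\<lambda>t. cnj (\<phi>1 t) * ?h t))"
    by (simp only: Bochner_Integration.integral_add Bochner_Integration.integral_minus integrable_minus
        Bochner_Integration.integrable_add i1 i2 i3 i4)
  also have "\<dots> = 0"
    unfolding weak_derivD[OF wy ab c\<xi>] weak_derivD[OF wz ab c\<phi>] by simp
  finally have "integral\<^sup>L lborel ?A = integral\<^sup>L lborel ?B"
    by simp
  moreover have "(l2_class f1, l2_class f2) + \<mu> *\<^sub>C (l2_class y1, l2_class y2)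
      = (l2_class (\<lambda>t. f1 t + \<mu> * y1 t), l2_class (\<lambda>t. f2 t + \<mu> * y2 t))"
    using sq by (simp add: scaleC_prod_def scaleC_l2_class plus_l2_class sq_integrable_scale)
  ultimately show ?thesis
    unfolding eq by (simp only: cinner_l2_pair sq sqm sqB)
qed

text \<open>
  A bounded right inverse of \<open>A\<^sub>0\<^sup>* - \<mu>\<close>. The second row with the inhomogeneity \<open>f\<^sub>2\<close> eliminates \<open>y\<^sub>2\<close> up to the
  square-integrable term \<open>f\<^sub>2 / \<mu>\<close>; the remaining unknowns are bounded functions on a bounded interval, hence
  square-integrable, with all bounds linear in the norm of \<open>f\<close>.
\<close>

lemma bounded_solution:
  "\<exists>K. \<forall>f\<in>stellar_space R. \<exists>y\<in>stellar_space R. norm y \<le> K * norm f \<and>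
    (\<forall>(\<phi>, a) \<in> minimal_operator. cinner y a = cinner (f + \<mu> *\<^sub>C y) \<phi>)"
proof -
  obtain D where D: "0 \<le> D" and sol: "\<And>h1 h2. sq_integrable h1 \<Longrightarrow> sq_integrable h2 \<Longrightarrow>
    \<exists>y \<zeta>. continuous_on {1<..<R} y \<and> continuous_on {1<..<R} \<zeta> \<and>
      (\<forall>t\<in>{1<..<R}. cmod (y t) \<le> D * (norm (l2_class h1) + norm (l2_class h2)) \<and>
        cmod (\<zeta> t) \<le> D * (norm (l2_class h1) + norm (l2_class h2))) \<and>
      primitive_of 1 R (\<lambda>t. inverse (int_factor t) * (a12 t * \<zeta> t + h1 t)) (\<lambda>t. y t / int_factor t) \<and>
      primitive_of 1 R (\<lambda>t. int_factor t * (coupling t * y t + h2 t)) (\<lambda>t. int_factor t * \<zeta> t)"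
    using endpoint_system.solvable[OF endpoint] by blast
  have m0: "0 < cmod \<mu>"
    using \<mu> by simp
  define G where "G = c / cmod \<mu> + ((C / cmod \<mu> + C * (c / cmod \<mu>)) + 1)"
  have G0: "0 \<le> G"
    using c C_pos by (simp add: G_def)
  define K1 where "K1 = D * G"
  define K2 where "K2 = (C * K1 + c * (C * K1 + K1)) / cmod \<mu>"
  have K0: "0 \<le> K1" "0 \<le> K2"
    using D G0 c C_pos by (auto simp: K1_def K2_def)
  define K where "K = K1 * sqrt (R - 1) + (K2 * sqrt (R - 1) + 1 / cmod \<mu>)"
  have ct: "\<bar>c / t\<bar> \<le> c" if "t \<in> {1<..<R}" for t
    using that c by (simp add: field_simps)
  have "\<exists>y\<in>stellar_space R. norm y \<le> K * norm f \<and>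
    (\<forall>(\<phi>, a) \<in> minimal_operator. cinner y a = cinner (f + \<mu> *\<^sub>C y) \<phi>)" if f: "f \<in> stellar_space R" for f
  proof -
    obtain f1 f2 where f1: "sq_integrable f1" "\<And>t. t \<notin> {1<..<R} \<Longrightarrow> f1 t = 0"
        and f2: "sq_integrable f2" "\<And>t. t \<notin> {1<..<R} \<Longrightarrow> f2 t = 0"
        and ff: "f = (l2_class f1, l2_class f2)"
      using f unfolding stellar_space_def by (auto elim!: l2_on_cases)
    have n1: "norm (l2_class f1) \<le> norm f" and n2: "norm (l2_class f2) \<le> norm f"
      using norm_fst_le[of "l2_class f1" "l2_class f2"] norm_snd_le[of "l2_class f2" "l2_class f1"] by (simp_all add: ff)
    define h1 where "h1 = (\<lambda>t. - of_real (c / t) / \<mu> * f2 t)"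
    define d2 where "d2 = (\<lambda>t. - of_real (q2 t) / \<mu> + of_real (r t) * (of_real (c / t) / \<mu>))"
    define h2 where "h2 = (\<lambda>t. d2 t * f2 t - f1 t)"
    have h1: "sq_integrable h1" "norm (l2_class h1) \<le> c / cmod \<mu> * norm (l2_class f2)"
    proof -
      have 1: "continuous_on {1<..<R} (\<lambda>t. - complex_of_real (c / t) / \<mu>)"
        using \<mu> by (intro continuous_on_divide continuous_on_minus complex_coeff_cont continuous_on_const) auto
      have 2: "cmod (- complex_of_real (c / t) / \<mu>) \<le> c / cmod \<mu>" if "t \<in> {1<..<R}" for t
        unfolding norm_divide norm_minus_cancel norm_of_real using ct[OF that] by (intro divide_right_mono) auto
      have 3: "0 \<le> c / cmod \<mu>"
        using c by simp
      show "sq_integrable h1"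
        unfolding h1_def by (rule sq_integrable_bounded_mult(1)[OF 1 _ 3 f2(1)]) (fact 2 f2(2))+
      show "norm (l2_class h1) \<le> c / cmod \<mu> * norm (l2_class f2)"
        unfolding h1_def by (rule sq_integrable_bounded_mult(2)[OF 1 _ 3 f2(1)]) (fact 2 f2(2))+
    qed
    have d2: "sq_integrable (\<lambda>t. d2 t * f2 t)"
      "norm (l2_class (\<lambda>t. d2 t * f2 t)) \<le> (C / cmod \<mu> + C * (c / cmod \<mu>)) * norm (l2_class f2)"
    proof -
      have 1: "continuous_on {1<..<R} d2"
        unfolding d2_def using \<mu>
        by (intro continuous_on_add continuous_on_mult continuous_on_divide continuous_on_minus
            complex_coeff_cont continuous_on_const continuous_on_of_real r_cont) auto
      have 2: "cmod (d2 t) \<le> C / cmod \<mu> + C * (c / cmod \<mu>)" if t: "t \<in> {1<..<R}" for t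
      proof -
        have "cmod (- of_real (q2 t) / \<mu>) \<le> C / cmod \<mu>"
          unfolding norm_divide norm_minus_cancel norm_of_real using q2_le[OF t] by (intro divide_right_mono) auto
        moreover have "cmod (of_real (r t) * (of_real (c / t) / \<mu>)) \<le> C * (c / cmod \<mu>)"
          unfolding norm_mult norm_divide norm_of_real using ct[OF t] r_le[OF t] C_pos
          by (intro mult_mono divide_right_mono) auto
        ultimately show ?thesis
          unfolding d2_def by (intro norm_triangle_le) linarith
      qed
      have 3: "0 \<le> C / cmod \<mu> + C * (c / cmod \<mu>)"
        using c C_pos by simp
      show "sq_integrable (\<lambda>t. d2 t * f2 t)"
        by (rule sq_integrable_bounded_mult(1)[OF 1 _ 3 f2(1)]) (use 2 f2 in auto)
      show "norm (l2_class (\<lambda>t. d2 t * f2 t)) \<le> (C / cmod \<mu> + C * (c / cmod \<mu>)) * norm (l2_class f2)"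
        by (rule sq_integrable_bounded_mult(2)[OF 1 _ 3 f2(1)]) (use 2 f2 in auto)
    qed
    have sqh2: "sq_integrable h2"
      unfolding h2_def by (rule sq_integrable_diff[OF d2(1) f1(1)])
    have "norm (l2_class h2) \<le> norm (l2_class (\<lambda>t. d2 t * f2 t)) + norm (l2_class f1)"
      unfolding h2_def minus_l2_class[OF d2(1) f1(1), symmetric] by (rule norm_triangle_ineq4)
    also have "\<dots> \<le> (C / cmod \<mu> + C * (c / cmod \<mu>)) * norm f + 1 * norm f"
      using d2(2) n1 n2 c C_pos m0
      by (intro add_mono order_trans[OF d2(2)] mult_left_mono) auto
    finally have nh2: "norm (l2_class h2) \<le> ((C / cmod \<mu> + C * (c / cmod \<mu>)) + 1) * norm f"
      by (simp add: algebra_simps)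
    have "norm (l2_class h1) \<le> c / cmod \<mu> * norm f"
      by (rule order_trans[OF h1(2)]) (use n2 c m0 in \<open>intro mult_left_mono, auto\<close>)
    then have NG: "norm (l2_class h1) + norm (l2_class h2) \<le> G * norm f"
      using nh2 by (simp add: G_def algebra_simps)
    obtain y \<zeta> where y: "continuous_on {1<..<R} y" and \<zeta>: "continuous_on {1<..<R} \<zeta>"
        and bd: "\<And>t. t \<in> {1<..<R} \<Longrightarrow> cmod (y t) \<le> D * (norm (l2_class h1) + norm (l2_class h2))"
          "\<And>t. t \<in> {1<..<R} \<Longrightarrow> cmod (\<zeta> t) \<le> D * (norm (l2_class h1) + norm (l2_class h2))"
        and Y: "primitive_of 1 R (\<lambda>t. inverse (int_factor t) * (a12 t * \<zeta> t + h1 t)) (\<lambda>t. y t / int_factor t)"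
        and Z: "primitive_of 1 R (\<lambda>t. int_factor t * (coupling t * y t + h2 t)) (\<lambda>t. int_factor t * \<zeta> t)"
      using sol[OF h1(1) sqh2] by blast
    define B where "B = K1 * norm f"
    have B0: "0 \<le> B"
      using K0 by (simp add: B_def)
    have DB: "D * (norm (l2_class h1) + norm (l2_class h2)) \<le> B"
      using mult_left_mono[OF NG D] by (simp add: B_def K1_def mult.assoc)
    have yB: "cmod (y t) \<le> B" and \<zeta>B: "cmod (\<zeta> t) \<le> B" if "t \<in> {1<..<R}" for t
      using bd[OF that] DB by linarith+
    define z where "z = (\<lambda>t. of_real (r t) * y t + \<zeta> t)"
    have z_cont: "continuous_on {1<..<R} z"
      unfolding z_def by (intro continuous_intros r_cont y \<zeta>)
    have zB: "cmod (z t) \<le> C * B + B" if t: "t \<in> {1<..<R}" for t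
    proof -
      have "cmod (of_real (r t) * y t) \<le> C * B"
        unfolding norm_mult norm_of_real using r_le[OF t] yB[OF t] C_pos by (intro mult_mono) auto
      then show ?thesis
        unfolding z_def using \<zeta>B[OF t] by (intro norm_triangle_le add_mono)
    qed
    have s_cont: "continuous_on {1<..<R} (second y z)"
      unfolding second_def[abs_def] using \<mu>
      by (intro continuous_on_divide continuous_on_diff continuous_on_mult complex_coeff_cont y z_cont
          continuous_on_const) auto
    have sB: "cmod (second y z t) \<le> K2 * norm f" if t: "t \<in> {1<..<R}" for t
    proof -
      have "cmod (of_real (q2 t) * y t) \<le> C * B"
        unfolding norm_mult norm_of_real using q2_le[OF t] yB[OF t] C_pos by (intro mult_mono) auto
      moreover have "cmod (of_real (c / t) * z t) \<le> c * (C * B + B)"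
        unfolding norm_mult norm_of_real using ct[OF t] zB[OF t] c by (intro mult_mono) auto
      ultimately have "cmod (of_real (q2 t) * y t - of_real (c / t) * z t) \<le> C * B + c * (C * B + B)"
        by (intro order_trans[OF norm_triangle_ineq4] add_mono)
      then have "cmod (second y z t) \<le> (C * B + c * (C * B + B)) / cmod \<mu>"
        unfolding second_def norm_divide by (intro divide_right_mono) auto
      also have "\<dots> = K2 * norm f"
        unfolding K2_def B_def by (simp add: algebra_simps)
      finally show ?thesis .
    qed
    define y1 where "y1 = (\<lambda>t. if t \<in> {1<..<R} then y t else 0)"
    define u2 where "u2 = (\<lambda>t. if t \<in> {1<..<R} then second y z t else 0)"
    define y2 where "y2 = (\<lambda>t. u2 t - (1 / \<mu>) * f2 t)"
    have y1: "sq_integrable y1" "norm (l2_class y1) \<le> B * sqrt (R - 1)"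
      unfolding y1_def using sq_integrable_bounded[OF R y yB B0] by simp_all
    have u2: "sq_integrable u2" "norm (l2_class u2) \<le> K2 * norm f * sqrt (R - 1)"
      unfolding u2_def using sq_integrable_bounded[OF R s_cont sB] K0 by simp_all
    have sqf: "sq_integrable (\<lambda>t. (1 / \<mu>) * f2 t)"
      by (rule sq_integrable_scale[OF f2(1)])
    have sqy2: "sq_integrable y2"
      unfolding y2_def by (rule sq_integrable_diff[OF u2(1) sqf])
    have "norm (l2_class y2) \<le> norm (l2_class u2) + norm ((1 / \<mu>) *\<^sub>C l2_class f2)"
      unfolding y2_def minus_l2_class[OF u2(1) sqf, symmetric] scaleC_l2_class[OF f2(1)]
      by (rule norm_triangle_ineq4)
    also have "norm ((1 / \<mu>) *\<^sub>C l2_class f2) \<le> 1 / cmod \<mu> * norm f"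
      unfolding norm_scaleC norm_divide norm_one using n2 m0 by (intro mult_left_mono) auto
    finally have ny2: "norm (l2_class y2) \<le> (K2 * sqrt (R - 1) + 1 / cmod \<mu>) * norm f"
      using u2(2) by (simp add: algebra_simps)
    have "norm (l2_class y1, l2_class y2) \<le> norm (l2_class y1) + norm (l2_class y2)"
      by (rule norm_Pair_le)
    also have "\<dots> \<le> K * norm f"
      using y1(2) ny2 by (simp add: K_def B_def algebra_simps)
    finally have nK: "norm (l2_class y1, l2_class y2) \<le> K * norm f" .
    have y2z: "y2 t = 0" if "t \<notin> {1<..<R}" for t
      using that f2(2)[OF that] by (auto simp: y2_def u2_def)
    have y1z: "y1 t = 0" if "t \<notin> {1<..<R}" for t
      using that by (auto simp: y1_def)
    have eqI: "y t = y1 t" "second y z t - f2 t / \<mu> = y2 t" if "t \<in> {1<..<R}" for t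
      using that by (auto simp: y1_def y2_def u2_def)
    have wd: "weak_deriv 1 R y (\<lambda>t. of_real (1 / p t) * z t + of_real (c / t) * (second y z t - f2 t / \<mu>))"
      "weak_deriv 1 R z (\<lambda>t. (of_real (q1 t) - \<mu>) * y t + of_real (q2 t) * (second y z t - f2 t / \<mu>) - f1 t)"
      by (rule weak_derivatives[OF Y Z, where ?f2.0 = f2 and ?f1.0 = f1]; simp add: h1_def h2_def d2_def z_def)+
    have wy: "weak_deriv 1 R y1 (\<lambda>t. of_real (1 / p t) * z t + of_real (c / t) * y2 t)"
      by (rule weak_deriv_cong[OF wd(1)]) (simp_all only: eqI)
    have wz: "weak_deriv 1 R z (\<lambda>t. (of_real (q1 t) - \<mu>) * y1 t + of_real (q2 t) * y2 t - f1 t)"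
      by (rule weak_deriv_cong[OF wd(2)]) (simp_all only: eqI)
    have y2eq: "y2 t = second y1 z t - f2 t / \<mu>" if "t \<in> {1<..<R}" for t
      using eqI[OF that] by (simp add: second_def)
    have "(l2_class y1, l2_class y2) \<in> stellar_space R"
      unfolding stellar_space_def l2_on_def using y1(1) sqy2 y1z y2z by blast
    then show ?thesis
      using nK weak_solution_verified[OF y1(1) sqy2 f1(1) f2(1) f2(2) y2z wy wz y2eq] unfolding ff by blast
  qed
  then show ?thesis
    by blast
qed

end

section \<open>The point 0\<close>

lemma sq_integrable_test_pair:
  assumes "test_pair a b \<psi> \<psi>'"
  shows "sq_integrable \<psi>" "sq_integrable \<psi>'"
  using test_pair_continuous[OF assms] test_pair_continuous_deriv[OF assms]
    test_pair_zero[OF assms] test_pair_deriv_zero[OF assms]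
  by (auto intro!: sq_integrable_compact_support[of a b] intro: continuous_on_subset)

lemma test_pair_endpoint:
  assumes \<psi>: "test_pair a b \<psi> \<psi>'"
  shows "\<psi> a = 0" "\<psi> b = 0"
proof -
  have *: "\<psi> t = 0" if "t \<in> {a, b}" for t
  proof (rule LIMSEQ_unique)
    define e :: real where "e = (if t = a \<and> t < b then - 1 else if t = b then 1 else - 1)"
    have e: "t + e / Suc n \<notin> {a..b}" for n
      using that by (auto simp: e_def field_simps split: if_splits)
    have "(\<lambda>n. e * (1 / Suc n)) \<longlonglongrightarrow> e * 0"
      by (intro tendsto_mult tendsto_const LIMSEQ_Suc[OF lim_1_over_n])
    then have "(\<lambda>n. t + e / Suc n) \<longlonglongrightarrow> t + 0"
      by (intro tendsto_add tendsto_const) simp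
    then have "(\<lambda>n. \<psi> (t + e / Suc n)) \<longlonglongrightarrow> \<psi> (t + 0)"
      using test_pair_continuous[OF \<psi>]
      by (intro isCont_tendsto_compose[of _ \<psi>]) (auto simp: continuous_on_eq_continuous_at)
    moreover have "(\<lambda>n. \<psi> (t + e / Suc n)) = (\<lambda>n. 0)"
      by (intro ext test_pair_zero[OF \<psi> e])
    ultimately show "(\<lambda>n. 0) \<longlonglongrightarrow> \<psi> t"
      by (simp only: add_0_right)
  qed (rule tendsto_const)
  show "\<psi> a = 0" "\<psi> b = 0"
    by (simp_all add: *)
qed

lemma Poincare_inequality:
  assumes \<psi>: "test_pair a b \<psi> \<psi>'" and ab: "a < b"
  shows "norm (l2_class \<psi>) \<le> (b - a) * norm (l2_class \<psi>')"
proof -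
  let ?N = "norm (l2_class \<psi>')"
  note c' = test_pair_continuous_deriv[OF \<psi>]
  have le: "cmod (\<psi> t) \<le> sqrt (b - a) * ?N" if t: "t \<in> {a<..<b}" for t
  proof -
    have "(\<psi>' has_integral \<psi> t - \<psi> a) {a..t}"
      using t test_pair_deriv[OF \<psi>]
      by (intro fundamental_theorem_of_calculus) (auto intro: has_vector_derivative_at_within)
    then have "cmod (\<psi> t) = cmod (integral {a..t} \<psi>')"
      by (simp add: test_pair_endpoint[OF \<psi>] integral_unique)
    also have "\<dots> \<le> integral {a..t} (\<lambda>x. cmod (\<psi>' x))"
      by (intro integral_norm_bound_integral integrable_continuous_real continuous_intros
          continuous_on_subset[OF c']) auto
    also have "\<dots> \<le> sqrt (t - a) * ?N"
      using t by (intro integral_cmod_le_l2 sq_integrable_test_pair[OF \<psi>]) auto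
    also have "\<dots> \<le> sqrt (b - a) * ?N"
      using t by (intro mult_right_mono) auto
    finally show ?thesis .
  qed
  have "(\<lambda>t. if t \<in> {a<..<b} then \<psi> t else 0) = \<psi>"
  proof
    fix t
    show "(if t \<in> {a<..<b} then \<psi> t else 0) = \<psi> t"
      using test_pair_endpoint[OF \<psi>] test_pair_zero[OF \<psi>, of t] by (cases "t = a \<or> t = b") auto
  qed
  moreover have "norm (l2_class (\<lambda>t. if t \<in> {a<..<b} then \<psi> t else 0)) \<le> sqrt (b - a) * ?N * sqrt (b - a)"
    by (rule sq_integrable_bounded(2)[OF ab continuous_on_subset[OF test_pair_continuous[OF \<psi>] subset_UNIV]])
      (use le ab in auto)
  ultimately have "norm (l2_class \<psi>) \<le> sqrt (b - a) * ?N * sqrt (b - a)"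
    by (simp only:)
  also have "\<dots> = (b - a) * ?N"
    using ab by (simp add: mult.commute mult.left_commute)
  finally show ?thesis .
qed

locale regular_matrix = degenerate_matrix +
  fixes q2' :: "real \<Rightarrow> real"
  assumes q2_deriv: "\<And>t. t \<in> {1<..<R} \<Longrightarrow> (q2 has_real_derivative q2' t) (at t)"
    and q2'_cont: "continuous_on {1<..<R} q2'"
begin

text \<open>
  Given \<open>\<phi>\<^sub>1\<close>, choosing \<open>\<phi>\<^sub>2 = (t/c) (\<phi>\<^sub>1' - h \<phi>\<^sub>1)\<close> with \<open>h = t q\<^sub>2 / (c p)\<close> makes the second
  row of the operator vanish and the first row a multiplication operator applied to \<open>\<phi>\<^sub>1\<close>; all
  derivatives of \<open>\<phi>\<^sub>1\<close> cancel. On short intervals \<open>\<phi>\<^sub>2\<close> dominates \<open>\<phi>\<^sub>1\<close> by the Poincare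
  inequality, so the image becomes small relative to the vector.
\<close>

lemma small_image:
  assumes uv: "1 < u" "u < v" "v < R" and \<epsilon>: "0 < \<epsilon>"
  shows "\<exists>f g z. ((l2_class f, l2_class g), z) \<in> minimal_operator \<and> sq_integrable f \<and> sq_integrable g \<and>
    (\<forall>t. t \<notin> {u..v} \<longrightarrow> f t = 0 \<and> g t = 0) \<and> 0 < norm (l2_class f, l2_class g) \<and>
    norm z \<le> \<epsilon> * norm (l2_class f, l2_class g)"
proof -
  have uvI: "{u..v} \<subseteq> {1<..<R}"
    using uv by auto
  define h where "h = (\<lambda>t. complex_of_real (t * q2 t / (c * p t)))"
  define M where "M = (\<lambda>t. complex_of_real (q1 t - (q2' t * t + q2 t) / c - (q2 t)\<^sup>2 * t\<^sup>2 / (c\<^sup>2 * p t)))"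
  have h_cont: "continuous_on {1<..<R} h"
    unfolding h_def using p_nz c by (intro continuous_intros q2_cont p_cont) auto
  have M_cont: "continuous_on {1<..<R} M"
    unfolding M_def using p_nz c by (intro continuous_intros q1_cont q2'_cont q2_cont p_cont) auto
  obtain H where H': "\<forall>t\<in>{u..v}. cmod (h t) \<le> H"
    using continuous_bounded_on_Icc[OF continuous_on_subset[OF h_cont uvI]] by blast
  obtain M0 where M0': "\<forall>t\<in>{u..v}. cmod (M t) \<le> M0"
    using continuous_bounded_on_Icc[OF continuous_on_subset[OF M_cont uvI]] by blast
  have H: "cmod (h t) \<le> H" and M0: "cmod (M t) \<le> M0" if "t \<in> {u..v}" for t
    using that H' M0' by blast+
  have H0: "0 \<le> H" and M00: "0 \<le> M0"
    using order_trans[OF norm_ge_zero H[of u]] order_trans[OF norm_ge_zero M0[of u]] uv by auto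
  \<comment> \<open>the length of the support: \<open>(1 / w - H) / c\<close> bounds the ratio of the two components from below\<close>
  define L where "L = H + c * (1 + M0 / \<epsilon>)"
  have L: "0 < L"
    using H0 M00 c \<epsilon> by (simp add: L_def add_nonneg_pos add_pos_nonneg)
  define w where "w = min (v - u) (1 / L)"
  have w: "0 < w" "u + w \<le> v" "L \<le> 1 / w"
  proof -
    show w: "0 < w" "u + w \<le> v"
      using uv L by (auto simp: w_def)
    have "w \<le> 1 / L"
      by (simp add: w_def)
    then show "L \<le> 1 / w"
      using w L by (simp add: field_simps)
  qed
  define b where "b = u + w"
  have b: "u < b" "b \<le> v" "b - u = w" "b < R"
    using w uv by (auto simp: b_def)
  note ub = uv(1) b(4)
  define \<beta> \<beta>' \<beta>'' where "\<beta> = (\<lambda>t. complex_of_real (bump u b t))"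
    and "\<beta>' = (\<lambda>t. complex_of_real (bump' u b t))" and "\<beta>'' = (\<lambda>t. complex_of_real (bump'' u b t))"
  have \<beta>: "test_pair u b \<beta> \<beta>'" "test_pair u b \<beta>' \<beta>''"
    unfolding \<beta>_def \<beta>'_def \<beta>''_def by (rule test_pair_bump[OF b(1)])+
  note sq\<beta> = sq_integrable_test_pair[OF \<beta>(1)]
  have rd: "((\<lambda>t. complex_of_real (k t)) has_vector_derivative of_real (k' t)) (at t)"
    if "(k has_real_derivative k' t) (at t)" for k k' t
    using that by (intro has_vector_derivative_of_real) (simp add: has_real_derivative_iff_has_vector_derivative)
  \<comment> \<open>\<open>h \<beta>\<close> and \<open>p h \<beta> = (t q\<^sub>2 / c) \<beta>\<close> as test functions\<close>
  have h_deriv: "(h has_vector_derivative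
      of_real (((q2 t + t * q2' t) * (c * p t) - t * q2 t * (c * p' t)) / (c * p t)\<^sup>2)) (at t)"
    if t: "t \<in> {1<..<R}" for t
    unfolding h_def using p_nz[OF t] c t
    by (intro rd) (auto intro!: derivative_eq_intros p_deriv q2_deriv simp: power2_eq_square)
  have h'_cont: "continuous_on {1<..<R}
      (\<lambda>t. complex_of_real (((q2 t + t * q2' t) * (c * p t) - t * q2 t * (c * p' t)) / (c * p t)\<^sup>2))"
    using p_nz c by (intro continuous_intros q2_cont q2'_cont p_cont p'_cont) auto
  obtain hb' where hb: "test_pair u b (\<lambda>t. h t * \<beta> t) hb'"
    using test_pair_mult[OF \<beta>(1) ub h_deriv h'_cont] by blast
  have t_deriv: "((\<lambda>t. complex_of_real (t / c)) has_vector_derivative of_real (1 / c)) (at t)" for t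
    using c by (intro rd) (auto intro!: derivative_eq_intros)
  define \<phi>2 where "\<phi>2 = (\<lambda>t. complex_of_real (t / c) * (\<beta>' t - h t * \<beta> t))"
  obtain \<phi>2' where \<phi>2: "test_pair u b \<phi>2 \<phi>2'"
    using test_pair_mult[OF test_pair_diff[OF \<beta>(2) hb] ub t_deriv continuous_on_const] unfolding \<phi>2_def by blast
  define \<xi> where "\<xi> = (\<lambda>t. complex_of_real (t * q2 t / c) * \<beta> t)"
  define \<xi>' where "\<xi>' = (\<lambda>t. complex_of_real ((q2 t + t * q2' t) / c) * \<beta> t + complex_of_real (t * q2 t / c) * \<beta>' t)"
  have \<xi>: "test_pair u b \<xi> \<xi>'"
    unfolding \<xi>_def \<xi>'_def
  proof (rule test_pair_mult[OF \<beta>(1) ub])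
    show "((\<lambda>t. complex_of_real (t * q2 t / c)) has_vector_derivative of_real ((q2 t + t * q2' t) / c)) (at t)"
      if t: "t \<in> {1<..<R}" for t
      using c t by (intro rd) (auto intro!: derivative_eq_intros q2_deriv)
    show "continuous_on {1<..<R} (\<lambda>t. complex_of_real ((q2 t + t * q2' t) / c))"
      using c by (intro continuous_intros q2_cont q2'_cont) auto
  qed
  have zero: "\<beta> t = 0 \<and> \<beta>' t = 0" if "t \<notin> {1<..<R}" for t
  proof -
    have "t \<notin> {u..b}"
      using that ub by auto
    then show ?thesis
      using test_pair_zero[OF \<beta>(1)] test_pair_zero[OF \<beta>(2)] by blast
  qed
  have \<xi>eq: "\<xi> t = of_real (p t) * (\<beta>' t - of_real (c / t) * \<phi>2 t)" for t
  proof (cases "t \<in> {1<..<R}")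
    case True
    then have "p t \<noteq> 0" "t \<noteq> 0"
      using p_nz by auto
    then show ?thesis
      unfolding \<xi>_def \<phi>2_def h_def using c by (simp add: field_simps)
  qed (simp add: \<xi>_def \<phi>2_def zero)
  note mem = minimal_operatorI[OF ub \<beta> \<phi>2 \<xi> \<xi>eq]
  have first: "- \<xi>' t + of_real (q1 t) * \<beta> t + of_real (q2 t) * \<phi>2 t = M t * \<beta> t" for t
  proof (cases "t \<in> {1<..<R}")
    case True
    then have "p t \<noteq> 0" "t \<noteq> 0"
      using p_nz by auto
    then show ?thesis
      unfolding \<xi>'_def \<phi>2_def h_def M_def using c by (simp add: field_simps power2_eq_square)
  qed (simp add: \<xi>'_def \<phi>2_def zero)
  have second: "- (of_real (c / t) * \<xi> t) + of_real (q2 t) * \<beta> t = 0" for t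
    by (cases "t \<in> {1<..<R}") (use c in \<open>auto simp: \<xi>_def zero\<close>)
  have mem': "((l2_class \<beta>, l2_class \<phi>2), (l2_class (\<lambda>t. M t * \<beta> t), 0)) \<in> minimal_operator"
    using mem unfolding first second zero_l2_class[symmetric] .
  have sq2: "sq_integrable \<phi>2"
    by (rule sq_integrable_test_pair(1)[OF \<phi>2])
  let ?N = "norm (l2_class \<beta>)"
  have \<beta>end: "\<beta> t = 0" if "t \<notin> {u<..<b}" for t
    using that bump_zero[of t u b] b(1) by (simp add: \<beta>_def)
  have ubI: "{u<..<b} \<subseteq> {1<..<R}"
    using ub by auto
  have Mle: "norm (l2_class (\<lambda>t. M t * \<beta> t)) \<le> M0 * ?N"
    by (rule sq_integrable_bounded_mult(2)[OF continuous_on_subset[OF M_cont ubI] _ M00 sq\<beta>(1)])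
      (use M0 b \<beta>end in auto)
  have hle: "sq_integrable (\<lambda>t. h t * \<beta> t)" "norm (l2_class (\<lambda>t. h t * \<beta> t)) \<le> H * ?N"
    by (rule sq_integrable_bounded_mult[OF continuous_on_subset[OF h_cont ubI] _ H0 sq\<beta>(1)];
        use H b \<beta>end in auto)+
  have "\<beta> t = 0" if "l2_class \<beta> = 0" for t
  proof -
    have "AE t in lborel. \<beta> t = 0"
      using that l2_class_eq_iff[OF sq\<beta>(1), of "\<lambda>_. 0"] by (simp add: zero_l2_class sq_integrable_def)
    then have "AE t in lborel. t \<notin> {u<..<b}"
    proof eventually_elim
      fix t assume "\<beta> t = 0"
      then show "t \<notin> {u<..<b}"
        using bump_pos[of t u b] by (auto simp: \<beta>_def)
    qed
    then have "{u<..<b} \<in> null_sets lborel"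
      by (subst AE_iff_null_sets) auto
    then show ?thesis
      using b(1) by (auto simp: null_sets_def)
  qed
  moreover have "\<beta> ((u + b) / 2) \<noteq> 0"
    using bump_pos[of "(u + b) / 2" u b] b(1) by (auto simp: \<beta>_def)
  ultimately have N: "0 < ?N"
    by auto
  have "?N \<le> w * norm (l2_class \<beta>')"
    using Poincare_inequality[OF \<beta>(1) b(1)] by (simp add: b)
  then have "1 / w * ?N \<le> norm (l2_class \<beta>')"
    using w(1) by (simp add: field_simps)
  also have "norm (l2_class \<beta>') \<le> norm (l2_class (\<lambda>t. \<beta>' t - h t * \<beta> t)) + norm (l2_class (\<lambda>t. h t * \<beta> t))"
    unfolding minus_l2_class[OF sq\<beta>(2) hle(1), symmetric]
    by (metis diff_add_cancel norm_triangle_ineq)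
  also have "norm (l2_class (\<lambda>t. \<beta>' t - h t * \<beta> t)) \<le> c * norm (l2_class \<phi>2)"
  proof -
    have eq: "(\<lambda>t. \<beta>' t - h t * \<beta> t) = (\<lambda>t. complex_of_real (c / t) * \<phi>2 t)"
    proof
      fix t
      show "\<beta>' t - h t * \<beta> t = complex_of_real (c / t) * \<phi>2 t"
        using c zero[of t] by (cases "t \<in> {1<..<R}") (auto simp: \<phi>2_def)
    qed
    have "\<phi>2 t = 0" if "t \<notin> {1<..<R}" for t
      using zero[OF that] by (simp add: \<phi>2_def)
    moreover have "cmod (complex_of_real (c / t)) \<le> c" if "t \<in> {1<..<R}" for t
      unfolding norm_of_real using that c by (simp add: field_simps)
    ultimately show ?thesis
      unfolding eq using c sq2
      by (intro sq_integrable_bounded_mult(2)[OF complex_coeff_cont(4)]) auto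
  qed
  finally have "1 / w * ?N \<le> c * norm (l2_class \<phi>2) + H * ?N"
    using hle(2) by linarith
  moreover have "L * ?N \<le> 1 / w * ?N"
    using w(3) by (intro mult_right_mono) auto
  ultimately have "c * ((1 + M0 / \<epsilon>) * ?N) \<le> c * norm (l2_class \<phi>2)"
    unfolding L_def by (simp only: distrib_right mult.assoc)
  then have ratio: "(1 + M0 / \<epsilon>) * ?N \<le> norm (l2_class \<phi>2)"
    using c by simp
  have n2: "norm (l2_class \<phi>2) \<le> norm (l2_class \<beta>, l2_class \<phi>2)"
    by (rule norm_snd_le)
  have "norm (l2_class (\<lambda>t. M t * \<beta> t), 0 :: l2) = norm (l2_class (\<lambda>t. M t * \<beta> t))"
    by simp
  also have "\<dots> \<le> \<epsilon> * ((M0 / \<epsilon>) * ?N)"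
    using Mle \<epsilon> by simp
  also have "\<dots> \<le> \<epsilon> * ((1 + M0 / \<epsilon>) * ?N)"
    using \<epsilon> N by (intro mult_left_mono mult_right_mono) auto
  also have "\<dots> \<le> \<epsilon> * norm (l2_class \<beta>, l2_class \<phi>2)"
    using ratio n2 \<epsilon> by (intro mult_left_mono) auto
  finally have "norm (l2_class (\<lambda>t. M t * \<beta> t), 0 :: l2) \<le> \<epsilon> * norm (l2_class \<beta>, l2_class \<phi>2)" .
  moreover have "0 < norm (l2_class \<beta>, l2_class \<phi>2)"
    using N norm_fst_le[of "l2_class \<beta>" "l2_class \<phi>2"] by linarith
  moreover have "\<forall>t. t \<notin> {u..v} \<longrightarrow> \<beta> t = 0 \<and> \<phi>2 t = 0"
    using test_pair_zero[OF \<beta>(1)] test_pair_zero[OF \<phi>2] b by auto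
  ultimately show ?thesis
    using mem' sq\<beta>(1) sq2 by blast
qed

lemma closed_stellar_space: "closed (stellar_space R)" and subspace_stellar_space: "complex_vector.subspace (stellar_space R)"
proof -
  show "closed (stellar_space R)"
    unfolding stellar_space_def by (intro closed_Times closed_l2_on) auto
  have s: "complex_vector.subspace (l2_on {1<..<R})"
    by (rule subspace_l2_on)
  show "complex_vector.subspace (stellar_space R)"
  proof (rule complex_vector.subspaceI)
    show "0 \<in> stellar_space R"
      using complex_vector.subspace_0[OF s] by (simp add: stellar_space_def zero_prod_def)
    show "x + y \<in> stellar_space R" if "x \<in> stellar_space R" "y \<in> stellar_space R" for x y
      using that complex_vector.subspace_add[OF s] by (simp add: stellar_space_def mem_Times_iff)
    show "k *\<^sub>C x \<in> stellar_space R" if "x \<in> stellar_space R" for k x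
      using that complex_vector.subspace_scale[OF s] by (simp add: stellar_space_def mem_Times_iff scaleC_prod_def)
  qed
qed

text \<open>
  Disjoint intervals accumulating at \<open>1\<close> carry orthogonal vectors whose images decay like \<open>4 ^ - k\<close> relative to
  them, so the range has infinite codimension.
\<close>

lemma zero_in_ess_spectrum:
  assumes T: "closed_symmetric_extension (stellar_space R) minimal_operator T"
  shows "\<not> fredholm_in (stellar_space R) T"
proof -
  define u v where "u = (\<lambda>k::nat. 1 + (R - 1) / (2 * k + 3))" and "v = (\<lambda>k::nat. 1 + (R - 1) / (2 * k + 2))"
  have uv: "1 < u k" "u k < v k" "v k < R" for k
  proof -
    show "1 < u k"
      using R by (simp add: u_def)
    show "u k < v k"
      unfolding u_def v_def using R by (intro add_strict_left_mono divide_strict_left_mono) auto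
    have "(R - 1) / (2 * real k + 2) < (R - 1) / 1"
      using R by (intro divide_strict_left_mono) auto
    then show "v k < R"
      by (simp add: v_def)
  qed
  have disj: "v k < u j" if "j < k" for j k
  proof -
    have "real (2 * j + 3) < real (2 * k + 2)"
      using that by linarith
    then have "(R - 1) / (2 * k + 2) < (R - 1) / (2 * j + 3)"
      using R by (intro divide_strict_left_mono) auto
    then show ?thesis
      by (simp add: u_def v_def add.commute)
  qed
  have "\<forall>k. \<exists>x. case x of (f, g, z) \<Rightarrow> ((l2_class f, l2_class g), z) \<in> minimal_operator \<and> sq_integrable f \<and> sq_integrable g \<and>
    (\<forall>t. t \<notin> {u k..v k} \<longrightarrow> f t = 0 \<and> g t = 0) \<and> 0 < norm (l2_class f, l2_class g) \<and>
    norm z \<le> (1 / 4) ^ k * norm (l2_class f, l2_class g)"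
    using small_image[OF uv] by (simp add: split_paired_Ex)
  from choice[OF this] obtain x where x: "\<forall>k. case x k of (f, g, z) \<Rightarrow> ((l2_class f, l2_class g), z) \<in> minimal_operator \<and> sq_integrable f \<and> sq_integrable g \<and>
    (\<forall>t. t \<notin> {u k..v k} \<longrightarrow> f t = 0 \<and> g t = 0) \<and> 0 < norm (l2_class f, l2_class g) \<and>
    norm z \<le> (1 / 4) ^ k * norm (l2_class f, l2_class g)" ..
  define f g z where "f = (\<lambda>k. fst (x k))" and "g = (\<lambda>k. fst (snd (x k)))" and "z = (\<lambda>k. snd (snd (x k)))"
  define y where "y = (\<lambda>k. (l2_class (f k), l2_class (g k)))"
  have mem: "(y k, z k) \<in> minimal_operator" and sq: "sq_integrable (f k)" "sq_integrable (g k)"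
    and supp: "\<And>t. t \<notin> {u k..v k} \<Longrightarrow> f k t = 0 \<and> g k t = 0" and pos: "0 < norm (y k)"
    and small: "norm (z k) \<le> (1 / 4) ^ k * norm (y k)" for k
    using x[rule_format, of k] by (auto simp: f_def g_def z_def y_def case_prod_unfold)
  have orth: "cinner (y j) (y k) = 0" if "j \<noteq> k" for j k
  proof -
    have "f j t * cnj (f k t) + g j t * cnj (g k t) = 0" for t
    proof -
      have "t \<notin> {u j..v j} \<or> t \<notin> {u k..v k}"
        using disj[of j k] disj[of k j] that by (cases "j < k") auto
      then show ?thesis
        using supp[of t j] supp[of t k] by auto
    qed
    then show ?thesis
      unfolding y_def cinner_l2_pair[OF sq sq] by simp
  qed
  define s where "s = (\<lambda>k. complex_of_real (1 / norm (y k)))"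
  have subT: "complex_vector.subspace T" and mT: "minimal_operator \<subseteq> T"
    using T unfolding closed_symmetric_extension_def symmetric_operator_in_def linear_operator_in_def by blast+
  show ?thesis
  proof (rule not_fredholm_criterion[where A\<^sub>0 = T and y = "\<lambda>k. s k *\<^sub>C y k" and z = "\<lambda>k. s k *\<^sub>C z k"])
    show "closed_symmetric_extension (stellar_space R) T T"
      using T by (simp add: closed_symmetric_extension_def)
    show "(s k *\<^sub>C y k, s k *\<^sub>C z k) \<in> T" for k
      using complex_vector.subspace_scale[OF subT, of "(y k, z k)" "s k"] mem[of k] mT
      by (auto simp: scaleC_prod_def)
    show "cinner (s j *\<^sub>C y j) (s k *\<^sub>C y k) = (if j = k then 1 else 0)" for j k
    proof (cases "j = k")
      case True
      have "cinner (s k *\<^sub>C y k) (s k *\<^sub>C y k) = complex_of_real ((cmod (s k) * norm (y k))\<^sup>2)"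
        unfolding cinner_self norm_scaleC ..
      also have "cmod (s k) * norm (y k) = 1"
        using pos[of k] by (simp add: s_def norm_divide)
      finally show ?thesis
        using True by simp
    qed (simp add: cinner_scaleC_left cinner_scaleC_right orth)
    show "norm (s k *\<^sub>C z k) \<le> 1 / 4 ^ k" for k
    proof -
      have "norm (s k *\<^sub>C z k) = norm (z k) / norm (y k)"
        unfolding norm_scaleC by (simp add: s_def norm_divide)
      also have "\<dots> \<le> (1 / 4) ^ k"
        using small[of k] pos[of k] by (simp add: field_simps)
      finally show ?thesis
        by (simp add: power_divide)
    qed
  qed (rule subspace_stellar_space closed_stellar_space)+
qed

end

section \<open>The stellar equilibrium operator\<close>

lemma at_within_open_interval: "t \<in> {1<..<R} \<Longrightarrow> at t within {1..<R} = at (t :: real)"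
  "t \<in> {1<..<R} \<Longrightarrow> at t within {1..R} = at t" "t \<in> {1<..<R} \<Longrightarrow> at t within {1<..<R} = at t"
  by (rule at_within_interior; simp)+

lemma deriv_within_eq:
  fixes f :: "real \<Rightarrow> 'a::real_normed_vector"
  assumes "(f has_vector_derivative d) (at t)" "t \<in> {1<..<R}"
  shows "deriv_within {1..<R} f t = d" "deriv_within {1<..<R} f t = d"
  using assms by (simp_all add: at_within_open_interval vector_derivative_at)

lemma deriv_within_eq_real:
  fixes f :: "real \<Rightarrow> real"
  assumes "(f has_real_derivative d) (at t)" "t \<in> {1<..<R}"
  shows "deriv_within {1..<R} f t = d" "deriv_within {1<..<R} f t = d"
  using deriv_within_eq[of f d t R] assms by (simp_all add: has_real_derivative_iff_has_vector_derivative)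

lemma Ck_on_Suc_openI:
  assumes "Ck_on k {1<..<R} f'" and f: "\<And>t. t \<in> {1<..<R} \<Longrightarrow> (f has_vector_derivative f' t) (at t)"
  shows "Ck_on (Suc k) {1<..<R} f"
proof -
  have cong: "Ck_on k {1<..<R} h" if "Ck_on k {1<..<R} g" "\<And>t. t \<in> {1<..<R} \<Longrightarrow> g t = h t"
    for g h :: "real \<Rightarrow> 'a" and k
    using that
  proof (induction k arbitrary: g h)
    case 0
    then show ?case
      by (auto intro: continuous_on_eq)
  next
    case (Suc k)
    have "\<forall>t\<in>{1<..<R}. h differentiable (at t within {1<..<R})"
      using Suc.prems by (auto intro: differentiable_transform_within[of g _ _ 1])
    moreover have "deriv_within {1<..<R} g t = deriv_within {1<..<R} h t" if "t \<in> {1<..<R}" for t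
    proof -
      have "(g has_vector_derivative d) (at t) \<longleftrightarrow> (h has_vector_derivative d) (at t)" for d
        using that Suc.prems(2)
        by (auto intro: has_vector_derivative_transform_within_open[of _ _ _ "{1<..<R}"])
      then show ?thesis
        using that by (simp add: at_within_open_interval vector_derivative_def)
    qed
    ultimately show ?case
      using Suc by auto
  qed
  have "Ck_on k {1<..<R} (deriv_within {1<..<R} f)"
    by (rule cong[OF assms(1)]) (simp add: deriv_within_eq(2)[OF f])
  moreover have "f differentiable (at t within {1<..<R})" if "t \<in> {1<..<R}" for t
    using f[OF that] by (auto intro: differentiableI_vector differentiable_at_withinI)
  ultimately show ?thesis
    by simp
qed

lemma Ck_on_2D:
  fixes f :: "real \<Rightarrow> real"
  assumes "Ck_on 2 {1..R} f"
  defines "f' \<equiv> deriv_within {1..R} f"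
  defines "f'' \<equiv> deriv_within {1..R} f'"
  shows "continuous_on {1..R} f" "continuous_on {1..R} f'" "continuous_on {1..R} f''"
    and "\<And>t. t \<in> {1<..<R} \<Longrightarrow> (f has_real_derivative f' t) (at t)"
    and "\<And>t. t \<in> {1<..<R} \<Longrightarrow> (f' has_real_derivative f'' t) (at t)"
proof -
  have d: "\<And>t. t \<in> {1..R} \<Longrightarrow> f differentiable (at t within {1..R})"
      "\<And>t. t \<in> {1..R} \<Longrightarrow> f' differentiable (at t within {1..R})" and c: "continuous_on {1..R} f''"
    using assms(1) by (auto simp: numeral_2_eq_2 f'_def f''_def)
  have hd: "(g has_real_derivative deriv_within {1..R} g t) (at t)"
    if "\<And>t. t \<in> {1..R} \<Longrightarrow> g differentiable (at t within {1..R})" "t \<in> {1<..<R}" for g :: "real \<Rightarrow> real" and t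
    using that(1)[of t] that(2)
    by (simp add: at_within_open_interval has_real_derivative_iff_has_vector_derivative vector_derivative_works)
  show "continuous_on {1..R} f" "continuous_on {1..R} f'"
    using d by (auto simp: continuous_on_eq_continuous_within intro: differentiable_imp_continuous_within)
  show "continuous_on {1..R} f''"
    by (rule c)
  show "(f has_real_derivative f' t) (at t)" if "t \<in> {1<..<R}" for t
    using hd[OF d(1) that] by (simp add: f'_def)
  show "(f' has_real_derivative f'' t) (at t)" if "t \<in> {1<..<R}" for t
    using hd[OF d(2) that] by (simp add: f''_def)
qed

lemma continuous_bounded_real:
  fixes f :: "real \<Rightarrow> real"
  assumes "continuous_on {a..b} f"
  shows "\<exists>B\<ge>0. \<forall>t\<in>{a..b}. \<bar>f t\<bar> \<le> B"
proof -
  have "bounded (f ` {a..b})"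
    by (intro compact_imp_bounded compact_continuous_image assms compact_Icc)
  then obtain B where "\<forall>t\<in>{a..b}. \<bar>f t\<bar> \<le> B"
    by (auto simp: bounded_iff)
  then show ?thesis
    by (intro exI[of _ "max B 0"]) auto
qed

lemma continuous_pos_lower_bound:
  fixes f :: "real \<Rightarrow> real"
  assumes "a \<le> b" "continuous_on {a..b} f" "\<And>t. t \<in> {a..b} \<Longrightarrow> 0 < f t"
  shows "\<exists>m>0. \<forall>t\<in>{a..b}. m \<le> f t"
proof -
  obtain t where "t \<in> {a..b}" "\<forall>s\<in>{a..b}. f t \<le> f s"
    using continuous_attains_inf[OF compact_Icc _ assms(2)] assms(1) by auto
  then show ?thesis
    using assms(3) by blast
qed

locale stellar =
  fixes n \<alpha> R pc \<rho>c :: real and l :: nat and \<theta> \<theta>' \<theta>'' \<Gamma> \<Gamma>' \<Gamma>'' :: "real \<Rightarrow> real"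
  assumes n: "0 < n" and R: "1 < R" and pc: "0 < pc" and \<rho>c: "0 < \<rho>c" and l: "1 \<le> l"
    and \<theta>_cont: "continuous_on {1..R} \<theta>" "continuous_on {1..R} \<theta>'" "continuous_on {1..R} \<theta>''"
    and \<theta>_deriv: "\<And>t. t \<in> {1<..<R} \<Longrightarrow> (\<theta> has_real_derivative \<theta>' t) (at t)"
      "\<And>t. t \<in> {1<..<R} \<Longrightarrow> (\<theta>' has_real_derivative \<theta>'' t) (at t)"
    and ode: "\<And>t. t \<in> {1..R} \<Longrightarrow> \<theta>'' t + 2 / t * \<theta>' t = - (1 / \<alpha>\<^sup>2) * \<theta> t powr n"
    and \<theta>_pos: "\<And>t. t \<in> {1..<R} \<Longrightarrow> 0 < \<theta> t" and \<theta>_R: "\<theta> R = 0"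
    and \<Gamma>_cont: "continuous_on {1..R} \<Gamma>" "continuous_on {1..R} \<Gamma>'" "continuous_on {1..R} \<Gamma>''"
    and \<Gamma>_deriv: "\<And>t. t \<in> {1<..<R} \<Longrightarrow> (\<Gamma> has_real_derivative \<Gamma>' t) (at t)"
      "\<And>t. t \<in> {1<..<R} \<Longrightarrow> (\<Gamma>' has_real_derivative \<Gamma>'' t) (at t)"
    and \<Gamma>_pos: "\<And>t. t \<in> {1..R} \<Longrightarrow> 0 < \<Gamma> t"
begin

text \<open>
  The first zero is simple: \<open>t\<^sup>2 \<theta>'\<close> is nonincreasing, so \<open>\<theta>' R \<ge> 0\<close> would make \<open>\<theta>\<close> nondecreasing.
\<close>

lemma \<theta>'_R: "\<theta>' R < 0"
proof (rule ccontr)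
  assume neg: "\<not> \<theta>' R < 0"
  have mono: "R\<^sup>2 * \<theta>' R \<le> t\<^sup>2 * \<theta>' t" if t: "t \<in> {1..R}" for t
  proof (rule DERIV_nonpos_imp_decreasing_open[where f = "\<lambda>t. t\<^sup>2 * \<theta>' t"])
    fix x assume x: "t < x" "x < R"
    have "((\<lambda>t. t\<^sup>2 * \<theta>' t) has_real_derivative x\<^sup>2 * (\<theta>'' x + 2 / x * \<theta>' x)) (at x)"
      using x t by (auto intro!: derivative_eq_intros \<theta>_deriv simp: field_simps power2_eq_square)
    moreover have "x\<^sup>2 * (\<theta>'' x + 2 / x * \<theta>' x) \<le> 0"
      using ode[of x] x t by (intro mult_nonneg_nonpos) auto
    ultimately show "\<exists>y. ((\<lambda>t. t\<^sup>2 * \<theta>' t) has_real_derivative y) (at x) \<and> y \<le> 0"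
      by blast
  next
    show "continuous_on {t..R} (\<lambda>t. t\<^sup>2 * \<theta>' t)"
      using t by (intro continuous_intros continuous_on_subset[OF \<theta>_cont(2)]) auto
  qed (use t in auto)
  have "0 \<le> \<theta>' t" if t: "t \<in> {1..R}" for t
  proof -
    have "0 \<le> t\<^sup>2 * \<theta>' t"
      using mono[OF t] neg by (smt (verit) mult_nonneg_nonneg zero_le_power2)
    then show ?thesis
      using t by (simp add: zero_le_mult_iff)
  qed
  then have "\<exists>y. (\<theta> has_real_derivative y) (at x) \<and> 0 \<le> y" if "1 < x" "x < R" for x
    using \<theta>_deriv(1)[of x] that by (intro exI[of _ "\<theta>' x"]) simp
  then have "\<theta> 1 \<le> \<theta> R"
    by (rule DERIV_nonneg_imp_increasing_open[OF less_imp_le[OF R] _ \<theta>_cont(1)])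
  then show False
    using \<theta>_pos[of 1] \<theta>_R R by simp
qed

text \<open>
  By the mean value theorem, since \<open>\<theta>'\<close> is bounded and, near \<open>R\<close>, bounded away from zero.
\<close>

lemma \<theta>_two_sided: "\<exists>K>0. \<forall>t\<in>{1..R}. R - t \<le> K * \<theta> t \<and> \<theta> t \<le> K * (R - t)"
proof -
  have mvt: "\<exists>x. t < x \<and> x < R \<and> \<theta> t = - \<theta>' x * (R - t)" if t: "t \<in> {1..<R}" for t
  proof -
    have "\<exists>L x. t < x \<and> x < R \<and> DERIV \<theta> x :> L \<and> \<theta> R - \<theta> t = (R - t) * L"
    proof (rule MVT)
      show "continuous_on {t..R} \<theta>"
        by (rule continuous_on_subset[OF \<theta>_cont(1)]) (use t in auto)
      show "\<theta> differentiable (at x)" if "t < x" "x < R" for x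
        using \<theta>_deriv(1)[of x] that t by (auto simp: real_differentiable_def)
    qed (use t in auto)
    then obtain L x where x: "t < x" "x < R" "DERIV \<theta> x :> L" "\<theta> R - \<theta> t = (R - t) * L"
      by blast
    have "L = \<theta>' x"
      using x t \<theta>_deriv(1)[of x] by (auto intro: DERIV_unique)
    then show ?thesis
      using x \<theta>_R by (intro exI[of _ x]) (simp add: algebra_simps)
  qed
  obtain B where B: "0 \<le> B" "\<forall>t\<in>{1..R}. \<bar>\<theta>' t\<bar> \<le> B"
    using continuous_bounded_real[OF \<theta>_cont(2)] by blast
  define d where "d = - \<theta>' R / 2"
  have d: "0 < d"
    using \<theta>'_R by (simp add: d_def)
  have "\<exists>e>0. \<forall>x\<in>{1..R}. dist x R < e \<longrightarrow> dist (\<theta>' x) (\<theta>' R) < d"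
    using \<theta>_cont(2) d R unfolding continuous_on_iff by auto
  then obtain e where e: "0 < e" "\<And>x. x \<in> {1..R} \<Longrightarrow> \<bar>x - R\<bar> < e \<Longrightarrow> \<bar>\<theta>' x - \<theta>' R\<bar> < d"
    by (auto simp: dist_real_def)
  define s where "s = max 1 (R - e / 2)"
  have s: "1 \<le> s" "s < R" "R - s < e"
    using R e by (auto simp: s_def)
  obtain m where m: "0 < m" "\<forall>t\<in>{1..s}. m \<le> \<theta> t"
    using continuous_pos_lower_bound[of 1 s \<theta>] s \<theta>_pos continuous_on_subset[OF \<theta>_cont(1), of "{1..s}"] by force
  define K where "K = B + 1 / d + (R - 1) / m"
  have K: "B \<le> K" "1 / d \<le> K" "(R - 1) / m \<le> K" "0 < K"
    using B d m R by (auto simp: K_def add_nonneg_pos add_pos_nonneg)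
  have "R - t \<le> K * \<theta> t \<and> \<theta> t \<le> K * (R - t)" if t: "t \<in> {1..R}" for t
  proof (cases "t = R")
    case False
    then have t': "t \<in> {1..<R}"
      using t by auto
    have pos: "0 < \<theta> t"
      by (rule \<theta>_pos[OF t'])
    obtain x where x: "t < x" "x < R" "\<theta> t = - \<theta>' x * (R - t)"
      using mvt[OF t'] by blast
    have "- \<theta>' x \<le> K"
      using B(2)[rule_format, of x] K(1) x t by auto
    then have upper: "\<theta> t \<le> K * (R - t)"
      unfolding x(3) using t by (intro mult_right_mono) auto
    have "R - t \<le> K * \<theta> t"
    proof (cases "s \<le> t")
      case True
      have "\<bar>\<theta>' x - \<theta>' R\<bar> < d"
        using x s True t by (intro e(2)) auto
      then have "d \<le> - \<theta>' x"
        by (simp add: d_def abs_if split: if_splits)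
      then have "d * (R - t) \<le> \<theta> t"
        unfolding x(3) using t by (intro mult_right_mono) auto
      then have "R - t \<le> 1 / d * \<theta> t"
        using d by (simp add: field_simps)
      also have "\<dots> \<le> K * \<theta> t"
        using K(2) pos by (intro mult_right_mono) auto
      finally show ?thesis .
    next
      case False
      then have "m \<le> \<theta> t"
        using m t by auto
      then have "(R - 1) / m * m \<le> K * \<theta> t"
        using K m pos by (intro mult_mono) auto
      then show ?thesis
        using m t by simp
    qed
    then show ?thesis
      using upper by blast
  qed (simp add: \<theta>_R)
  then show ?thesis
    using K(4) by blast
qed

definition pressure :: "real \<Rightarrow> real" where "pressure = (\<lambda>t. pc * \<theta> t powr (n + 1))"
definition mass_density :: "real \<Rightarrow> real" where "mass_density = (\<lambda>t. \<rho>c * \<theta> t powr n)"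

definition k :: real where "k = pc / \<rho>c"
abbreviation "c \<equiv> coeff_c l"

text \<open>
  With \<open>k = p\<^sub>c / \<rho>\<^sub>c\<close> the pressure is \<open>k \<theta> \<rho>\<close>, and the negative powers of \<open>\<theta>\<close> cancel in all coefficients below except
  in \<open>r\<^sup>2 / p\<^sub>1\<close>: here \<open>r = p\<^sub>1 w' / w\<close> for the weight \<open>w = t\<^sup>2 sqrt \<rho>\<close> occurring in \<open>q\<^sub>1\<close>, \<open>q0_coeff\<close> is the first
  summand of \<open>q\<^sub>1\<close>, and \<open>q2_coeff\<close> is \<open>q\<^sub>2\<close>. They extend continuously to \<open>R\<close>, because \<open>\<theta>\<close> and \<open>\<Gamma>\<close> are \<open>C\<^sup>2\<close> there.
\<close>

definition r_coeff :: "real \<Rightarrow> real" where "r_coeff t = k * \<Gamma> t * (2 * \<theta> t / t + n / 2 * \<theta>' t)"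
definition r_coeff' :: "real \<Rightarrow> real"
  where "r_coeff' t = k * \<Gamma>' t * (2 * \<theta> t / t + n / 2 * \<theta>' t)
    + k * \<Gamma> t * (2 * \<theta>' t / t - 2 * \<theta> t / t\<^sup>2 + n / 2 * \<theta>'' t)"
definition q0_coeff :: "real \<Rightarrow> real"
  where "q0_coeff t = k / t * (- 3 * \<Gamma>' t * \<theta> t + (4 - 3 * \<Gamma> t) * ((n + 1) * \<theta>' t))"
definition q2_coeff :: "real \<Rightarrow> real"
  where "q2_coeff t = c * k / t * (\<Gamma> t * (n / 2 * \<theta>' t) - (n + 1) * \<theta>' t - \<Gamma> t * \<theta> t / t)"
definition q2_coeff' :: "real \<Rightarrow> real"
  where "q2_coeff' t = - (c * k / t\<^sup>2) * (\<Gamma> t * (n / 2 * \<theta>' t) - (n + 1) * \<theta>' t - \<Gamma> t * \<theta> t / t)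
    + c * k / t * (\<Gamma>' t * (n / 2 * \<theta>' t) + \<Gamma> t * (n / 2 * \<theta>'' t) - (n + 1) * \<theta>'' t
      - ((\<Gamma>' t * \<theta> t + \<Gamma> t * \<theta>' t) / t - \<Gamma> t * \<theta> t / t\<^sup>2))"
definition weight :: "real \<Rightarrow> real" where "weight t = t\<^sup>2 * sqrt (mass_density t)"

abbreviation "P1 \<equiv> coeff_p1 \<Gamma> pressure mass_density"
abbreviation "Q1 \<equiv> coeff_q1 R \<Gamma> pressure mass_density"
abbreviation "Q2 \<equiv> coeff_q2 l R \<Gamma> pressure mass_density"

lemma c_pos: "0 < c"
  using l by (simp add: coeff_c_def)

lemma k_pos: "0 < k"
  using pc \<rho>c by (simp add: k_def)

lemma \<theta>_pos': "t \<in> {1<..<R} \<Longrightarrow> 0 < \<theta> t"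
  using \<theta>_pos by simp

lemma \<rho>_pos: "t \<in> {1<..<R} \<Longrightarrow> 0 < mass_density t"
  using \<theta>_pos'[of t] \<rho>c by (simp add: mass_density_def)

lemma p_eq: "t \<in> {1<..<R} \<Longrightarrow> pressure t = k * \<theta> t * mass_density t"
  using \<theta>_pos'[of t] \<rho>c by (simp add: pressure_def mass_density_def k_def powr_add)

lemma p1_eq: "t \<in> {1<..<R} \<Longrightarrow> P1 t = k * \<Gamma> t * \<theta> t"
  using \<rho>_pos[of t] by (simp add: coeff_p1_def p_eq)

lemma \<rho>_deriv: "t \<in> {1<..<R} \<Longrightarrow> (mass_density has_real_derivative n * \<theta>' t / \<theta> t * mass_density t) (at t)"
  unfolding mass_density_def using \<theta>_pos'[of t]
  by (auto intro!: derivative_eq_intros \<theta>_deriv simp: powr_diff field_simps)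

lemma p_deriv: "t \<in> {1<..<R} \<Longrightarrow> (pressure has_real_derivative k * ((n + 1) * \<theta>' t) * mass_density t) (at t)"
  unfolding pressure_def mass_density_def k_def using \<theta>_pos'[of t] \<rho>c
  by (auto intro!: derivative_eq_intros \<theta>_deriv simp: field_simps)

lemma w_deriv:
  assumes t: "t \<in> {1<..<R}"
  shows "(weight has_real_derivative (2 / t + n * \<theta>' t / (2 * \<theta> t)) * weight t) (at t)"
proof -
  have "((\<lambda>t. sqrt (mass_density t)) has_real_derivative n * \<theta>' t / \<theta> t * mass_density t * (inverse (sqrt (mass_density t)) / 2)) (at t)"
    using DERIV_chain2[OF DERIV_real_sqrt[OF \<rho>_pos[OF t]] \<rho>_deriv[OF t]] by (simp add: mult.commute)
  moreover have "mass_density t * (inverse (sqrt (mass_density t)) / 2) = sqrt (mass_density t) / 2"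
    using \<rho>_pos[OF t] by (simp add: field_simps)
  ultimately have s: "((\<lambda>t. sqrt (mass_density t)) has_real_derivative n * \<theta>' t / \<theta> t * (sqrt (mass_density t) / 2)) (at t)"
    by (simp only: mult.assoc)
  have "((\<lambda>t. t\<^sup>2 * sqrt (mass_density t)) has_real_derivative
      2 * t * sqrt (mass_density t) + n * \<theta>' t / \<theta> t * (sqrt (mass_density t) / 2) * t\<^sup>2) (at t)"
    by (rule DERIV_mult[OF _ s, THEN DERIV_cong]) (auto intro!: derivative_eq_intros)
  moreover have "2 * t * u + n * \<theta>' t / \<theta> t * (u / 2) * t\<^sup>2 = (2 / t + n * \<theta>' t / (2 * \<theta> t)) * (t\<^sup>2 * u)" for u
    using t \<theta>_pos'[OF t] by (simp add: field_simps power2_eq_square)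
  ultimately show ?thesis
    unfolding weight_def[abs_def] by (simp only:)
qed

lemma r_over_p: "t \<in> {1<..<R} \<Longrightarrow> r_coeff t / P1 t = 2 / t + n * \<theta>' t / (2 * \<theta> t)"
  using \<theta>_pos'[of t] \<Gamma>_pos[of t] k_pos by (simp add: r_coeff_def p1_eq field_simps)

lemma r_deriv: "t \<in> {1<..<R} \<Longrightarrow> (r_coeff has_real_derivative r_coeff' t) (at t)"
  unfolding r_coeff_def[abs_def] r_coeff'_def
  by (auto intro!: derivative_eq_intros \<theta>_deriv \<Gamma>_deriv simp: field_simps power2_eq_square)

lemma q2_deriv:
  assumes t: "t \<in> {1<..<R}"
  shows "(q2_coeff has_real_derivative q2_coeff' t) (at t)"
proof -
  have 1: "((\<lambda>t. c * k / t) has_real_derivative - (c * k / t\<^sup>2)) (at t)"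
    using t by (auto intro!: derivative_eq_intros simp: power2_eq_square)
  have 2: "((\<lambda>t. \<Gamma> t * \<theta> t / t) has_real_derivative
      (\<Gamma>' t * \<theta> t + \<Gamma> t * \<theta>' t) / t - \<Gamma> t * \<theta> t / t\<^sup>2) (at t)"
    using t by (auto intro!: derivative_eq_intros \<theta>_deriv \<Gamma>_deriv simp: field_simps power2_eq_square)
  have 3: "((\<lambda>t. \<Gamma> t * (n / 2 * \<theta>' t) - (n + 1) * \<theta>' t) has_real_derivative
      \<Gamma>' t * (n / 2 * \<theta>' t) + \<Gamma> t * (n / 2 * \<theta>'' t) - (n + 1) * \<theta>'' t) (at t)"
    using t by (auto intro!: derivative_eq_intros \<theta>_deriv \<Gamma>_deriv)
  show ?thesis
    unfolding q2_coeff_def[abs_def] q2_coeff'_def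
    by (rule DERIV_cong[OF DERIV_mult[OF 1 DERIV_diff[OF 3 2]]]) (simp add: mult.commute)
qed

lemma q2_eq:
  assumes t: "t \<in> {1<..<R}"
  shows "Q2 t = q2_coeff t"
proof -
  have nz: "\<theta> t \<noteq> 0" "\<Gamma> t \<noteq> 0" "mass_density t \<noteq> 0" "t \<noteq> 0" "k \<noteq> 0" "0 < \<rho>c"
    using \<theta>_pos'[OF t] \<Gamma>_pos[of t] \<rho>_pos[OF t] t k_pos \<rho>c by auto
  have "((\<lambda>s. s\<^sup>2 * mass_density s) has_real_derivative 2 * t * mass_density t + n * \<theta>' t / \<theta> t * mass_density t * t\<^sup>2) (at t)"
    by (rule DERIV_mult[OF _ \<rho>_deriv[OF t], THEN DERIV_cong]) (auto intro!: derivative_eq_intros)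
  note D = deriv_within_eq_real(1)[OF this t] deriv_within_eq_real(1)[OF \<rho>_deriv[OF t] t]
    deriv_within_eq_real(1)[OF p_deriv[OF t] t]
  have "Q2 t = c * (\<Gamma> t * (k * \<theta> t * mass_density t) / (t * mass_density t))
      * (n * \<theta>' t / \<theta> t * mass_density t / mass_density t - k * ((n + 1) * \<theta>' t) * mass_density t / (\<Gamma> t * (k * \<theta> t * mass_density t))
        - 1 / 2 * ((2 * t * mass_density t + n * \<theta>' t / \<theta> t * mass_density t * t\<^sup>2) / (t\<^sup>2 * mass_density t)))"
    unfolding coeff_q2_def coeff_p2_def Let_def D p_eq[OF t] ..
  also have "\<dots> = c * (\<Gamma> t * k * \<theta> t / t) * (n * \<theta>' t / \<theta> t - (n + 1) * \<theta>' t / (\<Gamma> t * \<theta> t)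
        - 1 / 2 * (2 / t + n * \<theta>' t / \<theta> t))"
  proof -
    have "\<Gamma> t * (k * \<theta> t * mass_density t) / (t * mass_density t) = \<Gamma> t * k * \<theta> t / t" "n * \<theta>' t / \<theta> t * mass_density t / mass_density t = n * \<theta>' t / \<theta> t"
      "k * ((n + 1) * \<theta>' t) * mass_density t / (\<Gamma> t * (k * \<theta> t * mass_density t)) = (n + 1) * \<theta>' t / (\<Gamma> t * \<theta> t)"
      "(2 * t * mass_density t + n * \<theta>' t / \<theta> t * mass_density t * t\<^sup>2) / (t\<^sup>2 * mass_density t) = 2 / t + n * \<theta>' t / \<theta> t"
      using nz pc by (simp_all add: field_simps power2_eq_square)
    then show ?thesis
      by (simp only:)
  qed
  also have "\<dots> = q2_coeff t"
    unfolding q2_coeff_def using nz by (simp add: field_simps)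
  finally show ?thesis .
qed

lemma q1_eq:
  assumes t: "t \<in> {1<..<R}"
  shows "Q1 t = q0_coeff t + r_coeff' t + (r_coeff t)\<^sup>2 / P1 t"
proof -
  have nz: "\<theta> t \<noteq> 0" "\<Gamma> t \<noteq> 0" "0 < mass_density t" "t \<noteq> 0" "k \<noteq> 0" "0 < \<rho>c"
    using \<theta>_pos'[OF t] \<Gamma>_pos[of t] \<rho>_pos[OF t] t k_pos \<rho>c by auto
  have d1: "((\<lambda>s. (4 - 3 * \<Gamma> s) * pressure s) has_real_derivative
      (- 3 * \<Gamma>' t) * pressure t + k * ((n + 1) * \<theta>' t) * mass_density t * (4 - 3 * \<Gamma> t)) (at t)"
    by (rule DERIV_mult[OF _ p_deriv[OF t], THEN DERIV_cong]) (auto intro!: derivative_eq_intros \<Gamma>_deriv t)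
  have w': "deriv_within {1..<R} (\<lambda>r. r\<^sup>2 * sqrt (mass_density r)) s = r_coeff s / P1 s * weight s" if s: "s \<in> {1<..<R}" for s
    using deriv_within_eq_real(1)[OF w_deriv[OF s] s] unfolding r_over_p[OF s] by (simp add: weight_def[abs_def])
  have "((\<lambda>s. r_coeff s * weight s) has_real_derivative r_coeff' t * weight t + r_coeff t / P1 t * weight t * r_coeff t) (at t)"
    unfolding r_over_p[OF t] by (rule DERIV_mult[OF r_deriv[OF t] w_deriv[OF t]])
  then have d2: "((\<lambda>s. \<Gamma> s * pressure s / mass_density s * deriv_within {1..<R} (\<lambda>r. r\<^sup>2 * sqrt (mass_density r)) s)
      has_real_derivative r_coeff' t * weight t + r_coeff t / P1 t * weight t * r_coeff t) (at t)"
  proof (rule has_field_derivative_transform_within_open[of _ _ _ "{1<..<R}"])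
    fix s assume s: "s \<in> {1<..<R}"
    have "P1 s \<noteq> 0"
      using p1_eq[OF s] k_pos \<theta>_pos'[OF s] \<Gamma>_pos[of s] s pc \<rho>c by auto
    moreover have "\<Gamma> s * pressure s / mass_density s = P1 s"
      by (simp add: coeff_p1_def)
    ultimately show "r_coeff s * weight s = \<Gamma> s * pressure s / mass_density s * deriv_within {1..<R} (\<lambda>r. r\<^sup>2 * sqrt (mass_density r)) s"
      unfolding w'[OF s] by simp
  qed (use t in auto)
  have "Q1 t = 1 / (t * mass_density t) * ((- 3 * \<Gamma>' t) * (k * \<theta> t * mass_density t) + k * ((n + 1) * \<theta>' t) * mass_density t * (4 - 3 * \<Gamma> t))
      + 1 / weight t * (r_coeff' t * weight t + r_coeff t / P1 t * weight t * r_coeff t)"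
    unfolding coeff_q1_def Let_def deriv_within_eq_real(1)[OF d1 t] deriv_within_eq_real(1)[OF d2 t]
    unfolding p_eq[OF t] by (simp add: weight_def)
  also have "1 / (t * mass_density t) * ((- 3 * \<Gamma>' t) * (k * \<theta> t * mass_density t) + k * ((n + 1) * \<theta>' t) * mass_density t * (4 - 3 * \<Gamma> t)) = q0_coeff t"
    unfolding q0_coeff_def using nz by (simp add: field_simps)
  also have "1 / weight t * (r_coeff' t * weight t + r_coeff t / P1 t * weight t * r_coeff t) = r_coeff' t + (r_coeff t)\<^sup>2 / P1 t"
    using nz by (simp add: weight_def field_simps power2_eq_square)
  finally show ?thesis
    by simp
qed

lemma continuous_I: "continuous_on {1..R} f \<Longrightarrow> continuous_on {1<..<R} f"
  by (rule continuous_on_subset) auto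

lemma coeffs_cont:
  "continuous_on {1..R} r_coeff" "continuous_on {1..R} r_coeff'" "continuous_on {1..R} q0_coeff"
  "continuous_on {1..R} q2_coeff" "continuous_on {1..R} q2_coeff'"
  unfolding r_coeff_def[abs_def] r_coeff'_def[abs_def] q0_coeff_def[abs_def] q2_coeff_def[abs_def] q2_coeff'_def[abs_def]
  by (intro continuous_intros \<theta>_cont \<Gamma>_cont; auto)+

definition P1' :: "real \<Rightarrow> real" where "P1' t = k * \<Gamma>' t * \<theta> t + k * \<Gamma> t * \<theta>' t"

lemma P1_pos: "t \<in> {1<..<R} \<Longrightarrow> 0 < P1 t"
  using k_pos \<theta>_pos'[of t] \<Gamma>_pos[of t] pc \<rho>c by (simp add: p1_eq)

lemma P1_deriv:
  assumes t: "t \<in> {1<..<R}"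
  shows "(P1 has_real_derivative P1' t) (at t)"
proof -
  have "((\<lambda>t. k * \<Gamma> t * \<theta> t) has_real_derivative P1' t) (at t)"
    unfolding P1'_def by (auto intro!: derivative_eq_intros \<theta>_deriv \<Gamma>_deriv t simp: algebra_simps)
  then show ?thesis
    by (rule has_field_derivative_transform_within_open[of _ _ _ "{1<..<R}"]) (use t p1_eq in auto)
qed

lemma regular: "regular_matrix R c P1 P1' Q1 Q2 q2_coeff'"
proof
  show "continuous_on {1<..<R} P1'"
    unfolding P1'_def[abs_def] by (intro continuous_intros continuous_I \<theta>_cont \<Gamma>_cont)
  have P1_cont: "continuous_on {1<..<R} P1"
    using P1_deriv by (intro continuous_at_imp_continuous_on) (blast intro: DERIV_isCont)
  have "continuous_on {1<..<R} (\<lambda>t. q0_coeff t + r_coeff' t + (r_coeff t)\<^sup>2 / P1 t)"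
    using P1_pos by (intro continuous_intros continuous_I coeffs_cont P1_cont) fastforce
  then show "continuous_on {1<..<R} Q1"
    by (rule continuous_on_eq) (simp add: q1_eq)
  show "continuous_on {1<..<R} Q2"
    by (rule continuous_on_eq[OF continuous_I[OF coeffs_cont(4)]]) (simp add: q2_eq)
  show "(Q2 has_real_derivative q2_coeff' t) (at t)" if t: "t \<in> {1<..<R}" for t
    by (rule has_field_derivative_transform_within_open[OF q2_deriv[OF t], of "{1<..<R}"]) (use t q2_eq in auto)
  show "continuous_on {1<..<R} q2_coeff'"
    by (rule continuous_I[OF coeffs_cont(5)])
qed (use R c_pos P1_pos P1_deriv in auto)

text \<open>
  Since \<open>\<theta>\<close> is comparable to \<open>R - t\<close>, so is \<open>p\<^sub>1\<close>, and \<open>w = t\<^sup>2 sqrt \<rho>\<close> is comparable to the decreasing function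
  \<open>(R - t) powr (n / 2)\<close>, which gives the quasi-monotonicity.
\<close>

lemma singular: "\<exists>C. singular_matrix R c P1 P1' Q1 Q2 r_coeff r_coeff' q0_coeff weight C"
proof -
  obtain K where K: "0 < K" "\<And>t. t \<in> {1..R} \<Longrightarrow> R - t \<le> K * \<theta> t" "\<And>t. t \<in> {1..R} \<Longrightarrow> \<theta> t \<le> K * (R - t)"
    using \<theta>_two_sided by blast
  obtain g where g: "0 < g" "\<And>t. t \<in> {1..R} \<Longrightarrow> g \<le> \<Gamma> t"
    using continuous_pos_lower_bound[of 1 R \<Gamma>] R \<Gamma>_cont(1) \<Gamma>_pos by fastforce
  obtain B1 where B1: "0 \<le> B1" "\<forall>t\<in>{1..R}. \<bar>r_coeff t\<bar> \<le> B1"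
    using continuous_bounded_real[OF coeffs_cont(1)] by blast
  obtain B2 where B2: "0 \<le> B2" "\<forall>t\<in>{1..R}. \<bar>q0_coeff t\<bar> \<le> B2"
    using continuous_bounded_real[OF coeffs_cont(3)] by blast
  obtain B3 where B3: "0 \<le> B3" "\<forall>t\<in>{1..R}. \<bar>q2_coeff t\<bar> \<le> B3"
    using continuous_bounded_real[OF coeffs_cont(4)] by blast
  define B4 where "B4 = K / (k * g)"
  define B5 where "B5 = R\<^sup>2 * sqrt (\<rho>c * (K * R) powr n)"
  define B6 where "B6 = R\<^sup>2 * sqrt ((K * K) powr n)"
  define C where "C = B1 + B2 + B3 + B4 + B5 + B6"
  have nn: "0 \<le> B4" "0 \<le> B5" "0 \<le> B6"
    using K g k_pos pc \<rho>c by (simp_all add: B4_def B5_def B6_def)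
  have C: "B1 \<le> C" "B2 \<le> C" "B3 \<le> C" "B4 \<le> C" "B5 \<le> C" "B6 \<le> C"
    using B1(1) B2(1) B3(1) nn by (simp_all add: C_def)
  have wpos: "0 < weight t" if "t \<in> {1<..<R}" for t
    using \<rho>_pos[OF that] that by (simp add: weight_def)
  have deg: "degenerate_matrix R c P1 P1' Q1 Q2"
    using regular by (simp add: regular_matrix_def)
  have "singular_matrix R c P1 P1' Q1 Q2 r_coeff r_coeff' q0_coeff weight C"
    unfolding singular_matrix_def
  proof (intro conjI deg, unfold_locales)
    fix t assume t: "t \<in> {1<..<R}"
    then have t': "t \<in> {1..R}"
      by auto
    show "(r_coeff has_real_derivative r_coeff' t) (at t)"
      by (rule r_deriv[OF t])
    show "Q1 t = q0_coeff t + r_coeff' t + (r_coeff t)\<^sup>2 / P1 t"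
      by (rule q1_eq[OF t])
    show "\<bar>r_coeff t\<bar> \<le> C" "\<bar>q0_coeff t\<bar> \<le> C" "\<bar>Q2 t\<bar> \<le> C"
      unfolding q2_eq[OF t] using B1(2) B2(2) B3(2) t' C by (meson order_trans)+
    show "R - t \<le> C * P1 t"
    proof -
      have "R - t \<le> B4 * (k * g * \<theta> t)"
        using K(2)[OF t'] k_pos g pc \<rho>c by (simp add: B4_def field_simps)
      also have "\<dots> \<le> C * (k * \<Gamma> t * \<theta> t)"
        using C(4) nn g(1) g(2)[OF t'] k_pos \<theta>_pos'[OF t] by (intro mult_mono mult_nonneg_nonneg) auto
      finally show ?thesis
        by (simp add: p1_eq[OF t])
    qed
    show "0 < weight t"
      by (rule wpos[OF t])
    show "(weight has_real_derivative r_coeff t / P1 t * weight t) (at t)"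
      unfolding r_over_p[OF t] by (rule w_deriv[OF t])
    show "weight t \<le> C"
    proof -
      have "\<theta> t \<le> K * R"
        using K(3)[OF t'] K(1) t by (smt (verit) mult_left_mono greaterThanLessThan_iff)
      then have "mass_density t \<le> \<rho>c * (K * R) powr n"
        unfolding mass_density_def using \<theta>_pos'[OF t] \<rho>c n by (intro mult_left_mono powr_mono2) auto
      then have "weight t \<le> B5"
        unfolding weight_def B5_def using t \<rho>_pos[OF t] by (intro mult_mono power_mono real_sqrt_le_mono) auto
      then show ?thesis
        using C(5) by simp
    qed
  next
    show "continuous_on {1<..<R} r_coeff'"
      by (rule continuous_I[OF coeffs_cont(2)])
    fix \<tau> t assume \<tau>: "1 < \<tau>" "\<tau> \<le> t" "t < R"
    then have I: "t \<in> {1<..<R}" "\<tau> \<in> {1<..<R}"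
      by auto
    have "\<theta> t \<le> K * (R - t)"
      using K(3)[of t] \<tau> by simp
    also have "\<dots> \<le> K * (K * \<theta> \<tau>)"
      using K(1) K(2)[of \<tau>] \<tau> by (intro mult_left_mono) auto
    finally have "\<theta> t powr n \<le> (K * K * \<theta> \<tau>) powr n"
      using \<theta>_pos'[OF I(1)] n by (intro powr_mono2) auto
    also have "\<dots> = (K * K) powr n * \<theta> \<tau> powr n"
      using K(1) \<theta>_pos'[OF I(2)] by (simp add: powr_mult)
    finally have "mass_density t \<le> (K * K) powr n * mass_density \<tau>"
      using mult_left_mono[of _ _ \<rho>c] \<rho>c unfolding mass_density_def by (simp add: mult.left_commute)
    then have "sqrt (mass_density t) \<le> sqrt ((K * K) powr n) * sqrt (mass_density \<tau>)"
      by (simp add: real_sqrt_mult[symmetric])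
    then have "weight t \<le> R\<^sup>2 * (sqrt ((K * K) powr n) * sqrt (mass_density \<tau>))"
      unfolding weight_def using \<tau> \<rho>_pos[OF I(1)] by (intro mult_mono power_mono) auto
    also have "\<dots> = B6 * (1 * sqrt (mass_density \<tau>))"
      by (simp add: B6_def)
    also have "\<dots> \<le> C * (\<tau>\<^sup>2 * sqrt (mass_density \<tau>))"
      using C(6) nn \<tau> \<rho>_pos[OF I(2)] by (intro mult_mono) (auto simp: one_le_power)
    finally show "weight t \<le> C * weight \<tau>"
      by (simp add: weight_def)
  qed
  then show ?thesis
    by blast
qed

sublocale regular_matrix R c P1 P1' Q1 Q2 q2_coeff'
  by (rule regular)

text \<open>
  Where \<open>\<xi>\<close> is continuously differentiable, \<open>- (p\<^sub>1 y\<^sub>1')' + (p\<^sub>2 y\<^sub>2)' = - \<xi>'\<close> and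
  \<open>- p\<^sub>2 y\<^sub>1' + p\<^sub>3 y\<^sub>2 = - (c / t) \<xi>\<close>.
\<close>

lemma minimal_operator_subset: "minimal_operator \<subseteq> stellar_operator l R \<Gamma> pressure mass_density"
proof
  fix x assume "x \<in> minimal_operator"
  then obtain \<phi>1 \<phi>2 \<xi> \<xi>' a b \<phi>1' \<phi>1'' \<phi>2' where x: "x = ((l2_class \<phi>1, l2_class \<phi>2),
      (l2_class (\<lambda>t. - \<xi>' t + of_real (Q1 t) * \<phi>1 t + of_real (Q2 t) * \<phi>2 t),
       l2_class (\<lambda>t. - (of_real (c / t) * \<xi> t) + of_real (Q2 t) * \<phi>1 t)))"
      and ab: "1 < a" "b < R" and tp: "test_pair a b \<phi>1 \<phi>1'" "test_pair a b \<phi>1' \<phi>1''" "test_pair a b \<phi>2 \<phi>2'"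
        "test_pair a b \<xi> \<xi>'"
      and \<xi>: "\<And>t. \<xi> t = of_real (P1 t) * (\<phi>1' t - of_real (c / t) * \<phi>2 t)"
    unfolding minimal_operator_def by blast
  let ?I = "{1<..<R}"
  let ?p2 = "coeff_p2 l \<Gamma> pressure mass_density" and ?p3 = "coeff_p3 l \<Gamma> pressure mass_density"
  have p2: "?p2 t = c / t * P1 t" and p3: "?p3 t = (c / t)\<^sup>2 * P1 t" for t
    by (simp_all add: coeff_p2_def coeff_p3_def coeff_p1_def power_divide)
  have out: "t \<notin> {a..b}" if "t \<notin> ?I" for t
    using that ab by auto
  have z: "\<phi>1 t = 0" "\<phi>2 t = 0" "\<xi> t = 0" "\<xi>' t = 0" if "t \<notin> ?I" for t
    using out[OF that] test_pair_zero[OF tp(1)] test_pair_zero[OF tp(3)] test_pair_zero[OF tp(4)]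
      test_pair_deriv_zero[OF tp(4)] by blast+
  have supp: "\<exists>K. compact K \<and> K \<subseteq> ?I \<and> (\<forall>t \<in> ?I - K. f t = 0)" if "test_pair a b f f'" for f f'
    using ab test_pair_zero[OF that] by (intro exI[of _ "{a..b}"]) auto
  have C0: "Ck_on 0 ?I f" if "continuous_on UNIV f" for f :: "real \<Rightarrow> complex"
    using that by (auto intro: continuous_on_subset)
  have y1: "Ck_compact_support 2 ?I \<phi>1"
  proof -
    have "Ck_on (Suc 0) ?I \<phi>1'"
      by (rule Ck_on_Suc_openI[OF C0[OF test_pair_continuous_deriv[OF tp(2)]] test_pair_deriv[OF tp(2)]])
    then have "Ck_on (Suc (Suc 0)) ?I \<phi>1"
      by (rule Ck_on_Suc_openI[OF _ test_pair_deriv[OF tp(1)]])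
    then show ?thesis
      unfolding Ck_compact_support_def numeral_2_eq_2 using supp[OF tp(1)] by blast
  qed
  have y2: "Ck_compact_support 1 ?I \<phi>2"
  proof -
    have "Ck_on (Suc 0) ?I \<phi>2"
      by (rule Ck_on_Suc_openI[OF C0[OF test_pair_continuous_deriv[OF tp(3)]] test_pair_deriv[OF tp(3)]])
    then show ?thesis
      unfolding Ck_compact_support_def One_nat_def using supp[OF tp(3)] by blast
  qed
  have D1: "deriv_within ?I \<phi>1 t = \<phi>1' t" if "t \<in> ?I" for t
    by (rule deriv_within_eq(2)[OF test_pair_deriv[OF tp(1)] that])
  have d1: "((\<lambda>s. P1 s *\<^sub>R deriv_within ?I \<phi>1 s) has_vector_derivative P1 t *\<^sub>R \<phi>1'' t + P1' t *\<^sub>R \<phi>1' t) (at t)"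
    if t: "t \<in> ?I" for t
  proof (rule has_vector_derivative_transform_within_open[of _ _ _ ?I])
    show "((\<lambda>s. P1 s *\<^sub>R \<phi>1' s) has_vector_derivative P1 t *\<^sub>R \<phi>1'' t + P1' t *\<^sub>R \<phi>1' t) (at t)"
      by (rule has_vector_derivative_scaleR[OF P1_deriv[OF t] test_pair_deriv[OF tp(2)]])
  qed (use t D1 in auto)
  have d2: "((\<lambda>s. ?p2 s *\<^sub>R \<phi>2 s) has_vector_derivative (P1 t *\<^sub>R \<phi>1'' t + P1' t *\<^sub>R \<phi>1' t) - \<xi>' t) (at t)"
    if t: "t \<in> ?I" for t
  proof (rule has_vector_derivative_transform_within_open[of _ _ _ ?I])
    show "((\<lambda>s. P1 s *\<^sub>R deriv_within ?I \<phi>1 s - \<xi> s) has_vector_derivative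
        (P1 t *\<^sub>R \<phi>1'' t + P1' t *\<^sub>R \<phi>1' t) - \<xi>' t) (at t)"
      by (intro has_vector_derivative_diff d1 t test_pair_deriv[OF tp(4)])
    show "P1 s *\<^sub>R deriv_within ?I \<phi>1 s - \<xi> s = ?p2 s *\<^sub>R \<phi>2 s" if "s \<in> ?I" for s
      unfolding D1[OF that] \<xi> p2 by (simp add: scaleR_conv_of_real algebra_simps)
  qed (use t in auto)
  have e1: "(\<lambda>t. if t \<in> ?I then - deriv_within ?I (\<lambda>s. P1 s *\<^sub>R deriv_within ?I \<phi>1 s) t + Q1 t *\<^sub>R \<phi>1 t
             + deriv_within ?I (\<lambda>s. ?p2 s *\<^sub>R \<phi>2 s) t + Q2 t *\<^sub>R \<phi>2 t else 0)
      = (\<lambda>t. - \<xi>' t + of_real (Q1 t) * \<phi>1 t + of_real (Q2 t) * \<phi>2 t)"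
  proof
    fix t
    show "(if t \<in> ?I then - deriv_within ?I (\<lambda>s. P1 s *\<^sub>R deriv_within ?I \<phi>1 s) t + Q1 t *\<^sub>R \<phi>1 t
             + deriv_within ?I (\<lambda>s. ?p2 s *\<^sub>R \<phi>2 s) t + Q2 t *\<^sub>R \<phi>2 t else 0)
      = - \<xi>' t + of_real (Q1 t) * \<phi>1 t + of_real (Q2 t) * \<phi>2 t"
    proof (cases "t \<in> ?I")
      case True
      then show ?thesis
        unfolding deriv_within_eq(2)[OF d1[OF True] True] deriv_within_eq(2)[OF d2[OF True] True]
        by (simp add: scaleR_conv_of_real)
    qed (use z in auto)
  qed
  have e2: "(\<lambda>t. if t \<in> ?I then - (?p2 t *\<^sub>R deriv_within ?I \<phi>1 t) + Q2 t *\<^sub>R \<phi>1 t + ?p3 t *\<^sub>R \<phi>2 t else 0)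
      = (\<lambda>t. - (of_real (c / t) * \<xi> t) + of_real (Q2 t) * \<phi>1 t)"
  proof
    fix t
    show "(if t \<in> ?I then - (?p2 t *\<^sub>R deriv_within ?I \<phi>1 t) + Q2 t *\<^sub>R \<phi>1 t + ?p3 t *\<^sub>R \<phi>2 t else 0)
      = - (of_real (c / t) * \<xi> t) + of_real (Q2 t) * \<phi>1 t"
    proof (cases "t \<in> ?I")
      case True
      then show ?thesis
        unfolding D1[OF True] \<xi> p2 p3 by (simp add: scaleR_conv_of_real algebra_simps power2_eq_square)
    qed (use z in auto)
  qed
  have e3: "(\<lambda>t. if t \<in> ?I then \<phi>1 t else 0) = \<phi>1" "(\<lambda>t. if t \<in> ?I then \<phi>2 t else 0) = \<phi>2"
    using z by (auto simp: fun_eq_iff)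
  show "x \<in> stellar_operator l R \<Gamma> pressure mass_density"
    unfolding stellar_operator_def Let_def mem_Collect_eq
    by (rule exI[of _ \<phi>1], rule exI[of _ \<phi>2]) (simp only: x l2_class_on_def e1 e2 e3 y1 y2 simp_thms)
qed

lemma regular_spectrum: "ess_spectrum_regular l R \<Gamma> pressure mass_density = {0}"
proof -
  have "coeff_Delta l \<Gamma> pressure mass_density t = 0" if t: "t \<in> {1..<R}" for t
  proof -
    have "mass_density t \<noteq> 0" "pressure t \<noteq> 0" "\<Gamma> t \<noteq> 0" "t \<noteq> 0"
      using \<theta>_pos[OF t] \<Gamma>_pos[of t] t pc \<rho>c by (auto simp: pressure_def mass_density_def)
    then show ?thesis
      by (simp add: coeff_Delta_def coeff_p1_def coeff_p2_def coeff_p3_def field_simps power2_eq_square)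
  qed
  then have "(\<lambda>t. complex_of_real (coeff_Delta l \<Gamma> pressure mass_density t)) ` {1..<R} = {0}"
    using R by (force simp: image_iff)
  then show ?thesis
    by (simp add: ess_spectrum_regular_def)
qed

text \<open>
  The solvability and finiteness statements concern the minimal operator only and hold for \<open>\<mu>\<close> and \<open>cnj \<mu>\<close> alike,
  so the Fredholm criterion applies to every closed symmetric extension.
\<close>

lemma essential_spectrum:
  assumes A: "closed_symmetric_extension (stellar_space R) (stellar_operator l R \<Gamma> pressure mass_density) A"
  shows "ess_spectrum_in (stellar_space R) A = {0}"
proof -
  have ext: "closed_symmetric_extension (stellar_space R) minimal_operator A"
    using A minimal_operator_subset by (auto simp: closed_symmetric_extension_def)
  obtain C where sing: "singular_matrix R c P1 P1' Q1 Q2 r_coeff r_coeff' q0_coeff weight C"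
    using singular by blast
  have "fredholm_in (stellar_space R) (operator_minus_scalar A \<mu>)" if \<mu>: "\<mu> \<noteq> 0" for \<mu>
  proof -
    have ne: "nonzero_eigenvalue R c P1 P1' Q1 Q2 \<nu>" if "\<nu> \<noteq> 0" for \<nu>
      using that degenerate_matrix_axioms by (simp add: nonzero_eigenvalue_def nonzero_eigenvalue_axioms_def)
    have "singular_matrix_nonzero R c P1 P1' Q1 Q2 r_coeff r_coeff' q0_coeff weight C \<mu>"
      using sing ne[OF \<mu>] by (simp add: singular_matrix_nonzero_def)
    from singular_matrix_nonzero.bounded_solution[OF this] obtain K where K:
      "\<And>f. f \<in> stellar_space R \<Longrightarrow> \<exists>y\<in>stellar_space R. norm y \<le> K * norm f \<and>
        (\<forall>(\<phi>, a) \<in> minimal_operator. cinner y a = cinner (f + \<mu> *\<^sub>C y) \<phi>)"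
      by blast
    show ?thesis
    proof (rule fredholm_criterion[OF subspace_stellar_space closed_stellar_space ext _ K])
      fix \<nu> assume "\<nu> \<in> {\<mu>, cnj \<mu>}"
      then have "\<nu> \<noteq> 0"
        using \<mu> by auto
      then show "\<exists>B. finite B \<and>
          {y \<in> stellar_space R. \<forall>(\<phi>, a) \<in> minimal_operator. cinner y a = \<nu> * cinner y \<phi>} \<subseteq> complex_vector.span B"
        by (rule nonzero_eigenvalue.weak_solutions_finite_span[OF ne])
    qed
  qed
  moreover have "operator_minus_scalar A 0 = A"
    by (auto simp: operator_minus_scalar_def)
  then have "\<not> fredholm_in (stellar_space R) (operator_minus_scalar A 0)"
    using zero_in_ess_spectrum[OF ext] by simp
  ultimately show ?thesis
    by (auto simp: ess_spectrum_in_def)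
qed

end

theorem mainTheorem5:
  fixes n \<alpha> R p\<^sub>c \<rho>\<^sub>c :: real
    and l :: nat
    and \<theta> \<Gamma> p \<rho> :: "real \<Rightarrow> real"
    and A :: "((l2 \<times> l2) \<times> (l2 \<times> l2)) set"
  assumes "0 < n" and "n < 5" and "\<alpha> > 0" and "R > 1"
    and "Ck_on 2 {1..R} \<theta>"
    and "\<And>t. t \<in> {1..R} \<Longrightarrow>
           deriv_within {1..R} (deriv_within {1..R} \<theta>) t + 2 / t * deriv_within {1..R} \<theta> t
             = - (1 / \<alpha>\<^sup>2) * \<theta> t powr n"
    and "\<And>t. t \<in> {1..<R} \<Longrightarrow> \<theta> t > 0" and "\<theta> R = 0"
    and "p\<^sub>c > 0" and "\<rho>\<^sub>c > 0"
    and "p = (\<lambda>t. p\<^sub>c * \<theta> t powr (n + 1))"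
    and "\<rho> = (\<lambda>t. \<rho>\<^sub>c * \<theta> t powr n)"
    and "Ck_on 2 {1..R} \<Gamma>"
    and "\<And>t. t \<in> {1..R} \<Longrightarrow> \<Gamma> t > 0"
    and "deriv_within {1..R} \<Gamma> R = 0"
    and "l \<ge> 1"
    and "closed_symmetric_extension (stellar_space R) (stellar_operator l R \<Gamma> p \<rho>) A"
  shows "ess_spectrum_singular l R \<Gamma> p \<rho> A = {}
    \<and> ess_spectrum_in (stellar_space R) A = ess_spectrum_regular l R \<Gamma> p \<rho>
    \<and> ess_spectrum_regular l R \<Gamma> p \<rho> = {0}"
proof -
  note \<theta> = Ck_on_2D[OF assms(5)] and \<Gamma> = Ck_on_2D[OF assms(13)]
  have loc: "stellar n \<alpha> R p\<^sub>c \<rho>\<^sub>c l \<theta> (deriv_within {1..R} \<theta>) (deriv_within {1..R} (deriv_within {1..R} \<theta>))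
      \<Gamma> (deriv_within {1..R} \<Gamma>) (deriv_within {1..R} (deriv_within {1..R} \<Gamma>))"
    by unfold_locales (fact assms \<theta> \<Gamma>)+
  have eq: "p = stellar.pressure n p\<^sub>c \<theta>" "\<rho> = stellar.mass_density n \<rho>\<^sub>c \<theta>"
    unfolding assms(11,12) stellar.pressure_def[OF loc] stellar.mass_density_def[OF loc] by (rule refl)+
  have "ess_spectrum_in (stellar_space R) A = {0}"
    using stellar.essential_spectrum[OF loc] assms(17) unfolding eq by blast
  moreover have "ess_spectrum_regular l R \<Gamma> p \<rho> = {0}"
    using stellar.regular_spectrum[OF loc] unfolding eq .
  ultimately show ?thesis
    by (simp add: ess_spectrum_singular_def)
qed

end
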